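(* Let $k\ge 1$ be an integer and consider the problem, its exact solution $\bm w=(u,p,q)=(u,\varepsilon u_x,\varepsilon u_y)$, the Shishkin mesh, the LDG method, the norms and the Gauss-Radau projections given in the context. Assume that $\varepsilon^{1/4}\ln N\le C_2$ for some fixed constant $C_2$, that the Regularity Assumption of the context is valid with $m=k$, and that $\sigma\ge k+2$ in the definition of the mesh transition parameters. Let $\bm W=(U,P,Q)\in\mathcal V_N^3$ be the solution of the LDG method. Then there exists a constant $C>0$, independent of $\varepsilon$ and $N$, such that the following three bounds hold: (1) the energy-norm error estimate $$|||\bm w-\bm W|||_E\le C(N^{-1}\ln N)^{k+1/2};$$ (2) the supercloseness property $$|||\bm\Pi\bm w-\bm W|||_E\le C(N^{-1}\ln N)^{k+1},$$ where $\bm\Pi\bm w=(\Pi^-u,\Pi_x^+p,\Pi_y^+q)\in\mathcal V_N^3$ is the local Gauss-Radau projection of $\bm w$; (3) the optimal-order $L^2$ error estimate $$|||\bm w-\bm W|||_2\le C(N^{-1}\ln N)^{k+1}.$$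
   Context: **Problem.** $\Omega=(0,1)^2$ and $$-\varepsilon\Delta u+a(x,y)u_x+b(x,y)u=f(x,y)\ \text{in }\Omega,\qquad u=0\ \text{on }\partial\Omega,$$ where $\varepsilon>0$ is a small parameter, $a,b,f$ are sufficiently smooth, $a\ge\alpha$ and $b\ge0$ on $\overline\Omega$ with a constant $\alpha>0$, and $b-\frac12a_x\ge\beta$ on $\overline\Omega$ with a constant $\beta>0$. Put $p=\varepsilon u_x$, $q=\varepsilon u_y$. **Constants.** $C$ may depend on the data $a,b,f$ (with $\alpha,\beta$), on $\sigma,\delta,k$ and on the other fixed constants named in the hypotheses, but not on $\varepsilon$ or $N$. **Regularity Assumption (with non-negative integer $m$).** For some $0<\kappa<1$, $u\in C^{m+2,\kappa}(\Omega)$ and $u=u_0+u_1+u_2+u_{12}$, where for all $(x,y)\in\overline\Omega$ and all integers $i,j\ge0$ with $i+j\le m+2$: $|\partial_x^i\partial_y^ju_0|\le C$; $|\partial_x^i\partial_y^ju_1|\le C\varepsilon^{-i}e^{-\alpha(1-x)/\varepsilon}$; $|\partial_x^i\partial_y^ju_2|\le C\varepsilon^{-j/2}\big(e^{-\delta y/\sqrt\varepsilon}+e^{-\delta(1-y)/\sqrt\varepsilon}\big)$; $|\partial_x^i\partial_y^ju_{12}|\le C\varepsilon^{-(i+j/2)}e^{-\alpha(1-x)/\varepsilon}\big(e^{-\delta y/\sqrt\varepsilon}+e^{-\delta(1-y)/\sqrt\varepsilon}\big)$, with constants $C>0$, $\delta>0$ independent of $\varepsilon$. **Mesh.** $N\ge4$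 is an integer divisible by 4; $\sigma>0$ is a user-chosen parameter. It is assumed throughout that $$\tau_1=\tfrac{\sigma\varepsilon}{\alpha}\ln N\le\tfrac12,\qquad \tau_2=\tfrac{\sigma\sqrt\varepsilon}{\delta}\ln N\le\tfrac14 .$$ Mesh points: $x_i=2(1-\tau_1)\frac iN$ for $0\le i\le N/2$, $x_i=1-2\tau_1(1-\frac iN)$ for $N/2<i\le N$; $y_j=4\tau_2\frac jN$ for $0\le j\le N/4$, $y_j=\tau_2+2(1-2\tau_2)(\frac jN-\frac14)$ for $N/4<j\le3N/4$, $y_j=1-4\tau_2(1-\frac jN)$ for $3N/4<j\le N$. Put $I_i=(x_{i-1},x_i)$, $J_j=(y_{j-1},y_j)$, $K_{ij}=I_i\times J_j$, $\Omega_N=\{K_{ij}\}_{i,j=1}^N$. **Space, traces, jumps.** $\mathcal P^k(I)$ is the space of polynomials of degree $\le k$ on $I$, $\mathcal Q^k(K_{ij})=\mathcal P^k(I_i)\otimes\mathcal P^k(J_j)$, $\mathcal V_N=\{v\in L^2(\Omega): v|_K\in\mathcal Q^k(K)\ \forall K\in\Omega_N\}$. For a piecewise smooth $v$: $v^\pm_{i,y}=\lim_{x\to x_i^\pm}v(x,y)$, $v^\pm_{x,j}=\lim_{y\to y_j^\pm}v(x,y)$, with traces from outside $\Omega$ set to zero ($v^-_{0,y}=v^+_{N,y}=0$, $v^-_{x,0}=v^+_{x,N}=0$); jumps $[\![v]\!]_{i,y}=v^+_{i,y}-v^-_{i,y}$, $[\![v]\!]_{x,j}=v^+_{x,j}-v^-_{x,j}$.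 $\langle\cdot,\cdot\rangle_D$ and $\|\cdot\|_D$ are the $L^2(D)$ inner product and norm ($D=\Omega$ if omitted). $a_{i,y}=a(x_i,y)$. **LDG method.** Find $\bm W=(U,P,Q)\in\mathcal V_N^3$ with $B(\bm W;\bm z)=\langle f,v\rangle$ for all $\bm z=(v,s,r)\in\mathcal V_N^3$, where $B(\bm W;\bm z)=\mathcal T_1+\mathcal T_2+\mathcal T_3+\mathcal T_4$ and $$\mathcal T_1=\varepsilon^{-1}[\langle P,s\rangle+\langle Q,r\rangle]+\langle(b-a_x)U,v\rangle,$$ $$\mathcal T_2=\langle U,s_x\rangle+\sum_{j=1}^N\sum_{i=1}^{N-1}\langle U^-_{i,y},[\![s]\!]_{i,y}\rangle_{J_j}+\langle U,r_y\rangle+\sum_{i=1}^N\sum_{j=1}^{N-1}\langle U^-_{x,j},[\![r]\!]_{x,j}\rangle_{I_i},$$ $$\mathcal T_3=\langle P,v_x\rangle+\sum_{j=1}^N\Big[\sum_{i=0}^{N-1}\langle P^+_{i,y},[\![v]\!]_{i,y}\rangle_{J_j}-\langle P^-_{N,y},v^-_{N,y}\rangle_{J_j}\Big]+\langle Q,v_y\rangle+\sum_{i=1}^N\Big[\sum_{j=0}^{N-1}\langle Q^+_{x,j},[\![v]\!]_{x,j}\rangle_{I_i}-\langle Q^-_{x,N},v^-_{x,N}\rangle_{I_i}\Big],$$ $$\mathcal T_4=-\langle aU,v_x\rangle-\sum_{j=1}^N\sum_{i=1}^N\langle a_{i,y}U^-_{i,y},[\![v]\!]_{i,y}\rangle_{J_j}+\sum_{j=1}^N\langle\lambda_1U^-_{N,y},v^-_{N,y}\rangle_{J_j}+\sum_{i=1}^N\langle\lambda_2U^-_{x,N},v^-_{x,N}\rangle_{I_i}.$$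 (Derivatives are taken elementwise.) The penalty parameters satisfy $0\le\lambda_1\le C_0$ and $C_1\varepsilon\le\lambda_2\le C_0$ with fixed positive constants $C_0,C_1$ independent of $\varepsilon,N$. The method has a unique solution. **Norms.** For $\bm z=(v,s,r)$: $$|||\bm z|||_2^2=\varepsilon^{-1}\|s\|^2+\varepsilon^{-1}\|r\|^2+\big\|(b-\tfrac12a_x)^{1/2}v\big\|^2,$$ $$|||\bm z|||_E^2=|||\bm z|||_2^2+\sum_{j=1}^N\sum_{i=0}^N\tfrac12\langle a_{i,y},[\![v]\!]_{i,y}^2\rangle_{J_j}+\sum_{j=1}^N\langle\lambda_1,[\![v]\!]^2_{N,y}\rangle_{J_j}+\sum_{i=1}^N\langle\lambda_2,[\![v]\!]^2_{x,N}\rangle_{I_i}.$$ **Gauss-Radau projections into $\mathcal V_N$** (conditions on every $K_{ij}$; in each condition all the listed test functions are used): $\Pi^-z$: $\int_{K_{ij}}(\Pi^-z)v=\int_{K_{ij}}zv$ for $v\in\mathcal Q^{k-1}(K_{ij})$; $\int_{J_j}(\Pi^-z)^-_{i,y}v\,dy=\int_{J_j}z^-_{i,y}v\,dy$ for $v\in\mathcal P^{k-1}(J_j)$; $\int_{I_i}(\Pi^-z)^-_{x,j}v\,dx=\int_{I_i}z^-_{x,j}v\,dx$ for $v\in\mathcal P^{k-1}(I_i)$; $(\Pi^-z)(x_i^-,y_j^-)=z(x_i^-,y_j^-)$. $\Pi_x^+z$: $\int_{K_{ij}}(\Pi_x^+z)v=\int_{K_{ij}}zv$ for $v\in\mathcal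 P^{k-1}(I_i)\otimes\mathcal P^k(J_j)$; $\int_{J_j}(\Pi_x^+z)^+_{i-1,y}v\,dy=\int_{J_j}z^+_{i-1,y}v\,dy$ for $v\in\mathcal P^k(J_j)$. $\Pi_y^+z$: $\int_{K_{ij}}(\Pi_y^+z)v=\int_{K_{ij}}zv$ for $v\in\mathcal P^k(I_i)\otimes\mathcal P^{k-1}(J_j)$; $\int_{I_i}(\Pi_y^+z)^+_{x,j-1}v\,dx=\int_{I_i}z^+_{x,j-1}v\,dx$ for $v\in\mathcal P^k(I_i)$. *)

theory Defs
  imports "HOL-Analysis.Analysis" "HOL-Computational_Algebra.Polynomial"
begin

section \<open>Functions on the unit square\<close>

type_synonym fn2 = "real \<times> real \<Rightarrow> real"

definition Omega :: "(real \<times> real) set"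
  where "Omega = {0<..<1} \<times> {0<..<1}"

text \<open>
  Partial derivatives relative to the closed unit square: the usual two-sided derivative at
  points of \<open>Omega\<close>, and one-sided in the normal direction on the boundary, so that values
  outside the closed square are irrelevant.  For a piecewise polynomial they are
  the elementwise derivatives, away from the (null) set of mesh lines.
\<close>

definition pdx :: "fn2 \<Rightarrow> fn2"
  where "pdx g z = vector_derivative (\<lambda>t. g (t, snd z)) (at (fst z) within {0..1})"

definition pdy :: "fn2 \<Rightarrow> fn2"
  where "pdy g z = vector_derivative (\<lambda>t. g (fst z, t)) (at (snd z) within {0..1})"

definition pd :: "nat \<Rightarrow> nat \<Rightarrow> fn2 \<Rightarrow> fn2"
  where "pd i j g = (pdx ^^ i) ((pdy ^^ j) g)"

text \<open>\<open>Ck n S g\<close> is meant for \<open>S = Omega\<close> and \<open>S = closure Omega\<close>: all partial derivatives of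
  order at most \<open>n\<close> exist and are continuous on \<open>S\<close>.\<close>

primrec Ck :: "nat \<Rightarrow> (real \<times> real) set \<Rightarrow> fn2 \<Rightarrow> bool"
  where
    "Ck 0 S g \<longleftrightarrow> continuous_on S g"
  | "Ck (Suc n) S g \<longleftrightarrow> continuous_on S g
      \<and> (\<forall>(x, y) \<in> S. (\<lambda>t. g (t, y)) differentiable (at x within {0..1}))
      \<and> (\<forall>(x, y) \<in> S. (\<lambda>t. g (x, t)) differentiable (at y within {0..1}))
      \<and> Ck n S (pdx g) \<and> Ck n S (pdy g)"

definition hoelder_space :: "nat \<Rightarrow> real \<Rightarrow> fn2 set"
  where "hoelder_space n \<kappa> = {g. Ck n Omega g
    \<and> (\<forall>i j. i + j \<le> n \<longrightarrow> bounded (pd i j g ` Omega))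
    \<and> (\<forall>i j. i + j = n \<longrightarrow>
        (\<exists>L. \<forall>z\<in>Omega. \<forall>z'\<in>Omega. \<bar>pd i j g z - pd i j g z'\<bar> \<le> L * dist z z' powr \<kappa>))}"

text \<open>The measure is the completed one because elements of the finite element space have
  arbitrary, possibly non-Borel, values on the mesh lines.\<close>

definition ip :: "'a::euclidean_space set \<Rightarrow> ('a \<Rightarrow> real) \<Rightarrow> ('a \<Rightarrow> real) \<Rightarrow> real"
  where "ip D g h = (LINT z:D|lebesgue. g z * h z)"

definition L2norm :: "'a::euclidean_space set \<Rightarrow> ('a \<Rightarrow> real) \<Rightarrow> real"
  where "L2norm D g = sqrt (ip D g g)"


section \<open>The boundary value problem and the regularity assumption\<close>

definition bvp_solution :: "real \<Rightarrow> fn2 \<Rightarrow> fn2 \<Rightarrow> fn2 \<Rightarrow> fn2 \<Rightarrow> bool"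
  where "bvp_solution \<epsilon> a b f u \<longleftrightarrow>
    (\<forall>z\<in>Omega. - \<epsilon> * (pdx (pdx u) z + pdy (pdy u) z) + a z * pdx u z + b z * u z = f z)
    \<and> (\<forall>z\<in>frontier Omega. u z = 0)"

definition regularity :: "nat \<Rightarrow> real \<Rightarrow> real \<Rightarrow> real \<Rightarrow> real \<Rightarrow> fn2 \<Rightarrow> bool"
  where "regularity m \<alpha> \<delta> C \<epsilon> u \<longleftrightarrow>
    (\<exists>\<kappa>. 0 < \<kappa> \<and> \<kappa> < 1 \<and> u \<in> hoelder_space (m + 2) \<kappa>) \<and>
    (\<exists>u0 u1 u2 u12.
      (\<forall>w\<in>{u0, u1, u2, u12}. Ck (m + 2) (closure Omega) w) \<and>
      (\<forall>z\<in>closure Omega. u z = u0 z + u1 z + u2 z + u12 z) \<and>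
      (\<forall>(x, y)\<in>closure Omega. \<forall>i j. i + j \<le> m + 2 \<longrightarrow>
        \<bar>pd i j u0 (x, y)\<bar> \<le> C \<and>
        \<bar>pd i j u1 (x, y)\<bar> \<le> C * \<epsilon> powr (- real i) * exp (- \<alpha> * (1 - x) / \<epsilon>) \<and>
        \<bar>pd i j u2 (x, y)\<bar> \<le> C * \<epsilon> powr (- real j / 2)
            * (exp (- \<delta> * y / sqrt \<epsilon>) + exp (- \<delta> * (1 - y) / sqrt \<epsilon>)) \<and>
        \<bar>pd i j u12 (x, y)\<bar> \<le> C * \<epsilon> powr (- (real i + real j / 2)) * exp (- \<alpha> * (1 - x) / \<epsilon>)
            * (exp (- \<delta> * y / sqrt \<epsilon>) + exp (- \<delta> * (1 - y) / sqrt \<epsilon>))))"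


section \<open>Mesh, finite element space, traces and jumps\<close>

record mesh =
  cells :: nat
  xpt :: "nat \<Rightarrow> real"
  ypt :: "nat \<Rightarrow> real"

definition tau1 :: "real \<Rightarrow> real \<Rightarrow> real \<Rightarrow> nat \<Rightarrow> real"
  where "tau1 \<sigma> \<alpha> \<epsilon> N = \<sigma> * \<epsilon> / \<alpha> * ln (real N)"

definition tau2 :: "real \<Rightarrow> real \<Rightarrow> real \<Rightarrow> nat \<Rightarrow> real"
  where "tau2 \<sigma> \<delta> \<epsilon> N = \<sigma> * sqrt \<epsilon> / \<delta> * ln (real N)"

definition shishkin_mesh :: "real \<Rightarrow> real \<Rightarrow> nat \<Rightarrow> mesh"
  where "shishkin_mesh \<tau>1 \<tau>2 N = \<lparr>
    cells = N,
    xpt = (\<lambda>i. if 2 * i \<le> N then 2 * (1 - \<tau>1) * (real i / real N)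
               else 1 - 2 * \<tau>1 * (1 - real i / real N)),
    ypt = (\<lambda>j. if 4 * j \<le> N then 4 * \<tau>2 * (real j / real N)
               else if 4 * j \<le> 3 * N then \<tau>2 + 2 * (1 - 2 * \<tau>2) * (real j / real N - 1 / 4)
               else 1 - 4 * \<tau>2 * (1 - real j / real N)) \<rparr>"

definition Iint :: "mesh \<Rightarrow> nat \<Rightarrow> real set"
  where "Iint M i = {xpt M (i - 1) <..< xpt M i}"

definition Jint :: "mesh \<Rightarrow> nat \<Rightarrow> real set"
  where "Jint M j = {ypt M (j - 1) <..< ypt M j}"

definition Kel :: "mesh \<Rightarrow> nat \<Rightarrow> nat \<Rightarrow> (real \<times> real) set"
  where "Kel M i j = Iint M i \<times> Jint M j"

definition polyP :: "nat \<Rightarrow> (real \<Rightarrow> real) set"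
  where "polyP k = {poly p | p. degree p \<le> k}"

text \<open>The tensor product of \<open>polyP k\<close> (in \<open>x\<close>) and \<open>polyP l\<close> (in \<open>y\<close>).\<close>

definition polyT :: "nat \<Rightarrow> nat \<Rightarrow> fn2 set"
  where "polyT k l = {g. \<exists>c. g = (\<lambda>(x, y). \<Sum>m\<le>k. \<Sum>n\<le>l. c m n * x ^ m * y ^ n)}"

text \<open>Membership in $L^2$ is automatic: the open elements cover \<open>Omega\<close> up to a null set.\<close>

definition VN :: "mesh \<Rightarrow> nat \<Rightarrow> fn2 set"
  where "VN M k = {v. \<forall>i\<in>{1..cells M}. \<forall>j\<in>{1..cells M}.
    \<exists>g\<in>polyT k k. \<forall>z\<in>Kel M i j. v z = g z}"

text \<open>\<open>tr_x_plus M v i y\<close> is $v^+_{i,y}$ and \<open>tr_y_plus M v j x\<close> is $v^+_{x,j}$; traces from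
  outside \<open>Omega\<close> are zero.\<close>

definition tr_x_plus :: "mesh \<Rightarrow> fn2 \<Rightarrow> nat \<Rightarrow> real \<Rightarrow> real"
  where "tr_x_plus M v i y =
    (if i = cells M then 0 else Lim (at_right (xpt M i)) (\<lambda>x. v (x, y)))"

definition tr_x_minus :: "mesh \<Rightarrow> fn2 \<Rightarrow> nat \<Rightarrow> real \<Rightarrow> real"
  where "tr_x_minus M v i y =
    (if i = 0 then 0 else Lim (at_left (xpt M i)) (\<lambda>x. v (x, y)))"

definition tr_y_plus :: "mesh \<Rightarrow> fn2 \<Rightarrow> nat \<Rightarrow> real \<Rightarrow> real"
  where "tr_y_plus M v j x =
    (if j = cells M then 0 else Lim (at_right (ypt M j)) (\<lambda>y. v (x, y)))"

definition tr_y_minus :: "mesh \<Rightarrow> fn2 \<Rightarrow> nat \<Rightarrow> real \<Rightarrow> real"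
  where "tr_y_minus M v j x =
    (if j = 0 then 0 else Lim (at_left (ypt M j)) (\<lambda>y. v (x, y)))"

definition jump_x :: "mesh \<Rightarrow> fn2 \<Rightarrow> nat \<Rightarrow> real \<Rightarrow> real"
  where "jump_x M v i y = tr_x_plus M v i y - tr_x_minus M v i y"

definition jump_y :: "mesh \<Rightarrow> fn2 \<Rightarrow> nat \<Rightarrow> real \<Rightarrow> real"
  where "jump_y M v j x = tr_y_plus M v j x - tr_y_minus M v j x"


section \<open>The LDG method\<close>

definition T1 :: "real \<Rightarrow> fn2 \<Rightarrow> fn2 \<Rightarrow> fn2 \<times> fn2 \<times> fn2 \<Rightarrow> fn2 \<times> fn2 \<times> fn2 \<Rightarrow> real"
  where "T1 \<epsilon> a b = (\<lambda>(U, P, Q) (v, s, r).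
    inverse \<epsilon> * (ip Omega P s + ip Omega Q r) + ip Omega (\<lambda>z. (b z - pdx a z) * U z) v)"

definition T2 :: "mesh \<Rightarrow> fn2 \<times> fn2 \<times> fn2 \<Rightarrow> fn2 \<times> fn2 \<times> fn2 \<Rightarrow> real"
  where "T2 M = (\<lambda>(U, P, Q) (v, s, r). let N = cells M in
    ip Omega U (pdx s)
    + (\<Sum>j=1..N. \<Sum>i=1..N-1. ip (Jint M j) (tr_x_minus M U i) (jump_x M s i))
    + ip Omega U (pdy r)
    + (\<Sum>i=1..N. \<Sum>j=1..N-1. ip (Iint M i) (tr_y_minus M U j) (jump_y M r j)))"

definition T3 :: "mesh \<Rightarrow> fn2 \<times> fn2 \<times> fn2 \<Rightarrow> fn2 \<times> fn2 \<times> fn2 \<Rightarrow> real"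
  where "T3 M = (\<lambda>(U, P, Q) (v, s, r). let N = cells M in
    ip Omega P (pdx v)
    + (\<Sum>j=1..N. (\<Sum>i=0..N-1. ip (Jint M j) (tr_x_plus M P i) (jump_x M v i))
                 - ip (Jint M j) (tr_x_minus M P N) (tr_x_minus M v N))
    + ip Omega Q (pdy v)
    + (\<Sum>i=1..N. (\<Sum>j=0..N-1. ip (Iint M i) (tr_y_plus M Q j) (jump_y M v j))
                 - ip (Iint M i) (tr_y_minus M Q N) (tr_y_minus M v N)))"

definition T4 :: "mesh \<Rightarrow> fn2 \<Rightarrow> real \<Rightarrow> real \<Rightarrow>
    fn2 \<times> fn2 \<times> fn2 \<Rightarrow> fn2 \<times> fn2 \<times> fn2 \<Rightarrow> real"
  where "T4 M a lam1 lam2 = (\<lambda>(U, P, Q) (v, s, r). let N = cells M in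
    - ip Omega (\<lambda>z. a z * U z) (pdx v)
    - (\<Sum>j=1..N. \<Sum>i=1..N. ip (Jint M j) (\<lambda>y. a (xpt M i, y) * tr_x_minus M U i y) (jump_x M v i))
    + (\<Sum>j=1..N. ip (Jint M j) (\<lambda>y. lam1 * tr_x_minus M U N y) (tr_x_minus M v N))
    + (\<Sum>i=1..N. ip (Iint M i) (\<lambda>x. lam2 * tr_y_minus M U N x) (tr_y_minus M v N)))"

definition ldg_form :: "mesh \<Rightarrow> real \<Rightarrow> fn2 \<Rightarrow> fn2 \<Rightarrow> real \<Rightarrow> real \<Rightarrow>
    fn2 \<times> fn2 \<times> fn2 \<Rightarrow> fn2 \<times> fn2 \<times> fn2 \<Rightarrow> real"
  where "ldg_form M \<epsilon> a b lam1 lam2 W z = T1 \<epsilon> a b W z + T2 M W z + T3 M W z + T4 M a lam1 lam2 W z"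

definition ldg_solution :: "mesh \<Rightarrow> nat \<Rightarrow> real \<Rightarrow> fn2 \<Rightarrow> fn2 \<Rightarrow> fn2 \<Rightarrow> real \<Rightarrow> real \<Rightarrow>
    fn2 \<times> fn2 \<times> fn2 \<Rightarrow> bool"
  where "ldg_solution M k \<epsilon> a b f lam1 lam2 W \<longleftrightarrow>
    W \<in> VN M k \<times> VN M k \<times> VN M k \<and>
    (\<forall>v\<in>VN M k. \<forall>s\<in>VN M k. \<forall>r\<in>VN M k.
      ldg_form M \<epsilon> a b lam1 lam2 W (v, s, r) = ip Omega f v)"


section \<open>Norms\<close>

definition norm2 :: "real \<Rightarrow> fn2 \<Rightarrow> fn2 \<Rightarrow> fn2 \<times> fn2 \<times> fn2 \<Rightarrow> real"
  where "norm2 \<epsilon> a b = (\<lambda>(v, s, r). sqrt (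
    inverse \<epsilon> * (L2norm Omega s)\<^sup>2 + inverse \<epsilon> * (L2norm Omega r)\<^sup>2
    + (L2norm Omega (\<lambda>z. sqrt (b z - pdx a z / 2) * v z))\<^sup>2))"

definition normE :: "mesh \<Rightarrow> real \<Rightarrow> fn2 \<Rightarrow> fn2 \<Rightarrow> real \<Rightarrow> real \<Rightarrow> fn2 \<times> fn2 \<times> fn2 \<Rightarrow> real"
  where "normE M \<epsilon> a b lam1 lam2 = (\<lambda>(v, s, r). let N = cells M in sqrt (
    (norm2 \<epsilon> a b (v, s, r))\<^sup>2
    + (\<Sum>j=1..N. \<Sum>i=0..N. 1 / 2 * ip (Jint M j) (\<lambda>y. a (xpt M i, y)) (\<lambda>y. (jump_x M v i y)\<^sup>2))
    + (\<Sum>j=1..N. ip (Jint M j) (\<lambda>y. lam1) (\<lambda>y. (jump_x M v N y)\<^sup>2))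
    + (\<Sum>i=1..N. ip (Iint M i) (\<lambda>x. lam2) (\<lambda>x. (jump_y M v N x)\<^sup>2))))"

definition diff3 :: "fn2 \<times> fn2 \<times> fn2 \<Rightarrow> fn2 \<times> fn2 \<times> fn2 \<Rightarrow> fn2 \<times> fn2 \<times> fn2"
  where "diff3 = (\<lambda>(u, p, q) (U, P, Q). (\<lambda>z. u z - U z, \<lambda>z. p z - P z, \<lambda>z. q z - Q z))"


section \<open>Gauss--Radau projections\<close>

text \<open>The defining conditions determine a projection on every open element; its values on mesh
  lines are immaterial, hence a choice rather than a definite description.\<close>

definition gr_minus :: "mesh \<Rightarrow> nat \<Rightarrow> fn2 \<Rightarrow> fn2"
  where "gr_minus M k z = (SOME Z. Z \<in> VN M k \<and>
    (\<forall>i\<in>{1..cells M}. \<forall>j\<in>{1..cells M}.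
      (\<forall>v\<in>polyT (k - 1) (k - 1). ip (Kel M i j) Z v = ip (Kel M i j) z v) \<and>
      (\<forall>v\<in>polyP (k - 1).
        ip (Jint M j) (tr_x_minus M Z i) v = ip (Jint M j) (tr_x_minus M z i) v) \<and>
      (\<forall>v\<in>polyP (k - 1).
        ip (Iint M i) (tr_y_minus M Z j) v = ip (Iint M i) (tr_y_minus M z j) v) \<and>
      Lim (at (xpt M i, ypt M j) within Kel M i j) Z
        = Lim (at (xpt M i, ypt M j) within Kel M i j) z))"

definition gr_x_plus :: "mesh \<Rightarrow> nat \<Rightarrow> fn2 \<Rightarrow> fn2"
  where "gr_x_plus M k z = (SOME Z. Z \<in> VN M k \<and>
    (\<forall>i\<in>{1..cells M}. \<forall>j\<in>{1..cells M}.
      (\<forall>v\<in>polyT (k - 1) k. ip (Kel M i j) Z v = ip (Kel M i j) z v) \<and>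
      (\<forall>v\<in>polyP k.
        ip (Jint M j) (tr_x_plus M Z (i - 1)) v = ip (Jint M j) (tr_x_plus M z (i - 1)) v)))"

definition gr_y_plus :: "mesh \<Rightarrow> nat \<Rightarrow> fn2 \<Rightarrow> fn2"
  where "gr_y_plus M k z = (SOME Z. Z \<in> VN M k \<and>
    (\<forall>i\<in>{1..cells M}. \<forall>j\<in>{1..cells M}.
      (\<forall>v\<in>polyT k (k - 1). ip (Kel M i j) Z v = ip (Kel M i j) z v) \<and>
      (\<forall>v\<in>polyP k.
        ip (Iint M i) (tr_y_plus M Z (j - 1)) v = ip (Iint M i) (tr_y_plus M z (j - 1)) v)))"

end

theory Submission
  imports Defs
begin

text \<open>
  Let \<open>\<Pi>w - W = \<xi>\<close> and \<open>w - \<Pi>w = \<eta>\<close>. The bilinear form reproduces the energy norm on the finite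
  element space, so by Galerkin orthogonality the energy of \<open>\<xi>\<close> equals \<open>-B(\<eta>; \<xi>)\<close>. The projections are
  tensor products of one-dimensional ones, and every term of \<open>B(\<eta>; \<xi>)\<close> is split along
  \<open>I - \<Pi>\<^sub>x \<Pi>\<^sub>y = (I - \<Pi>\<^sub>y) + (I - \<Pi>\<^sub>x) \<Pi>\<^sub>y\<close>. The second part is invisible to the one-dimensional Radau
  identities apart from outflow terms, while the first part is continuous in \<open>x\<close> and can be
  integrated by parts back onto the exact solution. In the convection term the smooth components
  are treated that way, and the layer components are written as the flux of a left Radau
  projection, whose remainder is turned into a term in \<open>p\<close> by the first error equation.
  Only the jumps of \<open>\<eta>\<close> at the vertical mesh lines lose half an order, which is why this loss is
  visible in the energy norm of \<open>w - W\<close> but neither in that of \<open>\<xi>\<close> nor in the \<open>L\<^sup>2\<close>-type norm.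
\<close>

text \<open>The weight \<open>1 / \<epsilon>\<close> on the flux components shapes the estimates.
  Errors of \<open>p\<close> must have size \<open>sqrt \<epsilon>\<close> in the mean, although the
  layer part of \<open>p\<close> has size one at the outflow boundary, and no power of
  \<open>N\<close> may be lost. This forces pointwise bounds
  \<open>c * H * (\<omega> + \<epsilon>)\<close>, where \<open>H\<close> is the target rate and the
  square of the exponential profile \<open>\<omega>\<close> integrates to order
  \<open>\<epsilon>\<close>. In coarse columns Taylor bounds say nothing about the layer part, so
  function and projection are estimated separately; \<sigma> \<ge> k + 2 makes the layer there
  smaller than the rate by a factor \<open>1 / N\<close>, which pays for the \<open>N\<close> in the
  bound \<open>\<epsilon> * N\<close> of the left Radau projection. Integrating the layer part of
  the convection error by parts would cost \<open>1 / \<epsilon>\<close>; the projected flux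
  \<open>\<phi>\<close> obeys the weighted bound instead and is an admissible test function.
  Functions are handled as families continuous on closed cells, and the y direction by exchanging
  variables; limits, Lebesgue integrals and arbitrary values on mesh lines enter only where families
  are identified with the given notions.\<close>

section \<open>Projections on an interval\<close>

text \<open>No integrability is assumed: the substitution preserves non-integrability, and then both
  integrals have the default value 0. So moments of arbitrary functions can be transported to the
  unit interval.\<close>

lemma integral_affine_unit:
 fixes f :: "real => real"
 assumes "c < d"
 shows "integral {c..d} f = (d - c) * integral {0..1} (%t. f (c + (d - c) * t))"
proof -
 have eq: "cbox ((c - c) /\<^sub>R (d - c)) ((d - c) /\<^sub>R (d - c)) = {0..1::real}"
  using assms by simp
 show ?thesis
 proof (cases "f integrable_on {c..d}")
  case True
  then have "(f has_integral integral {c..d} f) (cbox c d)" by auto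
  from has_integral_affinity'[OF this, of "d - c" c] assms
  have "((%t. f (c + (d - c) * t)) has_integral integral {c..d} f / (d - c)) {0..1}"
   unfolding eq by (simp add: algebra_simps divide_inverse)
  then show ?thesis using assms by (auto dest: integral_unique)
 next
  case False
  have "\<not> (%t. f (c + (d - c) * t)) integrable_on {0..1}"
  proof
   assume "(%t. f (c + (d - c) * t)) integrable_on {0..1}"
   then obtain I where "((%t. f (c + (d - c) * t)) has_integral I) {0..1}" by auto
   moreover have "((d - c) * I) /\<^sub>R (d - c) ^ DIM(real) = I" using assms by simp
   ultimately have "((%t. f ((d - c) *\<^sub>R t + c)) has_integral ((d - c) * I) /\<^sub>R (d - c) ^ DIM(real))
     (cbox ((c - c) /\<^sub>R (d - c)) ((d - c) /\<^sub>R (d - c)))"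
    unfolding eq by (simp only: add.commute real_scaleR_def)
   then have "(f has_integral ((d - c) * I)) (cbox c d)"
    using has_integral_affinity_iff[of "d - c" f c _ c d] assms by simp
   with False show False by (auto simp: integrable_on_def)
  qed
  then show ?thesis using False by (simp add: not_integrable_integral)
 qed
qed

lemma continuous_on_poly' [continuous_intros]:
 "continuous_on S f ==> continuous_on S (%x. poly p (f x :: real))"
 by (rule continuous_on_poly)

section \<open>Weighted orthogonal polynomials on the unit interval\<close>

definition ipw :: "real poly => real poly => real poly => real"
 where "ipw \<rho> p q = integral {0..1} (%t. poly \<rho> t * poly p t * poly q t)"

text \<open>Degree below \<open>n\<close>, phrased through coefficients so that \<open>dlt 0\<close>
  holds exactly for the zero polynomial. With \<open>degree p < n\<close> the zero polynomial would
  be lost at \<open>n = 0\<close>, where the induction for orthonormal systems starts.\<close>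

definition dlt :: "nat => real poly => bool"
 where "dlt n p \<longleftrightarrow> (\<forall>i\<ge>n. coeff p i = 0)"

lemma dlt_Suc: "dlt (Suc n) p \<longleftrightarrow> degree p <= n"
 unfolding dlt_def by (meson Suc_le_eq coeff_eq_0 degree_le less_le_trans order.strict_trans1 le_refl)

lemma dlt_diff: "dlt n p ==> dlt n q ==> dlt n (p - q)"
 and dlt_smult: "dlt n p ==> dlt n (smult c p)"
 and dlt_mono: "dlt m p ==> m <= n ==> dlt n p"
 by (auto simp: dlt_def)

lemma dlt_sum: "(!!i. i \<in> A ==> dlt n (f i)) ==> dlt n (\<Sum>i\<in>A. f i)"
 by (auto simp: dlt_def coeff_sum)

lemma ipw_commute: "ipw \<rho> p q = ipw \<rho> q p"
 by (simp add: ipw_def mult.commute mult.left_commute)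

lemma ipw_add: "ipw \<rho> (p + q) r = ipw \<rho> p r + ipw \<rho> q r"
 and ipw_diff: "ipw \<rho> (p - q) r = ipw \<rho> p r - ipw \<rho> q r"
 and ipw_smult: "ipw \<rho> (smult c p) r = c * ipw \<rho> p r"
proof -
 have i: "(%t. poly \<rho> t * poly p t * poly q t) integrable_on {0..1}" for p q :: "real poly"
  by (intro integrable_continuous_real continuous_intros)
 show "ipw \<rho> (p + q) r = ipw \<rho> p r + ipw \<rho> q r"
  unfolding ipw_def by (subst integral_add[OF i i, symmetric]) (simp add: algebra_simps)
 show "ipw \<rho> (p - q) r = ipw \<rho> p r - ipw \<rho> q r"
  unfolding ipw_def by (subst integral_diff[OF i i, symmetric]) (simp add: algebra_simps)
 show "ipw \<rho> (smult c p) r = c * ipw \<rho> p r"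
  unfolding ipw_def by (subst integral_mult_right[symmetric]) (simp add: algebra_simps)
qed

lemma ipw_0: "ipw \<rho> 0 r = 0"
 by (simp add: ipw_def)

lemma ipw_sum: "finite A ==> ipw \<rho> (\<Sum>m\<in>A. f m) r = (\<Sum>m\<in>A. ipw \<rho> (f m) r)"
 by (induction A rule: finite_induct) (auto simp: ipw_0 ipw_add)

text \<open>A continuous nonnegative integrand with integral 0 vanishes, so \<open>p\<close> would
  have infinitely many roots. Positivity of the weight is asked for only inside the interval,
  because the Radau weights vanish at one end.\<close>

lemma ipw_pos:
 assumes \<rho>: "!!t. 0 < t ==> t < 1 ==> poly \<rho> t > 0" and "p \<noteq> 0"
 shows "ipw \<rho> p p > 0"
proof -
 let ?f = "%t. poly \<rho> t * poly p t * poly p t"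
 have c: "continuous_on {0..1} ?f" by (intro continuous_intros)
 have nn: "?f t \<ge> 0" if "0 < t" "t < 1" for t
  using \<rho>[OF that] by (simp add: mult.assoc)
 have ge: "integral {0..1} ?f \<ge> 0"
  unfolding integral_open_interval_real by (rule integral_nonneg)
   (use nn integrable_continuous_real[OF c] integrable_on_open_interval_real[of ?f 0 1] in auto)
 have "integral {0..1} ?f \<noteq> 0"
 proof
  assume z: "integral {0..1} ?f = 0"
  have "(?f has_integral 0) (cbox 0 1)"
   using integrable_integral[OF integrable_continuous_real[OF c]] z by simp
  then have f0: "?f t = 0" if "t \<in> {0..1}" for t
   using has_integral_0_cbox_imp_0[of 0 1 ?f t] c nn that by auto
  have "{0<..<1::real} \<subseteq> {t. poly p t = 0}"
  proof
   fix t :: real assume "t \<in> {0<..<1}"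
   then have "?f t = 0" "poly \<rho> t \<noteq> 0" using f0[of t] \<rho>[of t] by auto
   then show "t \<in> {t. poly p t = 0}" by simp
  qed
  then have "finite {0<..<1::real}"
   using poly_roots_finite[OF \<open>p \<noteq> 0\<close>] finite_subset by blast
  then show False using infinite_Ioo[of 0 "1::real"] by simp
 qed
 with ge show ?thesis by (simp add: ipw_def)
qed

text \<open>The last clause is completeness in expansion form. It is what evaluates projections
  later and spares any argument on dimensions.\<close>

definition orthonormal :: "real poly => nat => (nat => real poly) => bool"
 where "orthonormal \<rho> n e \<longleftrightarrow> (\<forall>m<n. dlt n (e m))
  & (\<forall>i<n. \<forall>j<n. ipw \<rho> (e i) (e j) = (if i = j then 1 else 0))
  & (\<forall>p. dlt n p --> p = (\<Sum>m<n. smult (ipw \<rho> p (e m)) (e m)))"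

lemma orthonormal_exists:
 assumes \<rho>: "!!t. 0 < t ==> t < 1 ==> poly \<rho> t > 0"
 shows "\<exists>e. orthonormal \<rho> n e"
proof (induction n)
 case 0
 have "p = 0" if "dlt 0 p" for p using that by (auto simp: dlt_def poly_eq_iff)
 then show ?case by (auto simp: orthonormal_def)
next
 case (Suc n)
 then obtain e where e: "!!m. m < n ==> dlt n (e m)"
  "!!i j. i < n ==> j < n ==> ipw \<rho> (e i) (e j) = (if i = j then 1 else 0)"
  "!!p. dlt n p ==> p = (\<Sum>m<n. smult (ipw \<rho> p (e m)) (e m))"
  unfolding orthonormal_def by blast
 \<comment> \<open>Gram-Schmidt applied to the next monomial. Since \<open>s\<close> has lower
   degree, the remainder \<open>r\<close> keeps the leading coefficient 1 and can be
   normalised.\<close>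
 define s where "s = (\<Sum>m<n. smult (ipw \<rho> (monom 1 n) (e m)) (e m))"
 define r where "r = monom 1 n - s"
 have ds: "dlt n s" unfolding s_def by (intro dlt_sum dlt_smult e) auto
 have cr: "coeff r n = 1" using ds by (simp add: r_def dlt_def)
 then have "r \<noteq> 0" by auto
 have dr: "dlt (Suc n) r" using ds by (auto simp: r_def dlt_def)
 have orth: "ipw \<rho> r (e j) = 0" if "j < n" for j
 proof -
  have "ipw \<rho> s (e j) = (\<Sum>m<n. ipw \<rho> (monom 1 n) (e m) * (if m = j then 1 else 0))"
   unfolding s_def by (simp add: ipw_sum ipw_smult e that)
  also have "... = ipw \<rho> (monom 1 n) (e j)" using that
   by (simp add: sum.delta if_distrib cong: if_cong)
  finally show ?thesis by (simp add: r_def ipw_diff)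
 qed
 define \<kappa> where "\<kappa> = ipw \<rho> r r"
 have \<kappa>: "\<kappa> > 0" unfolding \<kappa>_def using ipw_pos[OF \<rho> \<open>r \<noteq> 0\<close>] .
 define f where "f = e(n := smult (1 / sqrt \<kappa>) r)"
 have fn: "f n = smult (1 / sqrt \<kappa>) r" and fm: "f m = e m" if "m < n" for m
  using that by (auto simp: f_def)
 have 1: "dlt (Suc n) (f m)" if "m < Suc n" for m
  using that dr e(1)[of m] dlt_mono[of n "e m" "Suc n"] by (auto simp: f_def intro: dlt_smult)
 have nn: "ipw \<rho> (f n) (f n) = 1"
  using \<kappa> by (simp add: f_def ipw_smult ipw_commute[of \<rho> r "smult _ r"] \<kappa>_def[symmetric] field_simps)
 have mn: "ipw \<rho> (f n) (f m) = 0" if "m < n" for m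
  using that by (simp add: fn fm ipw_smult orth)
 have 2: "ipw \<rho> (f i) (f j) = (if i = j then 1 else 0)" if "i < Suc n" "j < Suc n" for i j
  using that nn mn[of i] mn[of j] e(2)[of i j] ipw_commute[of \<rho> "f i" "f n"]
  by (auto simp: less_Suc_eq fm)
 have 3: "p = (\<Sum>m<Suc n. smult (ipw \<rho> p (f m)) (f m))" if p: "dlt (Suc n) p" for p
 proof -
  define c where "c = coeff p n"
  \<comment> \<open>Removing the leading coefficient times \<open>r\<close> lowers the degree, so
    the induction hypothesis expands \<open>q\<close>; the coefficient along \<open>r\<close> is
    recovered from \<open>ipw \<rho> q r = 0\<close>.\<close>
  define q where "q = p - smult c r"
  have "coeff q i = 0" if "i \<ge> n" for i
   using p dr cr that by (cases "i = n") (auto simp: q_def c_def dlt_def)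
  then have q: "q = (\<Sum>m<n. smult (ipw \<rho> q (e m)) (e m))"
   by (intro e(3)) (simp add: dlt_def)
  have qm: "ipw \<rho> q (e m) = ipw \<rho> p (f m)" if "m < n" for m
   using that by (simp add: q_def ipw_diff ipw_smult orth fm)
  have "ipw \<rho> q r = 0"
   by (subst q) (simp add: ipw_sum ipw_smult ipw_commute[of \<rho> "e _" r] orth)
  then have pr: "ipw \<rho> p r = c * \<kappa>" by (simp add: q_def ipw_diff ipw_smult \<kappa>_def)
  have "smult (ipw \<rho> p (f n)) (f n) = smult c r"
  proof -
   have "ipw \<rho> p (f n) = c * \<kappa> / sqrt \<kappa>"
    using pr by (simp add: f_def ipw_commute[of \<rho> p "smult _ r"] ipw_smult ipw_commute[of \<rho> r p])
   also have "... = c * (\<kappa> / sqrt \<kappa>)" by simp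
   also have "... = c * sqrt \<kappa>" using \<kappa> by (subst real_div_sqrt) auto
   finally show ?thesis using \<kappa> by (simp add: f_def)
  qed
  moreover have "(\<Sum>m<n. smult (ipw \<rho> p (f m)) (f m)) = q"
   by (subst q) (simp add: qm fm)
  ultimately have "(\<Sum>m<Suc n. smult (ipw \<rho> p (f m)) (f m)) = q + smult c r"
   by (simp only: sum.lessThan_Suc)
  then show ?thesis by (simp add: q_def)
 qed
 show ?case unfolding orthonormal_def using 1 2 3 by blast
qed

text \<open>All projections on the reference interval are of the form
  $\gamma(s)\,g(e)+\sum_m P_m(s)\int_0^1 Q_m g$ with polynomials $\gamma, P_m, Q_m$.
  Keeping this form explicit makes the tensor structure (commutation, differentiation
  with respect to the other variable) a matter of exchanging integrals.\<close>

record proj =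
 pgam :: "real poly"
 prank :: nat
 pP :: "nat => real poly"
 pQ :: "nat => real poly"
 pnode :: real

definition refpj :: "proj => (real => real) => real => real"
 where "refpj K g s = poly (pgam K) s * g (pnode K)
  + (\<Sum>m<prank K. poly (pP K m) s * integral {0..1} (%t. poly (pQ K m) t * g t))"

text \<open>\<open>k\<close> is the degree of the range and of exactness, \<open>l\<close> the
  degree of the test polynomials to which the error is orthogonal. The bound on the degrees of
  \<open>pQ\<close> makes the projection depend on a function only through its node value and its
  moments up to degree \<open>l\<close>.\<close>

definition good_proj :: "nat => nat => proj => bool"
 where "good_proj k l K \<longleftrightarrow> degree (pgam K) <= k
  & (\<forall>m<prank K. degree (pP K m) <= k & degree (pQ K m) <= l)
  & 0 <= pnode K & pnode K <= 1
  & (\<forall>p. degree p <= k --> refpj K (poly p) = poly p)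
  & (\<forall>g q. continuous_on {0..1} g --> degree q <= l \<longrightarrow>
    integral {0..1} (%t. (g t - refpj K g t) * poly q t) = 0)"

text \<open>The weight \<open>\<rho>\<close> and \<open>\<theta>\<close> are \<open>1 - x\<close>, \<open>x\<close> and \<open>1\<close> for the two Radau projections,
  and \<open>1\<close> and \<open>0\<close> for the $L^2$ projection.\<close>

lemma good_proj_exists:
 assumes \<rho>: "!!t. 0 < t ==> t < 1 ==> poly \<rho> t > 0"
  and n: "n = Suc l" and d\<rho>: "!!p. dlt n p ==> degree (\<rho> * p) <= k"
  and e: "0 <= e" "e <= 1"
  and div: "!!p. degree p <= k ==> \<exists>q. dlt n q & p - [:\<theta> * poly p e:] = \<rho> * q"
 shows "\<exists>K. good_proj k l K & pnode K = e & (\<theta> = 0 --> pgam K = 0)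
  & (poly \<rho> e = 0 --> \<theta> = 1 --> (\<forall>g. refpj K g e = g e))"
proof -
 obtain es where es: "!!m. m < n ==> dlt n (es m)"
  "!!i j. i < n ==> j < n ==> ipw \<rho> (es i) (es j) = (if i = j then 1 else 0)"
  "!!p. dlt n p ==> p = (\<Sum>m<n. smult (ipw \<rho> p (es m)) (es m))"
  using orthonormal_exists[OF \<rho>, of n] unfolding orthonormal_def by blast
 \<comment> \<open>The projection is \<theta> g(e) plus \<rho> times the \<rho>-weighted orthogonal
   projection of (g - \<theta> g(e)) / \<rho>; the weight cancels the division, so only plain
   moments occur. \<open>G\<close> collects everything that multiplies g(e).\<close>
 define G where "G = [:\<theta>:] - smult \<theta> (\<Sum>m<n. smult (integral {0..1} (poly (es m))) (\<rho> * es m))"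
 define K where "K = \<lparr>pgam = G, prank = n, pP = (%m. \<rho> * es m), pQ = es, pnode = e\<rparr>"
 have K: "refpj K g s = \<theta> * g e
   + poly \<rho> s * (\<Sum>m<n. poly (es m) s * integral {0..1} (%t. poly (es m) t * (g t - \<theta> * g e)))"
  if g: "continuous_on {0..1} g" for g s
 proof -
  have "integral {0..1} (%t. poly (es m) t * (g t - \<theta> * g e))
   = integral {0..1} (%t. poly (es m) t * g t) - integral {0..1} (poly (es m)) * (\<theta> * g e)" for m
  proof -
   have "integral {0..1} (%t. poly (es m) t * g t - poly (es m) t * (\<theta> * g e))
    = integral {0..1} (%t. poly (es m) t * g t) - integral {0..1} (%t. poly (es m) t * (\<theta> * g e))"
    by (intro integral_diff integrable_continuous_real continuous_intros g)
   then show ?thesis by (simp add: right_diff_distrib)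
  qed
  then show ?thesis
   by (simp add: K_def refpj_def G_def poly_sum right_diff_distrib left_diff_distrib sum_distrib_left sum_distrib_right sum_subtractf mult_ac)
 qed
 have deg: "degree p <= l" if "dlt n p" for p using that n by (simp add: dlt_Suc)
 have dsm: "degree (smult c p) <= k" if "degree p <= k" for c and p :: "real poly"
  using that degree_smult_le[of c p] by linarith
 have dG: "degree G <= k"
  unfolding G_def by (intro degree_diff_le dsm degree_sum_le d\<rho> es) auto
 \<comment> \<open>By \<open>div\<close> the deviation from the node value is \<rho> times a
   polynomial in the span of the system, which the weighted projection reproduces.\<close>
 have rep: "refpj K (poly p) = poly p" if p: "degree p <= k" for p
 proof -
  obtain q where q: "dlt n q" "p - [:\<theta> * poly p e:] = \<rho> * q" using div[OF p] by blast
  have pq: "poly p t - \<theta> * poly p e = poly \<rho> t * poly q t" for t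
   using arg_cong[OF q(2), of "%r. poly r t"] by simp
  have "refpj K (poly p) s = poly p s" for s
  proof -
   have "refpj K (poly p) s = \<theta> * poly p e + poly \<rho> s * (\<Sum>m<n. poly (es m) s * ipw \<rho> q (es m))"
    by (subst K) (auto intro!: continuous_intros simp: pq ipw_def mult_ac)
   also have "(\<Sum>m<n. poly (es m) s * ipw \<rho> q (es m)) = poly q s"
    by (subst (2) es(3)[OF q(1)]) (simp add: poly_sum mult.commute)
   finally show ?thesis using pq[of s] by simp
  qed
  then show ?thesis by blast
 qed
 have orth: "integral {0..1} (%t. (g t - refpj K g t) * poly q t) = 0"
  if g: "continuous_on {0..1} g" and q: "degree q <= l" for g q
 proof -
  define c where "c m = integral {0..1} (%t. poly (es m) t * (g t - \<theta> * g e))" for m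
  have q': "q = (\<Sum>m<n. smult (ipw \<rho> q (es m)) (es m))" using es(3)[of q] q n by (simp add: dlt_Suc)
  have "refpj K g t = \<theta> * g e + (\<Sum>m<n. c m * (poly \<rho> t * poly (es m) t))" for t
   unfolding K[OF g] c_def[symmetric] by (simp add: sum_distrib_left mult_ac)
  then have "(g t - refpj K g t) * poly q t
   = (g t - \<theta> * g e) * poly q t - (\<Sum>m<n. c m * (poly \<rho> t * poly (es m) t * poly q t))" for t
   by (simp add: algebra_simps sum_distrib_left)
  then have "integral {0..1} (%t. (g t - refpj K g t) * poly q t)
   = integral {0..1} (%t. (g t - \<theta> * g e) * poly q t - (\<Sum>m<n. c m * (poly \<rho> t * poly (es m) t * poly q t)))"
   by simp
  also have "... = integral {0..1} (%t. (g t - \<theta> * g e) * poly q t)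
    - integral {0..1} (%t. \<Sum>m<n. c m * (poly \<rho> t * poly (es m) t * poly q t))"
   by (intro integral_diff integrable_continuous_real continuous_intros g)
  also have "integral {0..1} (%t. \<Sum>m<n. c m * (poly \<rho> t * poly (es m) t * poly q t))
   = (\<Sum>m<n. c m * ipw \<rho> (es m) q)"
   by (subst integral_sum) (auto intro!: integrable_continuous_real continuous_intros simp: ipw_def)
  also have "integral {0..1} (%t. (g t - \<theta> * g e) * poly q t)
   = integral {0..1} (%t. \<Sum>m<n. ipw \<rho> q (es m) * (poly (es m) t * (g t - \<theta> * g e)))"
   by (subst q') (simp add: poly_sum sum_distrib_left mult_ac)
  also have "... = (\<Sum>m<n. ipw \<rho> q (es m) * c m)"
   by (subst integral_sum) (auto intro!: integrable_continuous_real continuous_intros g simp: c_def)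
  finally show ?thesis by (simp add: ipw_commute[of \<rho> q] mult.commute)
 qed
 have "good_proj k l K"
  unfolding good_proj_def using rep orth dG d\<rho> es(1) deg e by (auto simp: K_def)
 moreover have "refpj K g e = g e" if "poly \<rho> e = 0" "\<theta> = 1" for g
  using that by (simp add: refpj_def K_def G_def poly_sum)
 ultimately show ?thesis
  by (intro exI[of _ K]) (auto simp: K_def G_def)
qed

text \<open>The three projections of degree \<open>k\<close>: Radau at the right end, Radau at the left end, $L^2$.\<close>

definition radR :: "nat => proj"
 where "radR k = (SOME K. good_proj k (k - 1) K & pnode K = 1 & (\<forall>g. refpj K g 1 = g 1))"

definition radL :: "nat => proj"
 where "radL k = (SOME K. good_proj k (k - 1) K & pnode K = 0 & (\<forall>g. refpj K g 0 = g 0))"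

definition projL2 :: "nat => proj"
 where "projL2 k = (SOME K. good_proj k k K & pgam K = 0)"

lemma degree_linear_mult: "dlt k p ==> k \<ge> 1 ==> degree ([:a, b::real:] * p) <= k"
proof -
 assume "dlt k p" "k \<ge> 1"
 then have "degree p <= k - 1" using dlt_Suc[of "k - 1" p] by simp
 moreover have "degree [:a, b:] <= 1" by simp
 ultimately show "degree ([:a, b:] * p) <= k"
  using degree_mult_le[of "[:a, b:]" p] \<open>k \<ge> 1\<close> by linarith
qed

lemma linear_factor:
 fixes p :: "real poly"
 assumes "degree p <= k" "k \<ge> 1"
 shows "\<exists>q. dlt k q & p - [:poly p e:] = [:- e, 1:] * q"
proof -
 have "poly (p - [:poly p e:]) e = 0" by simp
 then obtain q where q: "p - [:poly p e:] = [:- e, 1:] * q"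
  by (metis poly_eq_0_iff_dvd dvdE)
 have "degree (p - [:poly p e:]) <= k" using assms by (intro degree_diff_le) auto
 then have "dlt k q"
 proof (cases "q = 0")
  case False
  then have "degree ([:- e, 1:] * q) = Suc (degree q)" by (subst degree_mult_eq) auto
  with \<open>degree (p - [:poly p e:]) <= k\<close> show ?thesis
   using dlt_Suc[of "k - 1" q] assms by (simp add: q del: mult_pCons_left)
 qed (simp add: dlt_def)
 with q show ?thesis by blast
qed

lemma radR: assumes "k \<ge> 1"
 shows "good_proj k (k - 1) (radR k) & pnode (radR k) = 1 & (\<forall>g. refpj (radR k) g 1 = g 1)"
proof -
 have "\<exists>q. dlt k q & p - [:1 * poly p 1:] = [:1, -1:] * q" if p: "degree p <= k" for p :: "real poly"
 proof -
  \<comment> \<open>The linear factor is x - 1, but the weight has to be positive inside the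
    interval; hence the sign change to 1 - x.\<close>
  obtain q where q: "dlt k q" "p - [:poly p 1:] = [:- 1, 1:] * q"
   using linear_factor[OF p assms, of 1] by blast
  then have "dlt k (- q)" "p - [:1 * poly p 1:] = [:1, -1:] * (- q)"
   by (auto simp: dlt_def)
  then show ?thesis by blast
 qed
 then have "\<exists>K. good_proj k (k - 1) K & pnode K = 1 & ((1::real) = 0 --> pgam K = 0)
  & (poly [:1, -1::real:] 1 = 0 --> (1::real) = 1 --> (\<forall>g. refpj K g 1 = g 1))"
  using assms by (intro good_proj_exists[where n = k]) (auto intro: degree_linear_mult simp del: mult_pCons_left)
 then show ?thesis unfolding radR_def by (intro someI_ex[where P = "%K. good_proj _ _ K & _ K"]) simp
qed

lemma radL: assumes "k \<ge> 1"
 shows "good_proj k (k - 1) (radL k) & pnode (radL k) = 0 & (\<forall>g. refpj (radL k) g 0 = g 0)"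
proof -
 have "\<exists>K. good_proj k (k - 1) K & pnode K = 0 & ((1::real) = 0 --> pgam K = 0)
  & (poly [:0, 1::real:] 0 = 0 --> (1::real) = 1 --> (\<forall>g. refpj K g 0 = g 0))"
  using assms linear_factor[OF _ assms, of _ 0]
  by (intro good_proj_exists[where n = k]) (auto intro: degree_linear_mult simp del: mult_pCons_left)
 then show ?thesis unfolding radL_def by (intro someI_ex[where P = "%K. good_proj _ _ K & _ K"]) simp
qed

lemma projL2: "good_proj k k (projL2 k) & pgam (projL2 k) = 0"
proof -
 have "\<exists>K. good_proj k k K & pnode K = 0 & ((0::real) = 0 --> pgam K = 0)
  & (poly 1 (0::real) = 0 --> (0::real) = 1 --> (\<forall>g. refpj K g 0 = g 0))"
  by (intro good_proj_exists[where n = "Suc k"]) (auto simp: dlt_Suc)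
 then have "\<exists>K. good_proj k k K & pgam K = 0" by blast
 then show ?thesis unfolding projL2_def by (rule someI_ex)
qed

section \<open>Linearity and stability of the reference projections\<close>

lemma refpj_cong:
 assumes "!!t. 0 <= t ==> t <= 1 ==> g t = h t" "0 <= pnode K" "pnode K <= 1"
 shows "refpj K g s = refpj K h s"
proof -
 have "integral {0..1} (%t. poly (pQ K m) t * g t) = integral {0..1} (%t. poly (pQ K m) t * h t)" for m
  by (intro integral_cong) (simp add: assms)
 then show ?thesis using assms by (simp add: refpj_def)
qed

lemma refpj_add:
 assumes "continuous_on {0..1} g" "continuous_on {0..1} h"
 shows "refpj K (%t. g t + h t) s = refpj K g s + refpj K h s"
proof -
 have "integral {0..1} (%t. poly (pQ K m) t * (g t + h t))
  = integral {0..1} (%t. poly (pQ K m) t * g t) + integral {0..1} (%t. poly (pQ K m) t * h t)" for m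
  by (subst integral_add[symmetric])
    (auto intro!: integrable_continuous_real continuous_intros assms simp: distrib_left)
 then show ?thesis by (simp add: refpj_def sum.distrib distrib_left)
qed

lemma refpj_cmult: "refpj K (%t. c * g t) s = c * refpj K g s"
proof -
 have "integral {0..1} (%t. poly (pQ K m) t * (c * g t))
  = c * integral {0..1} (%t. poly (pQ K m) t * g t)" for m
  by (subst integral_mult_right[symmetric]) (simp add: mult_ac)
 then show ?thesis by (simp add: refpj_def sum_distrib_left distrib_left mult_ac)
qed

definition pnorm :: "real poly => real"
 where "pnorm p = (\<Sum>i\<le>degree p. \<bar>coeff p i\<bar>)"

lemma pnorm_nonneg: "pnorm p \<ge> 0"
 by (simp add: pnorm_def sum_nonneg)

lemma poly_le_pnorm: "0 <= t ==> t <= 1 ==> \<bar>poly p t\<bar> <= pnorm p"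
 unfolding poly_altdef pnorm_def
 by (rule order_trans[OF sum_abs])
   (auto intro!: sum_mono mult_left_le simp: abs_mult power_le_one)

definition pjB :: "proj => real"
 where "pjB K = pnorm (pgam K) + (\<Sum>m<prank K. pnorm (pP K m) * pnorm (pQ K m))"

lemma pjB_nonneg: "pjB K \<ge> 0"
 by (simp add: pjB_def pnorm_nonneg sum_nonneg add_nonneg_nonneg)

text \<open>The node value and the mean of the modulus are kept, in place of a supremum: on a long
  cell a layer function has a tiny value at the left end and a tiny mean, which its supremum does
  not show.\<close>

lemma refpj_bound_L1:
 assumes g: "continuous_on {0..1} g" and s: "0 <= s" "s <= 1"
 shows "\<bar>refpj K g s\<bar> <= pjB K * (\<bar>g (pnode K)\<bar> + integral {0..1} (%t. \<bar>g t\<bar>))"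
proof -
 define A where "A = integral {0..1} (%t. \<bar>g t\<bar>)"
 have A0: "A \<ge> 0" unfolding A_def
  by (intro integral_nonneg integrable_continuous_real continuous_intros g) auto
 have I: "\<bar>integral {0..1} (%t. poly (pQ K m) t * g t)\<bar> <= pnorm (pQ K m) * A" for m
 proof -
  have "norm (integral {0..1} (%t. poly (pQ K m) t * g t))
   <= integral {0..1} (%t. pnorm (pQ K m) * \<bar>g t\<bar>)"
   by (rule integral_norm_bound_integral)
     (auto intro!: integrable_continuous_real continuous_intros g mult_right_mono poly_le_pnorm simp: abs_mult)
  then show ?thesis by (simp add: A_def)
 qed
 have "\<bar>refpj K g s\<bar> <= \<bar>poly (pgam K) s * g (pnode K)\<bar>
   + \<bar>\<Sum>m<prank K. poly (pP K m) s * integral {0..1} (%t. poly (pQ K m) t * g t)\<bar>"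
  unfolding refpj_def by (rule abs_triangle_ineq)
 also have "... <= pnorm (pgam K) * \<bar>g (pnode K)\<bar> + (\<Sum>m<prank K. pnorm (pP K m) * (pnorm (pQ K m) * A))"
  by (intro add_mono order_trans[OF sum_abs] sum_mono)
    (auto simp: abs_mult intro!: mult_mono poly_le_pnorm s I pnorm_nonneg)
 also have "... <= pjB K * \<bar>g (pnode K)\<bar> + pjB K * A"
 proof (rule add_mono)
  show "pnorm (pgam K) * \<bar>g (pnode K)\<bar> <= pjB K * \<bar>g (pnode K)\<bar>"
   unfolding pjB_def by (intro mult_right_mono) (auto intro!: sum_nonneg simp: pnorm_nonneg)
  have "(\<Sum>m<prank K. pnorm (pP K m) * (pnorm (pQ K m) * A)) = (\<Sum>m<prank K. pnorm (pP K m) * pnorm (pQ K m)) * A"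
   by (simp only: sum_distrib_right mult.assoc)
  also have "... <= pjB K * A"
   unfolding pjB_def using A0 by (intro mult_right_mono) (auto simp: pnorm_nonneg)
  finally show "(\<Sum>m<prank K. pnorm (pP K m) * (pnorm (pQ K m) * A)) <= pjB K * A" .
 qed
 finally show ?thesis by (simp add: A_def distrib_left)
qed

lemma refpj_bound:
 assumes g: "continuous_on {0..1} g" and s: "0 <= s" "s <= 1"
  and e: "0 <= pnode K" "pnode K <= 1"
  and S: "!!t. 0 <= t ==> t <= 1 ==> \<bar>g t\<bar> <= S"
 shows "\<bar>refpj K g s\<bar> <= 2 * pjB K * S"
proof -
 have "integral {0..1} (%t. \<bar>g t\<bar>) <= integral {0..1} (%t::real. S)"
  by (intro integral_le integrable_continuous_real continuous_intros g) (auto intro: S)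
 then have "\<bar>g (pnode K)\<bar> + integral {0..1} (%t. \<bar>g t\<bar>) <= 2 * S" using S[OF e] by simp
 then have "pjB K * (\<bar>g (pnode K)\<bar> + integral {0..1} (%t. \<bar>g t\<bar>)) <= pjB K * (2 * S)"
  by (intro mult_left_mono pjB_nonneg)
 then show ?thesis using refpj_bound_L1[OF g s, of K] by linarith
qed

section \<open>Projections on an arbitrary interval\<close>

definition pj :: "proj => real => real => (real => real) => real => real"
 where "pj K c d g x = refpj K (%t. g (c + (d - c) * t)) ((x - c) / (d - c))"

lemma unit_affine:
 assumes "c < (d::real)" "0 <= t" "t <= 1"
 shows "c + (d - c) * t \<in> {c..d}"
proof -
 have "(d - c) * t <= (d - c) * 1" "0 <= (d - c) * t"
  using assms by (auto intro: mult_left_le)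
 then show ?thesis by simp
qed

lemma continuous_on_unit_affine:
 assumes "c < (d::real)" "continuous_on {c..d} g"
 shows "continuous_on {0..1} (%t. g (c + (d - c) * t))"
 by (rule continuous_on_compose2[OF assms(2)]) (use unit_affine[OF assms(1)] in \<open>auto intro!: continuous_intros\<close>)

locale interval_proj =
 fixes k l :: nat and K :: proj
 assumes good: "good_proj k l K"
begin

lemma node: "0 <= pnode K" "pnode K <= 1"
 using good by (auto simp: good_proj_def)

lemma pj_cong:
 assumes "c < d" "!!t. t \<in> {c..d} ==> g t = h t"
 shows "pj K c d g x = pj K c d h x"
 unfolding pj_def using node unit_affine[OF assms(1)] assms(2) by (intro refpj_cong) auto

lemma pj_add:
 assumes "c < d" "continuous_on {c..d} g" "continuous_on {c..d} h"
 shows "pj K c d (%t. g t + h t) x = pj K c d g x + pj K c d h x"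
 unfolding pj_def by (intro refpj_add continuous_on_unit_affine assms)

lemma pj_cmult: "pj K c d (%t. r * g t) x = r * pj K c d g x"
 unfolding pj_def by (rule refpj_cmult)

lemma pj_diff:
 assumes "c < d" "continuous_on {c..d} g" "continuous_on {c..d} h"
 shows "pj K c d (%t. g t - h t) x = pj K c d g x - pj K c d h x"
 using pj_add[OF assms(1,2), of "%t. - 1 * h t" x] assms(3) pj_cmult[of c d "-1" h]
 by (simp add: continuous_on_minus)

lemma unit_coord: "(c::real) < d ==> x \<in> {c..d} ==> 0 <= (x - c) / (d - c) & (x - c) / (d - c) <= 1"
 using divide_nonneg_nonneg[of "x - c" "d - c"] divide_le_eq_1_pos[of "d - c" "x - c"] by simp

lemma pj_bound:
 assumes "c < d" "continuous_on {c..d} g" "x \<in> {c..d}" "!!t. t \<in> {c..d} ==> \<bar>g t\<bar> <= S"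
 shows "\<bar>pj K c d g x\<bar> <= 2 * pjB K * S"
 unfolding pj_def using unit_coord[OF assms(1,3)] unit_affine[OF assms(1)]
 by (intro refpj_bound continuous_on_unit_affine assms node) auto

lemma pj_is_poly: "\<exists>p. degree p <= k & pj K c d g = poly p"
proof -
 define r where "r = [:- c / (d - c), 1 / (d - c):]"
 define p where "p = smult (g (c + (d - c) * pnode K)) (pgam K \<circ>\<^sub>p r)
   + (\<Sum>m<prank K. smult (integral {0..1} (%t. poly (pQ K m) t * g (c + (d - c) * t))) (pP K m \<circ>\<^sub>p r))"
 have dr: "degree (q \<circ>\<^sub>p r) <= k" if "degree q <= k" for q
 proof -
  have "degree r <= 1" by (simp add: r_def)
  then have "degree q * degree r <= k * 1" using that by (intro mult_le_mono)
  then show ?thesis by (simp add: degree_pcompose)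
 qed
 have ds: "degree (smult a q) <= k" if "degree q <= k" for a and q :: "real poly"
  using that degree_smult_le[of a q] by linarith
 have "degree p <= k" unfolding p_def
  using good by (intro degree_add_le degree_sum_le ds dr) (auto simp: good_proj_def)
 moreover have "poly r x = (x - c) / (d - c)" for x by (simp add: r_def diff_divide_distrib)
 then have "pj K c d g = poly p"
  by (intro ext) (simp add: pj_def refpj_def p_def poly_sum poly_pcompose mult.commute)
 ultimately show ?thesis by blast
qed

lemma continuous_on_pj: "continuous_on S (pj K c d g)"
proof -
 obtain p where "pj K c d g = poly p" using pj_is_poly by blast
 then show ?thesis by (simp add: continuous_on_poly')
qed

lemma pj_poly:
 assumes "c < d" "degree p <= k"
 shows "pj K c d (poly p) x = poly p x"
proof -
 define r where "r = p \<circ>\<^sub>p [:c, d - c:]"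
 have "degree r = degree p * degree [:c, d - c:]" by (simp add: r_def degree_pcompose)
 then have "degree r <= k" using assms by simp
 then have "refpj K (poly r) s = poly r s" for s using good by (simp add: good_proj_def)
 moreover have "poly r t = poly p (c + (d - c) * t)" for t
  by (simp add: r_def poly_pcompose mult.commute)
 moreover have "c + (d - c) * ((x - c) / (d - c)) = x" using assms by simp
 moreover have "poly r = (%t. poly p (c + (d - c) * t))" using calculation(2) by blast
 ultimately show ?thesis by (metis pj_def)
qed

lemma pj_orth:
 assumes "c < d" "continuous_on {c..d} g" "degree q <= l"
 shows "integral {c..d} (%x. (g x - pj K c d g x) * poly q x) = 0"
proof -
 define r where "r = q \<circ>\<^sub>p [:c, d - c:]"
 have "degree r <= l" using assms by (simp add: r_def degree_pcompose)
 then have "integral {0..1} (%t. (g (c + (d - c) * t) - refpj K (%t. g (c + (d - c) * t)) t) * poly r t) = 0"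
  using good continuous_on_unit_affine[OF assms(1,2)] by (simp add: good_proj_def)
 moreover have "poly r t = poly q (c + (d - c) * t)" for t
  by (simp add: r_def poly_pcompose mult.commute)
 ultimately show ?thesis using assms(1) by (simp add: integral_affine_unit[OF assms(1)] pj_def)
qed

text \<open>The explicit form sees \<open>g\<close> only through the node value (absent if
  \<open>pgam\<close> is 0) and the moments up to degree \<open>l\<close>. This is what turns the
  defining conditions of the Gauss-Radau projections into an equality of functions.\<close>

lemma pj_moment_cong:
 assumes "c < d" "pgam K \<noteq> 0 ==> g (c + (d - c) * pnode K) = h (c + (d - c) * pnode K)"
  and "!!q. degree q <= l ==> integral {c..d} (%x. poly q x * g x) = integral {c..d} (%x. poly q x * h x)"
 shows "pj K c d g x = pj K c d h x"
proof -
 have "integral {0..1} (%t. poly (pQ K m) t * g (c + (d - c) * t))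
  = integral {0..1} (%t. poly (pQ K m) t * h (c + (d - c) * t))" if "m < prank K" for m
 proof -
  define q where "q = pQ K m \<circ>\<^sub>p [:- c / (d - c), 1 / (d - c):]"
  have q: "poly q (c + (d - c) * t) = poly (pQ K m) t" for t
  proof -
   have "- c / (d - c) + (c + (d - c) * t) * (1 / (d - c)) = t"
    using assms(1) by (simp add: add_divide_distrib)
   then show ?thesis by (simp add: q_def poly_pcompose)
  qed
  have "degree (pQ K m) <= l" using that good by (simp add: good_proj_def)
  moreover have "degree q = degree (pQ K m) * degree [:- c / (d - c), 1 / (d - c):]"
   by (simp add: q_def degree_pcompose)
  ultimately have "degree q <= l" using assms(1) by simp
  from assms(3)[OF this] show ?thesis using assms(1) by (simp add: integral_affine_unit[OF assms(1)] q)
 qed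
 then show ?thesis using assms(2) by (cases "pgam K = 0") (auto simp: pj_def refpj_def)
qed

text \<open>The Taylor polynomial at the left end point has degree at most \<open>k\<close>, hence
  is reproduced; the sup bound of the projection is applied to the Taylor remainder, whose factor 1
  / k! is dropped. \<open>D\<close> lists the derivatives, so that one-sided derivatives and
  weighted functions can be fed in directly.\<close>

lemma pj_error:
 assumes cd: "c < d" and x: "x \<in> {c..d}" and D0: "D 0 = g"
  and D: "!!m t. m <= k ==> t \<in> {c..d} ==> (D m has_real_derivative D (Suc m) t) (at t within {c..d})"
  and S: "!!t. t \<in> {c..d} ==> \<bar>D (Suc k) t\<bar> <= S"
 shows "\<bar>g x - pj K c d g x\<bar> <= (1 + 2 * pjB K) * ((d - c) ^ Suc k * S)"
proof -
 define p where "p = (\<Sum>i<Suc k. smult (D i c / fact i) ([:- c, 1:] ^ i))"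
 have "degree ([:- c, 1:] ^ i) <= k" if "i < Suc k" for i
  using degree_power_le[of "[:- c, 1:]" i] that by simp
 then have dp: "degree p <= k" unfolding p_def
  by (intro degree_sum_le) (auto intro: order_trans[OF degree_smult_le])
 have pv: "poly p t = (\<Sum>i<Suc k. ((t - c) ^ i / fact i) *\<^sub>R D i c)" for t
  by (simp add: p_def poly_sum mult.commute)
 have S0: "S \<ge> 0" using S[OF x] by linarith
 have cont: "continuous_on {c..d} g"
  using DERIV_continuous_on[of "{c..d}" "D 0" "D (Suc 0)"] D[of 0] D0 by simp
 have r: "\<bar>g t - poly p t\<bar> <= (d - c) ^ Suc k * S" if t: "t \<in> {c..d}" for t
 proof -
  have Dt: "(D m has_vector_derivative D (Suc m) s) (at s within {c..t})"
   if "m < Suc k" "c <= s" "s <= t" for m s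
   using D[of m s] that t
   by (auto simp: has_real_derivative_iff_has_vector_derivative intro: has_vector_derivative_within_subset)
  let ?i = "%x. ((t - x) ^ (Suc k - 1) / fact (Suc k - 1)) *\<^sub>R D (Suc k) x"
  have *: "g t = poly p t + integral {c..t} ?i" and int: "?i integrable_on {c..t}"
   unfolding pv using Taylor_integral[of "Suc k" D g c t, OF _ D0 Dt]
    Taylor_integrable[of "Suc k" D g c t, OF _ D0 Dt] t by auto
  have "norm (integral (cbox c t) ?i) <= (d - c) ^ k * S * Henstock_Kurzweil_Integration.content (cbox c t)"
  proof (rule integrable_bound)
   show "0 <= (d - c) ^ k * S" using S0 cd by simp
   show "?i integrable_on cbox c t" using int by simp
   fix s assume s: "s \<in> cbox c t"
   have "\<bar>t - s\<bar> ^ k <= (d - c) ^ k" using s t by (intro power_mono) auto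
   moreover have "\<bar>t - s\<bar> ^ k / fact k <= \<bar>t - s\<bar> ^ k" 
    by (simp add: divide_le_eq mult_le_cancel_left1)
   ultimately have "\<bar>t - s\<bar> ^ k / fact k * \<bar>D (Suc k) s\<bar> <= (d - c) ^ k * S"
    using S[of s] s t S0 by (intro mult_mono) auto
   then show "norm (?i s) <= (d - c) ^ k * S" by (simp add: abs_mult power_abs)
  qed
  also have "... <= (d - c) ^ k * S * (d - c)"
   using t S0 cd by (intro mult_left_mono) auto
  finally show ?thesis using * by (simp add: mult_ac)
 qed
 have "pj K c d (%t. g t - poly p t) x = pj K c d g x - pj K c d (poly p) x"
  using cd cont by (intro pj_diff continuous_on_poly' continuous_on_id)
 then have "g x - pj K c d g x = (g x - poly p x) - pj K c d (%t. g t - poly p t) x"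
  using pj_poly[OF cd dp] by simp
 also have "\<bar>...\<bar> <= (d - c) ^ Suc k * S + 2 * pjB K * ((d - c) ^ Suc k * S)"
  by (rule order_trans[OF abs_triangle_ineq4] add_mono r x pj_bound cd continuous_intros cont)+
 finally show ?thesis by (simp add: distrib_right)
qed

end

lemma pj_trace:
 assumes "c < d" "!!g. refpj K g (pnode K) = g (pnode K)"
 shows "pj K c d g (c + (d - c) * pnode K) = g (c + (d - c) * pnode K)"
 using assms by (simp add: pj_def)

subsection \<open>Projections of functions of two variables\<close>

lemma continuous_on_line_x:
 "continuous_on (A \<times> B) (u::real\<times>real=>real) ==> y \<in> B ==> continuous_on A (%x. u (x, y))"
 by (rule continuous_on_compose2[where g = u]) (auto intro!: continuous_intros)

lemma continuous_on_line_y: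
 "continuous_on (A \<times> B) (u::real\<times>real=>real) ==> x \<in> A ==> continuous_on B (%y. u (x, y))"
 by (rule continuous_on_compose2[where g = u]) (auto intro!: continuous_intros)

lemma continuous_on_swap:
 "continuous_on (A \<times> B) (u::real\<times>real=>real) ==> continuous_on (B \<times> A) (%(y, x). u (x, y))"
 unfolding split_beta by (rule continuous_on_compose2[where g = u]) (auto intro!: continuous_intros)

lemma continuous_on_integral_param:
 fixes u :: "'a::topological_space \<times> real => real"
 assumes "continuous_on (A \<times> {c..d}) u"
 shows "continuous_on A (%x. integral {c..d} (%t. u (x, t)))"
 using integral_continuous_on_param[of A c d "%x t. u (x, t)"] assms by simp

context interval_proj
begin

lemma continuous_on_param_affine:
 fixes u :: "real \<times> real => real"
 assumes "c < d" "continuous_on (A \<times> {c..d}) u"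
 shows "continuous_on (A \<times> {0..1}) (%(x, t). u (x, c + (d - c) * t))"
 unfolding split_beta
 by (rule continuous_on_compose2[OF assms(2)]) (use unit_affine[OF assms(1)] in \<open>auto intro!: continuous_intros\<close>)

lemma continuous_on_moment:
 fixes u :: "real \<times> real => real"
 assumes "c < d" "continuous_on (A \<times> {c..d}) u"
 shows "continuous_on A (%x. integral {0..1} (%t. poly q t * u (x, c + (d - c) * t)))"
proof -
 have "continuous_on (A \<times> {0..1}) (%z. poly q (snd z) * (%(x, t). u (x, c + (d - c) * t)) z)"
  by (intro continuous_intros continuous_on_param_affine assms)
 from continuous_on_integral_param[OF this] show ?thesis by simp
qed

lemma continuous_on_pj_y:
 fixes u :: "real \<times> real => real"
 assumes "c < d" "continuous_on (A \<times> {c..d}) u"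
 shows "continuous_on (A \<times> UNIV) (%(x, y). pj K c d (%t. u (x, t)) y)"
proof -
 have m: "continuous_on (A \<times> UNIV) (%z::real\<times>real. integral {0..1} (%t. poly q t * u (fst z, c + (d - c) * t)))" for q
  by (rule continuous_on_compose2[OF continuous_on_moment[OF assms]]) (auto intro!: continuous_intros)
 have n: "continuous_on (A \<times> UNIV) (%z::real\<times>real. u (fst z, c + (d - c) * pnode K))"
  by (rule continuous_on_compose2[OF assms(2)]) (use unit_affine[OF assms(1) node] in \<open>auto intro!: continuous_intros\<close>)
 show ?thesis unfolding split_beta pj_def refpj_def
  by (intro continuous_intros m n) (use assms in auto)
qed

lemma continuous_on_pj_x:
 fixes u :: "real \<times> real => real"
 assumes "c < d" "continuous_on ({c..d} \<times> B) u"
 shows "continuous_on (UNIV \<times> B) (%(x, y). pj K c d (%t. u (t, y)) x)"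
 using continuous_on_swap[OF continuous_on_pj_y[OF assms(1) continuous_on_swap[OF assms(2)]]]
 by (simp add: split_beta)

text \<open>Only the node value and the moments depend on the other variable, and each moment may be
  differentiated under the integral. Thus projecting in y commutes with differentiating in x, also
  one-sidedly at end points of \<open>A\<close>.\<close>

lemma pj_y_derivative:
 fixes u :: "real \<times> real => real"
 assumes cd: "c < d" and A: "convex A" "x \<in> A"
  and u: "continuous_on (A \<times> {c..d}) u" and ux: "continuous_on (A \<times> {c..d}) ux"
  and D: "!!x t. x \<in> A ==> t \<in> {c..d} ==> ((%x. u (x, t)) has_real_derivative ux (x, t)) (at x within A)"
 shows "((%x. pj K c d (%t. u (x, t)) y) has_real_derivative pj K c d (%t. ux (x, t)) y) (at x within A)"
proof -
 have *: "((%x. integral {0..1} (%t. poly q t * u (x, c + (d - c) * t))) has_real_derivative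
   integral {0..1} (%t. poly q t * ux (x, c + (d - c) * t))) (at x within A)" for q
 proof -
  have "((%x. integral (cbox 0 1) (%t. poly q t * u (x, c + (d - c) * t))) has_real_derivative
   integral (cbox 0 1) (%t. poly q t * ux (x, c + (d - c) * t))) (at x within A)"
  proof (rule leibniz_rule_field_derivative[OF _ _ _ A(2,1)])
   fix x t assume xt: "x \<in> A" "t \<in> cbox (0::real) 1"
   then show "((%x. poly q t * u (x, c + (d - c) * t)) has_real_derivative poly q t * ux (x, c + (d - c) * t)) (at x within A)"
    using unit_affine[OF cd, of t] by (intro DERIV_cmult D) auto
  next
   fix x assume "x \<in> A"
   then show "(%t. poly q t * u (x, c + (d - c) * t)) integrable_on cbox 0 1"
    unfolding cbox_interval
    by (intro integrable_continuous_real continuous_intros continuous_on_unit_affine cd continuous_on_line_y[OF u])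
  next
   have "continuous_on (A \<times> {0..1}) (%z. poly q (snd z) * (%(x, t). ux (x, c + (d - c) * t)) z)"
    by (intro continuous_intros continuous_on_param_affine cd ux)
   then show "continuous_on (A \<times> cbox 0 1) (%(x, t). poly q t * ux (x, c + (d - c) * t))"
    by (simp add: split_beta)
  qed
  then show ?thesis by simp
 qed
 show ?thesis unfolding pj_def refpj_def
  by (rule derivative_eq_intros * D A unit_affine cd node refl)+ (simp add: mult.commute)
qed

end

lemma pj_unfold:
 "pj K c d g x = poly (pgam K) ((x - c) / (d - c)) * g (c + (d - c) * pnode K)
  + (\<Sum>m<prank K. poly (pP K m) ((x - c) / (d - c)) * integral {0..1} (%t. poly (pQ K m) t * g (c + (d - c) * t)))"
 by (simp add: pj_def refpj_def)

section \<open>An inverse inequality for polynomials\<close>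

lemma pderiv_sum: "pderiv (\<Sum>m\<in>A. f m) = (\<Sum>m\<in>A. pderiv (f m))"
 by (induction A rule: infinite_finite_induct) (auto simp: pderiv_add)

text \<open>Reproduction by \<open>projL2\<close> writes \<open>p\<close> as a combination of fixed
  polynomials whose coefficients are moments of \<open>p\<close>; the derivative falls on the fixed
  polynomials. This gives an explicit constant in place of an equivalence of norms.\<close>

lemma poly_inverse_inequality_unit:
 assumes "degree p <= k" "0 <= t" "t <= 1"
 shows "\<bar>poly (pderiv p) t\<bar>
  <= (\<Sum>m<prank (projL2 k). pnorm (pderiv (pP (projL2 k) m)) * pnorm (pQ (projL2 k) m)) * integral {0..1} (%t. \<bar>poly p t\<bar>)"
proof -
 let ?K = "projL2 k"
 define c where "c m = integral {0..1} (%t. poly (pQ ?K m) t * poly p t)" for m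
 have "refpj ?K (poly p) = poly p" "pgam ?K = 0"
  using projL2[of k] assms(1) by (auto simp: good_proj_def)
 then have "poly p = poly (\<Sum>m<prank ?K. smult (c m) (pP ?K m))"
  by (intro ext) (simp add: refpj_def c_def poly_sum fun_eq_iff mult.commute)
 then have p: "p = (\<Sum>m<prank ?K. smult (c m) (pP ?K m))" by (simp add: poly_eq_poly_eq_iff)
 have "pderiv p = (\<Sum>m<prank ?K. smult (c m) (pderiv (pP ?K m)))"
  by (subst p) (simp add: pderiv_sum pderiv_smult)
 then have "\<bar>poly (pderiv p) t\<bar> = \<bar>\<Sum>m<prank ?K. c m * poly (pderiv (pP ?K m)) t\<bar>"
  by (simp add: poly_sum)
 also have "... <= (\<Sum>m<prank ?K. (pnorm (pQ ?K m) * integral {0..1} (%t. \<bar>poly p t\<bar>)) * pnorm (pderiv (pP ?K m)))"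
 proof (rule order_trans[OF sum_abs sum_mono])
  fix m
  have "norm (c m) <= integral {0..1} (%t. pnorm (pQ ?K m) * \<bar>poly p t\<bar>)" unfolding c_def
   by (rule integral_norm_bound_integral)
     (auto intro!: integrable_continuous_real continuous_intros mult_right_mono poly_le_pnorm simp: abs_mult)
  then have "\<bar>c m\<bar> <= pnorm (pQ ?K m) * integral {0..1} (%t. \<bar>poly p t\<bar>)" by simp
  then show "\<bar>c m * poly (pderiv (pP ?K m)) t\<bar> <= (pnorm (pQ ?K m) * integral {0..1} (%t. \<bar>poly p t\<bar>)) * pnorm (pderiv (pP ?K m))"
   unfolding abs_mult using assms by (intro mult_mono poly_le_pnorm) auto
 qed
 also have "... = (\<Sum>m<prank ?K. pnorm (pderiv (pP ?K m)) * pnorm (pQ ?K m)) * integral {0..1} (%t. \<bar>poly p t\<bar>)"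
  unfolding sum_distrib_right by (intro sum.cong refl) simp
 finally show ?thesis .
qed

definition invC :: "nat => real"
 where "invC k = (\<Sum>m<prank (projL2 k). pnorm (pderiv (pP (projL2 k) m)) * pnorm (pQ (projL2 k) m))"

lemma invC_nonneg: "invC k \<ge> 0"
 by (auto simp: invC_def intro!: sum_nonneg simp: pnorm_nonneg)

text \<open>The pointwise bound on the unit interval is integrated and rescaled. The power of the
  length matters: it will be cancelled exactly by the Lipschitz factor of the convection
  coefficient.\<close>

lemma poly_inverse_inequality:
 assumes "c < d" "degree p <= k"
 shows "integral {c..d} (%x. \<bar>poly (pderiv p) x\<bar>) <= invC k / (d - c) * integral {c..d} (%x. \<bar>poly p x\<bar>)"
proof -
 define r where "r = p \<circ>\<^sub>p [:c, d - c:]"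
 have r: "poly r t = poly p (c + (d - c) * t)" for t by (simp add: r_def poly_pcompose mult.commute)
 have r': "poly (pderiv r) t = (d - c) * poly (pderiv p) (c + (d - c) * t)" for t
  by (simp add: r_def pderiv_pcompose poly_pcompose pderiv_pCons mult.commute)
 have "degree r <= k" using assms by (simp add: r_def degree_pcompose)
 then have "integral {0..1} (%t. \<bar>poly (pderiv r) t\<bar>) <= integral {0..1} (%t::real. invC k * integral {0..1} (%t. \<bar>poly r t\<bar>))"
  unfolding invC_def
  by (intro integral_le poly_inverse_inequality_unit integrable_continuous_real continuous_intros) auto
 then have "(d - c) * integral {0..1} (%t. \<bar>poly (pderiv p) (c + (d - c) * t)\<bar>) <= invC k * integral {0..1} (%t. \<bar>poly r t\<bar>)"
  using assms by (simp add: r' abs_mult)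
 moreover have "invC k / (d - c) * ((d - c) * J) = invC k * J" for J using assms(1) by simp
 ultimately show ?thesis
  unfolding integral_affine_unit[OF assms(1)] r by metis
qed

section \<open>Line functionals on a one-dimensional mesh\<close>

text \<open>A broken function is a family indexed by the cells \<open>i = 1, \<dots>, N\<close>, the \<open>i\<close>-th member being
  used on \<open>{X (i - 1)..X i}\<close> only.\<close>

definition L1 :: "nat => (nat => real) => (nat => real => real) => real"
 where "L1 N X f = (\<Sum>i=1..N. integral {X (i - 1)..X i} (f i))"

text \<open>The terms of \<open>T2\<close> along one line: the numerical flux of \<open>U\<close> is
  the value from the left, and only interior nodes contribute. The derivative \<open>s'\<close> is
  an argument of its own, which allows purely algebraic statements.\<close>

definition D1 :: "nat => (nat => real) => (nat => real => real) => (nat => real => real) => (nat => real => real) => real"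
 where "D1 N X U s s' = L1 N X (%i x. U i x * s' i x)
  + (\<Sum>i=1..N-1. U i (X i) * (s (Suc i) (X i) - s i (X i)))"

text \<open>The terms of \<open>T3\<close> along one line: the numerical flux is the value from the
  right, except at the last node, where it is taken from the left. The two end terms are jumps of
  \<open>v\<close> against the zero trace outside.\<close>

definition D2 :: "nat => (nat => real) => (nat => real => real) => (nat => real => real) => (nat => real => real) => real"
 where "D2 N X P v v' = L1 N X (%i x. P i x * v' i x)
  + (\<Sum>i=1..N-1. P (Suc i) (X i) * (v (Suc i) (X i) - v i (X i)))
  + P 1 (X 0) * v 1 (X 0) - P N (X N) * v N (X N)"

text \<open>The volume and jump terms of \<open>T4\<close> along one line. The last jump of
  \<open>v\<close> is minus its trace, whence the positive outflow term beside
  \<open>D1\<close>.\<close>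

definition L4 :: "nat => (nat => real) => (real => real) => (nat => real => real) => (nat => real => real) => (nat => real => real) => real"
 where "L4 N X A U v v' = - D1 N X (%i x. A x * U i x) v v' + A (X N) * U N (X N) * v N (X N)"

definition pc :: "nat => (nat => real) => (nat => real => real) => bool"
 where "pc N X f \<longleftrightarrow> (\<forall>i\<in>{1..N}. continuous_on {X (i - 1)..X i} (f i))"

definition pder :: "nat => (nat => real) => (nat => real => real) => (nat => real => real) => bool"
 where "pder N X f f' \<longleftrightarrow> pc N X f' & (\<forall>i\<in>{1..N}. \<forall>x\<in>{X (i - 1)..X i}.
  (f i has_real_derivative f' i x) (at x within {X (i - 1)..X i}))"

definition pcw_poly :: "nat => nat => (nat => real => real) => (nat => real => real) => bool"
 where "pcw_poly N k v v' \<longleftrightarrow> (\<forall>i\<in>{1..N}. \<exists>p. degree p <= k & v i = poly p & v' i = poly (pderiv p))"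

lemma pc_add: "pc N X f ==> pc N X g ==> pc N X (%i x. f i x + g i x)"
 and pc_diff: "pc N X f ==> pc N X g ==> pc N X (%i x. f i x - g i x)"
 and pc_mult: "pc N X f ==> pc N X g ==> pc N X (%i x. f i x * g i x)"
 and pc_cmult: "pc N X f ==> pc N X (%i x. c * f i x)"
 and pc_power: "pc N X f ==> pc N X (%i x. f i x ^ n)"
 and pc_const: "pc N X (%i x. r i)"
 and pc_abs: "pc N X f ==> pc N X (%i x. \<bar>f i x\<bar>)"
 and pc_minus: "pc N X f ==> pc N X (%i x. - f i x)"
 by (auto simp: pc_def intro!: continuous_intros)

lemma pc_sum: "(!!m. m \<in> A ==> pc N X (f m)) ==> pc N X (%i x. \<Sum>m\<in>A. f m i x)"
 by (auto simp: pc_def intro!: continuous_intros)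

lemmas pc_intros = pc_add pc_diff pc_mult pc_cmult pc_power pc_const pc_abs pc_minus pc_sum

lemma pder_pc: "pder N X f f' ==> pc N X f"
 by (auto simp: pder_def pc_def intro!: DERIV_continuous_on)

lemma pder_pc': "pder N X f f' ==> pc N X f'"
 by (auto simp: pder_def)

lemma pcw_poly_pder: "pcw_poly N k v v' ==> pder N X v v'"
 unfolding pcw_poly_def pder_def pc_def
 by (force intro!: continuous_intros DERIV_subset[OF poly_DERIV])

lemma pcw_poly_pc: "pcw_poly N k v v' ==> pc N X v" "pcw_poly N k v v' ==> pc N X v'"
 using pder_pc pder_pc' pcw_poly_pder by blast+

lemma L1_add: "pc N X f ==> pc N X g ==> L1 N X (%i x. f i x + g i x) = L1 N X f + L1 N X g"
 unfolding L1_def sum.distrib[symmetric] pc_def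
 by (intro sum.cong refl integral_add integrable_continuous_real) auto

lemma L1_diff: "pc N X f ==> pc N X g ==> L1 N X (%i x. f i x - g i x) = L1 N X f - L1 N X g"
 unfolding L1_def sum_subtractf[symmetric] pc_def
 by (intro sum.cong refl integral_diff integrable_continuous_real) auto

lemma L1_cmult: "L1 N X (%i x. c * f i x) = c * L1 N X f"
 by (simp add: L1_def sum_distrib_left)

lemma L1_minus: "L1 N X (%i x. - f i x) = - L1 N X f"
 using L1_cmult[of N X "-1" f] by simp

lemma L1_sum:
 assumes "finite A" "!!m. m \<in> A ==> pc N X (f m)"
 shows "L1 N X (%i x. \<Sum>m\<in>A. f m i x) = (\<Sum>m\<in>A. L1 N X (f m))"
 using assms by (induction A rule: finite_induct) (auto simp: L1_add pc_sum, simp add: L1_def)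

lemma L1_mono:
 assumes "pc N X f" "pc N X g" "!!i x. i \<in> {1..N} ==> x \<in> {X (i - 1)..X i} ==> f i x <= g i x"
 shows "L1 N X f <= L1 N X g"
 unfolding L1_def using assms unfolding pc_def
 by (intro sum_mono integral_le integrable_continuous_real) auto

lemma L1_nonneg:
 assumes "pc N X f" "!!i x. i \<in> {1..N} ==> x \<in> {X (i - 1)..X i} ==> 0 <= f i x"
 shows "0 <= L1 N X f"
 using L1_mono[of N X "%_ _. 0" f] assms by (simp add: pc_const) (simp add: L1_def)

lemma L1_cong:
 assumes "!!i x. i \<in> {1..N} ==> x \<in> {X (i - 1)..X i} ==> f i x = g i x"
 shows "L1 N X f = L1 N X g"
 unfolding L1_def using assms by (intro sum.cong refl integral_cong) auto

lemma L1_0: "L1 N X (%_ _. 0) = 0"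
 by (simp add: L1_def)

lemma D1_cong:
 assumes "!!i x. i \<in> {1..N} ==> x \<in> {X (i - 1)..X i} ==> U i x = V i x" "!!i. i < N ==> X i <= X (Suc i)"
 shows "D1 N X U s s' = D1 N X V s s'"
proof -
 have "U i (X i) = V i (X i)" if "i \<in> {1..N - 1}" for i
  using that assms(2)[of "i - 1"] by (intro assms(1)) auto
 then show ?thesis unfolding D1_def
  by (intro arg_cong2[where f = "(+)"] L1_cong sum.cong) (auto simp: assms(1))
qed

lemma D1_add:
 assumes "pc N X (%i x. U i x * s' i x)" "pc N X (%i x. V i x * s' i x)"
 shows "D1 N X (%i x. U i x + V i x) s s' = D1 N X U s s' + D1 N X V s s'"
proof -
 have "L1 N X (%i x. (U i x + V i x) * s' i x) = L1 N X (%i x. U i x * s' i x) + L1 N X (%i x. V i x * s' i x)"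
  using L1_add[OF assms] by (simp add: distrib_right)
 then show ?thesis by (simp add: D1_def distrib_right sum.distrib)
qed

lemma D2_add:
 assumes "pc N X (%i x. U i x * s' i x)" "pc N X (%i x. V i x * s' i x)"
 shows "D2 N X (%i x. U i x + V i x) s s' = D2 N X U s s' + D2 N X V s s'"
proof -
 have "L1 N X (%i x. (U i x + V i x) * s' i x) = L1 N X (%i x. U i x * s' i x) + L1 N X (%i x. V i x * s' i x)"
  using L1_add[OF assms] by (simp add: distrib_right)
 then show ?thesis by (simp add: D2_def distrib_right sum.distrib)
qed

lemma L4_add:
 assumes "pc N X (%i x. A x * U i x * s' i x)" "pc N X (%i x. A x * V i x * s' i x)"
 shows "L4 N X A (%i x. U i x + V i x) s s' = L4 N X A U s s' + L4 N X A V s s'"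
 using D1_add[of N X "%i x. A x * U i x" s' "%i x. A x * V i x" s] assms
 by (simp add: L4_def distrib_left distrib_right)

section \<open>Discrete integration by parts on a one-dimensional mesh\<close>

locale grid =
 fixes N :: nat and X :: "nat => real"
 assumes N1: "N \<ge> 1" and strict: "i < N ==> X i < X (Suc i)"
begin

lemma cell: "i \<in> {1..N} ==> X (i - 1) < X i"
 using strict[of "i - 1"] by auto

lemma X_mono: "i <= j ==> j <= N ==> X i <= X j"
proof (induction j)
 case (Suc j) then show ?case using strict[of j] by (cases "i = Suc j") auto
qed simp

lemma cell_subset: "i \<in> {1..N} ==> {X (i - 1)..X i} \<subseteq> {X 0..X N}"
 using X_mono[of 0 "i - 1"] X_mono[of i N] by auto

lemma pc_global: "continuous_on {X 0..X N} g ==> pc N X (%_. g)"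
 using cell_subset unfolding pc_def by (meson continuous_on_subset)

lemma pder_global:
 assumes "continuous_on {X 0..X N} g'"
  "!!x. x \<in> {X 0..X N} ==> (g has_real_derivative g' x) (at x within {X 0..X N})"
 shows "pder N X (%_. g) (%_. g')"
 using assms pc_global cell_subset unfolding pder_def by (meson DERIV_subset subsetD)

lemma L1_const: "L1 N X (%_ _. c) = c * (X N - X 0)"
proof -
 have "L1 N X (%_ _. c) = (\<Sum>i=1..N. c * (X i - X (i - 1)))"
  unfolding L1_def using cell by (intro sum.cong refl) (auto simp: less_imp_le)
 also have "... = c * (\<Sum>i=1..N. X i - X (i - 1))" by (simp add: sum_distrib_left)
 also have "(\<Sum>i=1..N. X i - X (i - 1)) = X N - X 0"
  using sum_telescope''[of 0 N X] by simp
 finally show ?thesis .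
qed

lemma L1_whole:
 assumes "continuous_on {X 0..X N} g"
 shows "L1 N X (%_. g) = integral {X 0..X N} g"
proof -
 have "(\<Sum>i=1..n. integral {X (i - 1)..X i} g) = integral {X 0..X n} g" if "n <= N" for n
  using that
 proof (induction n)
  case (Suc n)
  have "integral {X 0..X n} g + integral {X n..X (Suc n)} g = integral {X 0..X (Suc n)} g"
   using X_mono[of 0 n] X_mono[of n "Suc n"] X_mono[of "Suc n" N] Suc.prems
   by (intro Henstock_Kurzweil_Integration.integral_combine integrable_continuous_real
     continuous_on_subset[OF assms]) auto
  then show ?case using Suc by simp
 qed simp
 then show ?thesis by (simp add: L1_def)
qed

lemma telescope: "(\<Sum>i=1..N. A i - B i) + (\<Sum>i=1..N-1. B (Suc i) - A i) = A N - (B 1 :: real)"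
proof -
 have "(\<Sum>i=1..Suc n. A i - B i) + (\<Sum>i=1..n. B (Suc i) - A i) = A (Suc n) - B 1" for n
  by (induction n) (auto simp: sum.distrib)
 from this[of "N - 1"] show ?thesis using N1 by simp
qed

lemma cell_parts:
 assumes "pder N X U U'" "pder N X s s'"
 shows "L1 N X (%i x. U i x * s' i x) + L1 N X (%i x. s i x * U' i x)
  = (\<Sum>i=1..N. U i (X i) * s i (X i) - U i (X (i - 1)) * s i (X (i - 1)))"
proof -
 note c = pder_pc[OF assms(1)] pder_pc[OF assms(2)] pder_pc'[OF assms(1)] pder_pc'[OF assms(2)]
 have "L1 N X (%i x. U i x * s' i x) + L1 N X (%i x. s i x * U' i x)
  = L1 N X (%i x. U i x * s' i x + s i x * U' i x)"
  by (intro L1_add[symmetric] pc_mult c)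
 also have "... = (\<Sum>i=1..N. U i (X i) * s i (X i) - U i (X (i - 1)) * s i (X (i - 1)))"
  unfolding L1_def
 proof (intro sum.cong refl integral_unique fundamental_theorem_of_calculus)
  fix i assume i: "i \<in> {1..N}"
  show "X (i - 1) <= X i" using cell[OF i] by simp
  fix x assume x: "x \<in> {X (i - 1)..X i}"
  have "((%x. U i x * s i x) has_real_derivative U i x * s' i x + U' i x * s i x) (at x within {X (i - 1)..X i})"
   using assms i x unfolding pder_def by (auto intro!: DERIV_mult')
  then show "((%x. U i x * s i x) has_vector_derivative U i x * s' i x + s i x * U' i x) (at x within {X (i - 1)..X i})"
   by (simp add: has_real_derivative_iff_has_vector_derivative mult.commute)
 qed
 finally show ?thesis .
qed

text \<open>The two alternating fluxes are adjoint up to sign: with \<open>U\<close> from the left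
  in \<open>D1\<close> and \<open>s\<close> from the right in \<open>D2\<close>, the nodal terms
  combine to the jump of the product, which telescopes against the end point values of the cellwise
  integration by parts.\<close>

lemma D1_D2:
 assumes "pder N X U U'" "pder N X s s'"
 shows "D1 N X U s s' + D2 N X s U U' = 0"
proof -
 have "(\<Sum>i=1..N-1. U i (X i) * (s (Suc i) (X i) - s i (X i)))
   + (\<Sum>i=1..N-1. s (Suc i) (X i) * (U (Suc i) (X i) - U i (X i)))
  = (\<Sum>i=1..N-1. U (Suc i) (X (Suc i - 1)) * s (Suc i) (X (Suc i - 1)) - U i (X i) * s i (X i))"
  unfolding sum.distrib[symmetric] by (intro sum.cong refl) (simp add: algebra_simps)
 then show ?thesis unfolding D1_def D2_def
  using telescope[of "%i. U i (X i) * s i (X i)" "%i. U i (X (i - 1)) * s i (X (i - 1))"]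
   cell_parts[OF assms] by (simp add: algebra_simps)
qed

text \<open>Integrating (A v) v' by parts on each cell leaves half jumps of A v^2. Together with the
  upwind flux the mixed products cancel and a square remains at every node, the two ends
  included.\<close>

lemma L4_energy:
 assumes v: "pder N X v v'" and A: "pder N X (%_. A) (%_. A')"
 shows "L4 N X A v v v' = (1/2) * L1 N X (%i x. A' x * (v i x)\<^sup>2)
  + (1/2) * (A (X 0) * (v 1 (X 0))\<^sup>2 + (\<Sum>i=1..N-1. A (X i) * (v (Suc i) (X i) - v i (X i))\<^sup>2)
    + A (X N) * (v N (X N))\<^sup>2)"
proof -
 note c = pder_pc[OF v] pder_pc'[OF v] pder_pc[OF A] pder_pc'[OF A]
 have Av: "pder N X (%i x. A x * v i x) (%i x. A x * v' i x + A' x * v i x)"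
  unfolding pder_def
 proof (intro conjI ballI)
  show "pc N X (%i x. A x * v' i x + A' x * v i x)" by (intro pc_add pc_mult c)
  show "((%x. A x * v i x) has_real_derivative A x * v' i x + A' x * v i x) (at x within {X (i - 1)..X i})"
   if "i \<in> {1..N}" "x \<in> {X (i - 1)..X i}" for i x
   using v A that unfolding pder_def by (auto intro!: DERIV_mult')
 qed
 have "L1 N X (%i x. A x * v i x * v' i x) + L1 N X (%i x. v i x * (A x * v' i x + A' x * v i x))
   = 2 * L1 N X (%i x. A x * v i x * v' i x) + L1 N X (%i x. A' x * (v i x)\<^sup>2)"
  unfolding L1_cmult[symmetric]
  by (subst (1 2) L1_add[symmetric])
    (auto intro!: pc_intros c simp: power2_eq_square algebra_simps)
 then have P: "2 * L1 N X (%i x. A x * v i x * v' i x) + L1 N X (%i x. A' x * (v i x)\<^sup>2)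
  = (\<Sum>i=1..N. A (X i) * (v i (X i))\<^sup>2 - A (X (i - 1)) * (v i (X (i - 1)))\<^sup>2)"
  using cell_parts[OF Av v] by (simp add: power2_eq_square mult_ac)
 have T: "(\<Sum>i=1..N-1. A (X (Suc i - 1)) * (v (Suc i) (X (Suc i - 1)))\<^sup>2 - A (X i) * (v i (X i))\<^sup>2)
  = (\<Sum>i=1..N-1. A (X i) * (v (Suc i) (X i) - v i (X i))\<^sup>2) + 2 * (\<Sum>i=1..N-1. A (X i) * v i (X i) * (v (Suc i) (X i) - v i (X i)))"
  unfolding sum_distrib_left sum.distrib[symmetric]
  by (intro sum.cong refl) (simp add: power2_eq_square algebra_simps)
 show ?thesis unfolding L4_def D1_def
  using P T telescope[of "%i. A (X i) * (v i (X i))\<^sup>2" "%i. A (X (i - 1)) * (v i (X (i - 1)))\<^sup>2"]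
  by (simp add: algebra_simps power2_eq_square)
qed

lemma D1_continuous:
 assumes "pder N X (%_. g) (%_. g')" "pder N X s s'"
 shows "D1 N X (%_. g) s s' = - L1 N X (%i x. g' x * s i x) - g (X 0) * s 1 (X 0) + g (X N) * s N (X N)"
 using D1_D2[OF assms] by (simp add: D2_def mult.commute)

lemma D2_continuous:
 assumes "pder N X (%_. g) (%_. g')" "pder N X v v'"
 shows "D2 N X (%_. g) v v' = - L1 N X (%i x. g' x * v i x)"
 using D1_D2[OF assms(2,1)] by (simp add: D1_def mult.commute)

lemma L4_continuous:
 assumes "pder N X (%_. %x. A x * g x) (%_. Ag')" "pder N X v v'"
 shows "L4 N X A (%_. g) v v' = L1 N X (%i x. Ag' x * v i x) + A (X 0) * g (X 0) * v 1 (X 0)"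
 using D1_continuous[OF assms] by (simp add: L4_def)

text \<open>A function without jumps has the same value from both sides, so its upwind flux is also
  a flux from the right; only the inflow term differs. This lets the convection of layer parts be
  treated like the flux terms of \<open>p\<close>.\<close>

lemma L4_D2:
 shows "L4 N X A (%_. g) v v' = - D2 N X (%_ x. A x * g x) v v' + A (X 0) * g (X 0) * v 1 (X 0)"
 by (simp add: L4_def D1_def D2_def)

section \<open>Radau projection errors inserted into the line functionals\<close>

context
 fixes k :: nat
 assumes k: "k \<ge> 1"
begin

lemma pc_pj:
 assumes "interval_proj k l K" "pc N X (%_. z)"
 shows "pc N X (%i x. z x - pj K (X (i - 1)) (X i) z x)"
 using assms interval_proj.continuous_on_pj[OF assms(1)] unfolding pc_def
 by (auto intro!: continuous_intros)

lemma pj_cell_orth: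
 assumes "interval_proj k l K" "pc N X z" "i \<in> {1..N}" "degree q <= l"
 shows "integral {X (i - 1)..X i} (%x. (z i x - pj K (X (i - 1)) (X i) (z i) x) * poly q x) = 0"
 using assms cell[OF assms(3)] by (intro interval_proj.pj_orth) (auto simp: pc_def)

lemma proj_radR: "interval_proj k (k - 1) (radR k)"
 and proj_radL: "interval_proj k (k - 1) (radL k)"
 and proj_L2: "interval_proj k k (projL2 k)"
 using radR[OF k] radL[OF k] projL2[of k] by (auto simp: interval_proj_def)

lemma radR_trace: "i \<in> {1..N} ==> pj (radR k) (X (i - 1)) (X i) z (X i) = z (X i)"
 using pj_trace[OF cell, of i "radR k" z] radR[OF k] by simp

lemma radL_trace: "i \<in> {1..N} ==> pj (radL k) (X (i - 1)) (X i) z (X (i - 1)) = z (X (i - 1))"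
 using pj_trace[OF cell, of i "radL k" z] radL[OF k] by simp

lemma L1_proj_orth:
 assumes "interval_proj k l K" "pc N X z" "!!i. i \<in> {1..N} ==> \<exists>q. degree q <= l & s i = poly q"
 shows "L1 N X (%i x. (z i x - pj K (X (i - 1)) (X i) (z i) x) * s i x) = 0"
 unfolding L1_def
proof (intro sum.neutral ballI)
 fix i assume i: "i \<in> {1..N}"
 then obtain q where q: "degree q <= l" "s i = poly q" using assms(3) by blast
 show "integral {X (i - 1)..X i} (%x. (z i x - pj K (X (i - 1)) (X i) (z i) x) * s i x) = 0"
  unfolding q(2) by (rule pj_cell_orth[OF assms(1,2) i q(1)])
qed

lemma pcw_poly_derivative_degree:
 "pcw_poly N k s s' ==> i \<in> {1..N} ==> \<exists>q. degree q <= k - 1 & s' i = poly q"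
 unfolding pcw_poly_def by (metis degree_pderiv diff_le_mono)

text \<open>Interpolation at the right end makes all values from the left exact, and
  \<open>s'\<close> has degree at most k - 1, so flux and volume terms vanish separately.\<close>

lemma D1_radau:
 assumes "pc N X (%_. z)" "pcw_poly N k s s'"
 shows "D1 N X (%i x. z x - pj (radR k) (X (i - 1)) (X i) z x) s s' = 0"
proof -
 have "(\<Sum>i=1..N-1. (z (X i) - pj (radR k) (X (i - 1)) (X i) z (X i)) * (s (Suc i) (X i) - s i (X i))) = 0"
  using radR_trace[of _ z] by (intro sum.neutral) auto
 then show ?thesis
  using L1_proj_orth[where z = "%_. z", OF proj_radR assms(1) pcw_poly_derivative_degree[OF assms(2)]]
  by (simp add: D1_def)
qed

text \<open>All values from the right are exact by interpolation at the left end of each cell. Only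
  at the last node is the flux taken from the left, and there the left Radau projection leaves a
  remainder.\<close>

lemma D2_radau:
 assumes "pc N X (%_. z)" "pcw_poly N k s s'"
 shows "D2 N X (%i x. z x - pj (radL k) (X (i - 1)) (X i) z x) s s'
  = - (z (X N) - pj (radL k) (X (N - 1)) (X N) z (X N)) * s N (X N)"
proof -
 have "z (X i) - pj (radL k) (X (Suc i - 1)) (X (Suc i)) z (X i) = 0" if "i < N" for i
  using radL_trace[of "Suc i" z] that by simp
 note t = this
 have "(\<Sum>i=1..N-1. (z (X i) - pj (radL k) (X (Suc i - 1)) (X (Suc i)) z (X i)) * (s (Suc i) (X i) - s i (X i))) = 0"
 proof (intro sum.neutral ballI)
  fix i assume "i \<in> {1..N - 1}"
  then show "(z (X i) - pj (radL k) (X (Suc i - 1)) (X (Suc i)) z (X i)) * (s (Suc i) (X i) - s i (X i)) = 0"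
   using t[of i] N1 by auto
 qed
 then show ?thesis
  using L1_proj_orth[where z = "%_. z", OF proj_radL assms(1) pcw_poly_derivative_degree[OF assms(2)]] N1 t[of 0]
  by (simp add: D2_def) (simp add: algebra_simps)
qed

text \<open>A coefficient that is constant on each cell is invisible by orthogonality, so
  \<open>A\<close> may be replaced by its difference to the value at the right node.\<close>

lemma L4_radau:
 assumes A: "pc N X (%_. A)" and z: "pc N X (%_. z)" and s: "pcw_poly N k s s'"
 shows "L4 N X A (%i x. z x - pj (radR k) (X (i - 1)) (X i) z x) s s'
  = - L1 N X (%i x. (A x - A (X i)) * (z x - pj (radR k) (X (i - 1)) (X i) z x) * s' i x)"
proof -
 let ?e = "%i x. z x - pj (radR k) (X (i - 1)) (X i) z x"
 note c = pc_pj[OF proj_radR z] A pcw_poly_pc[OF s]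
 have "L1 N X (%i x. A (X i) * (?e i x * s' i x)) = 0"
 proof -
  have "integral {X (i - 1)..X i} (%x. ?e i x * s' i x) = 0" if "i \<in> {1..N}" for i
  proof -
   obtain q where "degree q <= k - 1" "s' i = poly q"
    using pcw_poly_derivative_degree[OF s \<open>i \<in> {1..N}\<close>] by blast
   then show ?thesis using pj_cell_orth[OF proj_radR z that, of q] by simp
  qed
  then show ?thesis by (simp add: L1_def)
 qed
 moreover have "pc N X (%i x. A (X i) * (?e i x * s' i x))" "pc N X (%i x. A x * (?e i x * s' i x))"
  using c by (auto intro!: pc_intros)
 ultimately have "L1 N X (%i x. A x * ?e i x * s' i x) = L1 N X (%i x. (A x - A (X i)) * ?e i x * s' i x)"
  using L1_diff[of N X "%i x. A x * (?e i x * s' i x)" "%i x. A (X i) * (?e i x * s' i x)"]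
  by (simp add: algebra_simps)
 moreover have "(\<Sum>i=1..N-1. A (X i) * ?e i (X i) * (s (Suc i) (X i) - s i (X i))) = 0" "?e N (X N) = 0"
  using radR_trace[of _ z] N1 by (auto intro!: sum.neutral)
 ultimately show ?thesis by (simp add: L4_def D1_def)
qed

text \<open>The difference A(x) - A(X i) supplies a factor cell length, and the inverse inequality
  for \<open>s'\<close> consumes it. The constant is therefore uniform over all cells, however
  thin.\<close>

lemma L4_radau_bound:
 assumes A: "continuous_on {X 0..X N} A" and z: "continuous_on {X 0..X N} z" and s: "pcw_poly N k s s'"
  and M: "!!x y. x \<in> {X 0..X N} ==> y \<in> {X 0..X N} ==> \<bar>A x - A y\<bar> <= M * \<bar>x - y\<bar>" "M \<ge> 0"
  and Z: "!!i x. i \<in> {1..N} ==> x \<in> {X (i - 1)..X i} ==> \<bar>z x - pj (radR k) (X (i - 1)) (X i) z x\<bar> <= Z" "Z \<ge> 0"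
 shows "\<bar>L4 N X A (%i x. z x - pj (radR k) (X (i - 1)) (X i) z x) s s'\<bar> <= M * Z * invC k * L1 N X (%i x. \<bar>s i x\<bar>)"
proof -
 let ?e = "%i x. z x - pj (radR k) (X (i - 1)) (X i) z x"
 note c = pc_pj[OF proj_radR pc_global[OF z]] pc_global[OF A] pcw_poly_pc[OF s]
 have "\<bar>integral {X (i - 1)..X i} (%x. (A x - A (X i)) * ?e i x * s' i x)\<bar>
  <= M * Z * invC k * integral {X (i - 1)..X i} (%x. \<bar>s i x\<bar>)" if i: "i \<in> {1..N}" for i
 proof -
  obtain p where p: "degree p <= k" "s i = poly p" "s' i = poly (pderiv p)"
   using s i unfolding pcw_poly_def by blast
  let ?l = "X i - X (i - 1)"
  have l: "?l > 0" using cell[OF i] by simp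
  have "norm (integral {X (i - 1)..X i} (%x. (A x - A (X i)) * ?e i x * s' i x))
   <= integral {X (i - 1)..X i} (%x. M * ?l * Z * \<bar>poly (pderiv p) x\<bar>)"
  proof (rule integral_norm_bound_integral)
   show "(%x. (A x - A (X i)) * ?e i x * s' i x) integrable_on {X (i - 1)..X i}"
    using pc_mult[OF pc_mult[OF pc_diff[OF c(2) pc_const[of N X "%i. A (X i)"]] c(1)] c(4)] i
    by (auto simp: pc_def intro: integrable_continuous_real)
   show "(%x. M * ?l * Z * \<bar>poly (pderiv p) x\<bar>) integrable_on {X (i - 1)..X i}"
    by (intro integrable_continuous_real continuous_intros)
   fix x assume x: "x \<in> {X (i - 1)..X i}"
   have "\<bar>A x - A (X i)\<bar> <= M * \<bar>x - X i\<bar>"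
    using x l cell_subset[OF i] by (intro M) auto
   also have "... <= M * ?l" using x by (intro mult_left_mono M) auto
   finally show "norm ((A x - A (X i)) * ?e i x * s' i x) <= M * ?l * Z * \<bar>poly (pderiv p) x\<bar>"
    unfolding p(3) real_norm_def abs_mult using Z(1)[OF i x] M(2) l Z(2)
    by (intro mult_mono) auto
  qed
  also have "... = M * ?l * Z * integral {X (i - 1)..X i} (%x. \<bar>poly (pderiv p) x\<bar>)" by simp
  also have "... <= M * ?l * Z * (invC k / ?l * integral {X (i - 1)..X i} (%x. \<bar>poly p x\<bar>))"
   using M(2) Z(2) l cell[OF i] p(1) by (intro mult_left_mono poly_inverse_inequality) auto
  also have "... = M * Z * invC k * integral {X (i - 1)..X i} (%x. \<bar>s i x\<bar>)" using l by (simp add: p(2))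
  finally show ?thesis by simp
 qed
 then have "(\<Sum>i=1..N. \<bar>integral {X (i - 1)..X i} (%x. (A x - A (X i)) * ?e i x * s' i x)\<bar>)
  <= (\<Sum>i=1..N. M * Z * invC k * integral {X (i - 1)..X i} (%x. \<bar>s i x\<bar>))" by (intro sum_mono)
 then show ?thesis unfolding L4_radau[OF pc_global[OF A] pc_global[OF z] s]
  unfolding L1_def sum_distrib_left abs_minus_cancel by (rule order_trans[OF sum_abs])
qed

end

end

section \<open>Broken functions of two variables\<close>

definition pc2 :: "nat => (nat => real) => (nat => real) => (nat => nat => fn2) => bool"
 where "pc2 N X Y F \<longleftrightarrow> (\<forall>i\<in>{1..N}. \<forall>j\<in>{1..N}.
  continuous_on ({X (i - 1)..X i} \<times> {Y (j - 1)..Y j}) (F i j))"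

definition L2D :: "nat => (nat => real) => (nat => real) => (nat => nat => fn2) => real"
 where "L2D N X Y F = L1 N Y (%j y. L1 N X (%i x. F i j (x, y)))"

lemma pc2_add: "pc2 N X Y F ==> pc2 N X Y G ==> pc2 N X Y (%i j z. F i j z + G i j z)"
 and pc2_diff: "pc2 N X Y F ==> pc2 N X Y G ==> pc2 N X Y (%i j z. F i j z - G i j z)"
 and pc2_mult: "pc2 N X Y F ==> pc2 N X Y G ==> pc2 N X Y (%i j z. F i j z * G i j z)"
 and pc2_power: "pc2 N X Y F ==> pc2 N X Y (%i j z. F i j z ^ n)"
 and pc2_divide: "pc2 N X Y F ==> pc2 N X Y (%i j z. F i j z / c)"
 and pc2_const: "pc2 N X Y (%i j z. r i j)"
 and pc2_abs: "pc2 N X Y F ==> pc2 N X Y (%i j z. \<bar>F i j z\<bar>)"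
 and pc2_minus: "pc2 N X Y F ==> pc2 N X Y (%i j z. - F i j z)"
 unfolding pc2_def divide_inverse by (intro ballI continuous_intros; simp)+

lemma pc2_swap: "pc2 N X Y F ==> pc2 N Y X (%j i z. F i j (prod.swap z))"
 unfolding pc2_def using continuous_on_swap[where u = "F _ _"] by (auto simp: split_beta prod.swap_def)

lemma pc2_line_x: "pc2 N X Y F ==> j \<in> {1..N} ==> y \<in> {Y (j - 1)..Y j} ==> pc N X (%i x. F i j (x, y))"
 unfolding pc2_def pc_def by (metis continuous_on_line_x)

lemma pc2_line_y: "pc2 N X Y F ==> i \<in> {1..N} ==> x \<in> {X (i - 1)..X i} ==> pc N Y (%j y. F i j (x, y))"
 unfolding pc2_def pc_def by (metis continuous_on_line_y)

lemma pc_L1_y: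
 assumes "pc2 N X Y F"
 shows "pc N Y (%j y. L1 N X (%i x. F i j (x, y)))"
 unfolding L1_def
proof (rule pc_sum)
 fix i assume i: "i \<in> {1..N}"
 show "pc N Y (%j y. integral {X (i - 1)..X i} (%x. F i j (x, y)))"
  unfolding pc_def
 proof
  fix j assume j: "j \<in> {1..N}"
  have "continuous_on ({Y (j - 1)..Y j} \<times> {X (i - 1)..X i}) (%(y, x). F i j (x, y))"
   using assms i j unfolding pc2_def by (intro continuous_on_swap) auto
  from continuous_on_integral_param[OF this]
  show "continuous_on {Y (j - 1)..Y j} (%y. integral {X (i - 1)..X i} (%x. F i j (x, y)))" by simp
 qed
qed

lemma L2D_swap:
 assumes "pc2 N X Y F"
 shows "L2D N X Y F = L1 N X (%i x. L1 N Y (%j y. F i j (x, y)))"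
proof -
 have A: "L2D N X Y F = (\<Sum>j=1..N. \<Sum>i=1..N. integral {Y (j - 1)..Y j} (%y. integral {X (i - 1)..X i} (%x. F i j (x, y))))"
  if F: "pc2 N X Y F" for X Y :: "nat => real" and F
  unfolding L2D_def L1_def[of N Y]
 proof (rule sum.cong[OF refl])
  fix j assume j: "j \<in> {1..N}"
  show "integral {Y (j - 1)..Y j} (%y. L1 N X (%i x. F i j (x, y)))
   = (\<Sum>i=1..N. integral {Y (j - 1)..Y j} (%y. integral {X (i - 1)..X i} (%x. F i j (x, y))))"
   unfolding L1_def
  proof (rule integral_sum)
   fix i assume i: "i \<in> {1..N}"
   have "continuous_on ({Y (j - 1)..Y j} \<times> {X (i - 1)..X i}) (%(y, x). F i j (x, y))"
    using F i j unfolding pc2_def by (intro continuous_on_swap) auto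
   from continuous_on_integral_param[OF this]
   show "(%y. integral {X (i - 1)..X i} (%x. F i j (x, y))) integrable_on {Y (j - 1)..Y j}"
    by (intro integrable_continuous_real) simp
  qed simp
 qed
 have "integral {Y (j - 1)..Y j} (%y. integral {X (i - 1)..X i} (%x. F i j (x, y)))
  = integral {X (i - 1)..X i} (%x. integral {Y (j - 1)..Y j} (%y. F i j (x, y)))"
  if "i \<in> {1..N}" "j \<in> {1..N}" for i j
  using integral_swap_continuous[of "X (i - 1)" "Y (j - 1)" "X i" "Y j" "%x y. F i j (x, y)"] assms that
  by (simp add: pc2_def cbox_Pair_eq split_beta)
 then have "L2D N X Y F = (\<Sum>j=1..N. \<Sum>i=1..N. integral {X (i - 1)..X i} (%x. integral {Y (j - 1)..Y j} (%y. F i j (x, y))))"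
  unfolding A[OF assms] by (intro sum.cong) auto
 also have "... = L2D N Y X (%j i z. F i j (prod.swap z))"
  unfolding A[OF pc2_swap[OF assms]] by (subst sum.swap) simp
 finally show ?thesis by (simp add: L2D_def)
qed

lemma L2D_add: "pc2 N X Y F ==> pc2 N X Y G ==> L2D N X Y (%i j z. F i j z + G i j z) = L2D N X Y F + L2D N X Y G"
 unfolding L2D_def
 by (subst L1_add[symmetric]) (auto intro!: pc_L1_y L1_cong L1_add pc2_line_x)

lemma L2D_cmult: "L2D N X Y (%i j z. c * F i j z) = c * L2D N X Y F"
 by (simp add: L2D_def L1_cmult)

lemma L2D_minus: "L2D N X Y (%i j z. - F i j z) = - L2D N X Y F"
 by (simp add: L2D_def L1_minus)

lemma L2D_diff: "pc2 N X Y F ==> pc2 N X Y G ==> L2D N X Y (%i j z. F i j z - G i j z) = L2D N X Y F - L2D N X Y G"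
 using L2D_add[of N X Y F "%i j z. - G i j z"] by (simp add: pc2_minus L2D_minus)

lemma L2D_mono:
 assumes "pc2 N X Y F" "pc2 N X Y G"
  "!!i j z. i \<in> {1..N} ==> j \<in> {1..N} ==> z \<in> {X (i - 1)..X i} \<times> {Y (j - 1)..Y j} ==> F i j z <= G i j z"
 shows "L2D N X Y F <= L2D N X Y G"
 unfolding L2D_def using assms by (intro L1_mono pc_L1_y) (auto intro: pc2_line_x)

lemma L2D_cong:
 assumes "!!i j z. i \<in> {1..N} ==> j \<in> {1..N} ==> z \<in> {X (i - 1)..X i} \<times> {Y (j - 1)..Y j} ==> F i j z = G i j z"
 shows "L2D N X Y F = L2D N X Y G"
 unfolding L2D_def using assms by (intro L1_cong) auto

lemma L2D_nonneg:
 assumes "pc2 N X Y F"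
  "!!i j z. i \<in> {1..N} ==> j \<in> {1..N} ==> z \<in> {X (i - 1)..X i} \<times> {Y (j - 1)..Y j} ==> 0 <= F i j z"
 shows "0 <= L2D N X Y F"
 using L2D_mono[of N X Y "%_ _ _. 0" F] assms by (simp add: pc2_const) (simp add: L2D_def L1_0)

section \<open>Polynomials on a rectangle\<close>

text \<open>Families consist of polynomials on the whole plane, so the ordinary derivative is used
  here; its agreement with the relative derivative \<open>pdx\<close> inside the elements is the
  content of \<open>rep_pdx\<close>.\<close>

definition dX :: "fn2 => fn2" where "dX g z = deriv (%t. g (t, snd z)) (fst z)"
definition dY :: "fn2 => fn2" where "dY g z = deriv (%t. g (fst z, t)) (snd z)"

lemma polyT_add: "f \<in> polyT k l ==> g \<in> polyT k l ==> (%z. f z + g z) \<in> polyT k l"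
proof -
 assume "f \<in> polyT k l" "g \<in> polyT k l"
 then obtain c d where "f = (%(x, y). \<Sum>m\<le>k. \<Sum>n\<le>l. c m n * x ^ m * y ^ n)"
  "g = (%(x, y). \<Sum>m\<le>k. \<Sum>n\<le>l. d m n * x ^ m * y ^ n)" by (auto simp: polyT_def)
 then have "(%z. f z + g z) = (%(x, y). \<Sum>m\<le>k. \<Sum>n\<le>l. (c m n + d m n) * x ^ m * y ^ n)"
  by (auto simp: fun_eq_iff sum.distrib distrib_right)
 then show ?thesis unfolding polyT_def by (auto intro!: exI[of _ "%m n. c m n + d m n"])
qed

lemma polyT_cmult: "f \<in> polyT k l ==> (%z. r * f z) \<in> polyT k l"
proof -
 assume "f \<in> polyT k l"
 then obtain c where "f = (%(x, y). \<Sum>m\<le>k. \<Sum>n\<le>l. c m n * x ^ m * y ^ n)" by (auto simp: polyT_def)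
 then have "(%z. r * f z) = (%(x, y). \<Sum>m\<le>k. \<Sum>n\<le>l. (r * c m n) * x ^ m * y ^ n)"
  by (auto simp: fun_eq_iff sum_distrib_left mult_ac)
 then show ?thesis unfolding polyT_def by (auto intro!: exI[of _ "%m n. r * c m n"])
qed

lemma polyT_diff: "f \<in> polyT k l ==> g \<in> polyT k l ==> (%z. f z - g z) \<in> polyT k l"
 using polyT_add[OF _ polyT_cmult[of g k l "-1"], of f] by simp

lemma polyT_0: "(%z. 0) \<in> polyT k l"
 unfolding polyT_def by (auto intro!: exI[of _ "%_ _. 0"])

lemma polyT_sum: "(!!m. m \<in> A ==> f m \<in> polyT k l) ==> (%z. \<Sum>m\<in>A. f m z) \<in> polyT k l"
 by (induction A rule: infinite_finite_induct) (auto simp: polyT_0 intro: polyT_add)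

lemma poly_as_sum: "degree p <= k ==> poly p (x::real) = (\<Sum>i\<le>k. coeff p i * x ^ i)"
 unfolding poly_altdef by (rule sum.mono_neutral_left) (auto simp: coeff_eq_0)

lemma polyT_prod: 
 assumes "degree p <= k" "degree q <= l"
 shows "(%(x, y). poly p x * poly q y) \<in> polyT k l"
 unfolding polyT_def
 by (auto intro!: exI[of _ "%m n. coeff p m * coeff q n"]
   simp: fun_eq_iff poly_as_sum[OF assms(1)] poly_as_sum[OF assms(2)] sum_product mult_ac)

lemma polyT_slices:
 assumes "g \<in> polyT k l"
 shows "\<exists>p. (\<forall>y. degree (p y) <= k) & (\<forall>x y. g (x, y) = poly (p y) x)
   & continuous_on UNIV (%(x, y). poly (pderiv (p y)) x)
   & (\<forall>x. \<exists>q. degree q <= l & (%y. poly (pderiv (p y)) x) = poly q)"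
  and "\<forall>x. \<exists>q. degree q <= l & (%y. g (x, y)) = poly q"
  and "continuous_on S g"
proof -
 obtain c where c: "g = (%(x, y). \<Sum>m\<le>k. \<Sum>n\<le>l. c m n * x ^ m * y ^ n)" using assms by (auto simp: polyT_def)
 define p where "p y = (\<Sum>m\<le>k. monom (\<Sum>n\<le>l. c m n * y ^ n) m)" for y
 define r where "r x = (\<Sum>n\<le>l. monom (\<Sum>m\<le>k. c m n * x ^ m) n)" for x
 have d: "degree (p y) <= k" for y
  unfolding p_def by (intro degree_sum_le) (auto intro: order_trans[OF degree_monom_le])
 have g: "g (x, y) = poly (p y) x" for x y
  unfolding c p_def by (simp add: poly_sum poly_monom sum_distrib_left sum_distrib_right mult_ac)
 have dr: "degree (r x) <= l" for x
  unfolding r_def by (intro degree_sum_le) (auto intro: order_trans[OF degree_monom_le])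
 have r: "g (x, y) = poly (r x) y" for x y
  unfolding c r_def by (simp add: poly_sum poly_monom sum_distrib_left sum_distrib_right mult_ac) (rule sum.swap)
 have pd: "poly (pderiv (p y)) x = (\<Sum>m\<le>k. \<Sum>n\<le>l. (real m * c m n * x ^ (m - 1)) * y ^ n)" for x y
  unfolding p_def by (simp add: pderiv_sum pderiv_monom poly_sum poly_monom sum_distrib_left sum_distrib_right mult_ac)
 have "\<exists>q. degree q <= l & (%y. poly (pderiv (p y)) x) = poly q" for x
 proof (intro exI conjI)
  let ?q = "\<Sum>n\<le>l. monom (\<Sum>m\<le>k. real m * c m n * x ^ (m - 1)) n"
  show "degree ?q <= l" by (intro degree_sum_le) (auto intro: order_trans[OF degree_monom_le])
  show "(%y. poly (pderiv (p y)) x) = poly ?q"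
   by (rule ext, subst pd, subst sum.swap) (simp add: poly_sum poly_monom sum_distrib_right)
 qed
 moreover have "continuous_on UNIV (%(x, y). poly (pderiv (p y)) x)"
  unfolding pd split_beta by (intro continuous_intros)
 ultimately show "\<exists>p. (\<forall>y. degree (p y) <= k) & (\<forall>x y. g (x, y) = poly (p y) x)
   & continuous_on UNIV (%(x, y). poly (pderiv (p y)) x)
   & (\<forall>x. \<exists>q. degree q <= l & (%y. poly (pderiv (p y)) x) = poly q)"
  using d g by blast
 show "\<forall>x. \<exists>q. degree q <= l & (%y. g (x, y)) = poly q" using dr r by blast
 show "continuous_on S g" unfolding c split_beta by (intro continuous_intros)
qed

lemma polyT_swap: "g \<in> polyT k l ==> (%z. g (prod.swap z)) \<in> polyT l k"
proof -
 assume "g \<in> polyT k l"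
 then obtain c where "g = (%(x, y). \<Sum>m\<le>k. \<Sum>n\<le>l. c m n * x ^ m * y ^ n)" by (auto simp: polyT_def)
 then have "(%z. g (prod.swap z)) = (%(x, y). \<Sum>n\<le>l. \<Sum>m\<le>k. c m n * x ^ n * y ^ m)"
  by (auto simp: fun_eq_iff mult_ac intro: sum.swap)
 then show ?thesis unfolding polyT_def by (auto intro!: exI[of _ "%n m. c m n"])
qed

lemma polyT_dX:
 assumes "g \<in> polyT k l"
 shows "\<exists>p. degree p <= k & (%x. g (x, y)) = poly p & (%x. dX g (x, y)) = poly (pderiv p)"
  and "\<exists>q. degree q <= l & (%y. dX g (x, y)) = poly q"
  and "continuous_on S (dX g)"
proof -
 obtain p where p: "\<forall>y. degree (p y) <= k" "\<forall>x y. g (x, y) = poly (p y) x"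
  "continuous_on UNIV (%(x, y). poly (pderiv (p y)) x)"
  "\<forall>x. \<exists>q. degree q <= l & (%y. poly (pderiv (p y)) x) = poly q"
  using polyT_slices(1)[OF assms] by blast
 have d: "dX g (x, y) = poly (pderiv (p y)) x" for x y
  unfolding dX_def using p(2) by (auto intro!: DERIV_imp_deriv poly_DERIV)
 show "\<exists>p. degree p <= k & (%x. g (x, y)) = poly p & (%x. dX g (x, y)) = poly (pderiv p)"
  using p d by blast
 show "\<exists>q. degree q <= l & (%y. dX g (x, y)) = poly q" using p(4) d by auto
 have "dX g = (%(x, y). poly (pderiv (p y)) x)" using d by auto
 then show "continuous_on S (dX g)" using p(3) continuous_on_subset by auto
qed

definition disc :: "nat => nat => (nat => nat => fn2) => bool"
 where "disc N k V \<longleftrightarrow> (\<forall>i\<in>{1..N}. \<forall>j\<in>{1..N}. V i j \<in> polyT k k)"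

lemma disc_swap: "disc N k V ==> disc N k (%j i z. V i j (prod.swap z))"
 by (auto simp: disc_def intro: polyT_swap)

lemma disc_pcw_poly_x:
 "disc N k V ==> j \<in> {1..N} ==> pcw_poly N k (%i x. V i j (x, y)) (%i x. dX (V i j) (x, y))"
 unfolding disc_def pcw_poly_def using polyT_dX(1) by blast

lemma disc_pc2: "disc N k V ==> pc2 N X Y V" "disc N k V ==> pc2 N X Y (%i j. dX (V i j))"
 unfolding disc_def pc2_def using polyT_slices(3) polyT_dX(3) by blast+

subsection \<open>Tensor product projections\<close>

definition PX :: "proj => (nat => real) => nat => fn2 => fn2"
 where "PX K X i u = (%(x, y). pj K (X (i - 1)) (X i) (%t. u (t, y)) x)"

definition PY :: "proj => (nat => real) => nat => fn2 => fn2"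
 where "PY K Y j u = (%(x, y). pj K (Y (j - 1)) (Y j) (%t. u (x, t)) y)"

lemma PY_swap: "PY K Y j u z = PX K Y j (%z. u (prod.swap z)) (prod.swap z)"
 by (cases z) (simp add: PX_def PY_def)

text \<open>Node and moment functionals in the two variables give four groups of terms. In this form
  the product is visibly a polynomial in x and y, and exchanging the variables merely permutes the
  groups.\<close>

lemma pj_tensor:
 fixes u :: "real \<times> real => real"
 assumes K: "interval_proj k l K" "interval_proj k' l' K'" and cd: "c < d" "c' < d'"
  and u: "continuous_on ({c..d} \<times> {c'..d'}) u"
 defines "A \<equiv> %x. c + (d - c) * x" and "B \<equiv> %y. c' + (d' - c') * y"
 shows "pj K c d (%t. pj K' c' d' (%t'. u (t, t')) y) x =
   poly (pgam K) ((x - c) / (d - c)) * (poly (pgam K') ((y - c') / (d' - c')) * u (A (pnode K), B (pnode K'))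
    + (\<Sum>n<prank K'. poly (pP K' n) ((y - c') / (d' - c')) * integral {0..1} (%t'. poly (pQ K' n) t' * u (A (pnode K), B t'))))
   + (\<Sum>m<prank K. poly (pP K m) ((x - c) / (d - c)) *
    (poly (pgam K') ((y - c') / (d' - c')) * integral {0..1} (%t. poly (pQ K m) t * u (A t, B (pnode K')))
     + (\<Sum>n<prank K'. poly (pP K' n) ((y - c') / (d' - c')) *
      integral {0..1} (%t. integral {0..1} (%t'. poly (pQ K m) t * (poly (pQ K' n) t' * u (A t, B t')))))))"
proof -
 interpret K: interval_proj k l K by fact
 interpret K': interval_proj k' l' K' by fact
 have AB: "c + (d - c) * t = A t" "c' + (d' - c') * t = B t" for t by (simp_all add: A_def B_def)
 have uA: "continuous_on ({0..1} \<times> {c'..d'}) (%z. u (A (fst z), snd z))"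
  by (rule continuous_on_compose2[OF u]) (use unit_affine[OF cd(1)] in \<open>auto intro!: continuous_intros simp: A_def\<close>)
 have m: "continuous_on {0..1} (%t. integral {0..1} (%t'. poly q t' * u (A t, B t')))" for q
  using K'.continuous_on_moment[OF cd(2) uA, of q] by (simp add: B_def)
 have n: "continuous_on {0..1} (%t. u (A t, B (pnode K')))"
  using continuous_on_line_x[OF uA, of "B (pnode K')"] unit_affine[OF cd(2) K'.node] by (simp add: B_def)
 have "integral {0..1} (%t. poly (pQ K m) t * pj K' c' d' (%t'. u (A t, t')) y)
  = poly (pgam K') ((y - c') / (d' - c')) * integral {0..1} (%t. poly (pQ K m) t * u (A t, B (pnode K')))
     + (\<Sum>n<prank K'. poly (pP K' n) ((y - c') / (d' - c')) *
      integral {0..1} (%t. integral {0..1} (%t'. poly (pQ K m) t * (poly (pQ K' n) t' * u (A t, B t')))))" for m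
 proof -
  have "integral {0..1} (%t. poly (pQ K m) t * pj K' c' d' (%t'. u (A t, t')) y)
   = integral {0..1} (%t. poly (pgam K') ((y - c') / (d' - c')) * (poly (pQ K m) t * u (A t, B (pnode K')))
     + (\<Sum>n<prank K'. poly (pP K' n) ((y - c') / (d' - c')) *
      (poly (pQ K m) t * integral {0..1} (%t'. poly (pQ K' n) t' * u (A t, B t')))))"
   unfolding pj_unfold[of K'] AB by (simp add: distrib_left sum_distrib_left mult_ac)
  also have "... = integral {0..1} (%t. poly (pgam K') ((y - c') / (d' - c')) * (poly (pQ K m) t * u (A t, B (pnode K'))))
     + integral {0..1} (%t. \<Sum>n<prank K'. poly (pP K' n) ((y - c') / (d' - c')) *
      (poly (pQ K m) t * integral {0..1} (%t'. poly (pQ K' n) t' * u (A t, B t'))))"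
   by (intro integral_add integrable_continuous_real continuous_intros m n)
  also have "integral {0..1} (%t. \<Sum>n<prank K'. poly (pP K' n) ((y - c') / (d' - c')) *
      (poly (pQ K m) t * integral {0..1} (%t'. poly (pQ K' n) t' * u (A t, B t'))))
    = (\<Sum>n<prank K'. integral {0..1} (%t. poly (pP K' n) ((y - c') / (d' - c')) *
      (poly (pQ K m) t * integral {0..1} (%t'. poly (pQ K' n) t' * u (A t, B t')))))"
   by (intro integral_sum integrable_continuous_real continuous_intros m n) auto
  finally show ?thesis by simp
 qed
 then show ?thesis
  unfolding pj_unfold[of K] AB by (simp add: pj_unfold[of K'] AB)
qed

lemma tensor_sum_swap:
 fixes p p' V W :: "nat => real"
 shows "g * (g' * U + (\<Sum>n<b. p' n * V n)) + (\<Sum>m<a. p m * (g' * W m + (\<Sum>n<b. p' n * J m n)))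
  = g' * (g * U + (\<Sum>m<a. p m * W m)) + (\<Sum>n<b. p' n * (g * V n + (\<Sum>m<a. p m * J m n)))"
proof -
 have "(\<Sum>m<a. p m * (\<Sum>n<b. p' n * J m n)) = (\<Sum>n<b. p' n * (\<Sum>m<a. p m * J m n))"
  unfolding sum_distrib_left by (subst sum.swap) (simp add: mult_ac)
 then show ?thesis
  by (simp add: distrib_left sum.distrib sum_distrib_left mult_ac)
qed

text \<open>In the expanded form the two sides differ by the order of the sums and of the integrals
  in the double moments; the latter is settled by Fubini for continuous functions.\<close>

lemma pj_tensor_commute:
 fixes u :: "real \<times> real => real"
 assumes K: "interval_proj k l K" "interval_proj k' l' K'" and cd: "c < d" "c' < d'"
  and u: "continuous_on ({c..d} \<times> {c'..d'}) u"
 shows "pj K c d (%t. pj K' c' d' (%t'. u (t, t')) y) x = pj K' c' d' (%t'. pj K c d (%t. u (t, t')) x) y"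
proof -
 define I where "I m n = integral {0..1} (%t. integral {0..1} (%t'. poly (pQ K m) t * (poly (pQ K' n) t' * u (c + (d - c) * t, c' + (d' - c') * t'))))" for m n
 have I: "integral {0..1} (%t'. integral {0..1} (%t. poly (pQ K' n) t' * (poly (pQ K m) t * u (c + (d - c) * t, c' + (d' - c') * t')))) = I m n" for m n
 proof -
  have "continuous_on ({0..1} \<times> {0..1}) (%z. u (c + (d - c) * fst z, c' + (d' - c') * snd z))"
   by (rule continuous_on_compose2[OF u])
    (use unit_affine[OF cd(1)] unit_affine[OF cd(2)] in \<open>auto intro!: continuous_intros\<close>)
  then have "continuous_on (cbox (0, 0) (1, 1)) (%(t, t'). poly (pQ K m) t * (poly (pQ K' n) t' * u (c + (d - c) * t, c' + (d' - c') * t')))"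
   unfolding cbox_Pair_eq split_beta by (auto intro!: continuous_intros)
  from integral_swap_continuous[OF this] show ?thesis by (simp add: I_def mult_ac)
 qed
 have u': "continuous_on ({c'..d'} \<times> {c..d}) (%z. u (prod.swap z))"
  using continuous_on_swap[OF u] by (simp add: split_beta prod.swap_def)
 note e = pj_tensor[OF K(2,1) cd(2,1) u', of x y, unfolded swap_simp I]
 show ?thesis
  unfolding e pj_tensor[OF K cd u] I_def[symmetric] by (rule tensor_sum_swap)
qed

lemma PX_PY_commute:
 assumes "interval_proj k l K" "interval_proj k' l' K'" "X (i - 1) < X i" "Y (j - 1) < Y j"
  "continuous_on ({X (i - 1)..X i} \<times> {Y (j - 1)..Y j}) u"
 shows "PX K X i (PY K' Y j u) = PY K' Y j (PX K X i u)"
 using pj_tensor_commute[OF assms] by (auto simp: PX_def PY_def fun_eq_iff)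

lemma PX_PY_polyT:
 assumes "interval_proj k l K" "interval_proj k' l' K'" "X (i - 1) < X i" "Y (j - 1) < Y j"
  "continuous_on ({X (i - 1)..X i} \<times> {Y (j - 1)..Y j}) u"
 shows "PX K X i (PY K' Y j u) \<in> polyT k k'"
proof -
 let ?A = "%x. X (i - 1) + (X i - X (i - 1)) * x" and ?B = "%y. Y (j - 1) + (Y j - Y (j - 1)) * y"
 define a where "a p = p \<circ>\<^sub>p [:- X (i - 1) / (X i - X (i - 1)), 1 / (X i - X (i - 1)):]" for p :: "real poly"
 define b where "b p = p \<circ>\<^sub>p [:- Y (j - 1) / (Y j - Y (j - 1)), 1 / (Y j - Y (j - 1)):]" for p :: "real poly"
 have pa: "poly p ((x - X (i - 1)) / (X i - X (i - 1))) = poly (a p) x" for p x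
  by (simp add: a_def poly_pcompose diff_divide_distrib)
 have pb: "poly p ((x - Y (j - 1)) / (Y j - Y (j - 1))) = poly (b p) x" for p x
  by (simp add: b_def poly_pcompose diff_divide_distrib)
 have da: "degree (a p) <= k" if "degree p <= k" for p
  using that assms(3) by (simp add: a_def degree_pcompose)
 have db: "degree (b p) <= k'" if "degree p <= k'" for p
  using that assms(4) by (simp add: b_def degree_pcompose)
 have T: "(%z. poly (a p) (fst z) * (poly (b q) (snd z) * r)) \<in> polyT k k'"
  if "degree p <= k" "degree q <= k'" for p q r
  using polyT_cmult[OF polyT_prod[OF da[OF that(1)] db[OF that(2)]], of r]
  by (simp add: split_beta mult_ac)
 have S: "(%z. (\<Sum>n<m. poly (a p) (fst z) * (poly (b (q n)) (snd z) * r n))) \<in> polyT k k'"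
  if "degree p <= k" "!!n. n < m ==> degree (q n) <= k'" for p q r m
  using that by (intro polyT_sum T) auto
 have G: "degree (pgam K) <= k" "!!m. m < prank K ==> degree (pP K m) <= k"
  "degree (pgam K') <= k'" "!!m. m < prank K' ==> degree (pP K' m) <= k'"
  using assms(1,2) by (auto simp: interval_proj_def good_proj_def)
 show ?thesis
  unfolding PX_def PY_def split_beta fst_conv snd_conv pj_tensor[OF assms] pa pb
  by (simp only: distrib_left sum_distrib_left) (intro polyT_add polyT_sum T S G; simp add: G)
qed

text \<open>The corner value, the edge moments and the cell moments are the data that enter a tensor
  projection, where conditions at a node with vanishing \<open>pgam\<close> drop out. For the three
  Radau combinations these are the defining conditions, so the lemma provides uniqueness.\<close>

lemma PX_PY_cong:
 assumes K: "interval_proj k l K" "interval_proj k' l' K'" and cd: "X (i - 1) < X i" "Y (j - 1) < Y j"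
  and cont: "continuous_on ({X (i - 1)..X i} \<times> {Y (j - 1)..Y j}) u" "continuous_on ({X (i - 1)..X i} \<times> {Y (j - 1)..Y j}) v"
  and e: "xe = X (i - 1) + (X i - X (i - 1)) * pnode K" "ye = Y (j - 1) + (Y j - Y (j - 1)) * pnode K'"
  and 1: "pgam K \<noteq> 0 ==> pgam K' \<noteq> 0 ==> u (xe, ye) = v (xe, ye)"
  and 2: "!!q. pgam K' \<noteq> 0 ==> degree q <= l ==>
    integral {X (i - 1)..X i} (%t. poly q t * u (t, ye)) = integral {X (i - 1)..X i} (%t. poly q t * v (t, ye))"
  and 3: "!!q. pgam K \<noteq> 0 ==> degree q <= l' ==>
    integral {Y (j - 1)..Y j} (%t. poly q t * u (xe, t)) = integral {Y (j - 1)..Y j} (%t. poly q t * v (xe, t))"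
  and 4: "!!q q'. degree q <= l ==> degree q' <= l' ==>
    integral {X (i - 1)..X i} (%t. integral {Y (j - 1)..Y j} (%t'. poly q t * poly q' t' * u (t, t')))
    = integral {X (i - 1)..X i} (%t. integral {Y (j - 1)..Y j} (%t'. poly q t * poly q' t' * v (t, t')))"
 shows "PX K X i (PY K' Y j u) z = PX K X i (PY K' Y j v) z"
proof -
 interpret K: interval_proj k l K by fact
 interpret K': interval_proj k' l' K' by fact
 obtain x y where z: "z = (x, y)" by fastforce
 have xe: "xe \<in> {X (i - 1)..X i}" unfolding e by (rule unit_affine[OF cd(1) K.node])
 \<comment> \<open>Moments in y commute with the projection in x. Cell moments thus become moments
   of a function of x alone, to which the one-dimensional congruence applies.\<close>
 have m: "integral {Y (j - 1)..Y j} (%t'. poly q' t' * pj K (X (i - 1)) (X i) (%t. u (t, t')) x)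
  = integral {Y (j - 1)..Y j} (%t'. poly q' t' * pj K (X (i - 1)) (X i) (%t. v (t, t')) x)"
  if q': "degree q' <= l'" for q'
 proof -
  have "integral {Y (j - 1)..Y j} (%t'. poly q' t' * pj K (X (i - 1)) (X i) (%t. w (t, t')) x)
    = pj K (X (i - 1)) (X i) (%t. integral {Y (j - 1)..Y j} (%t'. poly q' t' * w (t, t'))) x" 
   if w: "continuous_on ({X (i - 1)..X i} \<times> {Y (j - 1)..Y j}) w" for w
  proof -
   let ?c = "X (i - 1)" and ?d = "X i" and ?c' = "Y (j - 1)" and ?d' = "Y j"
   let ?s = "(x - ?c) / (?d - ?c)"
   have wA: "continuous_on ({0..1} \<times> {?c'..?d'}) (%z. w (?c + (?d - ?c) * fst z, snd z))"
    by (rule continuous_on_compose2[OF w]) (use unit_affine[OF cd(1)] in \<open>auto intro!: continuous_intros\<close>)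
   have c1: "continuous_on {?c'..?d'} (%t'. w (?c + (?d - ?c) * pnode K, t'))"
    using continuous_on_line_y[OF w xe[unfolded e]] .
   have c2: "continuous_on {?c'..?d'} (%t'. integral {0..1} (%t. poly q t * w (?c + (?d - ?c) * t, t')))" for q
    using K.continuous_on_moment[OF cd(1) continuous_on_swap[OF w], of q] by simp
   have sw: "integral {?c'..?d'} (%t'. poly q' t' * integral {0..1} (%t. poly q t * w (?c + (?d - ?c) * t, t')))
    = integral {0..1} (%t. poly q t * integral {?c'..?d'} (%t'. poly q' t' * w (?c + (?d - ?c) * t, t')))" for q
   proof -
    have "continuous_on (cbox (0, ?c') (1, ?d')) (%(t, t'). poly q' t' * (poly q t * w (?c + (?d - ?c) * t, t')))"
     using wA unfolding cbox_Pair_eq split_beta by (auto intro!: continuous_intros)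
    from integral_swap_continuous[OF this]
    have "integral {?c'..?d'} (%t'. poly q' t' * integral {0..1} (%t. poly q t * w (?c + (?d - ?c) * t, t')))
     = integral {0..1} (%t. integral {?c'..?d'} (%t'. poly q' t' * (poly q t * w (?c + (?d - ?c) * t, t'))))" by simp
    also have "... = integral {0..1} (%t. integral {?c'..?d'} (%t'. poly q t * (poly q' t' * w (?c + (?d - ?c) * t, t'))))"
     by (simp only: mult.left_commute)
    finally show ?thesis by simp
   qed
   have "integral {?c'..?d'} (%t'. poly q' t' * pj K ?c ?d (%t. w (t, t')) x)
    = integral {?c'..?d'} (%t'. poly (pgam K) ?s * (poly q' t' * w (?c + (?d - ?c) * pnode K, t'))
      + (\<Sum>m<prank K. poly (pP K m) ?s * (poly q' t' * integral {0..1} (%t. poly (pQ K m) t * w (?c + (?d - ?c) * t, t')))))"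
    unfolding pj_unfold by (simp add: distrib_left sum_distrib_left mult_ac)
   also have "... = integral {?c'..?d'} (%t'. poly (pgam K) ?s * (poly q' t' * w (?c + (?d - ?c) * pnode K, t')))
      + integral {?c'..?d'} (%t'. \<Sum>m<prank K. poly (pP K m) ?s * (poly q' t' * integral {0..1} (%t. poly (pQ K m) t * w (?c + (?d - ?c) * t, t'))))"
    by (intro integral_add integrable_continuous_real continuous_intros c1 c2)
   also have "integral {?c'..?d'} (%t'. \<Sum>m<prank K. poly (pP K m) ?s * (poly q' t' * integral {0..1} (%t. poly (pQ K m) t * w (?c + (?d - ?c) * t, t'))))
     = (\<Sum>m<prank K. integral {?c'..?d'} (%t'. poly (pP K m) ?s * (poly q' t' * integral {0..1} (%t. poly (pQ K m) t * w (?c + (?d - ?c) * t, t')))))"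
    by (intro integral_sum integrable_continuous_real continuous_intros c2) auto
   finally show ?thesis unfolding pj_unfold integral_mult_right sw .
  qed
  moreover have "pj K (X (i - 1)) (X i) (%t. integral {Y (j - 1)..Y j} (%t'. poly q' t' * u (t, t'))) x
    = pj K (X (i - 1)) (X i) (%t. integral {Y (j - 1)..Y j} (%t'. poly q' t' * v (t, t'))) x"
   using 3[OF _ q'] 4[OF _ q'] unfolding e
   by (intro K.pj_moment_cong cd) (auto simp: mult.assoc simp flip: integral_mult_right)
  ultimately show ?thesis using cont by simp
 qed
 have n: "pj K (X (i - 1)) (X i) (%t. u (t, ye)) x = pj K (X (i - 1)) (X i) (%t. v (t, ye)) x"
  if "pgam K' \<noteq> 0" using 1[OF _ that] 2[OF that] unfolding e by (intro K.pj_moment_cong cd) auto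
 have "pj K' (Y (j - 1)) (Y j) (%t'. pj K (X (i - 1)) (X i) (%t. u (t, t')) x) y
   = pj K' (Y (j - 1)) (Y j) (%t'. pj K (X (i - 1)) (X i) (%t. v (t, t')) x) y"
  using m n unfolding e by (intro K'.pj_moment_cong cd) auto
 then show ?thesis using pj_tensor_commute[OF K cd cont(1)] pj_tensor_commute[OF K cd cont(2)]
  by (simp add: z PX_def PY_def)
qed

lemma PX_PY_polynomial:
 assumes K: "interval_proj k l K" "interval_proj k' l' K'" and cd: "X (i - 1) < X i" "Y (j - 1) < Y j"
  and g: "g \<in> polyT k k'"
 shows "PX K X i (PY K' Y j g) z = g z"
proof -
 have 1: "pj K' (Y (j - 1)) (Y j) (%t. g (x, t)) y = g (x, y)" for x y
 proof -
  obtain q where q: "degree q <= k'" "(%y. g (x, y)) = poly q" using polyT_slices(2)[OF g] by blast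
  have "pj K' (Y (j - 1)) (Y j) (%t. g (x, t)) y = poly q y"
   unfolding q(2) by (rule interval_proj.pj_poly[OF K(2) cd(2) q(1)])
  then show ?thesis using fun_cong[OF q(2), of y] by simp
 qed
 obtain x y where z: "z = (x, y)" by fastforce
 obtain q where q: "degree q <= k" "(%x. g (x, y)) = poly q" using polyT_dX(1)[OF g] by blast
 have "pj K (X (i - 1)) (X i) (%t. g (t, y)) x = poly q x"
  unfolding q(2) by (rule interval_proj.pj_poly[OF K(1) cd(1) q(1)])
 then show ?thesis using fun_cong[OF q(2), of x]
  unfolding z PX_def PY_def split_beta fst_conv snd_conv 1 by simp
qed

section \<open>The bilinear form on broken functions\<close>

definition XD1 :: "nat => (nat => real) => (nat => real) => (nat => nat => fn2) => (nat => nat => fn2) => real"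
 where "XD1 N X Y U s = L1 N Y (%j y. D1 N X (%i x. U i j (x, y)) (%i x. s i j (x, y)) (%i x. dX (s i j) (x, y)))"

definition XD2 :: "nat => (nat => real) => (nat => real) => (nat => nat => fn2) => (nat => nat => fn2) => real"
 where "XD2 N X Y P v = L1 N Y (%j y. D2 N X (%i x. P i j (x, y)) (%i x. v i j (x, y)) (%i x. dX (v i j) (x, y)))"

definition XL4 :: "nat => (nat => real) => (nat => real) => fn2 => (nat => nat => fn2) => (nat => nat => fn2) => real"
 where "XL4 N X Y a U v = L1 N Y (%j y. L4 N X (%x. a (x, y)) (%i x. U i j (x, y)) (%i x. v i j (x, y)) (%i x. dX (v i j) (x, y)))"

definition XT :: "nat => (nat => real) => (nat => real) => (nat => nat => fn2) => real"
 where "XT N X Y F = L1 N Y (%j y. F N j (X N, y))"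

text \<open>Twice the jump part of the squared energy norm; the two end terms are the jumps against
  the zero traces outside.\<close>

definition XJ :: "nat => (nat => real) => (nat => real) => fn2 => (nat => nat => fn2) => real"
 where "XJ N X Y a v = L1 N Y (%j y. a (X 0, y) * (v 1 j (X 0, y))\<^sup>2
  + (\<Sum>i=1..N-1. a (X i, y) * (v (Suc i) j (X i, y) - v i j (X i, y))\<^sup>2)
  + a (X N, y) * (v N j (X N, y))\<^sup>2)"

definition sw :: "(nat => nat => fn2) => (nat => nat => fn2)"
 where "sw F = (%j i z. F i j (prod.swap z))"

text \<open>The terms in y are the functionals in x applied to families with exchanged variables, so
  that each statement about them is proved for one direction only. The derivative \<open>ax\<close>
  is a separate argument, tied to \<open>a\<close> by \<open>has_dx\<close> where needed.\<close>

definition bform :: "nat => (nat => real) => (nat => real) => real => fn2 => fn2 => fn2 => real => real =>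
  (nat => nat => fn2) => (nat => nat => fn2) => (nat => nat => fn2) =>
  (nat => nat => fn2) => (nat => nat => fn2) => (nat => nat => fn2) => real"
 where "bform N X Y \<epsilon> a ax b l1 l2 U P Q v s r =
  L2D N X Y (%i j z. P i j z * s i j z + Q i j z * r i j z) / \<epsilon>
  + L2D N X Y (%i j z. (b z - ax z) * U i j z * v i j z)
  + XD1 N X Y U s + XD2 N X Y P v + XL4 N X Y a U v + l1 * XT N X Y (%i j z. U i j z * v i j z)
  + XD1 N Y X (sw U) (sw r) + XD2 N Y X (sw Q) (sw v) + l2 * XT N Y X (sw (%i j z. U i j z * v i j z))"

definition energy :: "nat => (nat => real) => (nat => real) => real => fn2 => fn2 => fn2 => real => real =>
  (nat => nat => fn2) => (nat => nat => fn2) => (nat => nat => fn2) => real"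
 where "energy N X Y \<epsilon> a ax b l1 l2 v s r =
  (L2D N X Y (%i j z. (s i j z)\<^sup>2) + L2D N X Y (%i j z. (r i j z)\<^sup>2)) / \<epsilon>
  + L2D N X Y (%i j z. (b z - ax z / 2) * (v i j z)\<^sup>2)
  + XJ N X Y a v / 2 + l1 * XT N X Y (%i j z. (v i j z)\<^sup>2) + l2 * XT N Y X (sw (%i j z. (v i j z)\<^sup>2))"

text \<open>The derivative is relative to \<open>A\<close>, hence one-sided at its ends, which
  matches \<open>pdx\<close> on the closed square. Derivatives in y are expressed by exchanging the
  arguments.\<close>

definition has_dx :: "real set => real set => fn2 => fn2 => bool"
 where "has_dx A B u ux \<longleftrightarrow> continuous_on (A \<times> B) u & continuous_on (A \<times> B) ux
  & (\<forall>x\<in>A. \<forall>y\<in>B. ((%x. u (x, y)) has_real_derivative ux (x, y)) (at x within A))"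

lemma has_dx_mult:
 assumes "has_dx A B u ux" "has_dx A B v vx"
 shows "has_dx A B (%z. u z * v z) (%z. u z * vx z + ux z * v z)"
 using assms unfolding has_dx_def by (auto intro!: continuous_intros DERIV_mult')

lemma has_dx_diff:
 assumes "has_dx A B u ux" "has_dx A B v vx"
 shows "has_dx A B (%z. u z - v z) (%z. ux z - vx z)"
 using assms unfolding has_dx_def by (auto intro!: continuous_intros DERIV_diff)

lemma has_dx_cmult:
 assumes "has_dx A B u ux"
 shows "has_dx A B (%z. c * u z) (%z. c * ux z)"
 using assms unfolding has_dx_def by (auto intro!: continuous_intros DERIV_cmult)

lemma has_dx_subset:
 assumes "has_dx A B u ux" "B' \<subseteq> B"
 shows "has_dx A B' u ux"
proof -
 have "A \<times> B' \<subseteq> A \<times> B" using assms(2) by auto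
 then show ?thesis using assms unfolding has_dx_def by (meson continuous_on_subset subsetD)
qed

lemma sw_sw [simp]: "sw (sw F) = F"
 by (simp add: sw_def)

lemma pc2_sw: "pc2 N X Y F ==> pc2 N Y X (sw F)"
 unfolding sw_def by (rule pc2_swap)

lemma disc_sw: "disc N k V ==> disc N k (sw V)"
 unfolding sw_def by (rule disc_swap)

lemma L2D_sw: "pc2 N X Y F ==> L2D N Y X (sw F) = L2D N X Y F"
 by (simp add: L2D_swap) (simp add: L2D_def sw_def)

locale grid2 = gx: grid N X + gy: grid N Y for N :: nat and X Y :: "nat => real" +
 fixes k :: nat
 assumes k: "k \<ge> 1"
begin

lemma swapped: "grid2 N Y X k"
 using k by unfold_locales (auto intro: gx.N1 gx.strict gy.strict)

abbreviation "RX \<equiv> {X 0..X N}"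
abbreviation "cl i j \<equiv> {X (i - 1)..X i} \<times> {Y (j - 1)..Y j}"
abbreviation "RY \<equiv> {Y 0..Y N}"

lemma pc2_rows:
 assumes "!!j. j \<in> {1..N} ==> continuous_on (RX \<times> {Y (j - 1)..Y j}) (F j)"
 shows "pc2 N X Y (%i. F)"
 unfolding pc2_def by (intro ballI continuous_on_subset[OF assms] Sigma_mono gx.cell_subset order_refl)

lemma pc2_global: "continuous_on (RX \<times> RY) F ==> pc2 N X Y (%i j. F)"
 by (intro pc2_rows, erule continuous_on_subset) (intro Sigma_mono gy.cell_subset order_refl)

lemma row_subset: "continuous_on (RX \<times> RY) F ==> j \<in> {1..N} ==> continuous_on (RX \<times> {Y (j - 1)..Y j}) F"
 by (erule continuous_on_subset) (intro Sigma_mono gy.cell_subset order_refl)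

lemma trace_pc:
 assumes "pc2 N X Y F" "i \<in> {1..N}"
 shows "pc N Y (%j y. F i j (X i, y))" "pc N Y (%j y. F i j (X (i - 1), y))"
 using gx.cell[OF assms(2)] by (auto intro!: pc2_line_y[OF assms])

lemma trace_pc_Suc:
 assumes "pc2 N X Y F" "i < N"
 shows "pc N Y (%j y. F (Suc i) j (X i, y))"
 using trace_pc(2)[OF assms(1), of "Suc i"] assms(2) by simp

lemma trace_pc_N: "pc2 N X Y F ==> pc N Y (%j y. F N j (X N, y))"
 and trace_pc_1: "pc2 N X Y F ==> pc N Y (%j y. F 1 j (X 0, y))"
 using trace_pc[of F N] trace_pc_Suc[of F 0] gx.N1 by auto

lemma trace_const: "continuous_on (RX \<times> RY) F ==> i <= N ==> pc N Y (%j y. F (X i, y))"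
 using gx.X_mono[of 0 i] gx.X_mono[of i N]
 by (intro gy.pc_global continuous_on_line_y[of RX]) auto

lemma pc_D1:
 assumes "pc2 N X Y U" "pc2 N X Y s" "pc2 N X Y s'"
 shows "pc N Y (%j y. D1 N X (%i x. U i j (x, y)) (%i x. s i j (x, y)) (%i x. s' i j (x, y)))"
 unfolding D1_def
 using pc_L1_y[OF pc2_mult[OF assms(1,3)]] gx.N1
 by (intro pc_add pc_sum pc_mult pc_diff trace_pc[OF assms(1)] trace_pc[OF assms(2)] trace_pc_Suc[OF assms(2)]) auto

lemma pc_D2:
 assumes "pc2 N X Y U" "pc2 N X Y s" "pc2 N X Y s'"
 shows "pc N Y (%j y. D2 N X (%i x. U i j (x, y)) (%i x. s i j (x, y)) (%i x. s' i j (x, y)))"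
 unfolding D2_def
 using pc_L1_y[OF pc2_mult[OF assms(1,3)]] gx.N1
 by (intro pc_add pc_sum pc_mult pc_diff trace_pc[OF assms(2)] trace_pc_Suc[OF assms(1)] trace_pc_Suc[OF assms(2)]
  trace_pc_N[OF assms(1)] trace_pc_1[OF assms(1)] trace_pc_N[OF assms(2)] trace_pc_1[OF assms(2)]) auto

lemma pc_L4:
 assumes a: "continuous_on (RX \<times> RY) a" and U: "pc2 N X Y U" and s: "pc2 N X Y s" "pc2 N X Y s'"
 shows "pc N Y (%j y. L4 N X (%x. a (x, y)) (%i x. U i j (x, y)) (%i x. s i j (x, y)) (%i x. s' i j (x, y)))"
 unfolding L4_def
 using pc_D1[OF pc2_mult[OF pc2_global[OF a] U] s]
 by (intro pc_add pc_minus pc_mult trace_const[OF a] trace_pc_N[OF U] trace_pc_N[OF s(1)]) auto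

lemma disc_lines:
 assumes "disc N k v" "j \<in> {1..N}"
 shows "pc N X (%i x. dX (v i j) (x, y))"
 using pcw_poly_pc[OF disc_pcw_poly_x[OF assms(1,2)]] by blast

lemma XD1_add:
 assumes "pc2 N X Y U" "pc2 N X Y U'" "disc N k s"
 shows "XD1 N X Y (%i j z. U i j z + U' i j z) s = XD1 N X Y U s + XD1 N X Y U' s"
 unfolding XD1_def using assms
 by (subst L1_add[symmetric])
   (auto intro!: pc_D1 disc_pc2 L1_cong D1_add pc_mult disc_lines intro: pc2_line_x)

lemma XD2_add:
 assumes "pc2 N X Y U" "pc2 N X Y U'" "disc N k s"
 shows "XD2 N X Y (%i j z. U i j z + U' i j z) s = XD2 N X Y U s + XD2 N X Y U' s"
 unfolding XD2_def using assms
 by (subst L1_add[symmetric])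
   (auto intro!: pc_D2 disc_pc2 L1_cong D2_add pc_mult disc_lines intro: pc2_line_x)

lemma line_a:
 assumes a: "continuous_on (RX \<times> RY) a" and j: "j \<in> {1..N}" and y: "y \<in> {Y (j - 1)..Y j}"
 shows "pc N X (%_ x. a (x, y))"
 using pc2_line_x[OF pc2_global[OF a] j y] by simp

lemma XL4_add:
 assumes "continuous_on (RX \<times> RY) a" "pc2 N X Y U" "pc2 N X Y U'" "disc N k s"
 shows "XL4 N X Y a (%i j z. U i j z + U' i j z) s = XL4 N X Y a U s + XL4 N X Y a U' s"
 unfolding XL4_def using assms
 by (subst L1_add[symmetric])
   (auto intro!: pc_L4 disc_pc2 L1_cong L4_add pc_mult disc_lines line_a intro: pc2_line_x)

lemma XT_add:
 assumes "pc2 N X Y U" "pc2 N X Y U'"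
 shows "XT N X Y (%i j z. U i j z + U' i j z) = XT N X Y U + XT N X Y U'"
 unfolding XT_def using assms by (intro L1_add trace_pc_N)

lemma XD1_XD2:
 assumes "disc N k v" "disc N k s"
 shows "XD1 N X Y v s = - XD2 N X Y s v"
 unfolding XD1_def XD2_def L1_minus[symmetric]
 using gx.D1_D2[OF pcw_poly_pder pcw_poly_pder, OF disc_pcw_poly_x[OF assms(1)] disc_pcw_poly_x[OF assms(2)]]
 by (intro L1_cong) (auto simp: add_eq_0_iff2)

lemma row_line:
 assumes "has_dx RX {Y (j - 1)..Y j} g gx" "y \<in> {Y (j - 1)..Y j}"
 shows "pder N X (%_ x. g (x, y)) (%_ x. gx (x, y))"
 using assms unfolding has_dx_def by (intro gx.pder_global continuous_on_line_x[of _ "{Y (j - 1)..Y j}"]) auto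

lemma XL4_energy:
 assumes "has_dx RX RY a ax" "disc N k v"
 shows "XL4 N X Y a v v = L2D N X Y (%i j z. ax z * (v i j z)\<^sup>2) / 2 + XJ N X Y a v / 2"
proof -
 have a: "continuous_on (RX \<times> RY) a" "continuous_on (RX \<times> RY) ax" using assms by (auto simp: has_dx_def)
 note v = disc_pc2(1)[OF assms(2), of X Y]
 let ?J = "%j y. a (X 0, y) * (v 1 j (X 0, y))\<^sup>2
  + (\<Sum>i=1..N-1. a (X i, y) * (v (Suc i) j (X i, y) - v i j (X i, y))\<^sup>2)
  + a (X N, y) * (v N j (X N, y))\<^sup>2"
 have "pc N Y ?J" using gx.N1
  by (intro pc_add pc_mult pc_sum pc_power pc_diff trace_const[OF a(1)] trace_pc_N[OF v] trace_pc_1[OF v]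
   trace_pc[OF v] trace_pc_Suc[OF v]) auto
 moreover have "pc N Y (%j y. L1 N X (%i x. ax (x, y) * (v i j (x, y))\<^sup>2))"
  using pc_L1_y[OF pc2_mult[OF pc2_global[OF a(2)] pc2_power[OF v]]] by simp
 ultimately have "L1 N Y (%j y. (1/2) * L1 N X (%i x. ax (x, y) * (v i j (x, y))\<^sup>2) + (1/2) * ?J j y)
  = (1/2) * L1 N Y (%j y. L1 N X (%i x. ax (x, y) * (v i j (x, y))\<^sup>2)) + (1/2) * L1 N Y ?J"
  unfolding L1_cmult[of N Y, symmetric] by (intro L1_add pc_cmult)
 moreover have "XL4 N X Y a v v = L1 N Y (%j y. (1/2) * L1 N X (%i x. ax (x, y) * (v i j (x, y))\<^sup>2) + (1/2) * ?J j y)"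
  unfolding XL4_def
 proof (intro L1_cong gx.L4_energy)
  fix j y assume j: "j \<in> {1..N}" "y \<in> {Y (j - 1)..Y j}"
  show "pder N X (%i x. v i j (x, y)) (%i x. dX (v i j) (x, y))"
   using pcw_poly_pder[OF disc_pcw_poly_x[OF assms(2) j(1)]] .
  show "pder N X (%_ x. a (x, y)) (%_ x. ax (x, y))"
   using row_line[OF has_dx_subset[OF assms(1) gy.cell_subset[OF j(1)]] j(2)] .
 qed
 ultimately show ?thesis by (simp add: L2D_def XJ_def)
qed

text \<open>The couplings of \<open>v\<close> with \<open>s\<close> and of \<open>v\<close> with
  \<open>r\<close> occur twice with opposite signs and cancel. The convection contributes half of
  \<open>ax\<close>, which turns \<open>b - ax\<close> into \<open>b - ax / 2\<close>.\<close>

lemma bform_energy: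
 assumes "has_dx RX RY a ax" "continuous_on (RX \<times> RY) b" "disc N k v" "disc N k s" "disc N k r"
 shows "bform N X Y \<epsilon> a ax b l1 l2 v s r v s r = energy N X Y \<epsilon> a ax b l1 l2 v s r"
proof -
 interpret S: grid2 N Y X k by (rule swapped)
 have ax: "continuous_on (RX \<times> RY) ax" using assms by (auto simp: has_dx_def)
 note c = disc_pc2(1)[OF assms(3), of X Y] disc_pc2(1)[OF assms(4), of X Y] disc_pc2(1)[OF assms(5), of X Y]
 have "L2D N X Y (%i j z. (b z - ax z) * (v i j z)\<^sup>2) + L2D N X Y (%i j z. ax z * (v i j z)\<^sup>2) / 2
  = L2D N X Y (%i j z. (b z - ax z / 2) * (v i j z)\<^sup>2)"
 proof -
  have "L2D N X Y (%i j z. (b z - ax z) * (v i j z)\<^sup>2) + L2D N X Y (%i j z. (1/2) * (ax z * (v i j z)\<^sup>2))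
   = L2D N X Y (%i j z. (b z - ax z) * (v i j z)\<^sup>2 + (1/2) * (ax z * (v i j z)\<^sup>2))"
   by (intro L2D_add[symmetric] pc2_mult pc2_diff pc2_power pc2_global pc2_const assms ax c)
  then show ?thesis unfolding L2D_cmult by (simp add: algebra_simps)
 qed
 moreover have "L2D N X Y (%i j z. s i j z * s i j z + r i j z * r i j z)
  = L2D N X Y (%i j z. (s i j z)\<^sup>2) + L2D N X Y (%i j z. (r i j z)\<^sup>2)"
  by (simp only: power2_eq_square[symmetric]) (intro L2D_add pc2_power c)
 ultimately show ?thesis
  unfolding bform_def energy_def XL4_energy[OF assms(1,3)]
   XD1_XD2[OF assms(3,4)] S.XD1_XD2[OF disc_sw[OF assms(3)] disc_sw[OF assms(5)]]
  by (simp add: mult.assoc power2_eq_square)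
qed

lemma bform_add:
 assumes "continuous_on (RX \<times> RY) a" "continuous_on (RX \<times> RY) ax" "continuous_on (RX \<times> RY) b"
  and z: "disc N k v" "disc N k s" "disc N k r"
  and U: "pc2 N X Y U" "pc2 N X Y P" "pc2 N X Y Q" "pc2 N X Y U'" "pc2 N X Y P'" "pc2 N X Y Q'"
 shows "bform N X Y \<epsilon> a ax b l1 l2 (%i j z. U i j z + U' i j z) (%i j z. P i j z + P' i j z) (%i j z. Q i j z + Q' i j z) v s r
  = bform N X Y \<epsilon> a ax b l1 l2 U P Q v s r + bform N X Y \<epsilon> a ax b l1 l2 U' P' Q' v s r"
proof -
 interpret S: grid2 N Y X k by (rule swapped)
 note c = disc_pc2(1)[OF z(1), of X Y] disc_pc2(1)[OF z(2), of X Y] disc_pc2(1)[OF z(3), of X Y]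
 have "L2D N X Y (%i j z. (P i j z + P' i j z) * s i j z + (Q i j z + Q' i j z) * r i j z)
  = L2D N X Y (%i j z. P i j z * s i j z + Q i j z * r i j z) + L2D N X Y (%i j z. P' i j z * s i j z + Q' i j z * r i j z)"
  by (subst L2D_add[symmetric]) (auto intro!: pc2_add pc2_mult c U L2D_cong simp: algebra_simps)
 moreover have "L2D N X Y (%i j z. (b z - ax z) * (U i j z + U' i j z) * v i j z)
  = L2D N X Y (%i j z. (b z - ax z) * U i j z * v i j z) + L2D N X Y (%i j z. (b z - ax z) * U' i j z * v i j z)"
  by (subst L2D_add[symmetric]) (auto intro!: pc2_diff pc2_mult c U pc2_global assms L2D_cong simp: algebra_simps)
 moreover have "XT N X Y (%i j z. (U i j z + U' i j z) * v i j z) = XT N X Y (%i j z. U i j z * v i j z) + XT N X Y (%i j z. U' i j z * v i j z)"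
  by (subst XT_add[symmetric]) (auto intro!: pc2_mult c U simp: distrib_right)
 moreover have "XT N Y X (sw (%i j z. (U i j z + U' i j z) * v i j z)) = XT N Y X (sw (%i j z. U i j z * v i j z)) + XT N Y X (sw (%i j z. U' i j z * v i j z))"
  using S.XT_add[OF pc2_sw[OF pc2_mult[OF U(1) c(1)]] pc2_sw[OF pc2_mult[OF U(4) c(1)]]]
  by (simp add: sw_def distrib_right)
 moreover have "XD1 N Y X (sw (%i j z. U i j z + U' i j z)) (sw r) = XD1 N Y X (sw U) (sw r) + XD1 N Y X (sw U') (sw r)"
  using S.XD1_add[OF pc2_sw[OF U(1)] pc2_sw[OF U(4)] disc_sw[OF z(3)]] by (simp add: sw_def)
 moreover have "XD2 N Y X (sw (%i j z. Q i j z + Q' i j z)) (sw v) = XD2 N Y X (sw Q) (sw v) + XD2 N Y X (sw Q') (sw v)"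
  using S.XD2_add[OF pc2_sw[OF U(3)] pc2_sw[OF U(6)] disc_sw[OF z(1)]] by (simp add: sw_def)
 ultimately show ?thesis
  unfolding bform_def XD1_add[OF U(1,4) z(2)] XD2_add[OF U(2,5) z(1)] XL4_add[OF assms(1) U(1,4) z(1)]
  by (simp add: algebra_simps add_divide_distrib)
qed

subsection \<open>Projection errors inserted into the form\<close>

lemma proj: "interval_proj k (k - 1) (radR k)" "interval_proj k (k - 1) (radL k)" "interval_proj k k (projL2 k)"
 using gx.proj_radR[OF k] gx.proj_radL[OF k] gx.proj_L2[OF k] by auto

lemma PY_row:
 assumes "interval_proj k l K" "j \<in> {1..N}" "continuous_on (RX \<times> {Y (j - 1)..Y j}) u"
 shows "continuous_on (RX \<times> {Y (j - 1)..Y j}) (PY K Y j u)"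
 unfolding PY_def
 using interval_proj.continuous_on_pj_y[OF assms(1) gy.cell[OF assms(2)] assms(3)]
 by (rule continuous_on_subset) auto

lemma PX_cell:
 assumes "interval_proj k l K" "i \<in> {1..N}" "continuous_on ({X (i - 1)..X i} \<times> B) u"
 shows "continuous_on ({X (i - 1)..X i} \<times> B) (PX K X i u)"
 unfolding PX_def
 using interval_proj.continuous_on_pj_x[OF assms(1) gx.cell[OF assms(2)] assms(3)]
 by (rule continuous_on_subset) auto

lemma pc2_PY:
 assumes "interval_proj k l K" "!!j. j \<in> {1..N} ==> continuous_on (RX \<times> {Y (j - 1)..Y j}) (u j)"
 shows "pc2 N X Y (%i j. PY K Y j (u j))"
 by (intro pc2_rows PY_row[OF assms(1)] assms(2))

lemma pc2_PX:
 assumes "interval_proj k l K" "pc2 N X Y u"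
 shows "pc2 N X Y (%i j. PX K X i (u i j))"
 unfolding pc2_def by (intro ballI PX_cell[OF assms(1)]) (use assms(2) in \<open>auto simp: pc2_def\<close>)

text \<open>A projection in y acts on a whole row, so its error stays continuous and differentiable
  in x across the vertical mesh lines. That is what permits integration by parts without jump
  terms.\<close>

lemma row_error_dx:
 assumes "interval_proj k l K" "j \<in> {1..N}" "has_dx RX {Y (j - 1)..Y j} u ux"
 shows "has_dx RX {Y (j - 1)..Y j} (%z. u z - PY K Y j u z) (%z. ux z - PY K Y j ux z)"
proof (rule has_dx_diff[OF assms(3)])
 have c: "continuous_on (RX \<times> {Y (j - 1)..Y j}) u" "continuous_on (RX \<times> {Y (j - 1)..Y j}) ux"
  using assms(3) by (auto simp: has_dx_def)
 show "has_dx RX {Y (j - 1)..Y j} (PY K Y j u) (PY K Y j ux)"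
  unfolding has_dx_def
 proof (intro conjI ballI PY_row[OF assms(1,2)] c)
  fix x y assume "x \<in> RX" "y \<in> {Y (j - 1)..Y j}"
  then show "((%x. PY K Y j u (x, y)) has_real_derivative PY K Y j ux (x, y)) (at x within RX)"
   unfolding PY_def split_beta fst_conv snd_conv
   using interval_proj.pj_y_derivative[OF assms(1) gy.cell[OF assms(2)], of RX x u ux y] c assms(3)
   by (auto simp: has_dx_def)
 qed
qed

text \<open>The error in y is integrated by parts without jumps, and the remaining error in x is
  invisible to \<open>D1\<close>.\<close>

lemma XD1_error:
 assumes u: "has_dx RX RY u ux" and u0: "!!y. y \<in> RY ==> u (X 0, y) = 0 & u (X N, y) = 0" and s: "disc N k s"
 shows "XD1 N X Y (%i j z. u z - PX (radR k) X i (PY (radR k) Y j u) z) s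
  = - L2D N X Y (%i j z. (ux z - PY (radR k) Y j ux z) * s i j z)"
 unfolding XD1_def L2D_def L1_minus[of N Y, symmetric]
proof (intro L1_cong)
 fix j y assume j: "j \<in> {1..N}" and y: "y \<in> {Y (j - 1)..Y j}"
 let ?g = "%x. u (x, y) - PY (radR k) Y j u (x, y)" and ?g' = "%x. ux (x, y) - PY (radR k) Y j ux (x, y)"
 let ?z = "%x. PY (radR k) Y j u (x, y)"
 note u' = has_dx_subset[OF u gy.cell_subset[OF j]]
 have g: "pder N X (%_. ?g) (%_. ?g')" by (rule row_line[OF row_error_dx[OF proj(1) j u'] y])
 have z: "pc N X (%_. ?z)"
  using u' by (intro gx.pc_global continuous_on_line_x[OF PY_row[OF proj(1) j] y]) (simp add: has_dx_def)
 note sp = disc_pcw_poly_x[OF s j, of y]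
 \<comment> \<open>The boundary terms vanish because \<open>u\<close> is 0 on both vertical sides
   and a projection in y maps 0 to 0.\<close>
 have z0: "?g x = 0" if "x = X 0 \<or> x = X N" for x
 proof -
  have "pj (radR k) (Y (j - 1)) (Y j) (%t. u (x, t)) y = pj (radR k) (Y (j - 1)) (Y j) (poly 0) y"
   using u0 gy.cell_subset[OF j] that by (intro interval_proj.pj_cong[OF proj(1) gy.cell[OF j]]) auto
  also have "... = poly 0 y" by (rule interval_proj.pj_poly[OF proj(1) gy.cell[OF j]]) simp
  finally show ?thesis using u0[of y] gy.cell_subset[OF j] y that by (auto simp: PY_def)
 qed
 have "D1 N X (%i x. u (x, y) - PX (radR k) X i (PY (radR k) Y j u) (x, y)) (%i x. s i j (x, y)) (%i x. dX (s i j) (x, y))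
  = D1 N X (%i x. ?g x + (?z x - pj (radR k) (X (i - 1)) (X i) ?z x)) (%i x. s i j (x, y)) (%i x. dX (s i j) (x, y))"
  by (simp add: PX_def)
 also have "... = D1 N X (%_. ?g) (%i x. s i j (x, y)) (%i x. dX (s i j) (x, y))
   + D1 N X (%i x. ?z x - pj (radR k) (X (i - 1)) (X i) ?z x) (%i x. s i j (x, y)) (%i x. dX (s i j) (x, y))"
  by (intro D1_add pc_mult pder_pc[OF g] gx.pc_pj[OF k proj(1) z] pcw_poly_pc(2)[OF sp])
 also have "... = - L1 N X (%i x. ?g' x * s i j (x, y))"
  unfolding gx.D1_radau[OF k z sp] gx.D1_continuous[OF g pcw_poly_pder[OF sp]] by (simp add: z0)
 finally show "D1 N X (%i x. u (x, y) - PX (radR k) X i (PY (radR k) Y j u) (x, y)) (%i x. s i j (x, y)) (%i x. dX (s i j) (x, y))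
  = - L1 N X (%i x. (ux (x, y) - PY (radR k) Y j ux (x, y)) * s i j (x, y))" .
qed

lemma line_orth:
 assumes p: "!!j. j \<in> {1..N} ==> continuous_on (RX \<times> {Y (j - 1)..Y j}) (p j)" and x: "x \<in> RX"
  and q: "!!j. j \<in> {1..N} ==> \<exists>q. degree q <= k & s j = poly q"
 shows "L1 N Y (%j y. (p j (x, y) - PY (projL2 k) Y j (p j) (x, y)) * s j y) = 0"
 unfolding PY_def split_beta fst_conv snd_conv
 using continuous_on_line_y[OF p x]
 by (intro gy.L1_proj_orth[OF k proj(3) _ q]) (auto simp: pc_def)

text \<open>Along every vertical line the error of the $L^2$ projection in y is orthogonal to
  polynomials of degree \<open>k\<close>, and \<open>v\<close> and \<open>dX v\<close> restrict to
  such polynomials. Integrating in y before x kills the volume term and every trace term, without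
  any derivative of \<open>p\<close>.\<close>

lemma XD2_row_error:
 assumes p: "!!j. j \<in> {1..N} ==> continuous_on (RX \<times> {Y (j - 1)..Y j}) (p j)" and v: "disc N k v"
 shows "XD2 N X Y (%i j z. p j z - PY (projL2 k) Y j (p j) z) v = 0"
proof -
 let ?g = "%(i::nat) j z. p j z - PY (projL2 k) Y j (p j) z"
 have g: "pc2 N X Y ?g" by (intro pc2_diff pc2_rows p pc2_PY[OF proj(3)])
 have line: "\<exists>q. degree q <= k & (%y. v i j (x, y)) = poly q" if "i \<in> {1..N}" "j \<in> {1..N}" for i j x
  using v that polyT_slices(2) by (metis disc_def)
 have line': "\<exists>q. degree q <= k & (%y. dX (v i j) (x, y)) = poly q" if "i \<in> {1..N}" "j \<in> {1..N}" for i j x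
  using v that polyT_dX(2) by (metis disc_def)
 have nodes: "X i \<in> RX" if "i <= N" for i using gx.X_mono[of 0 i] gx.X_mono[of i N] that by auto
 have 0: "L1 N Y (%j y. L1 N X (%i x. ?g i j (x, y) * dX (v i j) (x, y))) = 0"
 proof -
  have "L1 N Y (%j y. L1 N X (%i x. ?g i j (x, y) * dX (v i j) (x, y)))
   = L1 N X (%i x. L1 N Y (%j y. ?g i j (x, y) * dX (v i j) (x, y)))"
   using L2D_swap[OF pc2_mult[OF g disc_pc2(2)[OF v]]] by (simp add: L2D_def)
  also have "... = L1 N X (%i x. 0)"
   by (intro L1_cong line_orth p line' subsetD[OF gx.cell_subset])
  finally show ?thesis by (simp add: L1_0)
 qed
 have t: "L1 N Y (%j y. ?g i' j (X i, y) * v i' j (X i, y)) = 0" if "i <= N" "i' \<in> {1..N}" for i i'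
  using that by (intro line_orth p line nodes)
 have pt: "pc N Y (%j y. ?g i' j (X i, y) * v i' j (X i, y))" if "i <= N" "i' \<in> {1..N}" for i i'
  unfolding pc_def
 proof
  fix j assume j: "j \<in> {1..N}"
  have "continuous_on (RX \<times> {Y (j - 1)..Y j}) (%z. (p j z - PY (projL2 k) Y j (p j) z) * v i' j z)"
   using v that(2) j by (intro continuous_intros p PY_row[OF proj(3)] polyT_slices(3)[of _ k k]) (auto simp: disc_def)
  then show "continuous_on {Y (j - 1)..Y j} (%y. ?g i' j (X i, y) * v i' j (X i, y))"
   using continuous_on_line_y[OF _ nodes[OF that(1)]] by blast
 qed
 have "XD2 N X Y ?g v = L1 N Y (%j y. L1 N X (%i x. ?g i j (x, y) * dX (v i j) (x, y))
   + (\<Sum>i=1..N-1. ?g (Suc i) j (X i, y) * v (Suc i) j (X i, y) - ?g i j (X i, y) * v i j (X i, y))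
   + ?g 1 j (X 0, y) * v 1 j (X 0, y) - ?g N j (X N, y) * v N j (X N, y))"
  by (simp add: XD2_def D2_def right_diff_distrib)
 also have "... = L1 N Y (%j y. L1 N X (%i x. ?g i j (x, y) * dX (v i j) (x, y)))
   + (\<Sum>i=1..N-1. L1 N Y (%j y. ?g (Suc i) j (X i, y) * v (Suc i) j (X i, y)) - L1 N Y (%j y. ?g i j (X i, y) * v i j (X i, y)))
   + L1 N Y (%j y. ?g 1 j (X 0, y) * v 1 j (X 0, y)) - L1 N Y (%j y. ?g N j (X N, y) * v N j (X N, y))"
 proof -
  have A: "pc N Y (%j y. L1 N X (%i x. ?g i j (x, y) * dX (v i j) (x, y)))"
   using pc_L1_y[OF pc2_mult[OF g disc_pc2(2)[OF v]]] .
  have B: "pc N Y (%j y. ?g (Suc i) j (X i, y) * v (Suc i) j (X i, y) - ?g i j (X i, y) * v i j (X i, y))"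
   "L1 N Y (%j y. ?g (Suc i) j (X i, y) * v (Suc i) j (X i, y) - ?g i j (X i, y) * v i j (X i, y))
    = L1 N Y (%j y. ?g (Suc i) j (X i, y) * v (Suc i) j (X i, y)) - L1 N Y (%j y. ?g i j (X i, y) * v i j (X i, y))"
   if "i \<in> {1..N-1}" for i using that by (intro pc_diff L1_diff pt; auto)+
  have C: "pc N Y (%j y. ?g 1 j (X 0, y) * v 1 j (X 0, y))" "pc N Y (%j y. ?g N j (X N, y) * v N j (X N, y))"
   using gx.N1 by (intro pt; simp)+
  show ?thesis using B(2)
   by (simp only: L1_diff[OF pc_add[OF pc_add[OF A pc_sum[OF B(1)]] C(1)] C(2)] L1_add[OF pc_add[OF A pc_sum[OF B(1)]] C(1)]
    L1_add[OF A pc_sum[OF B(1)]] L1_sum[OF finite_atLeastAtMost B(1)] cong: sum.cong)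
 qed
 also have "... = 0"
  unfolding 0 using t gx.N1 by (auto intro!: sum.neutral)
 finally show ?thesis .
qed

end

context grid2
begin

lemma XD2_error:
 assumes p: "!!j. j \<in> {1..N} ==> continuous_on (RX \<times> {Y (j - 1)..Y j}) (p j)" and v: "disc N k v"
 shows "XD2 N X Y (%i j z. p j z - PX (radL k) X i (PY (projL2 k) Y j (p j)) z) v
  = - XT N X Y (%i j z. (PY (projL2 k) Y j (p j) z - PX (radL k) X i (PY (projL2 k) Y j (p j)) z) * v i j z)"
proof -
 let ?q = "%j. PY (projL2 k) Y j (p j)"
 let ?e = "%i j z. ?q j z - PX (radL k) X i (?q j) z"
 have q: "continuous_on (RX \<times> {Y (j - 1)..Y j}) (?q j)" if "j \<in> {1..N}" for j
  by (rule PY_row[OF proj(3) that p[OF that]])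
 have e: "pc2 N X Y ?e" by (intro pc2_diff pc2_rows q pc2_PX[OF proj(2)])
 have "XD2 N X Y (%i j z. (p j z - ?q j z) + ?e i j z) v = XD2 N X Y (%i j z. p j z - ?q j z) v + XD2 N X Y ?e v"
  by (intro XD2_add pc2_diff pc2_rows q p e v)
 moreover have "XD2 N X Y ?e v = - XT N X Y (%i j z. ?e i j z * v i j z)"
  unfolding XD2_def XT_def L1_minus[of N Y, symmetric]
 proof (intro L1_cong)
  fix j y assume j: "j \<in> {1..N}" and y: "y \<in> {Y (j - 1)..Y j}"
  have z: "pc N X (%_ x. ?q j (x, y))" by (intro gx.pc_global continuous_on_line_x[OF q[OF j] y])
  show "D2 N X (%i x. ?e i j (x, y)) (%i x. v i j (x, y)) (%i x. dX (v i j) (x, y)) = - (?e N j (X N, y) * v N j (X N, y))"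
   using gx.D2_radau[OF k z disc_pcw_poly_x[OF v j, of y]] by (simp add: PX_def mult_minus_left[symmetric])
 qed
 ultimately show ?thesis using XD2_row_error[OF p v] by simp
qed

text \<open>Only \<open>ua\<close> is differentiated. For the layer part a derivative would cost
  \<open>1 / \<epsilon>\<close>, so its error is left as the flux \<open>a * gb\<close>, taken from
  the right and ready for a left Radau projection.\<close>

lemma XL4_error:
 assumes a: "has_dx RX RY a ax" and ua: "has_dx RX RY ua uax" and ub: "continuous_on (RX \<times> RY) ub"
  and u: "u = (%z. ua z + ub z)" and u0: "!!y. y \<in> RY ==> u (X 0, y) = 0" and v: "disc N k v"
 defines "ga \<equiv> %j z. ua z - PY (radR k) Y j ua z" and "gax \<equiv> %j z. uax z - PY (radR k) Y j uax z"
  and "gb \<equiv> %j z. ub z - PY (radR k) Y j ub z"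
  and "\<zeta> \<equiv> %i j z. PY (radR k) Y j u z - PX (radR k) X i (PY (radR k) Y j u) z"
 shows "XL4 N X Y a (%i j z. u z - PX (radR k) X i (PY (radR k) Y j u) z) v
  = XL4 N X Y a \<zeta> v + L2D N X Y (%i j z. (a z * gax j z + ax z * ga j z) * v i j z)
   - XD2 N X Y (%i j z. a z * gb j z) v"
proof -
 have ac: "continuous_on (RX \<times> RY) a" "continuous_on (RX \<times> RY) ax" and uac: "continuous_on (RX \<times> RY) ua" "continuous_on (RX \<times> RY) uax"
  using a ua by (auto simp: has_dx_def)
 have uc: "continuous_on (RX \<times> RY) u" unfolding u by (intro continuous_intros uac ub)
 note row = row_subset[OF uac(1)] row_subset[OF uac(2)] row_subset[OF ub] row_subset[OF uc]
 have PYu: "pc2 N X Y (%i j. PY (radR k) Y j w)" if "continuous_on (RX \<times> RY) w" for w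
  by (intro pc2_PY[OF proj(1)] row_subset[OF that])
 have \<zeta>c: "pc2 N X Y \<zeta>" unfolding \<zeta>_def
  by (intro pc2_diff PYu[OF uc] pc2_PX[OF proj(1) PYu[OF uc]])
 have gc: "pc2 N X Y (%i. ga)" "pc2 N X Y (%i. gax)" "pc2 N X Y (%i. gb)"
  unfolding ga_def gax_def gb_def by (intro pc2_diff pc2_global uac ub PYu)+
 note vc = disc_pc2(1)[OF v, of X Y] disc_pc2(2)[OF v, of X Y]
 have split: "u z - PX (radR k) X i (PY (radR k) Y j u) z = \<zeta> i j z + (ga j z + gb j z)"
  if j: "j \<in> {1..N}" and "fst z \<in> RX" for i j z
 proof -
  have "PY (radR k) Y j u z = PY (radR k) Y j ua z + PY (radR k) Y j ub z"
   unfolding u PY_def split_beta fst_conv snd_conv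
   using continuous_on_line_y[OF row(1)[OF j] that(2)] continuous_on_line_y[OF row(3)[OF j] that(2)]
   by (intro interval_proj.pj_add[OF proj(1) gy.cell[OF j]])
  then show ?thesis by (simp add: \<zeta>_def ga_def gb_def u)
 qed
 have line: "L4 N X (%x. a (x, y)) (%i x. u (x, y) - PX (radR k) X i (PY (radR k) Y j u) (x, y)) (%i x. v i j (x, y)) (%i x. dX (v i j) (x, y))
  = L4 N X (%x. a (x, y)) (%i x. \<zeta> i j (x, y)) (%i x. v i j (x, y)) (%i x. dX (v i j) (x, y))
   + L1 N X (%i x. (a (x, y) * gax j (x, y) + ax (x, y) * ga j (x, y)) * v i j (x, y))
   - D2 N X (%i x. a (x, y) * gb j (x, y)) (%i x. v i j (x, y)) (%i x. dX (v i j) (x, y))"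
  if j: "j \<in> {1..N}" and y: "y \<in> {Y (j - 1)..Y j}" for j y
 proof -
  let ?L4 = "%U. L4 N X (%x. a (x, y)) U (%i x. v i j (x, y)) (%i x. dX (v i j) (x, y))"
  note sp = disc_pcw_poly_x[OF v j, of y]
  have "?L4 (%i x. u (x, y) - PX (radR k) X i (PY (radR k) Y j u) (x, y)) = ?L4 (%i x. \<zeta> i j (x, y) + (ga j (x, y) + gb j (x, y)))"
  proof -
   have "D1 N X (%i x. a (x, y) * (u (x, y) - PX (radR k) X i (PY (radR k) Y j u) (x, y))) (%i x. v i j (x, y)) (%i x. dX (v i j) (x, y))
    = D1 N X (%i x. a (x, y) * (\<zeta> i j (x, y) + (ga j (x, y) + gb j (x, y)))) (%i x. v i j (x, y)) (%i x. dX (v i j) (x, y))"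
   proof (intro D1_cong)
    fix i x assume "i \<in> {1..N}" "x \<in> {X (i - 1)..X i}"
    then have "x \<in> RX" using gx.cell_subset by blast
    then show "a (x, y) * (u (x, y) - PX (radR k) X i (PY (radR k) Y j u) (x, y)) = a (x, y) * (\<zeta> i j (x, y) + (ga j (x, y) + gb j (x, y)))"
     using split[OF j, of "(x, y)" i] by simp
   qed (simp add: less_imp_le gx.strict)
   moreover have "X N \<in> RX" using gx.X_mono[of 0 N] by simp
   ultimately show ?thesis unfolding L4_def by (simp add: split[OF j])
  qed
  also have "... = ?L4 (%i x. \<zeta> i j (x, y)) + (?L4 (%i x. ga j (x, y)) + ?L4 (%i x. gb j (x, y)))"
   by (subst L4_add, (intro pc_mult pc_add line_a[OF ac(1) j y] pc2_line_x[OF \<zeta>c j y]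
     pc2_line_x[OF gc(1) j y] pc2_line_x[OF gc(3) j y] pcw_poly_pc(2)[OF sp])+)
    (subst L4_add, (intro pc_mult pc_add line_a[OF ac(1) j y] pc2_line_x[OF \<zeta>c j y]
     pc2_line_x[OF gc(1) j y] pc2_line_x[OF gc(3) j y] pcw_poly_pc(2)[OF sp])+, rule refl)
  also have "?L4 (%i x. ga j (x, y)) = L1 N X (%i x. (a (x, y) * gax j (x, y) + ax (x, y) * ga j (x, y)) * v i j (x, y))
    + a (X 0, y) * ga j (X 0, y) * v 1 j (X 0, y)"
  proof (rule gx.L4_continuous[OF _ pcw_poly_pder[OF sp]])
   have "has_dx RX {Y (j - 1)..Y j} (%z. a z * ga j z) (%z. a z * gax j z + ax z * ga j z)"
    unfolding ga_def gax_def
    by (intro has_dx_mult row_error_dx[OF proj(1) j] has_dx_subset[OF a] has_dx_subset[OF ua] gy.cell_subset j)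
   from row_line[OF this y] show "pder N X (%_ x. a (x, y) * ga j (x, y)) (%_ x. a (x, y) * gax j (x, y) + ax (x, y) * ga j (x, y))" .
  qed
  also have "?L4 (%i x. gb j (x, y)) = - D2 N X (%i x. a (x, y) * gb j (x, y)) (%i x. v i j (x, y)) (%i x. dX (v i j) (x, y))
    + a (X 0, y) * gb j (X 0, y) * v 1 j (X 0, y)"
   by (rule gx.L4_D2)
  finally have *: "?L4 (%i x. u (x, y) - PX (radR k) X i (PY (radR k) Y j u) (x, y))
   = ?L4 (%i x. \<zeta> i j (x, y)) + L1 N X (%i x. (a (x, y) * gax j (x, y) + ax (x, y) * ga j (x, y)) * v i j (x, y))
    - D2 N X (%i x. a (x, y) * gb j (x, y)) (%i x. v i j (x, y)) (%i x. dX (v i j) (x, y))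
    + a (X 0, y) * (ga j (X 0, y) + gb j (X 0, y)) * v 1 j (X 0, y)"
   by (simp add: algebra_simps)
  \<comment> \<open>Neither \<open>ua\<close> nor \<open>ub\<close> has to vanish at the inflow
    boundary, only their sum does; hence the two inflow terms must be combined before they
    disappear.\<close>
  have "ga j (X 0, y) + gb j (X 0, y) = 0"
  proof -
   have X0: "X 0 \<in> RX" using gx.X_mono[of 0 N] by simp
   have u0j: "u (X 0, t) = 0" if "t \<in> {Y (j - 1)..Y j}" for t
    using u0 subsetD[OF gy.cell_subset[OF j] that] by blast
   have "PY (radR k) Y j u (X 0, y) = pj (radR k) (Y (j - 1)) (Y j) (poly 0) y"
    unfolding PY_def split_conv by (intro interval_proj.pj_cong[OF proj(1) gy.cell[OF j]]) (simp add: u0j)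
   also have "... = poly 0 y" by (rule interval_proj.pj_poly[OF proj(1) gy.cell[OF j]]) simp
   finally have "PY (radR k) Y j u (X 0, y) = 0" by simp
   moreover have "u (X 0, y) = 0" using u0j[OF y] .
   \<comment> \<open>Index 0 belongs to no cell, but \<open>split\<close> holds for every index and
     the projection in x cancels against the one inside \<open>\<zeta>\<close>.\<close>
   moreover have "ga j (X 0, y) + gb j (X 0, y) = u (X 0, y) - PX (radR k) X 0 (PY (radR k) Y j u) (X 0, y) - \<zeta> 0 j (X 0, y)"
    using split[OF j, of "(X 0, y)" 0] X0 by simp
   ultimately show ?thesis by (simp add: \<zeta>_def)
  qed
  with * show ?thesis by simp
 qed
 have "XL4 N X Y a (%i j z. u z - PX (radR k) X i (PY (radR k) Y j u) z) v
  = L1 N Y (%j y. L4 N X (%x. a (x, y)) (%i x. \<zeta> i j (x, y)) (%i x. v i j (x, y)) (%i x. dX (v i j) (x, y))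
   + L1 N X (%i x. (a (x, y) * gax j (x, y) + ax (x, y) * ga j (x, y)) * v i j (x, y))
   - D2 N X (%i x. a (x, y) * gb j (x, y)) (%i x. v i j (x, y)) (%i x. dX (v i j) (x, y)))"
  unfolding XL4_def by (intro L1_cong line)
 also have "... = XL4 N X Y a \<zeta> v + L2D N X Y (%i j z. (a z * gax j z + ax z * ga j z) * v i j z)
   - XD2 N X Y (%i j z. a z * gb j z) v"
 proof -
  have 1: "pc N Y (%j y. L4 N X (%x. a (x, y)) (%i x. \<zeta> i j (x, y)) (%i x. v i j (x, y)) (%i x. dX (v i j) (x, y)))"
   by (intro pc_L4 ac \<zeta>c vc)
  have 2: "pc N Y (%j y. L1 N X (%i x. (a (x, y) * gax j (x, y) + ax (x, y) * ga j (x, y)) * v i j (x, y)))"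
   using pc_L1_y[OF pc2_mult[OF pc2_add[OF pc2_mult[OF pc2_global[OF ac(1)] gc(2)] pc2_mult[OF pc2_global[OF ac(2)] gc(1)]] vc(1)]] .
  have 3: "pc N Y (%j y. D2 N X (%i x. a (x, y) * gb j (x, y)) (%i x. v i j (x, y)) (%i x. dX (v i j) (x, y)))"
   using pc_D2[OF pc2_mult[OF pc2_global[OF ac(1)] gc(3)] vc] .
  show ?thesis unfolding L1_diff[OF pc_add[OF 1 2] 3] L1_add[OF 1 2] by (simp add: XL4_def L2D_def XD2_def)
 qed
 finally show ?thesis .
qed

lemma XD1_smooth:
 assumes u: "has_dx RX RY u ux" and u0: "!!y. y \<in> RY ==> u (X 0, y) = 0 & u (X N, y) = 0" and s: "disc N k s"
 shows "XD1 N X Y (%i j. u) s = - L2D N X Y (%i j z. ux z * s i j z)"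
 unfolding XD1_def L2D_def L1_minus[of N Y, symmetric]
proof (intro L1_cong)
 fix j y assume j: "j \<in> {1..N}" and y: "y \<in> {Y (j - 1)..Y j}"
 have "y \<in> RY" using y gy.cell_subset[OF j] by blast
 then show "D1 N X (%i x. u (x, y)) (%i x. s i j (x, y)) (%i x. dX (s i j) (x, y)) = - L1 N X (%i x. ux (x, y) * s i j (x, y))"
  using gx.D1_continuous[OF row_line[OF has_dx_subset[OF u gy.cell_subset[OF j]] y] pcw_poly_pder[OF disc_pcw_poly_x[OF s j]]] u0
  by simp
qed

lemma XD2_smooth:
 assumes p: "has_dx RX RY p px" and v: "disc N k v"
 shows "XD2 N X Y (%i j. p) v = - L2D N X Y (%i j z. px z * v i j z)"
 unfolding XD2_def L2D_def L1_minus[of N Y, symmetric]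
 using gx.D2_continuous[OF row_line[OF has_dx_subset[OF p gy.cell_subset]] pcw_poly_pder[OF disc_pcw_poly_x[OF v]]]
 by (intro L1_cong) auto

lemma XL4_smooth:
 assumes a: "has_dx RX RY a ax" and u: "has_dx RX RY u ux" and u0: "!!y. y \<in> RY ==> u (X 0, y) = 0" and v: "disc N k v"
 shows "XL4 N X Y a (%i j. u) v = L2D N X Y (%i j z. (a z * ux z + ax z * u z) * v i j z)"
 unfolding XL4_def L2D_def
proof (intro L1_cong)
 fix j y assume j: "j \<in> {1..N}" and y: "y \<in> {Y (j - 1)..Y j}"
 have "y \<in> RY" using y gy.cell_subset[OF j] by blast
 then show "L4 N X (%x. a (x, y)) (%i x. u (x, y)) (%i x. v i j (x, y)) (%i x. dX (v i j) (x, y))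
  = L1 N X (%i x. (a (x, y) * ux (x, y) + ax (x, y) * u (x, y)) * v i j (x, y))"
  using gx.L4_continuous[OF row_line[OF has_dx_subset[OF has_dx_mult[OF a u] gy.cell_subset[OF j]] y] pcw_poly_pder[OF disc_pcw_poly_x[OF v j]]] u0
  by simp
qed

lemma XT_zero:
 assumes "!!j y. j \<in> {1..N} ==> y \<in> {Y (j - 1)..Y j} ==> F N j (X N, y) = 0"
 shows "XT N X Y F = 0"
proof -
 have "XT N X Y F = L1 N Y (%_ _. 0)" unfolding XT_def by (intro L1_cong assms)
 then show ?thesis by (simp add: L1_0)
qed

lemma PX_zero:
 assumes "interval_proj k l K" "i \<in> {1..N}" "!!x. x \<in> {X (i - 1)..X i} ==> w (x, y) = 0"
 shows "PX K X i w (x, y) = 0"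
proof -
 have "PX K X i w (x, y) = pj K (X (i - 1)) (X i) (poly 0) x"
  unfolding PX_def split_conv using assms by (intro interval_proj.pj_cong[OF assms(1) gx.cell]) auto
 also have "... = 0" using interval_proj.pj_poly[OF assms(1) gx.cell[OF assms(2)], of 0] by simp
 finally show ?thesis .
qed

lemma tensor_commute:
 assumes "interval_proj k l K" "interval_proj k' l' K'" "i \<in> {1..N}" "j \<in> {1..N}"
  "continuous_on (cl i j) u"
 shows "PX K X i (PY K' Y j u) = PY K' Y j (PX K X i u)"
 by (rule PX_PY_commute[OF assms(1,2) gx.cell[OF assms(3)] gy.cell[OF assms(4)] assms(5)])

lemma tensor_polyT:
 assumes "interval_proj k l K" "interval_proj k' l' K'" "i \<in> {1..N}" "j \<in> {1..N}"
  "continuous_on (cl i j) u"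
 shows "PX K X i (PY K' Y j u) \<in> polyT k k'"
 by (rule PX_PY_polyT[OF assms(1,2) gx.cell[OF assms(3)] gy.cell[OF assms(4)] assms(5)])

lemma PX_trace: "i \<in> {1..N} ==> PX (radR k) X i w (X i, y) = w (X i, y)"
 unfolding PX_def split_conv by (rule gx.radR_trace[OF k])

end

text \<open>The unknowns of the error analysis. \<open>u = ua + ub\<close>, where \<open>ub\<close> collects the components with a
  layer in \<open>x\<close>.\<close>

locale ldg_problem = grid2 N X Y k for N :: nat and X Y :: "nat => real" and k :: nat +
 fixes \<epsilon> l1 l2 :: real and a ax b f u ux uxx uy uyy ua uax ub :: fn2
  and U P Q :: "nat => nat => fn2"
 assumes \<epsilon>: "\<epsilon> > 0"
  and a: "has_dx RX RY a ax" and b: "continuous_on (RX \<times> RY) b" and f: "continuous_on (RX \<times> RY) f"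
  and u_dx: "has_dx RX RY u ux" "has_dx RX RY ux uxx"
  and u_dy: "has_dx RY RX (%z. u (prod.swap z)) (%z. uy (prod.swap z))"
   "has_dx RY RX (%z. uy (prod.swap z)) (%z. uyy (prod.swap z))"
  and u_split: "u = (%z. ua z + ub z)" and ua: "has_dx RX RY ua uax" and ub: "continuous_on (RX \<times> RY) ub"
  and bc_x: "!!y. y \<in> RY ==> u (X 0, y) = 0 & u (X N, y) = 0"
  and bc_y: "!!x. x \<in> RX ==> u (x, Y 0) = 0 & u (x, Y N) = 0"
  and pde: "!!z. z \<in> RX \<times> RY ==> - \<epsilon> * (uxx z + uyy z) + a z * ux z + b z * u z = f z"
  and UPQ: "disc N k U" "disc N k P" "disc N k Q"
  and galerkin: "!!v s r. disc N k v ==> disc N k s ==> disc N k r ==>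
   bform N X Y \<epsilon> a ax b l1 l2 U P Q v s r = L2D N X Y (%i j z. f z * v i j z)"
begin

sublocale S: grid2 N Y X k by (rule swapped)

section \<open>Projection errors, discrete errors and the error identity\<close>

definition "p = (%z. \<epsilon> * ux z)"
definition "q = (%z. \<epsilon> * uy z)"
definition "Pu = (%i j. PX (radR k) X i (PY (radR k) Y j u))"
definition "Pp = (%i j. PX (radL k) X i (PY (projL2 k) Y j p))"
definition "Pq = (%i j. PY (radL k) Y j (PX (projL2 k) X i q))"
definition "\<eta>u = (%i j z. u z - Pu i j z)"
definition "\<eta>p = (%i j z. p z - Pp i j z)"
definition "\<eta>q = (%i j z. q z - Pq i j z)"
definition "\<xi>u = (%i j z. Pu i j z - U i j z)"
definition "\<xi>p = (%i j z. Pp i j z - P i j z)"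
definition "\<xi>q = (%i j z. Pq i j z - Q i j z)"
text \<open>The \<zeta> families are errors in one variable that remain after projecting in the
  other; they are the parts to which the one-dimensional Radau identities apply.\<close>

definition "\<zeta>u = (%i j z. PY (radR k) Y j u z - Pu i j z)"
definition "\<zeta>p = (%i j z. PY (projL2 k) Y j p z - Pp i j z)"
definition "\<zeta>q = (%i j z. PX (projL2 k) X i q z - Pq i j z)"
definition "gx = (%(i::nat) j z. ux z - PY (radR k) Y j ux z)"
definition "gy = (%i (j::nat) z. uy z - PX (radR k) X i uy z)"
definition "ga = (%(i::nat) j z. ua z - PY (radR k) Y j ua z)"
definition "gax = (%(i::nat) j z. uax z - PY (radR k) Y j uax z)"
definition "agb = (%j z. a z * (ub z - PY (radR k) Y j ub z))"
text \<open>A polynomial substitute for the flux \<open>agb\<close> of the layer part. Being in the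
  finite element space, it can serve as a test function in the first error equation; the difference
  \<open>\<theta>\<close> then enters only through its trace at the outflow boundary.\<close>

definition "\<phi> = (%i j. PX (radL k) X i (PY (projL2 k) Y j (agb j)))"
definition "\<theta> = (%i j z. PY (projL2 k) Y j (agb j) z - \<phi> i j z)"

lemma conts:
 "continuous_on (RX \<times> RY) a" "continuous_on (RX \<times> RY) ax" "continuous_on (RX \<times> RY) u" "continuous_on (RX \<times> RY) ux"
 "continuous_on (RX \<times> RY) p" "continuous_on (RX \<times> RY) ua" "continuous_on (RX \<times> RY) uax"
 "continuous_on (RX \<times> RY) uy" "continuous_on (RX \<times> RY) q"
proof -
 show ux: "continuous_on (RX \<times> RY) ux" using u_dx by (simp add: has_dx_def)
 have "continuous_on (RY \<times> RX) (%z. uy (prod.swap z))" using u_dy by (simp add: has_dx_def)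
 from continuous_on_swap[OF this] show uy: "continuous_on (RX \<times> RY) uy" by (simp add: split_beta)
 show "continuous_on (RX \<times> RY) p" "continuous_on (RX \<times> RY) q" unfolding p_def q_def by (intro continuous_intros ux uy)+
qed (use a u_dx ua in \<open>auto simp: has_dx_def\<close>)

lemma cell2: "continuous_on (RX \<times> RY) (w :: fn2) ==> i \<in> {1..N} ==> j \<in> {1..N} ==> continuous_on (cl i j) w"
 using pc2_global[of w] by (auto simp: pc2_def)

lemma Pq_alt: "i \<in> {1..N} ==> j \<in> {1..N} ==> Pq i j = PX (projL2 k) X i (PY (radL k) Y j q)"
 unfolding Pq_def by (rule tensor_commute[OF proj(3) proj(2) _ _ cell2[OF conts(9)], symmetric])

lemma Pu_alt: "i \<in> {1..N} ==> j \<in> {1..N} ==> Pu i j = PY (radR k) Y j (PX (radR k) X i u)"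
 unfolding Pu_def by (rule tensor_commute[OF proj(1) proj(1) _ _ cell2[OF conts(3)]])

lemma agb_row: "j \<in> {1..N} ==> continuous_on (RX \<times> {Y (j - 1)..Y j}) (agb j)"
 unfolding agb_def by (intro continuous_intros PY_row[OF proj(1)] row_subset conts ub)

lemma agb_cell: "i \<in> {1..N} ==> j \<in> {1..N} ==> continuous_on (cl i j) (agb j)"
 by (rule continuous_on_subset[OF agb_row]) (intro Sigma_mono gx.cell_subset order_refl | assumption)+

lemma discs: "disc N k Pu" "disc N k Pp" "disc N k Pq" "disc N k \<phi>"
proof -
 show "disc N k Pu" unfolding disc_def Pu_def
  by (intro ballI tensor_polyT[OF proj(1) proj(1)] cell2 conts)
 show "disc N k Pp" unfolding disc_def Pp_def
  by (intro ballI tensor_polyT[OF proj(2) proj(3)] cell2 conts)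
 show "disc N k \<phi>" unfolding disc_def \<phi>_def
  by (intro ballI tensor_polyT[OF proj(2) proj(3)] agb_cell)
 have "Pq i j \<in> polyT k k" if "i \<in> {1..N}" "j \<in> {1..N}" for i j
  unfolding Pq_alt[OF that] using that by (intro tensor_polyT[OF proj(3) proj(2)] cell2 conts)
 then show "disc N k Pq" by (simp add: disc_def)
qed

lemma disc_diff: "disc N k V ==> disc N k W ==> disc N k (%i j z. V i j z - W i j z)"
 by (simp add: disc_def polyT_diff)

lemma disc_0: "disc N k (%_ _ _. 0)"
 by (simp add: disc_def polyT_0)

lemma disc_\<xi>: "disc N k \<xi>u" "disc N k \<xi>p" "disc N k \<xi>q"
 unfolding \<xi>u_def \<xi>p_def \<xi>q_def by (intro disc_diff discs UPQ)+

lemma pc2_errors: "pc2 N X Y \<eta>u" "pc2 N X Y \<eta>p" "pc2 N X Y \<eta>q" "pc2 N X Y \<zeta>u" "pc2 N X Y \<zeta>p" "pc2 N X Y gx" "pc2 N X Y ga" "pc2 N X Y gax" "pc2 N X Y \<theta>"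
 unfolding \<eta>u_def \<eta>p_def \<eta>q_def \<zeta>u_def \<zeta>p_def gx_def ga_def gax_def \<theta>_def
 by ((rule pc2_diff pc2_global conts disc_pc2[OF discs(1)] disc_pc2[OF discs(2)] disc_pc2[OF discs(3)] disc_pc2[OF discs(4)]
   pc2_PY[OF proj(1)] pc2_PY[OF proj(3)] agb_row row_subset | assumption)+)

lemma pc2_errors': "pc2 N X Y \<zeta>q" "pc2 N X Y gy"
 unfolding \<zeta>q_def gy_def
 by (intro pc2_diff pc2_global conts disc_pc2[OF discs(3)] pc2_PX[OF proj(3)] pc2_PX[OF proj(1)])+

text \<open>The exact triple has no interior jumps, and u vanishes on the boundary, so integration
  by parts returns the strong equations. The term \<open>ax * u\<close> from differentiating
  \<open>a * u\<close> compensates the reaction coefficient \<open>b - ax\<close>.\<close>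

lemma consistency:
 assumes v: "disc N k v" and s: "disc N k s" and r: "disc N k r"
 shows "bform N X Y \<epsilon> a ax b l1 l2 (%i j. u) (%i j. p) (%i j. q) v s r = L2D N X Y (%i j z. f z * v i j z)"
proof -
 note c = disc_pc2(1)[OF v, of X Y] disc_pc2(1)[OF s, of X Y] disc_pc2(1)[OF r, of X Y]
 have uxx: "continuous_on (RX \<times> RY) uxx" using u_dx by (simp add: has_dx_def)
 have "continuous_on (RY \<times> RX) (%z. uyy (prod.swap z))" using u_dy by (simp add: has_dx_def)
 from continuous_on_swap[OF this] have uyy: "continuous_on (RX \<times> RY) uyy" by (simp add: split_beta)
 have p: "has_dx RX RY p (%z. \<epsilon> * uxx z)" unfolding p_def by (rule has_dx_cmult[OF u_dx(2)])
 have q: "has_dx RY RX (%z. q (prod.swap z)) (%z. \<epsilon> * uyy (prod.swap z))" unfolding q_def by (rule has_dx_cmult[OF u_dy(2)])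
 have 1: "XT N X Y (%i j z. u z * v i j z) = 0"
  by (intro XT_zero) (use bc_x subsetD[OF gy.cell_subset] in simp)
 have 2: "XT N Y X (sw (%i j z. u z * v i j z)) = 0"
  unfolding sw_def by (intro S.XT_zero) (use bc_y subsetD[OF gx.cell_subset] in simp)
 have 3: "XD1 N Y X (sw (%i j. u)) (sw r) = - L2D N X Y (%i j z. uy z * r i j z)"
 proof -
  have "XD1 N Y X (%i j z. u (prod.swap z)) (sw r) = - L2D N Y X (sw (%i j z. uy z * r i j z))"
   unfolding sw_def using S.XD1_smooth[OF u_dy(1) _ disc_sw[OF r]] bc_y by (simp add: sw_def)
  then show ?thesis by (simp add: sw_def[of "%i j. u"] L2D_sw pc2_mult pc2_global conts c)
 qed
 have 4: "XD2 N Y X (sw (%i j. q)) (sw v) = - L2D N X Y (%i j z. (\<epsilon> * uyy z) * v i j z)"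
 proof -
  have "XD2 N Y X (%i j z. q (prod.swap z)) (sw v) = - L2D N Y X (sw (%i j z. (\<epsilon> * uyy z) * v i j z))"
   unfolding sw_def using S.XD2_smooth[OF q disc_sw[OF v]] by (simp add: sw_def)
  moreover have "pc2 N X Y (%i j z. (\<epsilon> * uyy z) * v i j z)" by (intro pc2_mult pc2_const pc2_global uyy c)
  ultimately show ?thesis by (simp add: sw_def[of "%i j. q"] L2D_sw)
 qed
 have u0: "u (X 0, y) = 0" if "y \<in> RY" for y using bc_x[OF that] by simp
 have e: "L2D N X Y (%i j z. p z * s i j z + q z * r i j z) / \<epsilon> = L2D N X Y (%i j z. ux z * s i j z + uy z * r i j z)"
 proof -
  have "L2D N X Y (%i j z. p z * s i j z + q z * r i j z) = \<epsilon> * L2D N X Y (%i j z. ux z * s i j z + uy z * r i j z)"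
   unfolding L2D_cmult[symmetric] by (simp add: p_def q_def algebra_simps)
  then show ?thesis using \<epsilon> by simp
 qed
 have "L2D N X Y (%i j z. ux z * s i j z + uy z * r i j z) = L2D N X Y (%i j z. ux z * s i j z) + L2D N X Y (%i j z. uy z * r i j z)"
  by (intro L2D_add pc2_mult pc2_global conts c)
 moreover have "L2D N X Y (%i j z. (b z - ax z) * u z * v i j z) - L2D N X Y (%i j z. (\<epsilon> * uxx z) * v i j z)
   + L2D N X Y (%i j z. (a z * ux z + ax z * u z) * v i j z) - L2D N X Y (%i j z. (\<epsilon> * uyy z) * v i j z)
  = L2D N X Y (%i j z. ((b z - ax z) * u z * v i j z - (\<epsilon> * uxx z) * v i j z + (a z * ux z + ax z * u z) * v i j z) - (\<epsilon> * uyy z) * v i j z)"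
 proof -
  have 1: "pc2 N X Y (%i j z. (b z - ax z) * u z * v i j z)" by (intro pc2_mult pc2_diff pc2_global conts b c)
  have 2: "pc2 N X Y (%i j z. (\<epsilon> * uxx z) * v i j z)" by (intro pc2_mult pc2_const pc2_global uxx c)
  have 3: "pc2 N X Y (%i j z. (a z * ux z + ax z * u z) * v i j z)" by (intro pc2_mult pc2_add pc2_global conts c)
  have 4: "pc2 N X Y (%i j z. (\<epsilon> * uyy z) * v i j z)" by (intro pc2_mult pc2_const pc2_global uyy c)
  show ?thesis
   unfolding L2D_diff[OF pc2_add[OF pc2_diff[OF 1 2] 3] 4] L2D_add[OF pc2_diff[OF 1 2] 3] L2D_diff[OF 1 2] by simp
 qed
 moreover have "... = L2D N X Y (%i j z. f z * v i j z)"
 proof (intro L2D_cong)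
  fix i j z assume "i \<in> {1..N}" "j \<in> {1..N}" "z \<in> cl i j"
  then have "z \<in> RX \<times> RY" using gx.cell_subset gy.cell_subset by blast
  then show "((b z - ax z) * u z * v i j z - (\<epsilon> * uxx z) * v i j z + (a z * ux z + ax z * u z) * v i j z) - (\<epsilon> * uyy z) * v i j z = f z * v i j z"
   using arg_cong[OF pde[of z], of "%t. t * v i j z"] by (simp add: algebra_simps)
 qed
 moreover have "XD1 N X Y (%i j. u) s = - L2D N X Y (%i j z. ux z * s i j z)"
  by (rule XD1_smooth[OF u_dx(1) bc_x s])
 moreover have "XL4 N X Y a (%i j. u) v = L2D N X Y (%i j z. (a z * ux z + ax z * u z) * v i j z)"
  by (rule XL4_smooth[OF a u_dx(1) u0 v])
 ultimately show ?thesis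
  unfolding bform_def e XD2_smooth[OF p v] 1 2 3 4 by simp
qed

lemma orthogonality:
 assumes "disc N k v" "disc N k s" "disc N k r"
 shows "bform N X Y \<epsilon> a ax b l1 l2 \<xi>u \<xi>p \<xi>q v s r = - bform N X Y \<epsilon> a ax b l1 l2 \<eta>u \<eta>p \<eta>q v s r"
proof -
 note c = disc_pc2(1)[OF disc_\<xi>(1)] disc_pc2(1)[OF disc_\<xi>(2)] disc_pc2(1)[OF disc_\<xi>(3)]
  disc_pc2(1)[OF UPQ(1)] disc_pc2(1)[OF UPQ(2)] disc_pc2(1)[OF UPQ(3)]
 have "bform N X Y \<epsilon> a ax b l1 l2 (%i j. u) (%i j. p) (%i j. q) v s r
  = bform N X Y \<epsilon> a ax b l1 l2 (%i j z. (\<xi>u i j z + U i j z) + \<eta>u i j z) (%i j z. (\<xi>p i j z + P i j z) + \<eta>p i j z) (%i j z. (\<xi>q i j z + Q i j z) + \<eta>q i j z) v s r"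
  by (simp add: \<xi>u_def \<xi>p_def \<xi>q_def \<eta>u_def \<eta>p_def \<eta>q_def)
 also have "... = bform N X Y \<epsilon> a ax b l1 l2 \<xi>u \<xi>p \<xi>q v s r + bform N X Y \<epsilon> a ax b l1 l2 U P Q v s r + bform N X Y \<epsilon> a ax b l1 l2 \<eta>u \<eta>p \<eta>q v s r"
  by (subst bform_add, (intro conts b assms pc2_add c pc2_errors)+)
   (subst bform_add, (intro conts b assms c)+, rule refl)
 finally show ?thesis using consistency[OF assms] galerkin[OF assms] by simp
qed

lemma bform_\<eta>:
 assumes v: "disc N k v" and s: "disc N k s" and r: "disc N k r"
 shows "bform N X Y \<epsilon> a ax b l1 l2 \<eta>u \<eta>p \<eta>q v s r =
  L2D N X Y (%i j z. \<eta>p i j z * s i j z + \<eta>q i j z * r i j z) / \<epsilon>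
  + L2D N X Y (%i j z. (b z - ax z) * \<eta>u i j z * v i j z)
  - L2D N X Y (%i j z. gx i j z * s i j z) - L2D N X Y (%i j z. gy i j z * r i j z)
  - XT N X Y (%i j z. \<zeta>p i j z * v i j z) - XT N Y X (sw (%i j z. \<zeta>q i j z * v i j z))
  + XL4 N X Y a \<eta>u v"
proof -
 have 1: "XD1 N X Y \<eta>u s = - L2D N X Y (%i j z. gx i j z * s i j z)"
  unfolding \<eta>u_def Pu_def gx_def by (rule XD1_error[OF u_dx(1) bc_x s])
 have 2: "XD2 N X Y \<eta>p v = - XT N X Y (%i j z. \<zeta>p i j z * v i j z)"
  unfolding \<eta>p_def Pp_def \<zeta>p_def by (rule XD2_error[OF row_subset[OF conts(5)] v])
 have 3: "XD1 N Y X (sw \<eta>u) (sw r) = - L2D N X Y (%i j z. gy i j z * r i j z)"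
 proof -
  have "XD1 N Y X (sw \<eta>u) (sw r) = XD1 N Y X (%i j z. u (prod.swap z) - PX (radR k) Y i (PY (radR k) X j (%z. u (prod.swap z))) z) (sw r)"
   unfolding XD1_def
  proof (intro L1_cong D1_cong)
   fix j y i x assume "j \<in> {1..N}" "y \<in> {X (j - 1)..X j}" "i \<in> {1..N}" "x \<in> {Y (i - 1)..Y i}"
   then show "sw \<eta>u i j (x, y) = u (prod.swap (x, y)) - PX (radR k) Y i (PY (radR k) X j (%z. u (prod.swap z))) (x, y)"
    by (simp add: sw_def \<eta>u_def Pu_alt) (simp add: PX_def PY_def)
  qed (simp add: gy.strict less_imp_le)
  also have "... = - L2D N Y X (%i j z. (uy (prod.swap z) - PY (radR k) X j (%z. uy (prod.swap z)) z) * sw r i j z)"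
   using bc_y by (intro S.XD1_error[OF u_dy(1) _ disc_sw[OF r]]) simp
  also have "L2D N Y X (%i j z. (uy (prod.swap z) - PY (radR k) X j (%z. uy (prod.swap z)) z) * sw r i j z)
   = L2D N Y X (sw (%i j z. gy i j z * r i j z))"
   by (intro L2D_cong) (simp add: sw_def gy_def PY_swap)
  also have "... = L2D N X Y (%i j z. gy i j z * r i j z)"
   by (intro L2D_sw pc2_mult pc2_errors' disc_pc2[OF r])
  finally show ?thesis .
 qed
 have 4: "XD2 N Y X (sw \<eta>q) (sw v) = - XT N Y X (sw (%i j z. \<zeta>q i j z * v i j z))"
 proof -
  have c: "continuous_on (RY \<times> RX) (%z. q (prod.swap z))"
   using continuous_on_swap[OF conts(9)] by (simp add: split_beta prod.swap_def)
  have "XD2 N Y X (sw \<eta>q) (sw v) = XD2 N Y X (%i j z. q (prod.swap z) - PX (radL k) Y i (PY (projL2 k) X j (%z. q (prod.swap z))) z) (sw v)"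
   by (simp add: sw_def \<eta>q_def Pq_def[abs_def] PX_def PY_def split_beta prod.swap_def)
  also have "... = - XT N Y X (%i j z. (PY (projL2 k) X j (%z. q (prod.swap z)) z - PX (radL k) Y i (PY (projL2 k) X j (%z. q (prod.swap z))) z) * sw v i j z)"
   by (intro S.XD2_error[OF S.row_subset[OF c] disc_sw[OF v]])
  also have "(%i j z. (PY (projL2 k) X j (%z. q (prod.swap z)) z - PX (radL k) Y i (PY (projL2 k) X j (%z. q (prod.swap z))) z) * sw v i j z)
   = sw (%i j z. \<zeta>q i j z * v i j z)"
   by (simp add: sw_def \<zeta>q_def Pq_def PX_def PY_def fun_eq_iff)
  finally show ?thesis .
 qed
 \<comment> \<open>The right Radau projections reproduce the zero trace at x = 1, and likewise at y
   = 1 in the next step; so the penalty terms of the projection error vanish.\<close>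
 have 5: "XT N X Y (%i j z. \<eta>u i j z * v i j z) = 0"
 proof (rule XT_zero)
  fix j y assume j: "j \<in> {1..N}" and y: "y \<in> {Y (j - 1)..Y j}"
  have "PY (radR k) Y j u (X N, y) = 0"
   using S.PX_zero[OF proj(1) j, of "%z. u (prod.swap z)" "X N" y] bc_x gy.cell_subset[OF j] by (auto simp: PY_swap)
  moreover have "u (X N, y) = 0" using bc_x gy.cell_subset[OF j] y by blast
  moreover have "N \<in> {1..N}" using gx.N1 by simp
  ultimately show "\<eta>u N j (X N, y) * v N j (X N, y) = 0" using PX_trace[of N] by (simp add: \<eta>u_def Pu_def)
 qed
 have 6: "XT N Y X (sw (%i j z. \<eta>u i j z * v i j z)) = 0"
 proof (rule S.XT_zero)
  fix i x assume i: "i \<in> {1..N}" and x: "x \<in> {X (i - 1)..X i}"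
  have N: "N \<in> {1..N}" using gx.N1 by simp
  have "PX (radR k) X i u (x, Y N) = 0"
   using bc_y gx.cell_subset[OF i] by (intro PX_zero[OF proj(1) i]) auto
  moreover have "u (x, Y N) = 0" using bc_y gx.cell_subset[OF i] x by blast
  moreover have "PY (radR k) Y N (PX (radR k) X i u) (x, Y N) = PX (radR k) X i u (x, Y N)"
   using S.PX_trace[OF N, of "%z. PX (radR k) X i u (prod.swap z)" x] by (simp add: PY_swap)
  ultimately show "sw (%i j z. \<eta>u i j z * v i j z) N i (Y N, x) = 0" by (simp add: sw_def \<eta>u_def Pu_alt[OF i N])
 qed
 show ?thesis unfolding bform_def 1 2 3 4 5 6 by simp
qed

text \<open>Testing with (0, s, 0) isolates the equation that defines the discrete flux in
  x.\<close>

lemma bform_test: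
 "disc N k s ==> bform N X Y \<epsilon> a ax b l1 l2 V S' R (%_ _ _. 0) s (%_ _ _. 0) = L2D N X Y (%i j z. S' i j z * s i j z) / \<epsilon> + XD1 N X Y V s"
 by (simp add: bform_def XD2_def XL4_def XD1_def D2_def D1_def L4_def XT_def dX_def sw_def L1_0 L2D_def)

text \<open>The flux \<open>agb\<close> is replaced by \<open>\<phi>\<close> up to the trace of
  \<open>\<theta>\<close>. Adjointness turns \<open>XD2\<close> of \<open>\<phi>\<close> and
  \<open>\<xi>u\<close> into \<open>XD1\<close> of \<open>\<xi>u\<close> and \<open>\<phi>\<close>,
  and the error equation tested with (0, \<phi>, 0) trades this for products of
  \<open>\<phi>\<close> with \<open>\<xi>p\<close>, \<open>\<eta>p\<close> and \<open>gx\<close>.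
  Derivatives and jumps of \<open>\<xi>u\<close> survive only next to
  \<open>\<zeta>u\<close>.\<close>

theorem error_identity:
 "energy N X Y \<epsilon> a ax b l1 l2 \<xi>u \<xi>p \<xi>q = - (
  L2D N X Y (%i j z. \<eta>p i j z * \<xi>p i j z + \<eta>q i j z * \<xi>q i j z) / \<epsilon>
  + L2D N X Y (%i j z. (b z - ax z) * \<eta>u i j z * \<xi>u i j z)
  - L2D N X Y (%i j z. gx i j z * \<xi>p i j z) - L2D N X Y (%i j z. gy i j z * \<xi>q i j z)
  - XT N X Y (%i j z. \<zeta>p i j z * \<xi>u i j z) - XT N Y X (sw (%i j z. \<zeta>q i j z * \<xi>u i j z))
  + XL4 N X Y a \<zeta>u \<xi>u + L2D N X Y (%i j z. (a z * gax i j z + ax z * ga i j z) * \<xi>u i j z)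
  + XT N X Y (%i j z. \<theta> i j z * \<xi>u i j z)
  - L2D N X Y (%i j z. \<xi>p i j z * \<phi> i j z) / \<epsilon> - L2D N X Y (%i j z. \<eta>p i j z * \<phi> i j z) / \<epsilon>
  + L2D N X Y (%i j z. gx i j z * \<phi> i j z))"
proof -
 have u0: "u (X 0, y) = 0" if "y \<in> RY" for y using bc_x[OF that] by simp
 have "XD2 N X Y (%i j z. agb j z - \<phi> i j z) \<xi>u = - XT N X Y (%i j z. \<theta> i j z * \<xi>u i j z)"
  unfolding \<phi>_def \<theta>_def by (rule XD2_error[OF agb_row disc_\<xi>(1)])
 moreover have "XD2 N X Y (%i j z. (agb j z - \<phi> i j z) + \<phi> i j z) \<xi>u = XD2 N X Y (%i j z. agb j z - \<phi> i j z) \<xi>u + XD2 N X Y \<phi> \<xi>u"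
  by (intro XD2_add pc2_diff pc2_rows agb_row disc_pc2[OF discs(4)] disc_\<xi>)
 moreover have "XD1 N X Y \<xi>u \<phi> = - XD2 N X Y \<phi> \<xi>u" by (rule XD1_XD2[OF disc_\<xi>(1) discs(4)])
 ultimately have A: "XD2 N X Y (%i j. agb j) \<xi>u = - XD1 N X Y \<xi>u \<phi> - XT N X Y (%i j z. \<theta> i j z * \<xi>u i j z)" by simp
 have "XL4 N X Y a \<eta>u \<xi>u = XL4 N X Y a \<zeta>u \<xi>u + L2D N X Y (%i j z. (a z * gax i j z + ax z * ga i j z) * \<xi>u i j z) - XD2 N X Y (%i j. agb j) \<xi>u"
  unfolding \<eta>u_def Pu_def \<zeta>u_def gax_def ga_def agb_def by (rule XL4_error[OF a ua ub u_split u0 disc_\<xi>(1)])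
 moreover have "L2D N X Y (%i j z. \<xi>p i j z * \<phi> i j z) / \<epsilon> + XD1 N X Y \<xi>u \<phi>
  = - (L2D N X Y (%i j z. \<eta>p i j z * \<phi> i j z) / \<epsilon> - L2D N X Y (%i j z. gx i j z * \<phi> i j z))"
  using orthogonality[OF disc_0 discs(4) disc_0] bform_\<eta>[OF disc_0 discs(4) disc_0]
  unfolding bform_test[OF discs(4)]
  by (simp add: XT_def sw_def L1_0 L2D_def XL4_def L4_def D1_def dX_def)
 ultimately show ?thesis
  using bform_energy[OF a b disc_\<xi>, of \<epsilon> l1 l2] orthogonality[OF disc_\<xi>] bform_\<eta>[OF disc_\<xi>] A by simp
qed

end

section \<open>Weighted Young inequalities and absorption\<close>

lemma young_weighted:
 fixes x y w :: real
 assumes "w > 0"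
 shows "\<bar>x * y\<bar> <= w / 22 * x\<^sup>2 + 11 / (2 * w) * y\<^sup>2"
proof -
 have "0 <= (w / 11 * \<bar>x\<bar> - \<bar>y\<bar>)\<^sup>2" by simp
 then have "2 * (w / 11 * \<bar>x\<bar>) * \<bar>y\<bar> <= (w / 11)\<^sup>2 * x\<^sup>2 + y\<^sup>2"
  unfolding power2_diff power_mult_distrib power2_abs by linarith
 then have "11 / (2 * w) * (2 * (w / 11 * \<bar>x\<bar>) * \<bar>y\<bar>) <= 11 / (2 * w) * ((w / 11)\<^sup>2 * x\<^sup>2 + y\<^sup>2)"
  using assms by (intro mult_left_mono) auto
 moreover have "11 / (2 * w) * (2 * (w / 11 * \<bar>x\<bar>) * \<bar>y\<bar>) = \<bar>x * y\<bar>" using assms by (simp add: abs_mult)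
 moreover have "11 / (2 * w) * ((w / 11)\<^sup>2 * x\<^sup>2 + y\<^sup>2) = w / 22 * x\<^sup>2 + 11 / (2 * w) * y\<^sup>2"
  using assms by (simp add: power2_eq_square field_simps)
 ultimately show ?thesis by (simp only:)
qed

text \<open>Eleven of the thirteen terms contain a discrete error and may each use
  \<open>E / 22\<close>, together half of the energy; this is the origin of 11 and 22 in the Young
  inequalities. The last two terms contain data only.\<close>

lemma absorb_terms:
 fixes E :: real
 assumes "E = - (x1 + x2 + x3 - x4 - x5 - x6 - x7 + x8 + x9 + x10 - x11 - x12 + x13)"
  and "\<bar>x1\<bar> <= E / 22 + e1" "\<bar>x2\<bar> <= E / 22 + e2" "\<bar>x3\<bar> <= E / 22 + e3" "\<bar>x4\<bar> <= E / 22 + e4"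
  "\<bar>x5\<bar> <= E / 22 + e5" "\<bar>x6\<bar> <= E / 22 + e6" "\<bar>x7\<bar> <= E / 22 + e7" "\<bar>x8\<bar> <= E / 22 + e8"
  "\<bar>x9\<bar> <= E / 22 + e9" "\<bar>x10\<bar> <= E / 22 + e10" "\<bar>x11\<bar> <= E / 22 + e11" "\<bar>x12\<bar> <= e12" "\<bar>x13\<bar> <= e13"
 shows "E <= 2 * (e1 + e2 + e3 + e4 + e5 + e6 + e7 + e8 + e9 + e10 + e11 + e12 + e13)"
proof -
 have "E <= (E / 22 + e1) + (E / 22 + e2) + (E / 22 + e3) + (E / 22 + e4) + (E / 22 + e5) + (E / 22 + e6)
  + (E / 22 + e7) + (E / 22 + e8) + (E / 22 + e9) + (E / 22 + e10) + (E / 22 + e11) + e12 + e13"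
  using assms(1) assms(2,3,4,9,10,11,14)[THEN abs_le_D2] assms(5,6,7,8,12,13)[THEN abs_le_D1] by linarith
 then show ?thesis by (simp add: field_simps)
qed

lemma L1_abs: "pc N X f ==> \<bar>L1 N X f\<bar> <= L1 N X (%i x. \<bar>f i x\<bar>)"
 using L1_mono[of N X f "%i x. \<bar>f i x\<bar>"] L1_mono[of N X "%i x. - f i x" "%i x. \<bar>f i x\<bar>"]
 by (auto simp: pc_abs pc_minus L1_minus abs_le_iff)

text \<open>\<open>w\<close> is the weight with which the square of \<open>F\<close> is controlled
  by the energy. \<open>G\<close> is measured against the same weight, so that \<open>w\<close>
  drops out of the result.\<close>

lemma L1_young:
 assumes "pc N X F" "pc N X G" and w: "w > 0"
  and F: "w * L1 N X (%i x. (F i x)\<^sup>2) <= E" and G: "L1 N X (%i x. (G i x)\<^sup>2) <= w * B"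
 shows "\<bar>L1 N X (%i x. F i x * G i x)\<bar> <= E / 22 + 11 / 2 * B"
proof -
 have "\<bar>L1 N X (%i x. F i x * G i x)\<bar> <= L1 N X (%i x. \<bar>F i x * G i x\<bar>)"
  by (intro L1_abs pc_mult assms)
 also have "... <= L1 N X (%i x. w / 22 * (F i x)\<^sup>2 + 11 / (2 * w) * (G i x)\<^sup>2)"
  by (intro L1_mono young_weighted w pc_abs pc_mult pc_add pc_cmult pc_power assms)
 also have "... = w / 22 * L1 N X (%i x. (F i x)\<^sup>2) + 11 / (2 * w) * L1 N X (%i x. (G i x)\<^sup>2)"
  unfolding L1_cmult[symmetric] by (intro L1_add pc_cmult pc_power assms)
 also have "... <= E / 22 + 11 / (2 * w) * (w * B)"
  using F G w by (intro add_mono mult_left_mono) auto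
 also have "11 / (2 * w) * (w * B) = 11 / 2 * B" using w by simp
 finally show ?thesis .
qed

lemma L2D_abs: "pc2 N X Y f ==> \<bar>L2D N X Y f\<bar> <= L2D N X Y (%i j z. \<bar>f i j z\<bar>)"
 using L2D_mono[of N X Y f "%i j z. \<bar>f i j z\<bar>"] L2D_mono[of N X Y "%i j z. - f i j z" "%i j z. \<bar>f i j z\<bar>"]
 by (auto simp: pc2_abs pc2_minus L2D_minus abs_le_iff)

lemma L2D_young:
 assumes "pc2 N X Y F" "pc2 N X Y G" and w: "w > 0"
  and F: "w * L2D N X Y (%i j z. (F i j z)\<^sup>2) <= E" and G: "L2D N X Y (%i j z. (G i j z)\<^sup>2) <= w * B"
 shows "\<bar>L2D N X Y (%i j z. F i j z * G i j z)\<bar> <= E / 22 + 11 / 2 * B"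
proof -
 have "\<bar>L2D N X Y (%i j z. F i j z * G i j z)\<bar> <= L2D N X Y (%i j z. \<bar>F i j z * G i j z\<bar>)"
  by (intro L2D_abs pc2_mult assms)
 also have "... <= L2D N X Y (%i j z. w / 22 * (F i j z)\<^sup>2 + 11 / (2 * w) * (G i j z)\<^sup>2)"
  by (intro L2D_mono young_weighted w pc2_abs pc2_mult pc2_add pc2_power pc2_const assms)
 also have "... = w / 22 * L2D N X Y (%i j z. (F i j z)\<^sup>2) + 11 / (2 * w) * L2D N X Y (%i j z. (G i j z)\<^sup>2)"
  unfolding L2D_cmult[symmetric] by (intro L2D_add pc2_mult pc2_const pc2_power assms)
 also have "... <= E / 22 + 11 / (2 * w) * (w * B)"
  using F G w by (intro add_mono mult_left_mono) auto
 also have "11 / (2 * w) * (w * B) = 11 / 2 * B" using w by simp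
 finally show ?thesis .
qed

lemma (in grid2) L2D_const: "L2D N X Y (%_ _ _. c) = c * (X N - X 0) * (Y N - Y 0)"
 by (simp add: L2D_def gx.L1_const gy.L1_const)

lemma (in grid2) trace_le:
 assumes "pc2 N X Y F" "!!j y. j \<in> {1..N} ==> y \<in> {Y (j - 1)..Y j} ==> F N j (X N, y) <= c"
 shows "XT N X Y F <= c * (Y N - Y 0)"
proof -
 have "XT N X Y F <= L1 N Y (%_ _. c)" unfolding XT_def by (intro L1_mono trace_pc_N assms pc_const)
 then show ?thesis by (simp add: gy.L1_const)
qed

lemma abs_le_square_bound: "\<bar>x\<bar> <= y ==> x\<^sup>2 <= (y::real)\<^sup>2"
 by (metis abs_ge_zero power2_abs power_mono)

context ldg_problem
begin

section \<open>The energy estimate under pointwise bounds on the projection errors\<close>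

context
 fixes \<alpha> \<beta> C1 Ma H c \<kappa> e0 :: real and \<omega> :: "nat => nat => fn2"
 assumes unit: "X 0 = 0" "X N = 1" "Y 0 = 0" "Y N = 1"
  and \<alpha>: "\<alpha> > 0" "!!z. z \<in> RX \<times> RY ==> \<alpha> <= a z"
  and \<beta>: "\<beta> > 0" "!!z. z \<in> RX \<times> RY ==> \<beta> <= b z - ax z / 2"
  and l1: "l1 \<ge> 0" and l2: "C1 > 0" "C1 * \<epsilon> <= l2"
  and Ma: "!!z. z \<in> RX \<times> RY ==> \<bar>a z\<bar> <= Ma" "!!z. z \<in> RX \<times> RY ==> \<bar>ax z\<bar> <= Ma" "!!z. z \<in> RX \<times> RY ==> \<bar>b z\<bar> <= Ma"
  and H: "H \<ge> 0" and c: "c \<ge> 0" and \<epsilon>1: "\<epsilon> <= e0"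
  and \<omega>: "pc2 N X Y \<omega>" "L2D N X Y (%i j z. (\<omega> i j z)\<^sup>2) <= \<kappa> * \<epsilon>" 
begin

lemma cell_sub: "i \<in> {1..N} ==> j \<in> {1..N} ==> z \<in> cl i j ==> z \<in> RX \<times> RY"
 using gx.cell_subset gy.cell_subset by blast

text \<open>The trace at x = 1 is controlled by the jump term there, with half of \<open>a\<close>
  as weight. At y = 1 there is no convection, and the control comes from \<open>l2\<close> with the
  weaker weight \<open>C1 * \<epsilon>\<close>.\<close>

lemma energy_parts:
 assumes v: "disc N k v" "disc N k s" "disc N k r"
 defines "E \<equiv> energy N X Y \<epsilon> a ax b l1 l2 v s r"
 shows "1 / \<epsilon> * L2D N X Y (%i j z. (s i j z)\<^sup>2) <= E" "1 / \<epsilon> * L2D N X Y (%i j z. (r i j z)\<^sup>2) <= E"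
  "\<beta> * L2D N X Y (%i j z. (v i j z)\<^sup>2) <= E" "\<alpha> / 2 * XT N X Y (%i j z. (v i j z)\<^sup>2) <= E"
  "C1 * \<epsilon> * XT N Y X (sw (%i j z. (v i j z)\<^sup>2)) <= E"
  "0 <= E"
proof -
 note c = disc_pc2(1)[OF v(1), of X Y] disc_pc2(1)[OF v(2), of X Y] disc_pc2(1)[OF v(3), of X Y]
 have 1: "0 <= L2D N X Y (%i j z. (s i j z)\<^sup>2)" "0 <= L2D N X Y (%i j z. (r i j z)\<^sup>2)"
  by (intro L2D_nonneg pc2_power c; simp)+
 have 2: "\<beta> * L2D N X Y (%i j z. (v i j z)\<^sup>2) <= L2D N X Y (%i j z. (b z - ax z / 2) * (v i j z)\<^sup>2)"
  unfolding L2D_cmult[symmetric]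
  by (intro L2D_mono mult_right_mono \<beta>(2) cell_sub pc2_mult pc2_const pc2_power pc2_diff pc2_divide pc2_global c b conts; simp)
 have 3: "0 <= \<beta> * L2D N X Y (%i j z. (v i j z)\<^sup>2)"
  using \<beta>(1) by (intro mult_nonneg_nonneg L2D_nonneg pc2_power c) auto
 have 4: "0 <= XT N X Y (%i j z. (v i j z)\<^sup>2)" unfolding XT_def
  by (intro L1_nonneg trace_pc_N[of "%i j z. (v i j z)\<^sup>2"] pc2_power c) auto
 have 5: "0 <= XT N Y X (sw (%i j z. (v i j z)\<^sup>2))" unfolding XT_def
  by (intro L1_nonneg S.trace_pc_N pc2_sw pc2_power c) (auto simp: sw_def)
 have node: "(X i, y) \<in> RX \<times> RY" if "i <= N" "j \<in> {1..N}" "y \<in> {Y (j - 1)..Y j}" for i j y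
  using that gx.X_mono[of 0 i] gx.X_mono[of i N] subsetD[OF gy.cell_subset[OF that(2)] that(3)] by auto
 have 6: "\<alpha> * XT N X Y (%i j z. (v i j z)\<^sup>2) <= XJ N X Y a v"
  unfolding XJ_def XT_def L1_cmult[symmetric]
 proof (intro L1_mono pc_cmult trace_pc_N[of "%i j z. (v i j z)\<^sup>2"] pc2_power c)
  show "pc N Y (%j y. a (X 0, y) * (v 1 j (X 0, y))\<^sup>2
   + (\<Sum>i=1..N-1. a (X i, y) * (v (Suc i) j (X i, y) - v i j (X i, y))\<^sup>2) + a (X N, y) * (v N j (X N, y))\<^sup>2)"
   using gx.N1 by (intro pc_add pc_mult pc_sum pc_power pc_diff trace_const[OF conts(1)] trace_pc_N[OF c(1)] trace_pc_1[OF c(1)]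
    trace_pc[OF c(1)] trace_pc_Suc[OF c(1)]) auto
  fix j y assume j: "j \<in> {1..N}" "y \<in> {Y (j - 1)..Y j}"
  have a0: "0 <= a (X i, y)" if "i <= N" for i using \<alpha>(2)[OF node[OF that j]] \<alpha>(1) by linarith
  have "\<alpha> * (v N j (X N, y))\<^sup>2 <= a (X N, y) * (v N j (X N, y))\<^sup>2"
   by (intro mult_right_mono \<alpha>(2) node[OF _ j]) auto
  moreover have "0 <= (\<Sum>i=1..N-1. a (X i, y) * (v (Suc i) j (X i, y) - v i j (X i, y))\<^sup>2)"
   using a0 by (intro sum_nonneg) auto
  ultimately show "\<alpha> * (v N j (X N, y))\<^sup>2 <= a (X 0, y) * (v 1 j (X 0, y))\<^sup>2
   + (\<Sum>i=1..N-1. a (X i, y) * (v (Suc i) j (X i, y) - v i j (X i, y))\<^sup>2) + a (X N, y) * (v N j (X N, y))\<^sup>2"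
   using a0[of 0] by (smt (verit) mult_nonneg_nonneg zero_le_power2 le0)
 qed
 have 7: "C1 * \<epsilon> * XT N Y X (sw (%i j z. (v i j z)\<^sup>2)) <= l2 * XT N Y X (sw (%i j z. (v i j z)\<^sup>2))"
  using l2 5 by (intro mult_right_mono) auto
 have 8: "0 <= C1 * \<epsilon> * XT N Y X (sw (%i j z. (v i j z)\<^sup>2))" "0 <= \<alpha> * XT N X Y (%i j z. (v i j z)\<^sup>2)"
  "0 <= l1 * XT N X Y (%i j z. (v i j z)\<^sup>2)"
  using l2 \<epsilon> 5 4 \<alpha> l1 by auto
 have E: "E = 1 / \<epsilon> * L2D N X Y (%i j z. (s i j z)\<^sup>2) + 1 / \<epsilon> * L2D N X Y (%i j z. (r i j z)\<^sup>2)
  + L2D N X Y (%i j z. (b z - ax z / 2) * (v i j z)\<^sup>2)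
  + XJ N X Y a v / 2 + l1 * XT N X Y (%i j z. (v i j z)\<^sup>2) + l2 * XT N Y X (sw (%i j z. (v i j z)\<^sup>2))"
  by (simp add: E_def energy_def add_divide_distrib)
 have 9: "0 <= 1 / \<epsilon> * L2D N X Y (%i j z. (s i j z)\<^sup>2)" "0 <= 1 / \<epsilon> * L2D N X Y (%i j z. (r i j z)\<^sup>2)"
  using 1 \<epsilon> by auto
 show "1 / \<epsilon> * L2D N X Y (%i j z. (s i j z)\<^sup>2) <= E" "1 / \<epsilon> * L2D N X Y (%i j z. (r i j z)\<^sup>2) <= E"
  "\<beta> * L2D N X Y (%i j z. (v i j z)\<^sup>2) <= E" "\<alpha> / 2 * XT N X Y (%i j z. (v i j z)\<^sup>2) <= E"
  "C1 * \<epsilon> * XT N Y X (sw (%i j z. (v i j z)\<^sup>2)) <= E" "0 <= E"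
  unfolding E using 2 3 6 7 8 9 by linarith+
qed

text \<open>On each horizontal line the one-dimensional estimate applies, with the bound on
  \<open>ax\<close> as Lipschitz constant by the mean value inequality. What remains is an $L^1$
  norm of \<open>v\<close>, without derivatives or jumps.\<close>

lemma XL4_\<zeta>_bound:
 assumes \<zeta>: "!!i j z. i \<in> {1..N} ==> j \<in> {1..N} ==> z \<in> cl i j ==> \<bar>\<zeta>u i j z\<bar> <= c * H"
  and v: "disc N k v"
 shows "\<bar>XL4 N X Y a \<zeta>u v\<bar> <= Ma * (c * H) * invC k * L2D N X Y (%i j z. \<bar>v i j z\<bar>)"
proof -
 have R: "(X 0, Y 0) \<in> RX \<times> RY" using unit by simp
 have Ma0: "Ma \<ge> 0" using Ma(1)[OF R] by linarith
 note vc = disc_pc2(1)[OF v, of X Y]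
 have p: "pc N Y (%j y. L4 N X (%x. a (x, y)) (%i x. \<zeta>u i j (x, y)) (%i x. v i j (x, y)) (%i x. dX (v i j) (x, y)))"
  by (intro pc_L4 conts pc2_errors vc disc_pc2[OF v])
 have "\<bar>XL4 N X Y a \<zeta>u v\<bar> <= L1 N Y (%j y. \<bar>L4 N X (%x. a (x, y)) (%i x. \<zeta>u i j (x, y)) (%i x. v i j (x, y)) (%i x. dX (v i j) (x, y))\<bar>)"
  unfolding XL4_def by (rule L1_abs[OF p])
 also have "... <= L1 N Y (%j y. Ma * (c * H) * invC k * L1 N X (%i x. \<bar>v i j (x, y)\<bar>))"
 proof (intro L1_mono pc_abs[OF p] pc_cmult pc_L1_y[OF pc2_abs[OF vc]])
  fix j y assume j: "j \<in> {1..N}" and y: "y \<in> {Y (j - 1)..Y j}"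
  have yR: "y \<in> RY" using gy.cell_subset[OF j] y by blast
  have z: "continuous_on RX (%x. PY (radR k) Y j u (x, y))"
   by (intro continuous_on_line_x[OF PY_row[OF proj(1) j row_subset[OF conts(3) j]] y])
  have "\<bar>L4 N X (%x. a (x, y)) (%i x. PY (radR k) Y j u (x, y) - pj (radR k) (X (i - 1)) (X i) (%x. PY (radR k) Y j u (x, y)) x) (%i x. v i j (x, y)) (%i x. dX (v i j) (x, y))\<bar>
   <= Ma * (c * H) * invC k * L1 N X (%i x. \<bar>v i j (x, y)\<bar>)"
  proof (rule gx.L4_radau_bound[OF k continuous_on_line_x[OF conts(1) yR] z disc_pcw_poly_x[OF v j]])
   show "\<bar>a (x, y) - a (x', y)\<bar> <= Ma * \<bar>x - x'\<bar>" if "x \<in> RX" "x' \<in> RX" for x x'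
    using field_differentiable_bound[of RX "%x. a (x, y)" "%x. ax (x, y)" Ma x x'] a yR that Ma(2)
    by (simp add: has_dx_def)
   show "0 <= Ma" "0 <= c * H" using Ma0 c H by auto
   show "\<bar>PY (radR k) Y j u (x, y) - pj (radR k) (X (i - 1)) (X i) (%x. PY (radR k) Y j u (x, y)) x\<bar> <= c * H"
    if "i \<in> {1..N}" "x \<in> {X (i - 1)..X i}" for i x
    using \<zeta>[OF that(1) j, of "(x, y)"] that y unfolding \<zeta>u_def Pu_def PX_def split_conv by blast
  qed
  then show "\<bar>L4 N X (%x. a (x, y)) (%i x. \<zeta>u i j (x, y)) (%i x. v i j (x, y)) (%i x. dX (v i j) (x, y))\<bar>
   <= Ma * (c * H) * invC k * L1 N X (%i x. \<bar>v i j (x, y)\<bar>)"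
   unfolding \<zeta>u_def Pu_def PX_def split_conv .
 qed
 also have "... = Ma * (c * H) * invC k * L2D N X Y (%i j z. \<bar>v i j z\<bar>)" by (simp add: L1_cmult L2D_def)
 finally show ?thesis .
qed

definition "K\<omega> = 2 * (\<kappa> + e0)"

text \<open>\<open>c * H * (\<omega> + \<epsilon>)\<close> is the form common to all errors that
  meet the weight \<open>1 / \<epsilon>\<close>. Its square integrates to order
  \<open>\<epsilon>\<close>: for \<open>\<omega>\<close> by assumption, for the constant part
  because \<open>\<epsilon>\<close> squared is at most \<open>e0 * \<epsilon>\<close>. The 2 in
  \<open>K\<omega>\<close> comes from squaring the sum.\<close>

lemma weight_bound:
 assumes G: "pc2 N X Y G"
  "!!i j z. i \<in> {1..N} ==> j \<in> {1..N} ==> z \<in> cl i j ==> \<bar>G i j z\<bar> <= c * H * (\<omega> i j z + \<epsilon>)"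
 shows "L2D N X Y (%i j z. (G i j z)\<^sup>2) <= \<epsilon> * (c\<^sup>2 * H\<^sup>2 * K\<omega>)"
proof -
 have "L2D N X Y (%i j z. (G i j z)\<^sup>2) <= L2D N X Y (%i j z. 2 * (c * H)\<^sup>2 * ((\<omega> i j z)\<^sup>2 + \<epsilon>\<^sup>2))"
 proof (intro L2D_mono pc2_power G(1) pc2_mult pc2_const pc2_add \<omega>(1))
  fix i j z assume "i \<in> {1..N}" "j \<in> {1..N}" "z \<in> cl i j"
  from G(2)[OF this] have "(G i j z)\<^sup>2 <= (c * H * (\<omega> i j z + \<epsilon>))\<^sup>2" by (rule abs_le_square_bound)
  also have "... = (c * H)\<^sup>2 * (\<omega> i j z + \<epsilon>)\<^sup>2" by (simp add: power_mult_distrib)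
  also have "... <= (c * H)\<^sup>2 * (2 * ((\<omega> i j z)\<^sup>2 + \<epsilon>\<^sup>2))"
   using zero_le_power2[of "\<omega> i j z - \<epsilon>"] by (intro mult_left_mono) (auto simp: power2_sum power2_diff)
  finally show "(G i j z)\<^sup>2 <= 2 * (c * H)\<^sup>2 * ((\<omega> i j z)\<^sup>2 + \<epsilon>\<^sup>2)" by linarith
 qed
 also have "... = 2 * (c * H)\<^sup>2 * (L2D N X Y (%i j z. (\<omega> i j z)\<^sup>2) + \<epsilon>\<^sup>2)"
  by (simp add: L2D_cmult L2D_add pc2_power \<omega>(1) pc2_const L2D_const unit)
 also have "... <= 2 * (c * H)\<^sup>2 * (\<kappa> * \<epsilon> + e0 * \<epsilon>)"
  using \<omega>(2) \<epsilon> \<epsilon>1 by (intro mult_left_mono add_mono) (auto simp: power2_eq_square mult_right_mono)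
 finally show ?thesis by (simp add: K\<omega>_def power_mult_distrib algebra_simps)
qed

lemma const_bound:
 assumes G: "pc2 N X Y G" 
  "!!i j z. i \<in> {1..N} ==> j \<in> {1..N} ==> z \<in> cl i j ==> \<bar>G i j z\<bar> <= S"
 shows "L2D N X Y (%i j z. (G i j z)\<^sup>2) <= S\<^sup>2"
proof -
 have "L2D N X Y (%i j z. (G i j z)\<^sup>2) <= L2D N X Y (%i j z. S\<^sup>2)"
  by (intro L2D_mono pc2_power G(1) pc2_const abs_le_square_bound G(2))
 then show ?thesis by (simp add: L2D_const unit)
qed

text \<open>Bookkeeping of the thirteen terms: the outer 2 stems from absorbing half of the energy,
  each of the eleven terms treated by Young carries 11 / 2, and the final
  \<open>2 * K\<omega>\<close> belongs to the two terms that contain data only.\<close>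

definition "C\<xi> = 2 * (11 / 2 * (3 * K\<omega> + 2 + (8 * Ma\<^sup>2 + Ma\<^sup>2 * (invC k)\<^sup>2) / \<beta> + 4 / \<alpha> + 1 / C1) + 2 * K\<omega>)"

text \<open>Each hypothesis matches the weight of its partner in the energy:
  \<open>\<omega> + \<epsilon>\<close> or \<open>sqrt \<epsilon>\<close> where the partner carries
  \<open>1 / \<epsilon>\<close> (for \<open>gx\<close> and \<open>gy\<close> after multiplication by
  \<open>\<epsilon>\<close>), plain \<open>c * H\<close> for terms paired with \<open>\<xi>u\<close>
  and its trace at x = 1, and \<open>c * H * sqrt \<epsilon>\<close> at y = 1, where the control has
  weight \<open>C1 * \<epsilon>\<close>.\<close>

theorem energy_estimate:
 assumes \<eta>p: "!!i j z. i \<in> {1..N} ==> j \<in> {1..N} ==> z \<in> cl i j ==> \<bar>\<eta>p i j z\<bar> <= c * H * (\<omega> i j z + \<epsilon>)"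
  and \<eta>q: "!!i j z. i \<in> {1..N} ==> j \<in> {1..N} ==> z \<in> cl i j ==> \<bar>\<eta>q i j z\<bar> <= c * H * sqrt \<epsilon>"
  and \<eta>u: "!!i j z. i \<in> {1..N} ==> j \<in> {1..N} ==> z \<in> cl i j ==> \<bar>\<eta>u i j z\<bar> <= c * H"
  and gxb: "!!i j z. i \<in> {1..N} ==> j \<in> {1..N} ==> z \<in> cl i j ==> \<epsilon> * \<bar>gx i j z\<bar> <= c * H * (\<omega> i j z + \<epsilon>)"
  and gyb: "!!i j z. i \<in> {1..N} ==> j \<in> {1..N} ==> z \<in> cl i j ==> sqrt \<epsilon> * \<bar>gy i j z\<bar> <= c * H"
  and \<zeta>p: "!!j y. j \<in> {1..N} ==> y \<in> {Y (j - 1)..Y j} ==> \<bar>\<zeta>p N j (X N, y)\<bar> <= c * H"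
  and \<zeta>q: "!!i x. i \<in> {1..N} ==> x \<in> {X (i - 1)..X i} ==> \<bar>\<zeta>q i N (x, Y N)\<bar> <= c * H * sqrt \<epsilon>"
  and \<zeta>u: "!!i j z. i \<in> {1..N} ==> j \<in> {1..N} ==> z \<in> cl i j ==> \<bar>\<zeta>u i j z\<bar> <= c * H"
  and gab: "!!i j z. i \<in> {1..N} ==> j \<in> {1..N} ==> z \<in> cl i j ==> \<bar>ga i j z\<bar> <= c * H & \<bar>gax i j z\<bar> <= c * H"
  and \<phi>b: "!!i j z. i \<in> {1..N} ==> j \<in> {1..N} ==> z \<in> cl i j ==> \<bar>\<phi> i j z\<bar> <= c * H * (\<omega> i j z + \<epsilon>)"
  and \<theta>b: "!!j y. j \<in> {1..N} ==> y \<in> {Y (j - 1)..Y j} ==> \<bar>\<theta> N j (X N, y)\<bar> <= c * H"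
 shows "energy N X Y \<epsilon> a ax b l1 l2 \<xi>u \<xi>p \<xi>q <= C\<xi> * c\<^sup>2 * H\<^sup>2"
proof -
 define E where "E = energy N X Y \<epsilon> a ax b l1 l2 \<xi>u \<xi>p \<xi>q"
 note e = energy_parts[OF disc_\<xi>, folded E_def]
 note cu = disc_pc2(1)[OF disc_\<xi>(1), of X Y] and cp = disc_pc2(1)[OF disc_\<xi>(2), of X Y]
  and cq = disc_pc2(1)[OF disc_\<xi>(3), of X Y] and c\<phi> = disc_pc2(1)[OF discs(4), of X Y]
 have R: "(X 0, Y 0) \<in> RX \<times> RY" using unit by simp
 have Ma0: "Ma \<ge> 0" using Ma(1)[OF R] by linarith
 let ?B = "c\<^sup>2 * H\<^sup>2"
 have \<epsilon>i: "1 / \<epsilon> > 0" using \<epsilon> by simp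
 have cancel: "1 / \<epsilon>\<^sup>2 * (\<epsilon> * B) = 1 / \<epsilon> * B" for B using \<epsilon> by (simp add: power2_eq_square)
 have scale: "L2D N X Y (%i j z. (G i j z / \<epsilon>)\<^sup>2) <= 1 / \<epsilon> * (?B * K\<omega>)"
  if "L2D N X Y (%i j z. (G i j z)\<^sup>2) <= \<epsilon> * (?B * K\<omega>)" for G
 proof -
  have "L2D N X Y (%i j z. (G i j z / \<epsilon>)\<^sup>2) = 1 / \<epsilon>\<^sup>2 * L2D N X Y (%i j z. (G i j z)\<^sup>2)"
   unfolding L2D_cmult[symmetric] by (simp add: power_divide)
  also have "... <= 1 / \<epsilon>\<^sup>2 * (\<epsilon> * (?B * K\<omega>))" using that by (intro mult_left_mono) auto
  also have "... = 1 / \<epsilon> * (?B * K\<omega>)" using \<epsilon> by (simp add: power2_eq_square)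
  finally show ?thesis .
 qed
 note w\<eta>p = weight_bound[OF pc2_errors(2) \<eta>p] and w\<phi> = weight_bound[OF c\<phi> \<phi>b]
 have wgx: "L2D N X Y (%i j z. (\<epsilon> * gx i j z)\<^sup>2) <= \<epsilon> * (?B * K\<omega>)"
  using gxb \<epsilon> by (intro weight_bound pc2_mult pc2_const pc2_errors) (auto simp: abs_mult)
 have gx\<epsilon>: "gx = (%i j z. \<epsilon> * gx i j z / \<epsilon>)" using \<epsilon> by simp
 have pull: "L2D N X Y (%i j z. F i j z * (G i j z / \<epsilon>)) = L2D N X Y (%i j z. F i j z * G i j z) / \<epsilon>" for F G
  using L2D_cmult[of N X Y "1 / \<epsilon>" "%i j z. F i j z * G i j z"] by simp
 have T1: "\<bar>L2D N X Y (%i j z. \<eta>p i j z * \<xi>p i j z)\<bar> / \<epsilon> <= E / 22 + 11 / 2 * (?B * K\<omega>)"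
  using L2D_young[OF cp pc2_divide[OF pc2_errors(2)] \<epsilon>i e(1) scale[OF w\<eta>p]] \<epsilon>
  unfolding pull by (simp add: mult.commute[of "\<xi>p _ _ _"])
 have T1': "\<bar>L2D N X Y (%i j z. \<eta>q i j z * \<xi>q i j z)\<bar> / \<epsilon> <= E / 22 + 11 / 2 * ?B"
 proof -
  have "L2D N X Y (%i j z. (\<eta>q i j z / \<epsilon>)\<^sup>2) = 1 / \<epsilon>\<^sup>2 * L2D N X Y (%i j z. (\<eta>q i j z)\<^sup>2)"
   unfolding L2D_cmult[symmetric] by (simp add: power_divide)
  also have "... <= 1 / \<epsilon>\<^sup>2 * (c * H * sqrt \<epsilon>)\<^sup>2"
   using const_bound[OF pc2_errors(3) \<eta>q] by (intro mult_left_mono) auto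
  also have "(c * H * sqrt \<epsilon>)\<^sup>2 = \<epsilon> * ?B" using \<epsilon> by (simp add: power_mult_distrib)
  also have "1 / \<epsilon>\<^sup>2 * (\<epsilon> * ?B) = 1 / \<epsilon> * ?B" by (rule cancel)
  finally have "L2D N X Y (%i j z. (\<eta>q i j z / \<epsilon>)\<^sup>2) <= 1 / \<epsilon> * ?B" .
  from L2D_young[OF cq pc2_divide[OF pc2_errors(3)] \<epsilon>i e(2) this] \<epsilon>
  show ?thesis unfolding pull by (simp add: mult.commute[of "\<xi>q _ _ _"])
 qed
 have T2: "\<bar>L2D N X Y (%i j z. (b z - ax z) * \<eta>u i j z * \<xi>u i j z)\<bar> <= E / 22 + 11 / 2 * (4 * Ma\<^sup>2 * ?B / \<beta>)"
 proof -
  have "L2D N X Y (%i j z. ((b z - ax z) * \<eta>u i j z)\<^sup>2) <= (2 * Ma * (c * H))\<^sup>2"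
  proof (rule const_bound)
   show "pc2 N X Y (%i j z. (b z - ax z) * \<eta>u i j z)" by (intro pc2_mult pc2_diff pc2_global b conts pc2_errors)
   fix i j z assume z: "i \<in> {1..N}" "j \<in> {1..N}" "z \<in> cl i j"
   show "\<bar>(b z - ax z) * \<eta>u i j z\<bar> <= 2 * Ma * (c * H)"
    unfolding abs_mult using Ma(2,3)[OF cell_sub[OF z]] \<eta>u[OF z] Ma0 by (intro mult_mono) auto
  qed
  also have "... = \<beta> * (4 * Ma\<^sup>2 * ?B / \<beta>)" using \<beta>(1) by (simp add: power_mult_distrib)
  finally have "L2D N X Y (%i j z. ((b z - ax z) * \<eta>u i j z)\<^sup>2) <= \<beta> * (4 * Ma\<^sup>2 * ?B / \<beta>)" .
  from L2D_young[OF cu _ \<beta>(1) e(3) this] show ?thesis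
   by (simp add: mult.commute[of "\<xi>u _ _ _"] pc2_mult pc2_diff pc2_global b conts pc2_errors)
 qed
 have T3: "\<bar>L2D N X Y (%i j z. gx i j z * \<xi>p i j z)\<bar> <= E / 22 + 11 / 2 * (?B * K\<omega>)"
  using L2D_young[OF cp _ \<epsilon>i e(1) scale[OF wgx]] \<epsilon> pc2_errors(6) by (simp add: mult.commute[of "\<xi>p _ _ _"])
 have T4: "\<bar>L2D N X Y (%i j z. gy i j z * \<xi>q i j z)\<bar> <= E / 22 + 11 / 2 * ?B"
 proof -
  have "L2D N X Y (%i j z. (gy i j z)\<^sup>2) <= (c * H / sqrt \<epsilon>)\<^sup>2"
   using gyb \<epsilon> by (intro const_bound pc2_errors') (auto simp: field_simps)
  also have "... = 1 / \<epsilon> * ?B" using \<epsilon> by (simp add: power_divide power_mult_distrib)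
  finally have "L2D N X Y (%i j z. (gy i j z)\<^sup>2) <= 1 / \<epsilon> * ?B" .
  from L2D_young[OF cq pc2_errors'(2) \<epsilon>i e(2) this] show ?thesis by (simp add: mult.commute[of "\<xi>q _ _ _"])
 qed
 have XTb: "\<bar>XT N X Y (%i j z. G i j z * \<xi>u i j z)\<bar> <= E / 22 + 11 / 2 * (2 * ?B / \<alpha>)"
  if G: "pc2 N X Y G" "!!j y. j \<in> {1..N} ==> y \<in> {Y (j - 1)..Y j} ==> \<bar>G N j (X N, y)\<bar> <= c * H" for G
 proof -
  have "XT N X Y (%i j z. (G i j z)\<^sup>2) <= (c * H)\<^sup>2 * (Y N - Y 0)"
   by (intro trace_le pc2_power G abs_le_square_bound)
  then have "L1 N Y (%j y. (G N j (X N, y))\<^sup>2) <= \<alpha> / 2 * (2 * ?B / \<alpha>)"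
   using \<alpha>(1) by (simp add: unit XT_def power_mult_distrib)
  from L1_young[OF trace_pc_N[OF cu] trace_pc_N[OF G(1)] _ e(4)[unfolded XT_def] this] \<alpha>(1)
  show ?thesis by (simp add: XT_def mult.commute[of "\<xi>u _ _ _"])
 qed
 have T5: "\<bar>XT N X Y (%i j z. \<zeta>p i j z * \<xi>u i j z)\<bar> <= E / 22 + 11 / 2 * (2 * ?B / \<alpha>)"
  by (rule XTb[OF pc2_errors(5) \<zeta>p])
 have T9: "\<bar>XT N X Y (%i j z. \<theta> i j z * \<xi>u i j z)\<bar> <= E / 22 + 11 / 2 * (2 * ?B / \<alpha>)"
  by (rule XTb[OF pc2_errors(9) \<theta>b])
 have T6: "\<bar>XT N Y X (sw (%i j z. \<zeta>q i j z * \<xi>u i j z))\<bar> <= E / 22 + 11 / 2 * (?B / C1)"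
 proof -
  have "XT N Y X (sw (%i j z. (\<zeta>q i j z)\<^sup>2)) <= (c * H * sqrt \<epsilon>)\<^sup>2 * (X N - X 0)"
   using \<zeta>q by (intro S.trace_le pc2_sw pc2_power pc2_errors') (auto simp: sw_def intro!: abs_le_square_bound)
  then have "L1 N X (%i x. (sw \<zeta>q N i (Y N, x))\<^sup>2) <= C1 * \<epsilon> * (?B / C1)"
   using l2 \<epsilon> by (simp add: unit XT_def power_mult_distrib sw_def mult_ac)
  from L1_young[OF S.trace_pc_N[OF pc2_sw[OF cu]] S.trace_pc_N[OF pc2_sw[OF pc2_errors'(1)]] _ _ this] e(5) l2 \<epsilon>
  show ?thesis by (simp add: XT_def sw_def mult.commute[of "\<xi>u _ _ _"])
 qed
 have T7: "\<bar>XL4 N X Y a \<zeta>u \<xi>u\<bar> <= E / 22 + 11 / 2 * (Ma\<^sup>2 * (invC k)\<^sup>2 * ?B / \<beta>)"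
 proof -
  let ?M = "Ma * (c * H) * invC k"
  have M0: "?M \<ge> 0" using Ma0 c H invC_nonneg by auto
  have "L2D N X Y (%i j z. ?M\<^sup>2) <= \<beta> * (?M\<^sup>2 / \<beta>)" using \<beta>(1) by (simp add: L2D_const unit)
  from L2D_young[OF pc2_abs[OF cu] pc2_const[of N X Y "%i j. ?M"] \<beta>(1) _ this] e(3)
  have "\<bar>L2D N X Y (%i j z. \<bar>\<xi>u i j z\<bar> * ?M)\<bar> <= E / 22 + 11 / 2 * (?M\<^sup>2 / \<beta>)" by simp
  moreover have "L2D N X Y (%i j z. \<bar>\<xi>u i j z\<bar> * ?M) = ?M * L2D N X Y (%i j z. \<bar>\<xi>u i j z\<bar>)"
   unfolding L2D_cmult[symmetric] by (simp add: mult_ac)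
  ultimately show ?thesis using XL4_\<zeta>_bound[OF \<zeta>u disc_\<xi>(1)] by (simp add: power_mult_distrib mult_ac)
 qed
 have T8: "\<bar>L2D N X Y (%i j z. (a z * gax i j z + ax z * ga i j z) * \<xi>u i j z)\<bar> <= E / 22 + 11 / 2 * (4 * Ma\<^sup>2 * ?B / \<beta>)"
 proof -
  have G: "pc2 N X Y (%i j z. a z * gax i j z + ax z * ga i j z)" by (intro pc2_mult pc2_add pc2_global conts pc2_errors)
  have "L2D N X Y (%i j z. (a z * gax i j z + ax z * ga i j z)\<^sup>2) <= (2 * Ma * (c * H))\<^sup>2"
  proof (rule const_bound[OF G])
   fix i j z assume z: "i \<in> {1..N}" "j \<in> {1..N}" "z \<in> cl i j"
   have "\<bar>a z * gax i j z\<bar> <= Ma * (c * H)" "\<bar>ax z * ga i j z\<bar> <= Ma * (c * H)"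
    unfolding abs_mult using Ma(1,2)[OF cell_sub[OF z]] gab[OF z] Ma0 by (intro mult_mono; simp)+
   then show "\<bar>a z * gax i j z + ax z * ga i j z\<bar> <= 2 * Ma * (c * H)" by linarith
  qed
  also have "... = \<beta> * (4 * Ma\<^sup>2 * ?B / \<beta>)" using \<beta>(1) by (simp add: power_mult_distrib)
  finally have "L2D N X Y (%i j z. (a z * gax i j z + ax z * ga i j z)\<^sup>2) <= \<beta> * (4 * Ma\<^sup>2 * ?B / \<beta>)" .
  from L2D_young[OF cu G \<beta>(1) e(3) this] show ?thesis by (simp add: mult.commute[of "\<xi>u _ _ _"])
 qed
 have T10: "\<bar>L2D N X Y (%i j z. \<xi>p i j z * \<phi> i j z)\<bar> / \<epsilon> <= E / 22 + 11 / 2 * (?B * K\<omega>)"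
  using L2D_young[OF cp pc2_divide[OF c\<phi>] \<epsilon>i e(1) scale[OF w\<phi>]] \<epsilon> unfolding pull by simp
 \<comment> \<open>Products of two data terms: each factor contributes
   \<open>sqrt \<epsilon>\<close> in the mean, so the product pays for the division by
   \<open>\<epsilon>\<close> and nothing has to be absorbed.\<close>
 have half: "\<bar>L2D N X Y (%i j z. F i j z * G i j z)\<bar> <= \<epsilon> * (?B * K\<omega>)"
  if "pc2 N X Y F" "pc2 N X Y G" "L2D N X Y (%i j z. (F i j z)\<^sup>2) <= \<epsilon> * (?B * K\<omega>)" "L2D N X Y (%i j z. (G i j z)\<^sup>2) <= \<epsilon> * (?B * K\<omega>)" for F G
 proof -
  have "\<bar>L2D N X Y (%i j z. F i j z * G i j z)\<bar> <= L2D N X Y (%i j z. \<bar>F i j z * G i j z\<bar>)" by (intro L2D_abs pc2_mult that)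
  also have "... <= L2D N X Y (%i j z. (1/2) * ((F i j z)\<^sup>2 + (G i j z)\<^sup>2))"
  proof (intro L2D_mono pc2_abs pc2_mult pc2_const pc2_add pc2_power that)
   fix i j z
   show "\<bar>F i j z * G i j z\<bar> <= (1/2) * ((F i j z)\<^sup>2 + (G i j z)\<^sup>2)"
    using zero_le_power2[of "\<bar>F i j z\<bar> - \<bar>G i j z\<bar>"] by (simp add: power2_diff abs_mult)
  qed
  also have "... = (1/2) * (L2D N X Y (%i j z. (F i j z)\<^sup>2) + L2D N X Y (%i j z. (G i j z)\<^sup>2))"
   by (simp only: L2D_cmult L2D_add[OF pc2_power[OF that(1)] pc2_power[OF that(2)]])
  also have "... <= (1/2) * (\<epsilon> * (?B * K\<omega>) + \<epsilon> * (?B * K\<omega>))" by (intro mult_left_mono add_mono that) simp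
  finally show ?thesis by (simp add: mult_ac)
 qed
 have T11: "\<bar>L2D N X Y (%i j z. \<eta>p i j z * \<phi> i j z)\<bar> / \<epsilon> <= ?B * K\<omega>"
  using half[OF pc2_errors(2) c\<phi> w\<eta>p w\<phi>] \<epsilon> by (simp add: divide_le_eq mult_ac)
 have T12: "\<bar>L2D N X Y (%i j z. gx i j z * \<phi> i j z)\<bar> <= ?B * K\<omega>"
 proof -
  have "\<epsilon> * \<bar>L2D N X Y (%i j z. gx i j z * \<phi> i j z)\<bar> = \<bar>L2D N X Y (%i j z. (\<epsilon> * gx i j z) * \<phi> i j z)\<bar>"
   using L2D_cmult[of N X Y \<epsilon> "%i j z. gx i j z * \<phi> i j z"] \<epsilon> by (simp add: mult.assoc abs_mult)
  also have "... <= \<epsilon> * (?B * K\<omega>)" by (intro half pc2_mult pc2_const pc2_errors c\<phi> wgx w\<phi>)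
  finally show ?thesis using \<epsilon> by simp
 qed
 have "L2D N X Y (%i j z. \<eta>p i j z * \<xi>p i j z + \<eta>q i j z * \<xi>q i j z) / \<epsilon>
  = L2D N X Y (%i j z. \<eta>p i j z * \<xi>p i j z) / \<epsilon> + L2D N X Y (%i j z. \<eta>q i j z * \<xi>q i j z) / \<epsilon>"
  by (simp add: L2D_add pc2_mult pc2_errors cp cq add_divide_distrib)
 note I = error_identity[folded E_def, unfolded this]
 have abs: "\<bar>x / \<epsilon>\<bar> = \<bar>x\<bar> / \<epsilon>" for x using \<epsilon> by simp
 note T = T1[folded abs] T1'[folded abs] T2 T3 T4 T5 T6 T7 T8 T9 T10[folded abs] T11[folded abs] T12
 have "E <= 2 * (11 / 2 * (?B * K\<omega>) + 11 / 2 * ?B + 11 / 2 * (4 * Ma\<^sup>2 * ?B / \<beta>) + 11 / 2 * (?B * K\<omega>) + 11 / 2 * ?B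
  + 11 / 2 * (2 * ?B / \<alpha>) + 11 / 2 * (?B / C1) + 11 / 2 * (Ma\<^sup>2 * (invC k)\<^sup>2 * ?B / \<beta>) + 11 / 2 * (4 * Ma\<^sup>2 * ?B / \<beta>)
  + 11 / 2 * (2 * ?B / \<alpha>) + 11 / 2 * (?B * K\<omega>) + ?B * K\<omega> + ?B * K\<omega>)"
  by (rule absorb_terms[OF I T])
 also have "... = C\<xi> * c\<^sup>2 * H\<^sup>2" by (simp add: C\<xi>_def algebra_simps add_divide_distrib)
 finally show ?thesis by (simp add: E_def)
qed

end

end

section \<open>Partial derivatives on the closed square\<close>

abbreviation "Q01 \<equiv> {0..1::real} \<times> {0..1::real}"

lemma closure_Omega: "closure Omega = Q01"
 by (simp add: Omega_def closure_Times)

text \<open>No point of the interval is isolated, end points included. This makes derivatives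
  relative to it unique, so that \<open>pdx\<close> and \<open>pdy\<close> can be evaluated.\<close>

lemma at_within_unit_nontrivial: "t \<in> {0..1::real} ==> at t within {0..1} \<noteq> bot"
 using connected_imp_perfect[of "{0..1::real}" t] by (auto simp: trivial_limit_within set_eq_iff dest: spec[of _ 0] spec[of _ 1])

lemma Ck_pdx: "Ck (Suc n) S g ==> Ck n S (pdx g)"
 and Ck_pdy: "Ck (Suc n) S g ==> Ck n S (pdy g)"
 and Ck_continuous: "Ck n S g ==> continuous_on S g"
 by (cases n; simp)+

lemma Ck_pd: "Ck (i + j + n) S g ==> Ck n S (pd i j g)"
proof -
 have y: "Ck (j + n) S g ==> Ck n S ((pdy ^^ j) g)" for n
  by (induction j arbitrary: n) (auto intro: Ck_pdy simp flip: add_Suc_right)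
 have x: "Ck (i + n) S g ==> Ck n S ((pdx ^^ i) g)" for n and g :: fn2
  by (induction i arbitrary: n) (auto intro: Ck_pdx simp flip: add_Suc_right)
 show "Ck (i + j + n) S g ==> Ck n S (pd i j g)"
  unfolding pd_def using x[of n "(pdy ^^ j) g"] y[of "i + n"] by (simp add: add_ac)
qed

lemma Ck_dx:
 assumes "Ck (Suc n) Q01 g" "x \<in> {0..1}" "y \<in> {0..1}"
 shows "((%t. g (t, y)) has_real_derivative pdx g (x, y)) (at x within {0..1})"
 using assms by (auto simp: pdx_def vector_derivative_works has_real_derivative_iff_has_vector_derivative)

lemma Ck_dy:
 assumes "Ck (Suc n) Q01 g" "x \<in> {0..1}" "y \<in> {0..1}"
 shows "((%t. g (x, t)) has_real_derivative pdy g (x, y)) (at y within {0..1})"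
 using assms by (auto simp: pdy_def vector_derivative_works has_real_derivative_iff_has_vector_derivative)

lemma pdx_eqI:
 assumes "((%t. g (t, y)) has_real_derivative d) (at x within {0..1})" "x \<in> {0..1}"
 shows "pdx g (x, y) = d"
 using assms vector_derivative_within[OF at_within_unit_nontrivial]
 by (simp add: pdx_def has_real_derivative_iff_has_vector_derivative)

lemma pdy_eqI:
 assumes "((%t. g (x, t)) has_real_derivative d) (at y within {0..1})" "y \<in> {0..1}"
 shows "pdy g (x, y) = d"
 using assms vector_derivative_within[OF at_within_unit_nontrivial]
 by (simp add: pdy_def has_real_derivative_iff_has_vector_derivative)

text \<open>Clairaut's theorem: differentiate \<open>g (x, y) = g (x, 0) + \<integral>_0^y g_y\<close> under the integral.\<close>

lemma pdx_pdy_commute: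
 assumes g: "Ck (Suc (Suc n)) Q01 g" and x: "x \<in> {0..1}" and y: "y \<in> {0..1}"
 shows "((%t. pdx g (x, t)) has_real_derivative pdx (pdy g) (x, y)) (at y within {0..1})"
proof -
 have c: "continuous_on Q01 (pdy g)" "continuous_on Q01 (pdx (pdy g))"
  using Ck_continuous[OF Ck_pdy[OF g]] Ck_continuous[OF Ck_pdx[OF Ck_pdy[OF g]]] by auto
 have gy: "Ck (Suc n) Q01 (pdy g)" using Ck_pdy[OF g] .
 have int: "g (t, s) - g (t, 0) = integral {0..s} (%r. pdy g (t, r))" if "t \<in> {0..1}" "s \<in> {0..1}" for t s
 proof -
  have "((%r. pdy g (t, r)) has_integral g (t, s) - g (t, 0)) {0..s}"
  proof (intro fundamental_theorem_of_calculus)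
   fix r assume "r \<in> {0..s}"
   then have "((%r. g (t, r)) has_vector_derivative pdy g (t, r)) (at r within {0..1})"
    using Ck_dy[OF g that(1), of r] that by (simp add: has_real_derivative_iff_has_vector_derivative)
   then show "((%r. g (t, r)) has_vector_derivative pdy g (t, r)) (at r within {0..s})"
    by (rule has_vector_derivative_within_subset) (use that in auto)
  qed (use that in auto)
  then show ?thesis by (simp add: integral_unique)
 qed
 have main: "pdx g (x, s) = pdx g (x, 0) + integral {0..s} (%r. pdx (pdy g) (x, r))" if s: "s \<in> {0..1}" for s
 proof -
  have sub: "{0..1} \<times> {0..s} \<subseteq> Q01" using s by auto
  have "((%t. integral (cbox 0 s) (%r. pdy g (t, r))) has_real_derivative integral (cbox 0 s) (%r. pdx (pdy g) (x, r))) (at x within {0..1})"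
  proof (rule leibniz_rule_field_derivative[OF _ _ _ x])
   fix t r :: real assume "t \<in> {0..1}" "r \<in> cbox 0 s"
   then show "((%t. pdy g (t, r)) has_real_derivative pdx (pdy g) (t, r)) (at t within {0..1})"
    using Ck_dx[OF gy] s by auto
  next
   fix t :: real assume "t \<in> {0..1}"
   then show "(%r. pdy g (t, r)) integrable_on cbox 0 s"
    unfolding cbox_interval
    by (intro integrable_continuous_real continuous_on_line_y[OF continuous_on_subset[OF c(1) sub]])
  next
   show "continuous_on ({0..1} \<times> cbox 0 s) (%(t, r). pdx (pdy g) (t, r))"
    using continuous_on_subset[OF c(2) sub] by simp
  qed simp
  then have "((%t. g (t, 0) + integral {0..s} (%r. pdy g (t, r))) has_real_derivative pdx g (x, 0) + integral {0..s} (%r. pdx (pdy g) (x, r))) (at x within {0..1})"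
   using DERIV_add[OF Ck_dx[OF g x, of 0]] by simp
  then have "((%t. g (t, s)) has_real_derivative pdx g (x, 0) + integral {0..s} (%r. pdx (pdy g) (x, r))) (at x within {0..1})"
   by (rule has_field_derivative_transform_within[OF _ zero_less_one x]) (use s in \<open>simp flip: int\<close>)
  from pdx_eqI[OF this x] show ?thesis .
 qed
 have "((%s. integral {0..s} (%r. pdx (pdy g) (x, r))) has_vector_derivative pdx (pdy g) (x, y)) (at y within {0..1})"
  by (intro integral_has_vector_derivative continuous_on_line_y[OF c(2) x] y)
 then have "((%s. pdx g (x, 0) + integral {0..s} (%r. pdx (pdy g) (x, r))) has_real_derivative 0 + pdx (pdy g) (x, y)) (at y within {0..1})"
  by (intro DERIV_add) (auto simp: has_real_derivative_iff_has_vector_derivative)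
 then have "((%s. pdx g (x, s)) has_real_derivative 0 + pdx (pdy g) (x, y)) (at y within {0..1})"
  by (rule has_field_derivative_transform_within[OF _ zero_less_one y]) (rule main[symmetric])
 then show ?thesis by simp
qed

lemma pdx_cong:
 assumes "!!z. z \<in> Q01 ==> g z = h z" "z \<in> Q01"
 shows "pdx g z = pdx h z"
proof -
 have "(%t. g (t, snd z)) x = (%t. h (t, snd z)) x" if "x \<in> {0..1}" for x
  using assms that by auto
 then show ?thesis unfolding pdx_def using assms(2)
  by (intro vector_derivative_cong_eq) (auto simp: eventually_at_filter)
qed

lemma pdy_cong:
 assumes "!!z. z \<in> Q01 ==> g z = h z" "z \<in> Q01"
 shows "pdy g z = pdy h z"
proof -
 have "(%t. g (fst z, t)) x = (%t. h (fst z, t)) x" if "x \<in> {0..1}" for x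
  using assms that by (cases z) auto
 then show ?thesis unfolding pdy_def using assms(2)
  by (intro vector_derivative_cong_eq) (auto simp: eventually_at_filter)
qed

lemma pd_Suc_x: "pd (Suc i) j g = pdx (pd i j g)"
 by (simp add: pd_def)

lemma pd_0_Suc: "pd 0 (Suc j) g = pdy (pd 0 j g)"
 by (simp add: pd_def)

lemma pd_0_0: "pd 0 0 g = g"
 by (simp add: pd_def)

text \<open>\<open>pd\<close> applies the y derivatives first, so a further y derivative has to be
  carried inwards past the x derivatives, one exchange at a time.\<close>

lemma pdy_pd:
 assumes "Ck n Q01 g" "i + j < n" "z \<in> Q01"
 shows "pdy (pd i j g) z = pd i (Suc j) g z"
 using assms(2,3)
proof (induction i arbitrary: z)
 case (Suc i)
 obtain x y where z: "z = (x, y)" "x \<in> {0..1}" "y \<in> {0..1}" using Suc.prems by auto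
 have "Ck (i + j + (n - i - j)) Q01 g" using assms(1) Suc.prems by simp
 then have "Ck (n - i - j) Q01 (pd i j g)" by (rule Ck_pd)
 \<comment> \<open>The exchange needs two orders of smoothness of \<open>pd i j g\<close>; the
   strict inequality for \<open>Suc i\<close> provides them.\<close>
 moreover have "n - i - j = Suc (Suc (n - i - j - 2))" using Suc.prems by simp
 ultimately have "Ck (Suc (Suc (n - i - j - 2))) Q01 (pd i j g)" by simp
 from pdy_eqI[OF pdx_pdy_commute[OF this z(2,3)] z(3)]
 have "pdy (pd (Suc i) j g) z = pdx (pdy (pd i j g)) z" by (simp add: pd_Suc_x z)
 also have "... = pdx (pd i (Suc j) g) z" using Suc by (intro pdx_cong) auto
 finally show ?case by (simp add: pd_Suc_x)
qed (simp add: pd_0_Suc)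

section \<open>The Shishkin mesh\<close>

locale shishkin =
 fixes k N m :: nat and \<alpha> \<delta> \<sigma> \<epsilon> :: real
 assumes k1: "k \<ge> 1" and \<alpha>0: "\<alpha> > 0" and \<delta>0: "\<delta> > 0" and \<sigma>k: "\<sigma> \<ge> real k + 2" and \<epsilon>0: "\<epsilon> > 0"
  and N4: "N = 4 * m" "m \<ge> 1" and \<tau>1: "tau1 \<sigma> \<alpha> \<epsilon> N <= 1 / 2" and \<tau>2: "tau2 \<sigma> \<delta> \<epsilon> N <= 1 / 4"
begin

definition "\<tau>x = tau1 \<sigma> \<alpha> \<epsilon> N"
definition "\<tau>y = tau2 \<sigma> \<delta> \<epsilon> N"
definition "X = xpt (shishkin_mesh \<tau>x \<tau>y N)"
definition "Y = ypt (shishkin_mesh \<tau>x \<tau>y N)"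
definition "h = ln (real N) / real N"
definition "H = h ^ Suc k"
definition "EE x = exp (- \<alpha> * (1 - x) / \<epsilon>)"
definition "FF y = exp (- \<delta> * y / sqrt \<epsilon>) + exp (- \<delta> * (1 - y) / sqrt \<epsilon>)"
definition "CP = 2 * (1 + 2 * pjB (radR k) + 2 * pjB (radL k) + 2 * pjB (projL2 k))"

lemma lnN: "1 <= ln (real N)"
proof -
 have "exp 1 <= real N" using N4 exp_le by simp
 then show ?thesis by (metis exp_gt_zero less_le_trans ln_ge_iff)
qed

lemma N0: "real N \<ge> 4" "real N > 0" using N4 by auto

lemma \<sigma>0: "\<sigma> > 0" using \<sigma>k by linarith

lemma \<tau>_pos: "0 < \<tau>x" "\<tau>x <= 1 / 2" "0 < \<tau>y" "\<tau>y <= 1 / 4"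
 using \<tau>1 \<tau>2 lnN \<alpha>0 \<delta>0 \<epsilon>0 \<sigma>0 by (auto simp: \<tau>x_def \<tau>y_def tau1_def tau2_def)

lemma h_pos: "0 < h" "1 / real N <= h"
 using lnN N0 by (auto simp: h_def divide_right_mono)

lemma h_less_1: "h < 1"
 using ln_less_self[of "real N"] N0 by (simp add: h_def)

lemma H_ge: "1 / real N ^ Suc k <= H"
 unfolding H_def using power_mono[OF h_pos(2), of "Suc k"] N0 by (simp add: power_divide)

lemma H_pos: "0 < H" using h_pos by (simp add: H_def)

lemma H_le_1: "H <= 1" using h_pos h_less_1 unfolding H_def by (intro power_le_one) auto

lemma rN: "real N = 4 * real m" "real m \<ge> 1" using N4 by auto

lemma X_coarse: "X i = 2 * (1 - \<tau>x) * (real i / real N)" if "i <= 2 * m"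
proof -
 have "2 * i <= N" using that N4 by linarith
 then show ?thesis by (simp add: X_def shishkin_mesh_def)
qed

text \<open>Both branches of the mesh definition agree at the transition index, so the formula holds
  there as well. Each cell, with both of its nodes, then falls under one formula.\<close>

lemma X_fine: "X i = 1 - 2 * \<tau>x * (1 - real i / real N)" if "2 * m <= i"
proof (cases "i = 2 * m")
 case True
 then have "real i / real N = 1 / 2" using rN by simp
 then show ?thesis using X_coarse[of i] True by simp
next
 case False
 then have "\<not> 2 * i <= N" using that N4 by linarith
 then show ?thesis by (simp add: X_def shishkin_mesh_def)
qed

lemma Y_fine1: "Y j = 4 * \<tau>y * (real j / real N)" if "j <= m"
proof -
 have "4 * j <= N" using that N4 by linarith
 then show ?thesis by (simp add: Y_def shishkin_mesh_def)
qed

lemma Y_coarse: "Y j = \<tau>y + 2 * (1 - 2 * \<tau>y) * (real j / real N - 1 / 4)" if "m <= j" "j <= 3 * m"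
proof (cases "j = m")
 case True
 then have "real j / real N = 1 / 4" using rN by simp
 then show ?thesis using Y_fine1[of j] True by simp
next
 case False
 then have "\<not> 4 * j <= N" "4 * j <= 3 * N" using that N4 by linarith+
 then show ?thesis by (simp add: Y_def shishkin_mesh_def)
qed

lemma Y_fine2: "Y j = 1 - 4 * \<tau>y * (1 - real j / real N)" if "3 * m <= j"
proof (cases "j = 3 * m")
 case True
 then have r: "real j / real N = 3 / 4" using rN by simp
 have "Y j = \<tau>y + 2 * (1 - 2 * \<tau>y) * (real j / real N - 1 / 4)" by (rule Y_coarse) (use True in auto)
 then show ?thesis unfolding r by (simp add: field_simps)
next
 case False
 then have "\<not> 4 * j <= N" "\<not> 4 * j <= 3 * N" using that N4 by linarith+
 then show ?thesis by (simp add: Y_def shishkin_mesh_def)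
qed

lemma prev_ratio: "i \<in> {1..N} ==> real (i - 1) / real N = real i / real N - 1 / real N"
 by (simp add: of_nat_diff diff_divide_distrib)

lemma X_step: "X i - X (i - 1) = (if i <= 2 * m then 2 * (1 - \<tau>x) / N else 2 * \<tau>x / N)" if i: "i \<in> {1..N}"
proof (cases "i <= 2 * m")
 case True
 then have "i - 1 <= 2 * m" by simp
 then show ?thesis unfolding X_coarse[OF True] X_coarse[OF \<open>i - 1 <= 2 * m\<close>] prev_ratio[OF i]
  using True by (simp add: right_diff_distrib)
next
 case False
 then have "2 * m <= i" "2 * m <= i - 1" by auto
 then show ?thesis unfolding X_fine[OF \<open>2 * m <= i\<close>] X_fine[OF \<open>2 * m <= i - 1\<close>] prev_ratio[OF i]
  using False by (simp add: right_diff_distrib distrib_left)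
qed

lemma Y_step: "Y j - Y (j - 1) = (if m < j & j <= 3 * m then 2 * (1 - 2 * \<tau>y) / N else 4 * \<tau>y / N)" if j: "j \<in> {1..N}"
proof -
 consider "j <= m" | "m < j" "j <= 3 * m" | "3 * m < j" by linarith
 then show ?thesis
 proof cases
  case 1
  then have "j - 1 <= m" by simp
  show ?thesis unfolding Y_fine1[OF 1] Y_fine1[OF \<open>j - 1 <= m\<close>] prev_ratio[OF j]
   using 1 by (simp add: right_diff_distrib)
 next
  case 2
  then have *: "m <= j" "m <= j - 1" "j - 1 <= 3 * m" by auto
  show ?thesis unfolding Y_coarse[OF *(1) 2(2)] Y_coarse[OF *(2,3)] prev_ratio[OF j]
   using 2 by (simp add: right_diff_distrib)
 next
  case 3
  then have *: "3 * m <= j" "3 * m <= j - 1" by auto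
  show ?thesis unfolding Y_fine2[OF *(1)] Y_fine2[OF *(2)] prev_ratio[OF j]
   using 3 by (simp add: right_diff_distrib distrib_left)
 qed
qed

lemma X_ends: "X 0 = 0" "X N = 1"
 using X_coarse[of 0] X_fine[of N] N4 N0 by auto

lemma Y_ends: "Y 0 = 0" "Y N = 1"
 using Y_fine1[of 0] Y_fine2[of N] N4 N0 by auto

lemma mesh_grid2: "grid2 N X Y k"
proof unfold_locales
 show "1 <= N" using N4 by simp
 show "X i < X (Suc i)" if "i < N" for i
 proof -
  have "X (Suc i) - X i > 0" using X_step[of "Suc i"] that \<tau>_pos N0 by (auto simp: divide_pos_pos)
  then show ?thesis by simp
 qed
 show "Y i < Y (Suc i)" if "i < N" for i
 proof -
  have "Y (Suc i) - Y i > 0" using Y_step[of "Suc i"] that \<tau>_pos N0 by (auto simp: divide_pos_pos)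
  then show ?thesis by simp
 qed
qed (rule k1)

sublocale grid2 N X Y k by (rule mesh_grid2)

lemma RX_RY: "{X 0..X N} = {0..1}" "{Y 0..Y N} = {0..1}"
 by (simp_all add: X_ends Y_ends)

lemma X_len: "i \<in> {1..N} ==> X i - X (i - 1) <= 2 / N"
 using X_step \<tau>_pos N0 by (auto intro!: divide_right_mono)

lemma X_len_coarse: "i \<in> {1..N} ==> i <= 2 * m ==> 1 / N <= X i - X (i - 1)"
 using X_step \<tau>_pos N0 by (auto intro!: divide_right_mono)

lemma X_len_fine: "i \<in> {1..N} ==> \<not> i <= 2 * m ==> X i - X (i - 1) = (2 * \<sigma> / \<alpha>) * h * \<epsilon>"
 using X_step by (simp add: \<tau>x_def tau1_def h_def)

lemma Y_len: "j \<in> {1..N} ==> Y j - Y (j - 1) <= 2 / N"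
 using Y_step \<tau>_pos N0 by (auto intro!: divide_right_mono)

lemma Y_len_fine: "j \<in> {1..N} ==> \<not> (m < j & j <= 3 * m) ==> Y j - Y (j - 1) = (4 * \<sigma> / \<delta>) * h * sqrt \<epsilon>"
 by (subst Y_step, assumption, subst if_not_P, assumption) (simp add: \<tau>y_def tau2_def h_def)

text \<open>At the transition point the layer is smaller than \<open>1 / N ^ (k + 1)\<close> by a
  further factor \<open>1 / N\<close>. On coarse cells this factor compensates the reciprocal cell
  length.\<close>

lemma N_powr: "real N powr - \<sigma> <= 1 / real N ^ (k + 2)"
proof -
 have "real N powr - \<sigma> <= real N powr - real (k + 2)"
  using N0 \<sigma>k by (intro powr_mono) auto
 also have "... = 1 / real N ^ (k + 2)" by (simp only: powr_minus powr_realpow[OF N0(2)] inverse_eq_divide)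
 finally show ?thesis .
qed

lemma EE_mono: "x <= x' ==> EE x <= EE x'"
 unfolding EE_def using \<alpha>0 \<epsilon>0 by (simp add: divide_right_mono mult_left_mono)

lemma EE_pos: "EE x > 0" and EE_le_1: "x <= 1 ==> EE x <= 1"
 unfolding EE_def using \<alpha>0 \<epsilon>0 by (auto simp: divide_le_0_iff mult_le_0_iff)

lemma EE_coarse:
 assumes "i \<in> {1..N}" "i <= 2 * m"
 shows "EE (X i) <= real N powr - \<sigma>"
proof -
 have "X i <= X (2 * m)" using assms N4 gx.X_mono[of i "2 * m"] by simp
 also have "X (2 * m) = 1 - \<tau>x" using X_coarse[of "2 * m"] N4 N0 by simp
 finally have "EE (X i) <= EE (1 - \<tau>x)" by (rule EE_mono)
 also have "EE (1 - \<tau>x) = exp (- \<sigma> * ln N)"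
  using \<alpha>0 \<epsilon>0 by (simp add: EE_def \<tau>x_def tau1_def)
 finally show ?thesis using N0 by (simp add: powr_def)
qed

lemma FF_coarse:
 assumes "j \<in> {1..N}" "m < j" "j <= 3 * m" "y \<in> {Y (j - 1)..Y j}"
 shows "FF y <= 2 * real N powr - \<sigma>"
proof -
 have "m <= j - 1" "j - 1 <= N" "3 * m <= N" using assms N4 by auto
 then have "Y m <= Y (j - 1)" "Y j <= Y (3 * m)" using assms(3) by (intro gy.X_mono; simp)+
 moreover have "Y m = \<tau>y" "Y (3 * m) = 1 - \<tau>y"
  using Y_fine1[of m] Y_fine2[of "3 * m"] rN by (auto simp: field_simps)
 ultimately have y: "\<tau>y <= y" "\<tau>y <= 1 - y" using assms(4) by auto
 have *: "exp (- \<delta> * t / sqrt \<epsilon>) <= real N powr - \<sigma>" if "\<tau>y <= t" for t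
 proof -
  have "exp (- \<delta> * t / sqrt \<epsilon>) <= exp (- \<delta> * \<tau>y / sqrt \<epsilon>)"
   using that \<delta>0 \<epsilon>0 by (simp add: divide_right_mono mult_left_mono)
  also have "- \<delta> * \<tau>y / sqrt \<epsilon> = - \<sigma> * ln N" using \<delta>0 \<epsilon>0 by (simp add: \<tau>y_def tau2_def)
  finally show ?thesis using N0 by (simp add: powr_def)
 qed
 show ?thesis using *[OF y(1)] *[OF y(2)] by (simp add: FF_def)
qed

lemma FF_le_2: "0 <= y ==> y <= 1 ==> FF y <= 2"
proof -
 assume "0 <= y" "y <= 1"
 then have "exp (- \<delta> * y / sqrt \<epsilon>) <= 1" "exp (- \<delta> * (1 - y) / sqrt \<epsilon>) <= 1"
  using \<delta>0 \<epsilon>0 by (auto simp: divide_le_0_iff mult_le_0_iff)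
 then have "FF y <= 1 + 1" unfolding FF_def by (intro add_mono)
 then show ?thesis by simp
qed

text \<open>A fine cell has length of order \<open>h * \<epsilon>\<close> with \<open>h\<close>
  below 1, so over one cell the layer function changes only by a bounded factor, here
  \<open>exp (2 * \<sigma>)\<close>.\<close>

lemma EE_fine:
 assumes "i \<in> {1..N}" "\<not> i <= 2 * m" "x \<in> {X (i - 1)..X i}" "x' \<in> {X (i - 1)..X i}"
 shows "EE x' <= exp (2 * \<sigma>) * EE x"
proof -
 have "x' - x <= (2 * \<sigma> / \<alpha>) * h * \<epsilon>" using assms(3,4) X_len_fine[OF assms(1,2)] by auto
 also have "... <= (2 * \<sigma> / \<alpha>) * 1 * \<epsilon>" using h_less_1 h_pos \<sigma>0 \<alpha>0 \<epsilon>0 by (intro mult_mono) auto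
 finally have "\<alpha> * (x' - x) / \<epsilon> <= 2 * \<sigma>" using \<alpha>0 \<epsilon>0 by (simp add: field_simps)
 then have "exp (\<alpha> * (x' - x) / \<epsilon>) <= exp (2 * \<sigma>)" by simp
 moreover have "EE x' = exp (\<alpha> * (x' - x) / \<epsilon>) * EE x"
  unfolding EE_def exp_add[symmetric] by (simp add: diff_divide_distrib right_diff_distrib)
 ultimately show ?thesis using EE_pos[of x] by simp
qed

section \<open>One-dimensional projection errors on the Shishkin mesh\<close>

definition "three_projs = {radR k, radL k, projL2 k}"

lemma three_projs: "K \<in> three_projs ==> \<exists>l. interval_proj k l K"
 using proj by (auto simp: three_projs_def)

lemma CP: "K \<in> three_projs ==> 1 + 2 * pjB K <= CP" "K \<in> three_projs ==> pjB K <= CP" "1 <= CP"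
 using pjB_nonneg[of "radR k"] pjB_nonneg[of "radL k"] pjB_nonneg[of "projL2 k"]
 by (auto simp: three_projs_def CP_def)

lemma pj_le_CP:
 assumes "K \<in> three_projs" "c < d" "continuous_on {c..d} g" "x \<in> {c..d}" "!!t. t \<in> {c..d} ==> \<bar>g t\<bar> <= S"
 shows "\<bar>pj K c d g x\<bar> <= CP * S"
proof -
 obtain l where "interval_proj k l K" using three_projs[OF assms(1)] by blast
 then have "\<bar>pj K c d g x\<bar> <= 2 * pjB K * S" by (rule interval_proj.pj_bound) (fact assms(2-5))+
 also have "... <= CP * S"
  using assms(5)[OF assms(4)] CP(1)[OF assms(1)] by (intro mult_right_mono) auto
 finally show ?thesis .
qed

definition deriv_chain :: "real => real => (nat => real => real) => bool"
 where "deriv_chain c d D \<longleftrightarrow> (\<forall>m\<le>k. \<forall>t\<in>{c..d}. (D m has_real_derivative D (Suc m) t) (at t within {c..d}))"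

lemma deriv_chain_cont: "deriv_chain c d D ==> continuous_on {c..d} (D 0)"
 using DERIV_continuous_on[of "{c..d}" "D 0" "D (Suc 0)"] by (simp add: deriv_chain_def)

lemma pj_error_CP:
 assumes "K \<in> three_projs" "c < d" "x \<in> {c..d}" "deriv_chain c d D" "!!t. t \<in> {c..d} ==> \<bar>D (Suc k) t\<bar> <= S"
 shows "\<bar>D 0 x - pj K c d (D 0) x\<bar> <= CP * ((d - c) ^ Suc k * S)"
proof -
 obtain l where "interval_proj k l K" using three_projs[OF assms(1)] by blast
 then have "\<bar>D 0 x - pj K c d (D 0) x\<bar> <= (1 + 2 * pjB K) * ((d - c) ^ Suc k * S)"
  by (rule interval_proj.pj_error) (use assms in \<open>auto simp: deriv_chain_def\<close>)
 also have "... <= CP * ((d - c) ^ Suc k * S)"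
  using assms(2) assms(5)[OF assms(3)] CP(1)[OF assms(1)] by (intro mult_right_mono mult_nonneg_nonneg) auto
 finally show ?thesis .
qed

lemma pj_trivial_error:
 assumes "K \<in> three_projs" "c < d" "x \<in> {c..d}" "continuous_on {c..d} g" "!!t. t \<in> {c..d} ==> \<bar>g t\<bar> <= S"
 shows "\<bar>g x - pj K c d g x\<bar> <= 2 * CP * S"
proof -
 have "S \<ge> 0" using assms(5)[OF assms(3)] by linarith
 then have "1 * S <= CP * S" using CP(3) by (intro mult_right_mono) auto
 then show ?thesis using pj_le_CP[OF assms(1,2,4,3,5)] assms(5)[OF assms(3)] by linarith
qed

declare power_Suc [simp del]

text \<open>The summands belong to the three cases: smooth function, layer on fine cells, layer on
  coarse cells. \<open>CY\<close> is built likewise.\<close>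

definition "CX = CP * (2 ^ Suc k + (2 * \<sigma> / \<alpha>) ^ Suc k * exp (2 * \<sigma>) + 2)"
definition "CY = CP * (2 ^ Suc k + 2 * (4 * \<sigma> / \<delta>) ^ Suc k + 4)"

lemma X_error_smooth:
 assumes "K \<in> three_projs" "i \<in> {1..N}" "x \<in> {X (i - 1)..X i}" "deriv_chain (X (i - 1)) (X i) D"
  "!!t. t \<in> {X (i - 1)..X i} ==> \<bar>D (Suc k) t\<bar> <= S"
 shows "\<bar>D 0 x - pj K (X (i - 1)) (X i) (D 0) x\<bar> <= CP * 2 ^ Suc k * S * (1 / real N ^ Suc k)"
proof -
 have S: "S \<ge> 0" using assms(5)[OF assms(3)] by linarith
 have "(X i - X (i - 1)) ^ Suc k <= (2 / N) ^ Suc k"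
  using X_len[OF assms(2)] gx.cell[OF assms(2)] by (intro power_mono) auto
 then have "CP * ((X i - X (i - 1)) ^ Suc k * S) <= CP * ((2 / N) ^ Suc k * S)"
  using S CP(3) by (intro mult_left_mono mult_right_mono) auto
 then show ?thesis using pj_error_CP[OF assms(1) gx.cell[OF assms(2)] assms(3-5)] by (simp add: power_divide mult_ac)
qed

text \<open>The power k + 1 of the cell length
  \<open>(2 * \<sigma> / \<alpha>) * h * \<epsilon>\<close> cancels the powers of
  \<open>\<epsilon>\<close> lost in the derivative and leaves \<open>H\<close>. The layer value at
  the point itself is kept, since squares of these errors are summed over the columns later.\<close>

lemma X_error_fine:
 assumes "K \<in> three_projs" "i \<in> {1..N}" "\<not> i <= 2 * m" "x \<in> {X (i - 1)..X i}" "deriv_chain (X (i - 1)) (X i) D"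
  "!!t. t \<in> {X (i - 1)..X i} ==> \<bar>D (Suc k) t\<bar> * \<epsilon> ^ Suc k <= S * EE t" and S: "S \<ge> 0"
 shows "\<bar>D 0 x - pj K (X (i - 1)) (X i) (D 0) x\<bar> <= CP * (2 * \<sigma> / \<alpha>) ^ Suc k * exp (2 * \<sigma>) * S * (H * EE x)"
proof -
 have "\<bar>D (Suc k) t\<bar> <= S * (exp (2 * \<sigma>) * EE x) / \<epsilon> ^ Suc k" if "t \<in> {X (i - 1)..X i}" for t
 proof -
  have "\<bar>D (Suc k) t\<bar> * \<epsilon> ^ Suc k <= S * (exp (2 * \<sigma>) * EE x)"
   using assms(6)[OF that] mult_left_mono[OF EE_fine[OF assms(2,3,4) that] S] by linarith
  then show ?thesis using \<epsilon>0 by (subst pos_le_divide_eq) auto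
 qed
 from pj_error_CP[OF assms(1) gx.cell[OF assms(2)] assms(4,5) this]
 have "\<bar>D 0 x - pj K (X (i - 1)) (X i) (D 0) x\<bar>
  <= CP * (((2 * \<sigma> / \<alpha>) * h * \<epsilon>) ^ Suc k * (S * (exp (2 * \<sigma>) * EE x) / \<epsilon> ^ Suc k))"
  unfolding X_len_fine[OF assms(2,3)] .
 also have "... = CP * (2 * \<sigma> / \<alpha>) ^ Suc k * exp (2 * \<sigma>) * S * (H * EE x)"
  unfolding power_mult_distrib H_def using \<epsilon>0 by simp
 finally show ?thesis .
qed

text \<open>The cell may be long compared with the layer, so derivatives are of no help. Stability
  is enough, because the function itself is below a multiple of \<open>N powr - \<sigma>\<close> on
  the cell.\<close>

lemma X_error_coarse:
 assumes "K \<in> three_projs" "i \<in> {1..N}" "i <= 2 * m" "x \<in> {X (i - 1)..X i}" "continuous_on {X (i - 1)..X i} g"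
  "!!t. t \<in> {X (i - 1)..X i} ==> \<bar>g t\<bar> <= S * EE t" and S: "S \<ge> 0"
 shows "\<bar>g x - pj K (X (i - 1)) (X i) g x\<bar> <= 2 * CP * (S * real N powr - \<sigma>)"
proof (rule pj_trivial_error[OF assms(1) gx.cell[OF assms(2)] assms(4,5)])
 fix t assume t: "t \<in> {X (i - 1)..X i}"
 have "EE t <= EE (X i)" using t by (intro EE_mono) auto
 then have "S * EE t <= S * real N powr - \<sigma>" using EE_coarse[OF assms(2,3)] S by (intro mult_left_mono) auto
 then show "\<bar>g t\<bar> <= S * real N powr - \<sigma>" using assms(6)[OF t] by linarith
qed

text \<open>The exponent \<mu> switches the layer factor on or off, so that one statement serves all
  four components. Fine columns carry the decaying profile \<open>H * EE x\<close> instead of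
  \<open>H\<close>; the jump estimate depends on this.\<close>

lemma X_error:
 assumes K: "K \<in> three_projs" and i: "i \<in> {1..N}" and x: "x \<in> {X (i - 1)..X i}" and D: "deriv_chain (X (i - 1)) (X i) D"
  and \<mu>: "\<mu> <= (1::nat)" and S: "S \<ge> 0" and b: "!!t. t \<in> {X (i - 1)..X i} ==> \<bar>D 0 t\<bar> <= S * EE t ^ \<mu>"
   "!!t. t \<in> {X (i - 1)..X i} ==> \<bar>D (Suc k) t\<bar> * \<epsilon> ^ (\<mu> * Suc k) <= S * EE t ^ \<mu>"
 shows "\<bar>D 0 x - pj K (X (i - 1)) (X i) (D 0) x\<bar> <= CX * S * (1 / real N ^ Suc k + (if i <= 2 * m then 0 else H * EE x))"
proof -
 let ?n = "1 / real N ^ Suc k" and ?e = "if i <= 2 * m then 0 else H * EE x"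
 have e: "?e \<ge> 0" using H_pos EE_pos[of x] by (simp add: less_imp_le)
 have n: "?n \<ge> 0" by simp
 have p: "(2 * \<sigma> / \<alpha>) ^ Suc k * exp (2 * \<sigma>) \<ge> 0" using \<sigma>0 \<alpha>0 by (auto intro!: mult_nonneg_nonneg)
 have le: "A * S * r <= CX * S * (?n + ?e)" if "A <= CX" "r <= ?n + ?e" "r \<ge> 0" "A \<ge> 0" for A r
  using that S by (intro mult_mono) auto
 consider "\<mu> = 0" | "\<mu> = 1" "\<not> i <= 2 * m" | "\<mu> = 1" "i <= 2 * m" using \<mu> by linarith
 then show ?thesis
 proof cases
  case 1
  have "CP * 2 ^ Suc k <= CX" unfolding CX_def using CP(3) p by (intro mult_left_mono) auto
  then have "CP * 2 ^ Suc k * S * ?n <= CX * S * (?n + ?e)" using e CP(3) by (intro le) auto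
  then show ?thesis using X_error_smooth[OF K i x D, of S] b(2) 1 by simp
 next
  case 2
  have "CP * ((2 * \<sigma> / \<alpha>) ^ Suc k * exp (2 * \<sigma>)) <= CX" unfolding CX_def using CP(3) by (intro mult_left_mono) auto
  then have "CP * ((2 * \<sigma> / \<alpha>) ^ Suc k * exp (2 * \<sigma>)) * S * (H * EE x) <= CX * S * (?n + ?e)"
   using e 2 mult_nonneg_nonneg[OF _ p, of CP] CP(3) by (intro le) auto
  then show ?thesis using X_error_fine[OF K i 2(2) x D _ S] b(2) 2 by (simp add: mult.assoc)
 next
  case 3
  have "CP * 2 <= CX" unfolding CX_def using CP(3) p by (intro mult_left_mono) auto
  moreover have "real N powr - \<sigma> <= ?n"
  proof -
   have "1 / real N ^ (k + 2) <= ?n" using N0 by (intro divide_left_mono power_increasing) auto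
   then show ?thesis using N_powr by linarith
  qed
  ultimately have "CP * 2 * S * (real N powr - \<sigma>) <= CX * S * (?n + ?e)"
   using e CP(3) by (intro le) auto
  then show ?thesis using X_error_coarse[OF K i 3(2) x deriv_chain_cont[OF D] _ S] b(1) 3 by (simp add: mult_ac)
 qed
qed

text \<open>No decay in y has to be retained, so all cases collapse to the rate \<open>H\<close>. A
  factor depending on x can be carried by \<open>S\<close>.\<close>

lemma Y_error:
 assumes K: "K \<in> three_projs" and j: "j \<in> {1..N}" and y: "y \<in> {Y (j - 1)..Y j}" and D: "deriv_chain (Y (j - 1)) (Y j) D"
  and \<nu>: "\<nu> <= (1::nat)" and S: "S \<ge> 0" and b: "!!t. t \<in> {Y (j - 1)..Y j} ==> \<bar>D 0 t\<bar> <= S * FF t ^ \<nu>"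
   "!!t. t \<in> {Y (j - 1)..Y j} ==> \<bar>D (Suc k) t\<bar> * sqrt \<epsilon> ^ (\<nu> * Suc k) <= S * FF t ^ \<nu>"
 shows "\<bar>D 0 y - pj K (Y (j - 1)) (Y j) (D 0) y\<bar> <= CY * S * H"
proof -
 have p: "2 * (4 * \<sigma> / \<delta>) ^ Suc k \<ge> 0" using \<sigma>0 \<delta>0 by auto
 have le: "A * S * r <= CY * S * H" if "A <= CY" "r <= H" "r \<ge> 0" "A \<ge> 0" for A r
  using that S by (intro mult_mono) auto
 have F2: "FF t <= 2" if "t \<in> {Y (j - 1)..Y j}" for t
  using gy.cell_subset[OF j] that RX_RY by (intro FF_le_2) auto
 consider "\<nu> = 0" | "\<nu> = 1" "\<not> (m < j & j <= 3 * m)" | "\<nu> = 1" "m < j & j <= 3 * m" using \<nu> by linarith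
 then show ?thesis
 proof cases
  case 1
  have "CP * 2 ^ Suc k <= CY" unfolding CY_def using CP(3) p by (intro mult_left_mono) auto
  then have "CP * 2 ^ Suc k * S * (1 / real N ^ Suc k) <= CY * S * H" using H_ge CP(3) by (intro le) auto
  moreover have "(Y j - Y (j - 1)) ^ Suc k <= (2 / N) ^ Suc k"
   using Y_len[OF j] gy.cell[OF j] by (intro power_mono) auto
  then have "CP * ((Y j - Y (j - 1)) ^ Suc k * S) <= CP * ((2 / N) ^ Suc k * S)"
   using S CP(3) by (intro mult_left_mono mult_right_mono) auto
  moreover have "\<bar>D 0 y - pj K (Y (j - 1)) (Y j) (D 0) y\<bar> <= CP * ((Y j - Y (j - 1)) ^ Suc k * S)"
   using b(2) 1 by (intro pj_error_CP[OF K gy.cell[OF j] y D]) auto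
  ultimately show ?thesis by (simp add: power_divide mult_ac)
 next
  case 2
  have "\<bar>D (Suc k) t\<bar> <= S * 2 / sqrt \<epsilon> ^ Suc k" if t: "t \<in> {Y (j - 1)..Y j}" for t
  proof -
   have "\<bar>D (Suc k) t\<bar> * sqrt \<epsilon> ^ Suc k <= S * 2"
    using b(2)[OF t] 2 mult_left_mono[OF F2[OF t] S] by simp
   then show ?thesis using \<epsilon>0 by (subst pos_le_divide_eq) auto
  qed
  from pj_error_CP[OF K gy.cell[OF j] y D this]
  have "\<bar>D 0 y - pj K (Y (j - 1)) (Y j) (D 0) y\<bar> <= CP * (((4 * \<sigma> / \<delta>) * h * sqrt \<epsilon>) ^ Suc k * (S * 2 / sqrt \<epsilon> ^ Suc k))"
   unfolding Y_len_fine[OF j 2(2)] .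
  also have "... = CP * (2 * (4 * \<sigma> / \<delta>) ^ Suc k) * S * H"
   unfolding power_mult_distrib H_def using \<epsilon>0 by simp
  also have "... <= CY * S * H"
   using CP(3) p H_pos by (intro le) (auto simp: CY_def intro!: mult_left_mono)
  finally show ?thesis .
 next
  case 3
  have "1 / real N ^ (k + 2) <= 1 / real N ^ Suc k" using N0 by (intro divide_left_mono power_increasing) auto
  then have NH: "real N powr - \<sigma> <= H" using N_powr H_ge by linarith
  have "\<bar>D 0 t\<bar> <= S * (2 * real N powr - \<sigma>)" if t: "t \<in> {Y (j - 1)..Y j}" for t
   using b(1)[OF t] 3 mult_left_mono[OF FF_coarse[OF j _ _ t] S] by simp
  from pj_trivial_error[OF K gy.cell[OF j] y deriv_chain_cont[OF D] this]
  have "\<bar>D 0 y - pj K (Y (j - 1)) (Y j) (D 0) y\<bar> <= CP * 4 * S * (real N powr - \<sigma>)" by (simp add: mult_ac)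
  also have "... <= CY * S * H" using CP(3) p NH by (intro le) (auto simp: CY_def intro!: mult_left_mono)
  finally show ?thesis .
 qed
qed

text \<open>On the coarse part the left Radau projection only sees \<open>EE\<close> at the left end of the cell and its mean,
  both of which are \<open>O(\<epsilon> N)\<close> times the value at the right end.\<close>

lemma exp_coarse:
 assumes "i \<in> {1..N}" "i <= 2 * m"
 shows "EE (X (i - 1)) + integral {0..1} (%t. EE (X (i - 1) + (X i - X (i - 1)) * t)) <= 2 / \<alpha> * (H * \<epsilon>)"
proof -
 define l where "l = X i - X (i - 1)"
 define s where "s = \<alpha> * l / \<epsilon>"
 have l: "1 / N <= l" "l > 0" using X_len_coarse[OF assms] gx.cell[OF assms(1)] by (auto simp: l_def)
 have s: "s > 0" using l \<alpha>0 \<epsilon>0 by (simp add: s_def)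
 have E: "EE (X (i - 1) + l * t) = EE (X i) * exp (s * (t - 1))" for t
  unfolding EE_def s_def exp_add[symmetric] using \<epsilon>0 by (simp add: l_def field_simps)
 have int: "integral {0..1} (%t. exp (s * (t - 1))) = (1 - exp (- s)) / s"
 proof -
  have "((%t. exp (s * (t - 1))) has_integral exp (s * (1 - 1)) / s - exp (s * (0 - 1)) / s) {0..1}"
   using s by (intro fundamental_theorem_of_calculus)
    (auto intro!: derivative_eq_intros simp flip: has_real_derivative_iff_has_vector_derivative)
  then show ?thesis by (simp add: integral_unique diff_divide_distrib)
 qed
 have "exp (- s) <= 1 / s"
 proof -
  have "s <= exp s" using exp_ge_add_one_self[of s] by linarith
  then have "1 / exp s <= 1 / s" using s by (intro divide_left_mono) auto
  then show ?thesis by (simp add: exp_minus divide_inverse)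
 qed
 moreover have "(1 - exp (- s)) / s <= 1 / s" using s by (intro divide_right_mono) auto
 ultimately have "exp (- s) + (1 - exp (- s)) / s <= 2 / s" by linarith
 also have "... <= 2 / \<alpha> * (\<epsilon> * N)"
 proof -
  have "1 <= l * N" using l N0 by (simp add: pos_divide_le_eq)
  then have "2 * \<epsilon> * 1 <= 2 * \<epsilon> * (l * N)" using \<epsilon>0 by (intro mult_left_mono) auto
  then show ?thesis using \<alpha>0 \<epsilon>0 l by (simp add: s_def field_simps)
 qed
 finally have A: "exp (- s) + (1 - exp (- s)) / s <= 2 / \<alpha> * (\<epsilon> * N)" .
 have "EE (X (i - 1)) = EE (X i) * exp (- s)" using E[of 0] by simp
 moreover have "integral {0..1} (%t. EE (X (i - 1) + l * t)) = EE (X i) * ((1 - exp (- s)) / s)"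
  unfolding E by (simp add: int)
 ultimately have "EE (X (i - 1)) + integral {0..1} (%t. EE (X (i - 1) + l * t)) = EE (X i) * (exp (- s) + (1 - exp (- s)) / s)"
  by (simp add: distrib_left)
 \<comment> \<open>Here the exponent k + 2 is spent: one power of \<open>N\<close> goes against the
   factor \<open>\<epsilon> * N\<close>.\<close>
 also have "... <= 1 / real N ^ (k + 2) * (2 / \<alpha> * (\<epsilon> * N))"
  using EE_coarse[OF assms] N_powr A EE_pos[of "X i"] s by (intro mult_mono) (auto intro!: add_nonneg_nonneg divide_nonneg_nonneg)
 also have "... = 2 / \<alpha> * \<epsilon> * (1 / real N ^ Suc k)"
 proof -
  have "real N ^ (k + 2) = real N ^ Suc k * real N" by (simp add: power_Suc)
  then show ?thesis using N0 by simp
 qed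
 also have "... <= 2 / \<alpha> * \<epsilon> * H" using H_ge \<alpha>0 \<epsilon>0 by (intro mult_left_mono) auto
 finally show ?thesis by (simp add: l_def mult_ac)
qed

text \<open>In coarse columns this is \<open>EE\<close> shifted by \<open>\<tau>x\<close>, so that
  it reaches 1 at the transition point, and \<open>EE\<close> equals
  \<open>N powr - \<sigma>\<close> times it. Factoring out this power, which is below
  \<open>H\<close>, leaves a profile whose square still integrates to order
  \<open>\<epsilon>\<close>: the rate and the power of \<open>\<epsilon>\<close> are obtained at the
  same time.\<close>

definition "\<omega> = (%i (j::nat) (z::real\<times>real). if i <= 2 * m then exp (- \<alpha> * (1 - \<tau>x - fst z) / \<epsilon>) else EE (fst z))"

lemma EE_\<omega>: "i <= 2 * m ==> EE (fst z) = real N powr - \<sigma> * \<omega> i j z"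
proof -
 have "real N powr - \<sigma> = exp (- \<alpha> * \<tau>x / \<epsilon>)" using N0 \<alpha>0 \<epsilon>0 by (simp add: powr_def \<tau>x_def tau1_def)
 then show "i <= 2 * m ==> ?thesis" by (simp add: \<omega>_def EE_def flip: exp_add add_divide_distrib) (simp add: add_divide_distrib diff_divide_distrib right_diff_distrib)
qed

lemma N_powr_H: "real N powr - \<sigma> <= H"
proof -
 have "1 / real N ^ (k + 2) <= 1 / real N ^ Suc k" using N0 by (intro divide_left_mono power_increasing) auto
 then show ?thesis using N_powr H_ge by linarith
qed

lemma \<omega>_nonneg: "0 <= \<omega> i j z" by (simp add: \<omega>_def EE_def)

lemma EE_le_\<omega>: "EE (fst z) <= \<omega> i j z"
proof (cases "i <= 2 * m")
 case True
 have "real N powr - \<sigma> * \<omega> i j z <= 1 * \<omega> i j z" using N_powr_H H_le_1 \<omega>_nonneg by (intro mult_right_mono) auto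
 then show ?thesis using EE_\<omega>[OF True, of z j] by simp
qed (simp add: \<omega>_def)

text \<open>The left Radau projection is bounded by the left node value and the mean. On coarse
  cells both gain the factor \<open>\<epsilon>\<close>; on fine cells both are comparable with the
  layer value at x.\<close>

lemma radL_layer_bound:
 assumes i: "i \<in> {1..N}" and x: "x \<in> {X (i - 1)..X i}" and g: "continuous_on {X (i - 1)..X i} g"
  and S: "S \<ge> 0" "!!t. t \<in> {X (i - 1)..X i} ==> \<bar>g t\<bar> <= S * EE t"
 shows "\<bar>pj (radL k) (X (i - 1)) (X i) g x\<bar> <= CP * S * (if i <= 2 * m then 2 / \<alpha> * (H * \<epsilon>) else 2 * exp (2 * \<sigma>) * EE x)"
proof -
 let ?c = "X (i - 1)" and ?d = "X i"
 let ?A = "%t. ?c + (?d - ?c) * t"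
 note cd = gx.cell[OF i]
 have cont: "continuous_on {0..1} (%t. g (?A t))" by (rule continuous_on_unit_affine[OF cd g])
 have EEc: "continuous_on {0..1} (%t. EE (?A t))" unfolding EE_def using \<epsilon>0 by (intro continuous_intros) auto
 have node: "pnode (radL k) = 0" using radL[OF k] by simp
 have "\<bar>pj (radL k) ?c ?d g x\<bar> <= pjB (radL k) * (\<bar>g (?A (pnode (radL k)))\<bar> + integral {0..1} (%t. \<bar>g (?A t)\<bar>))"
  unfolding pj_def using interval_proj.unit_coord[OF proj(2) cd x] by (intro refpj_bound_L1 cont) auto
 also have "\<bar>g (?A (pnode (radL k)))\<bar> + integral {0..1} (%t. \<bar>g (?A t)\<bar>) <= S * EE ?c + integral {0..1} (%t. S * EE (?A t))"
 proof (rule add_mono)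
  show "\<bar>g (?A (pnode (radL k)))\<bar> <= S * EE ?c" using S(2)[of ?c] cd by (simp add: node)
  show "integral {0..1} (%t. \<bar>g (?A t)\<bar>) <= integral {0..1} (%t. S * EE (?A t))"
   using S(2)[OF unit_affine[OF cd]] by (intro integral_le integrable_continuous_real continuous_intros cont EEc) auto
 qed
 also have "... = S * (EE ?c + integral {0..1} (%t. EE (?A t)))" by (simp add: distrib_left)
 also have "EE ?c + integral {0..1} (%t. EE (?A t)) <= (if i <= 2 * m then 2 / \<alpha> * (H * \<epsilon>) else 2 * exp (2 * \<sigma>) * EE x)"
 proof (cases "i <= 2 * m")
  case True then show ?thesis using exp_coarse[OF i] by simp
 next
  case False
  have "integral {0..1} (%t. EE (?A t)) <= integral {0..1} (%t::real. exp (2 * \<sigma>) * EE x)"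
   using unit_affine[OF cd] by (intro integral_le integrable_continuous_real EEc continuous_intros EE_fine[OF i False x]) auto
  moreover have "EE ?c <= exp (2 * \<sigma>) * EE x" using cd by (intro EE_fine[OF i False x]) auto
  ultimately show ?thesis using False by simp
 qed
 finally have "\<bar>pj (radL k) ?c ?d g x\<bar> <= pjB (radL k) * (S * (if i <= 2 * m then 2 / \<alpha> * (H * \<epsilon>) else 2 * exp (2 * \<sigma>) * EE x))"
  using S(1) pjB_nonneg by (simp add: mult_left_mono)
 also have "... <= CP * (S * (if i <= 2 * m then 2 / \<alpha> * (H * \<epsilon>) else 2 * exp (2 * \<sigma>) * EE x))"
  using CP(2) S(1) \<alpha>0 \<epsilon>0 H_pos EE_pos[of x] by (intro mult_right_mono) (auto simp: three_projs_def intro!: mult_nonneg_nonneg)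
 finally show ?thesis by (simp add: mult.assoc)
qed

definition "CX\<omega> = CX + 1 + CP * (2 / \<alpha>) + CP * 2 * exp (2 * \<sigma>)"

text \<open>On coarse cells function and projection are bounded separately, the function by
  \<open>H * \<omega>\<close> and the projection by \<open>H * \<epsilon>\<close>; no cancellation
  between them is used. On fine cells the Taylor estimate applies and \<open>\<omega>\<close> is
  \<open>EE\<close> itself.\<close>

lemma X_error_radL_layer:
 assumes i: "i \<in> {1..N}" and z: "fst z \<in> {X (i - 1)..X i}" and D: "deriv_chain (X (i - 1)) (X i) D"
  and S: "S \<ge> 0" and b: "!!t. t \<in> {X (i - 1)..X i} ==> \<bar>D 0 t\<bar> <= S * EE t"
   "!!t. t \<in> {X (i - 1)..X i} ==> \<bar>D (Suc k) t\<bar> * \<epsilon> ^ Suc k <= S * EE t"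
 shows "\<bar>D 0 (fst z) - pj (radL k) (X (i - 1)) (X i) (D 0) (fst z)\<bar> <= CX\<omega> * S * H * (\<omega> i j z + \<epsilon>)"
proof -
 have K: "radL k \<in> three_projs" by (simp add: three_projs_def)
 have p: "(2 * \<sigma> / \<alpha>) ^ Suc k * exp (2 * \<sigma>) \<ge> 0" using \<sigma>0 \<alpha>0 by (auto intro!: mult_nonneg_nonneg)
 have q: "0 <= CP * (2 / \<alpha>)" "0 <= CP * 2 * exp (2 * \<sigma>)" "0 <= CX" using CP(3) \<alpha>0 p by (auto simp: CX_def intro!: mult_nonneg_nonneg)
 have SH: "S * H \<ge> 0" using S H_pos by simp
 show ?thesis
 proof (cases "i <= 2 * m")
  case False
  have "CP * ((2 * \<sigma> / \<alpha>) ^ Suc k * exp (2 * \<sigma>)) <= CX" unfolding CX_def using CP(3) by (intro mult_left_mono) auto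
  then have A: "CP * ((2 * \<sigma> / \<alpha>) ^ Suc k * exp (2 * \<sigma>)) <= CX\<omega>" using q by (simp add: CX\<omega>_def)
  have "0 <= CX\<omega> * (S * H)" by (rule mult_nonneg_nonneg[OF _ SH]) (use q in \<open>auto simp: CX\<omega>_def\<close>)
  then have "CP * ((2 * \<sigma> / \<alpha>) ^ Suc k * exp (2 * \<sigma>)) * (S * H) * EE (fst z) <= CX\<omega> * (S * H) * (\<omega> i j z + \<epsilon>)"
   using EE_pos[of "fst z"] \<epsilon>0 EE_le_\<omega>[of z i j] by (intro mult_mono mult_right_mono A SH) auto
  then show ?thesis using X_error_fine[OF K i False z D _ S] b(2) by (simp add: mult_ac)
 next
  case True
  have "\<bar>D 0 (fst z)\<bar> <= S * EE (fst z)" by (rule b(1)[OF z])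
  also have "EE (fst z) <= H * \<omega> i j z" unfolding EE_\<omega>[OF True, of z j] using N_powr_H \<omega>_nonneg by (intro mult_right_mono) auto
  finally have 1: "\<bar>D 0 (fst z)\<bar> <= S * H * \<omega> i j z" using S by (simp add: mult_left_mono mult.assoc)
  have 2: "\<bar>pj (radL k) (X (i - 1)) (X i) (D 0) (fst z)\<bar> <= CP * (2 / \<alpha>) * (S * H) * \<epsilon>"
   using radL_layer_bound[OF i z deriv_chain_cont[OF D] S b(1)] True by (simp add: mult_ac)
  have 3: "1 * (S * H) * \<omega> i j z <= CX\<omega> * (S * H) * \<omega> i j z" "CP * (2 / \<alpha>) * (S * H) * \<epsilon> <= CX\<omega> * (S * H) * \<epsilon>"
   using q SH \<omega>_nonneg \<epsilon>0 unfolding CX\<omega>_def by (intro mult_right_mono; simp)+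
  show ?thesis using 1 2 3 by (simp add: distrib_left mult.assoc)
 qed
qed

end

section \<open>Weighted bounds for the four solution components\<close>

context shishkin
begin

text \<open>The exponents \<mu> and \<nu>, each 0 or 1, say whether there is a layer in x and in y,
  so that the four components obey a single bound. The negative powers of \<open>\<epsilon>\<close>
  stand on the left as natural powers.\<close>

definition comp :: "nat => nat => real => fn2 => bool"
 where "comp \<mu> \<nu> C w \<longleftrightarrow> Ck (k + 2) Q01 w & (\<forall>x\<in>{0..1}. \<forall>y\<in>{0..1}. \<forall>i j. i + j <= k + 2 \<longrightarrow>
  \<bar>pd i j w (x, y)\<bar> * (\<epsilon> ^ (\<mu> * i) * sqrt \<epsilon> ^ (\<nu> * j)) <= C * EE x ^ \<mu> * FF y ^ \<nu>)"

lemma comp_pd_Ck: "comp \<mu> \<nu> C w ==> i + j <= k + 2 ==> Ck (k + 2 - (i + j)) Q01 (pd i j w)"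
 by (intro Ck_pd) (simp add: comp_def)

lemma comp_dx:
 assumes "comp \<mu> \<nu> C w" "i + j < k + 2" "x \<in> {0..1}" "y \<in> {0..1}"
 shows "((%t. pd i j w (t, y)) has_real_derivative pd (Suc i) j w (x, y)) (at x within {0..1})"
proof -
 have "Ck (Suc (k + 1 - (i + j))) Q01 (pd i j w)"
  using comp_pd_Ck[OF assms(1), of i j] assms(2) by (simp add: Suc_diff_le[symmetric])
 from Ck_dx[OF this assms(3,4)] show ?thesis by (simp add: pd_Suc_x)
qed

lemma comp_dy:
 assumes "comp \<mu> \<nu> C w" "i + j < k + 2" "x \<in> {0..1}" "y \<in> {0..1}"
 shows "((%t. pd i j w (x, t)) has_real_derivative pd i (Suc j) w (x, y)) (at y within {0..1})"
proof -
 have "Ck (Suc (k + 1 - (i + j))) Q01 (pd i j w)"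
  using comp_pd_Ck[OF assms(1), of i j] assms(2) by (simp add: Suc_diff_le[symmetric])
 from Ck_dy[OF this assms(3,4)] show ?thesis
  using pdy_pd[of "k + 2" w i j "(x, y)"] assms by (simp add: comp_def)
qed

lemma comp_cont: "comp \<mu> \<nu> C w ==> i + j <= k + 2 ==> continuous_on Q01 (pd i j w)"
 using Ck_continuous[OF comp_pd_Ck] by blast

lemma comp_bound:
 "comp \<mu> \<nu> C w ==> i + j <= k + 2 ==> x \<in> {0..1} ==> y \<in> {0..1} ==>
  \<bar>pd i j w (x, y)\<bar> * (\<epsilon> ^ (\<mu> * i) * sqrt \<epsilon> ^ (\<nu> * j)) <= C * EE x ^ \<mu> * FF y ^ \<nu>"
 by (simp add: comp_def)

lemma X_cell_unit: "i \<in> {1..N} ==> x \<in> {X (i - 1)..X i} ==> x \<in> {0..1}"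
 using gx.cell_subset RX_RY by blast

lemma Y_cell_unit: "j \<in> {1..N} ==> y \<in> {Y (j - 1)..Y j} ==> y \<in> {0..1}"
 using gy.cell_subset RX_RY by blast

definition "weight \<mu> \<nu> a b = \<epsilon> ^ (\<mu> * a) * sqrt \<epsilon> ^ (\<nu> * b)"
definition "rate i x = 1 / real N ^ Suc k + (if i <= 2 * m then 0 else H * EE x)"

context
 fixes \<mu> \<nu> :: nat and C :: real and w :: fn2 and a b :: nat
 assumes w: "comp \<mu> \<nu> C w" and \<mu>\<nu>: "\<mu> <= 1" "\<nu> <= 1" and C: "C \<ge> 0" and ab: "a + b <= 1"
begin

abbreviation "Wt \<equiv> weight \<mu> \<nu> a b"

lemma Wt_pos: "Wt > 0" using \<epsilon>0 by (simp add: weight_def)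

lemma Wt_abs: "\<bar>Wt * r\<bar> = Wt * \<bar>r\<bar>" using Wt_pos by (simp add: abs_mult)

text \<open>Errors are needed for derivatives of order \<open>a + b\<close> up to 1, and a
  projection error takes k + 1 further derivatives; this uses exactly the k + 2 available ones. The
  constant factor \<open>Wt\<close> normalises the starting derivative.\<close>

lemma X_chain:
 assumes i: "i \<in> {1..N}" and y: "y \<in> {0..1}"
 shows "deriv_chain (X (i - 1)) (X i) (%n t. Wt * pd (n + a) b w (t, y))"
 unfolding deriv_chain_def
proof (intro allI impI ballI)
 fix n t assume n: "n <= k" and t: "t \<in> {X (i - 1)..X i}"
 have "((%t. pd (n + a) b w (t, y)) has_real_derivative pd (Suc (n + a)) b w (t, y)) (at t within {0..1})"
  using n ab by (intro comp_dx[OF w _ X_cell_unit[OF i t] y]) auto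
 then have "((%t. pd (n + a) b w (t, y)) has_real_derivative pd (Suc (n + a)) b w (t, y)) (at t within {X (i - 1)..X i})"
  by (rule DERIV_subset) (use X_cell_unit[OF i] in blast)
 from DERIV_cmult[OF this, of Wt]
 show "((%t. Wt * pd (n + a) b w (t, y)) has_real_derivative Wt * pd (Suc n + a) b w (t, y)) (at t within {X (i - 1)..X i})"
  by simp
qed

lemma X_bounds:
 assumes "t \<in> {0..1}" "y \<in> {0..1}" and n: "n <= Suc k"
 shows "\<bar>Wt * pd (n + a) b w (t, y)\<bar> * \<epsilon> ^ (\<mu> * n) <= 2 * C * EE t ^ \<mu>"
proof -
 have "\<bar>Wt * pd (n + a) b w (t, y)\<bar> * \<epsilon> ^ (\<mu> * n) = \<bar>pd (n + a) b w (t, y)\<bar> * (\<epsilon> ^ (\<mu> * (n + a)) * sqrt \<epsilon> ^ (\<nu> * b))"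
  unfolding Wt_abs by (simp add: weight_def power_add distrib_left mult_ac)
 also have "... <= C * EE t ^ \<mu> * FF y ^ \<nu>" using n ab by (intro comp_bound[OF w _ assms(1,2)]) auto
 also have "... <= C * EE t ^ \<mu> * 2"
 proof (intro mult_left_mono)
  show "FF y ^ \<nu> <= 2" using \<mu>\<nu> FF_le_2[of y] assms(2) by (cases "\<nu> = 0") (auto simp: le_Suc_eq)
  show "0 <= C * EE t ^ \<mu>" using C EE_pos[of t] by simp
 qed
 finally show ?thesis by simp
qed

lemma pull_X: "i \<in> {1..N} ==> K \<in> three_projs ==>
 \<bar>Wt * pd a b w (x, y) - pj K (X (i - 1)) (X i) (%t. Wt * pd a b w (t, y)) x\<bar> = \<bar>pd a b w (x, y) - PX K X i (pd a b w) (x, y)\<bar> * Wt"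
proof -
 assume "K \<in> three_projs"
 then obtain l where "interval_proj k l K" using three_projs by blast
 then have "pj K (X (i - 1)) (X i) (%t. Wt * pd a b w (t, y)) x = Wt * PX K X i (pd a b w) (x, y)"
  by (simp add: interval_proj.pj_cmult PX_def)
 then show ?thesis using Wt_pos by (simp add: abs_mult mult.commute flip: right_diff_distrib)
qed

lemma comp_X:
 assumes K: "K \<in> three_projs" and i: "i \<in> {1..N}" and x: "x \<in> {X (i - 1)..X i}" and y: "y \<in> {0..1}"
 shows "\<bar>pd a b w (x, y) - PX K X i (pd a b w) (x, y)\<bar> * Wt
  <= CX * (2 * C) * rate i x"
 unfolding pull_X[OF i K, symmetric] rate_def
 using X_error[OF K i x X_chain[OF i y] \<mu>\<nu>(1), of "2 * C"] C
  X_bounds[OF X_cell_unit[OF i] y, of _ 0] X_bounds[OF X_cell_unit[OF i] y, of _ "Suc k"]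
 by simp

lemma comp_X_layer:
 assumes i: "i \<in> {1..N}" and x: "x \<in> {X (i - 1)..X i}" and y: "y \<in> {0..1}" and \<mu>1: "\<mu> = 1"
 shows "\<bar>pd a b w (x, y) - PX (radL k) X i (pd a b w) (x, y)\<bar> * Wt <= CX\<omega> * (2 * C) * H * (\<omega> i j (x, y) + \<epsilon>)"
proof -
 have K: "radL k \<in> three_projs" by (simp add: three_projs_def)
 show ?thesis unfolding pull_X[OF i K, symmetric]
  using X_error_radL_layer[OF i _ X_chain[OF i y], of "(x, y)" "2 * C" j] C x \<mu>1
   X_bounds[OF X_cell_unit[OF i] y, of _ 0] X_bounds[OF X_cell_unit[OF i] y, of _ "Suc k"]
  by simp
qed

text \<open>The point x stays fixed while projecting in y, so the layer factor in x passes unchanged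
  into the bound.\<close>

lemma comp_Y:
 assumes K: "K \<in> three_projs" and j: "j \<in> {1..N}" and x: "x \<in> {0..1}" and y: "y \<in> {Y (j - 1)..Y j}"
 shows "\<bar>pd a b w (x, y) - PY K Y j (pd a b w) (x, y)\<bar> * Wt <= CY * (C * EE x ^ \<mu>) * H"
proof -
 obtain l where l: "interval_proj k l K" using three_projs[OF K] by blast
 have D: "deriv_chain (Y (j - 1)) (Y j) (%n t. Wt * pd a (n + b) w (x, t))"
  unfolding deriv_chain_def
 proof (intro allI impI ballI)
  fix n t assume n: "n <= k" and t: "t \<in> {Y (j - 1)..Y j}"
  have "((%t. pd a (n + b) w (x, t)) has_real_derivative pd a (Suc (n + b)) w (x, t)) (at t within {0..1})"
   using n ab by (intro comp_dy[OF w _ x Y_cell_unit[OF j t]]) auto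
  then have "((%t. pd a (n + b) w (x, t)) has_real_derivative pd a (Suc (n + b)) w (x, t)) (at t within {Y (j - 1)..Y j})"
   by (rule DERIV_subset) (use Y_cell_unit[OF j] in blast)
  from DERIV_cmult[OF this, of Wt]
  show "((%t. Wt * pd a (n + b) w (x, t)) has_real_derivative Wt * pd a (Suc n + b) w (x, t)) (at t within {Y (j - 1)..Y j})"
   by simp
 qed
 have B: "\<bar>Wt * pd a (n + b) w (x, t)\<bar> * sqrt \<epsilon> ^ (\<nu> * n) <= (C * EE x ^ \<mu>) * FF t ^ \<nu>"
  if n: "n <= Suc k" and t: "t \<in> {Y (j - 1)..Y j}" for n t
 proof -
  have "\<bar>Wt * pd a (n + b) w (x, t)\<bar> * sqrt \<epsilon> ^ (\<nu> * n) = \<bar>pd a (n + b) w (x, t)\<bar> * (\<epsilon> ^ (\<mu> * a) * sqrt \<epsilon> ^ (\<nu> * (n + b)))"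
   unfolding Wt_abs by (simp add: weight_def power_add distrib_left mult_ac)
  also have "... <= C * EE x ^ \<mu> * FF t ^ \<nu>" using n ab by (intro comp_bound[OF w _ x Y_cell_unit[OF j t]]) auto
  finally show ?thesis .
 qed
 have "pj K (Y (j - 1)) (Y j) (%t. Wt * pd a b w (x, t)) y = Wt * PY K Y j (pd a b w) (x, y)"
  by (simp add: interval_proj.pj_cmult[OF l] PY_def)
 then have "\<bar>Wt * pd a b w (x, y) - pj K (Y (j - 1)) (Y j) (%t. Wt * pd a b w (x, t)) y\<bar> = \<bar>pd a b w (x, y) - PY K Y j (pd a b w) (x, y)\<bar> * Wt"
  using Wt_pos by (simp add: abs_mult mult.commute flip: right_diff_distrib)
 moreover have "C * EE x ^ \<mu> \<ge> 0" using C EE_pos[of x] by simp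
 ultimately show ?thesis using Y_error[OF K j y D \<mu>\<nu>(2), of "C * EE x ^ \<mu>"] B[of 0] B[of "Suc k"] by simp
qed

end

text \<open>The condition on the transition point, together with ln N at least 1, bounds
  \<open>\<epsilon>\<close> by data alone. Powers of \<open>\<epsilon>\<close> that are too high can
  therefore be reduced at the cost of a constant.\<close>

lemma \<epsilon>_bound: "\<epsilon> <= \<alpha> / (2 * \<sigma>)"
proof -
 have "\<sigma> * \<epsilon> / \<alpha> * 1 <= \<sigma> * \<epsilon> / \<alpha> * ln (real N)"
  using lnN \<sigma>0 \<epsilon>0 \<alpha>0 by (intro mult_left_mono) auto
 then have "\<sigma> * \<epsilon> / \<alpha> <= 1 / 2" using \<tau>1 unfolding tau1_def by linarith
 then show ?thesis using \<sigma>0 \<alpha>0 by (simp add: field_simps)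
qed

lemma sqrt_\<epsilon>_bound: "sqrt \<epsilon> <= 1 + \<alpha> / (2 * \<sigma>)"
proof -
 have "(sqrt \<epsilon>)\<^sup>2 <= (1 + \<epsilon>)\<^sup>2" using \<epsilon>0 by (simp add: power2_sum)
 then have "sqrt \<epsilon> <= 1 + \<epsilon>" by (rule power2_le_imp_le) (use \<epsilon>0 in simp)
 then show ?thesis using \<epsilon>_bound by linarith
qed

lemma EE_square_integral: 
 assumes "c <= d"
 shows "integral {c..d} (%x. (EE x)\<^sup>2) = \<epsilon> / (2 * \<alpha>) * ((EE d)\<^sup>2 - (EE c)\<^sup>2)"
proof -
 have "((%x. (EE x)\<^sup>2) has_integral \<epsilon> / (2 * \<alpha>) * (EE d)\<^sup>2 - \<epsilon> / (2 * \<alpha>) * (EE c)\<^sup>2) {c..d}"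
 proof (intro fundamental_theorem_of_calculus assms)
  fix x
  have "((%x. \<epsilon> / (2 * \<alpha>) * (EE x)\<^sup>2) has_real_derivative (EE x)\<^sup>2) (at x within {c..d})"
   unfolding EE_def using \<epsilon>0 \<alpha>0 by (auto intro!: derivative_eq_intros simp: power2_eq_square)
  then show "((%x. \<epsilon> / (2 * \<alpha>) * (EE x)\<^sup>2) has_vector_derivative (EE x)\<^sup>2) (at x within {c..d})"
   by (simp add: has_real_derivative_iff_has_vector_derivative)
 qed
 then show ?thesis by (simp add: integral_unique right_diff_distrib)
qed

lemma cont_EE: "continuous_on S EE"
 unfolding EE_def[abs_def] using \<epsilon>0 by (intro continuous_intros) auto

lemma L1_EE_square: "L1 N X (%i x. (EE x)\<^sup>2) <= \<epsilon> / (2 * \<alpha>)"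
proof -
 have "L1 N X (%i x. (EE x)\<^sup>2) = integral {0..1} (%x. (EE x)\<^sup>2)"
  using gx.L1_whole[of "%x. (EE x)\<^sup>2"] RX_RY by (simp add: continuous_intros cont_EE)
 also have "... = \<epsilon> / (2 * \<alpha>) * ((EE 1)\<^sup>2 - (EE 0)\<^sup>2)" by (rule EE_square_integral) simp
 also have "... <= \<epsilon> / (2 * \<alpha>) * 1" using \<epsilon>0 \<alpha>0 EE_le_1[of 1] EE_pos[of 1]
  by (intro mult_left_mono) (auto simp: EE_def)
 finally show ?thesis by simp
qed

lemma pc2_\<omega>: "pc2 N X Y \<omega>"
 unfolding pc2_def
proof (intro ballI)
 fix i j
 show "continuous_on (cl i j) (\<omega> i j)"
  unfolding \<omega>_def EE_def using \<epsilon>0 by (cases "i <= 2 * m") (auto intro!: continuous_intros)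
qed

text \<open>The shifted profile on the coarse columns and \<open>EE\<close> on the fine ones both
  end with the value at most 1, and each contributes at most half of the bound.\<close>

lemma \<omega>_square: "L2D N X Y (%i j z. (\<omega> i j z)\<^sup>2) <= 1 / \<alpha> * \<epsilon>"
proof -
 let ?w = "%(i::nat) x. (if i <= 2 * m then exp (- \<alpha> * (1 - \<tau>x - x) / \<epsilon>) else EE x)\<^sup>2"
 have sub: "2 * m <= N" using N4 by simp
 have nn: "0 <= integral {X (i - 1)..X i} (%x. (EE x)\<^sup>2)" for i
  by (intro integral_nonneg integrable_continuous_real continuous_intros cont_EE) auto
 interpret c: grid "2 * m" X
  using gx.strict sub N4 by unfold_locales auto
 have s: "exp (- \<alpha> * (1 - \<tau>x - x) / \<epsilon>) = EE (x + \<tau>x)" for x by (simp add: EE_def algebra_simps)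
 have X2m: "X (2 * m) = 1 - \<tau>x" using X_coarse[of "2 * m"] rN by simp
 have "L1 (2 * m) X (%i x. (EE (x + \<tau>x))\<^sup>2) = integral {X 0..X (2 * m)} (%x. (EE (x + \<tau>x))\<^sup>2)"
  by (intro c.L1_whole continuous_intros continuous_on_compose2[OF cont_EE[of UNIV]]) auto
 also have "... = \<epsilon> / (2 * \<alpha>) * ((EE (X (2 * m) + \<tau>x))\<^sup>2 - (EE (X 0 + \<tau>x))\<^sup>2)"
 proof -
  have "((%x. (EE (x + \<tau>x))\<^sup>2) has_integral \<epsilon> / (2 * \<alpha>) * (EE (X (2 * m) + \<tau>x))\<^sup>2 - \<epsilon> / (2 * \<alpha>) * (EE (X 0 + \<tau>x))\<^sup>2) {X 0..X (2 * m)}"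
  proof (intro fundamental_theorem_of_calculus)
   show "X 0 <= X (2 * m)" using gx.X_mono[of 0 "2 * m"] sub by simp
   fix x
   have "((%x. \<epsilon> / (2 * \<alpha>) * (EE (x + \<tau>x))\<^sup>2) has_real_derivative (EE (x + \<tau>x))\<^sup>2) (at x within {X 0..X (2 * m)})"
    unfolding EE_def using \<epsilon>0 \<alpha>0 by (auto intro!: derivative_eq_intros simp: power2_eq_square)
   then show "((%x. \<epsilon> / (2 * \<alpha>) * (EE (x + \<tau>x))\<^sup>2) has_vector_derivative (EE (x + \<tau>x))\<^sup>2) (at x within {X 0..X (2 * m)})"
    by (simp add: has_real_derivative_iff_has_vector_derivative)
  qed
  then show ?thesis by (simp add: integral_unique right_diff_distrib)
 qed
 also have "... <= \<epsilon> / (2 * \<alpha>) * 1" using \<epsilon>0 \<alpha>0 by (intro mult_left_mono) (auto simp: X2m EE_def)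
 finally have A: "L1 (2 * m) X (%i x. (EE (x + \<tau>x))\<^sup>2) <= \<epsilon> / (2 * \<alpha>)" by simp
 have "L1 N X ?w = (\<Sum>i=1..2*m. integral {X (i - 1)..X i} (?w i)) + (\<Sum>i=2*m+1..N. integral {X (i - 1)..X i} (?w i))"
  unfolding L1_def using sub sum.ub_add_nat[of 1 "2 * m" "%i. integral {X (i - 1)..X i} (?w i)" "N - 2 * m"] by simp
 also have "... <= L1 (2 * m) X (%i x. (EE (x + \<tau>x))\<^sup>2) + L1 N X (%i x. (EE x)\<^sup>2)"
 proof (rule add_mono)
  show "(\<Sum>i=1..2*m. integral {X (i - 1)..X i} (?w i)) <= L1 (2 * m) X (%i x. (EE (x + \<tau>x))\<^sup>2)"
   unfolding L1_def s by simp
  have "(\<Sum>i=2*m+1..N. integral {X (i - 1)..X i} (?w i)) = (\<Sum>i=2*m+1..N. integral {X (i - 1)..X i} (%x. (EE x)\<^sup>2))"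
   by (intro sum.cong) auto
  also have "... <= L1 N X (%i x. (EE x)\<^sup>2)"
   unfolding L1_def by (intro sum_mono2) (auto simp: nn[simplified])
  finally show "(\<Sum>i=2*m+1..N. integral {X (i - 1)..X i} (?w i)) <= L1 N X (%i x. (EE x)\<^sup>2)" .
 qed
 also have "... <= \<epsilon> / (2 * \<alpha>) + \<epsilon> / (2 * \<alpha>)" using A L1_EE_square by linarith
 finally have "L1 N X ?w <= 1 / \<alpha> * \<epsilon>" by (simp add: field_simps)
 then have "L1 N Y (%j y. L1 N X ?w) <= L1 N Y (%_ _. 1 / \<alpha> * \<epsilon>)" by (intro L1_mono pc_const)
 moreover have "(%i x. (\<omega> i j (x, y))\<^sup>2) = ?w" for j y by (simp add: \<omega>_def fun_eq_iff)
 ultimately show ?thesis using gy.L1_const[of "1 / \<alpha> * \<epsilon>"] unfolding L2D_def by (simp add: Y_ends)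
qed

end

section \<open>Errors of the assembled solution and its first derivatives\<close>

locale shishkin_solution = shishkin k N m \<alpha> \<delta> \<sigma> \<epsilon> for k N m :: nat and \<alpha> \<delta> \<sigma> \<epsilon> :: real +
 fixes u0 u1 u2 u12 :: fn2 and CR :: real
 assumes comps: "comp 0 0 CR u0" "comp 1 0 CR u1" "comp 0 1 CR u2" "comp 1 1 CR u12" and CR: "CR \<ge> 0"
begin

text \<open>Derivatives of the solution are introduced as sums of derivatives of the components,
  which are the quantities with known bounds; \<open>pdx_tot\<close> and \<open>pdy_tot\<close>
  identify them with derivatives of the sum. \<open>tota\<close> collects the components without a
  layer in x.\<close>

definition "tota a b = (%z. pd a b u0 z + pd a b u2 z)"
definition "totb a b = (%z. pd a b u1 z + pd a b u12 z)"
definition "tot a b = (%z. tota a b z + totb a b z)"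

lemma cont_tot:
 assumes "a + b <= k + 2"
 shows "continuous_on Q01 (tota a b)" "continuous_on Q01 (totb a b)" "continuous_on Q01 (tot a b)"
 unfolding tot_def tota_def totb_def by (intro continuous_intros comp_cont[OF comps(1)] comp_cont[OF comps(2)]
   comp_cont[OF comps(3)] comp_cont[OF comps(4)] assms)+

lemma X_line: "continuous_on Q01 (f :: fn2) ==> i \<in> {1..N} ==> y \<in> {0..1} ==> continuous_on {X (i - 1)..X i} (%x. f (x, y))"
 by (rule continuous_on_subset[OF continuous_on_line_x[of "{0..1}" "{0..1}" f y]]) (use X_cell_unit in blast)+

lemma Y_line: "continuous_on Q01 (f :: fn2) ==> j \<in> {1..N} ==> x \<in> {0..1} ==> continuous_on {Y (j - 1)..Y j} (%y. f (x, y))"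
 by (rule continuous_on_subset[OF continuous_on_line_y[of "{0..1}" "{0..1}" f x]]) (use Y_cell_unit in blast)+

lemma PX_add:
 assumes "K \<in> three_projs" "i \<in> {1..N}" "y \<in> {0..1}" "continuous_on Q01 f" "continuous_on Q01 g"
 shows "PX K X i (%z. f z + g z) (x, y) = PX K X i f (x, y) + PX K X i g (x, y)"
 using three_projs[OF assms(1)] interval_proj.pj_add[OF _ gx.cell[OF assms(2)] X_line[OF assms(4,2,3)] X_line[OF assms(5,2,3)]]
 by (auto simp: PX_def)

lemma PY_add:
 assumes "K \<in> three_projs" "j \<in> {1..N}" "x \<in> {0..1}" "continuous_on Q01 f" "continuous_on Q01 g"
 shows "PY K Y j (%z. f z + g z) (x, y) = PY K Y j f (x, y) + PY K Y j g (x, y)"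
 using three_projs[OF assms(1)] interval_proj.pj_add[OF _ gy.cell[OF assms(2)] Y_line[OF assms(4,2,3)] Y_line[OF assms(5,2,3)]]
 by (auto simp: PY_def)

definition "e0 = \<alpha> / (2 * \<sigma>)"
definition "B = 16 * (CX + CX\<omega> + CY) * CR * (2 + e0)"

lemma e0_pos: "e0 > 0" using \<alpha>0 \<sigma>0 by (simp add: e0_def)

lemma consts_nonneg: "CX \<ge> 0" "CX\<omega> \<ge> 0" "CY \<ge> 0" "B \<ge> 0"
proof -
 have "(2 * \<sigma> / \<alpha>) ^ Suc k * exp (2 * \<sigma>) \<ge> 0" "(4 * \<sigma> / \<delta>) ^ Suc k \<ge> 0" using \<sigma>0 \<alpha>0 \<delta>0 by auto
 then show 1: "CX \<ge> 0" "CY \<ge> 0" using CP(3) by (auto simp: CX_def CY_def intro!: mult_nonneg_nonneg)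
 then show 2: "CX\<omega> \<ge> 0" using CP(3) \<alpha>0 by (auto simp: CX\<omega>_def intro!: add_nonneg_nonneg mult_nonneg_nonneg)
 show "B \<ge> 0" unfolding B_def using 1 2 CR e0_pos by (intro mult_nonneg_nonneg) auto
qed

text \<open>\<open>B\<close> dominates every combination of the constants of the four components that occurs below.\<close>

lemma B_ge:
 assumes "0 <= r" "r <= 16 * (2 + e0)"
 shows "CX * CR * r <= B" "CX\<omega> * CR * r <= B" "CY * CR * r <= B"
proof -
 have "C * CR * r <= B" if "0 <= C" "C <= CX + CX\<omega> + CY" for C
 proof -
  have "C * CR * r <= (CX + CX\<omega> + CY) * CR * (16 * (2 + e0))"
   using that assms CR by (intro mult_mono) (auto intro: mult_nonneg_nonneg)
  also have "... = B" by (simp only: B_def mult.assoc mult.commute mult.left_commute)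
  finally show ?thesis .
 qed
 then show "CX * CR * r <= B" "CX\<omega> * CR * r <= B" "CY * CR * r <= B" using consts_nonneg by auto
qed

lemma tot_PX_error:
 assumes K: "K \<in> three_projs" and i: "i \<in> {1..N}" and y: "y \<in> {0..1}" and ab: "a + b <= k + 2"
 shows "\<bar>tot a b (x, y) - PX K X i (tot a b) (x, y)\<bar>
  <= \<bar>pd a b u0 (x, y) - PX K X i (pd a b u0) (x, y)\<bar> + \<bar>pd a b u2 (x, y) - PX K X i (pd a b u2) (x, y)\<bar>
   + \<bar>pd a b u1 (x, y) - PX K X i (pd a b u1) (x, y)\<bar> + \<bar>pd a b u12 (x, y) - PX K X i (pd a b u12) (x, y)\<bar>"
 unfolding tot_def
 using PX_add[OF K i y cont_tot(1,2)[OF ab]] PX_add[OF K i y comp_cont[OF comps(1) ab] comp_cont[OF comps(3) ab]]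
  PX_add[OF K i y comp_cont[OF comps(2) ab] comp_cont[OF comps(4) ab]]
 by (simp add: tota_def totb_def)

lemma tota_PY_error:
 assumes K: "K \<in> three_projs" and j: "j \<in> {1..N}" and x: "x \<in> {0..1}" and ab: "a + b <= k + 2"
 shows "\<bar>tota a b (x, y) - PY K Y j (tota a b) (x, y)\<bar>
  <= \<bar>pd a b u0 (x, y) - PY K Y j (pd a b u0) (x, y)\<bar> + \<bar>pd a b u2 (x, y) - PY K Y j (pd a b u2) (x, y)\<bar>"
 using PY_add[OF K j x comp_cont[OF comps(1) ab] comp_cont[OF comps(3) ab]] by (simp add: tota_def)

lemma totb_PY_error:
 assumes K: "K \<in> three_projs" and j: "j \<in> {1..N}" and x: "x \<in> {0..1}" and ab: "a + b <= k + 2"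
 shows "\<bar>totb a b (x, y) - PY K Y j (totb a b) (x, y)\<bar>
  <= \<bar>pd a b u1 (x, y) - PY K Y j (pd a b u1) (x, y)\<bar> + \<bar>pd a b u12 (x, y) - PY K Y j (pd a b u12) (x, y)\<bar>"
 using PY_add[OF K j x comp_cont[OF comps(2) ab] comp_cont[OF comps(4) ab]] by (simp add: totb_def)

lemma tot_PY_error:
 assumes K: "K \<in> three_projs" and j: "j \<in> {1..N}" and x: "x \<in> {0..1}" and ab: "a + b <= k + 2"
 shows "\<bar>tot a b (x, y) - PY K Y j (tot a b) (x, y)\<bar>
  <= \<bar>tota a b (x, y) - PY K Y j (tota a b) (x, y)\<bar> + \<bar>totb a b (x, y) - PY K Y j (totb a b) (x, y)\<bar>"
 using PY_add[OF K j x cont_tot(1,2)[OF ab]] by (simp add: tot_def)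

lemma rate_le: "x <= 1 ==> rate i x <= 2 * H"
proof -
 assume "x <= 1"
 then have "H * EE x <= H * 1" using H_pos EE_le_1[of x] by (intro mult_left_mono) auto
 moreover have "rate i x <= 1 / real N ^ Suc k + H * EE x" using H_pos EE_pos[of x] by (simp add: rate_def)
 ultimately show ?thesis using H_ge by linarith
qed

lemma rate_nonneg: "0 <= rate i x"
 using H_pos EE_pos[of x] by (simp add: rate_def less_imp_le)

text \<open>The profile \<open>rate\<close> is kept rather than its bound \<open>2 * H\<close>,
  because the jump estimate sums its squares over the columns.\<close>

lemma error_u_X:
 assumes K: "K \<in> three_projs" and i: "i \<in> {1..N}" and x: "x \<in> {X (i - 1)..X i}" and y: "y \<in> {0..1}"
 shows "\<bar>tot 0 0 (x, y) - PX K X i (tot 0 0) (x, y)\<bar> <= B / 2 * rate i x"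
proof -
 have "\<bar>tot 0 0 (x, y) - PX K X i (tot 0 0) (x, y)\<bar> <= 4 * (CX * (2 * CR) * rate i x)"
  using tot_PX_error[OF K i y, of 0 0 x] comp_X[OF comps(1) _ _ CR _ K i x y, of 0 0] comp_X[OF comps(2) _ _ CR _ K i x y, of 0 0]
   comp_X[OF comps(3) _ _ CR _ K i x y, of 0 0] comp_X[OF comps(4) _ _ CR _ K i x y, of 0 0]
  by (simp add: weight_def)
 also have "... = CX * CR * 16 / 2 * rate i x" by simp
 also have "... <= B / 2 * rate i x" using e0_pos rate_nonneg by (intro mult_right_mono divide_right_mono B_ge) auto
 finally show ?thesis .
qed

lemma error_u_X_sup:
 assumes K: "K \<in> three_projs" and i: "i \<in> {1..N}" and x: "x \<in> {X (i - 1)..X i}" and y: "y \<in> {0..1}"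
 shows "\<bar>tot 0 0 (x, y) - PX K X i (tot 0 0) (x, y)\<bar> <= B * H"
 using error_u_X[OF assms] mult_left_mono[OF rate_le[of x i], of "B / 2"] X_cell_unit[OF i x] consts_nonneg(4) by auto

lemma error_uy_X:
 assumes K: "K \<in> three_projs" and i: "i \<in> {1..N}" and x: "x \<in> {X (i - 1)..X i}" and y: "y \<in> {0..1}"
 shows "sqrt \<epsilon> * \<bar>tot 0 1 (x, y) - PX K X i (tot 0 1) (x, y)\<bar> <= B * H"
proof -
 let ?e = "%w. \<bar>pd 0 1 w (x, y) - PX K X i (pd 0 1 w) (x, y)\<bar>"
 have r: "CX * (2 * CR) * rate i x <= CX * (2 * CR) * (2 * H)"
  using rate_le[of x i] X_cell_unit[OF i x] consts_nonneg CR by (intro mult_left_mono) auto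
 have 1: "?e u0 <= CX * (2 * CR) * (2 * H)" "?e u1 <= CX * (2 * CR) * (2 * H)"
  "?e u2 * sqrt \<epsilon> <= CX * (2 * CR) * (2 * H)" "?e u12 * sqrt \<epsilon> <= CX * (2 * CR) * (2 * H)"
  by (rule order_trans[OF _ r], use comp_X[OF comps(1) _ _ CR _ K i x y, of 0 1] comp_X[OF comps(2) _ _ CR _ K i x y, of 0 1]
   comp_X[OF comps(3) _ _ CR _ K i x y, of 0 1] comp_X[OF comps(4) _ _ CR _ K i x y, of 0 1] in \<open>simp add: weight_def\<close>)+
 have "sqrt \<epsilon> * \<bar>tot 0 1 (x, y) - PX K X i (tot 0 1) (x, y)\<bar> <= sqrt \<epsilon> * (?e u0 + ?e u2 + ?e u1 + ?e u12)"
  using tot_PX_error[OF K i y, of 0 1 x] \<epsilon>0 by (intro mult_left_mono) auto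
 also have "... <= sqrt \<epsilon> * (CX * (2 * CR) * (2 * H)) + CX * (2 * CR) * (2 * H) + sqrt \<epsilon> * (CX * (2 * CR) * (2 * H)) + CX * (2 * CR) * (2 * H)"
  unfolding distrib_left using \<epsilon>0 1(3,4) by (intro add_mono mult_left_mono 1(1,2)) (auto simp: mult.commute)
 also have "... = CX * CR * (8 * sqrt \<epsilon> + 8) * H" by (simp add: algebra_simps)
 also have "... <= B * H" using sqrt_\<epsilon>_bound e0_pos \<epsilon>0 H_pos by (intro mult_right_mono B_ge) (auto simp: e0_def)
 finally show ?thesis .
qed

text \<open>The \<open>\<epsilon>\<close> in the weight comes from the components without a layer in
  x: their x derivatives are bounded, so \<open>\<epsilon>\<close> times their error is of order
  \<open>H * \<epsilon>\<close>. The layer components use the left Radau estimate and also bring in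
  \<open>\<omega>\<close>.\<close>

lemma error_ux_X:
 assumes i: "i \<in> {1..N}" and x: "x \<in> {X (i - 1)..X i}" and y: "y \<in> {0..1}"
 shows "\<epsilon> * \<bar>tot 1 0 (x, y) - PX (radL k) X i (tot 1 0) (x, y)\<bar> <= B * H * (\<omega> i j (x, y) + \<epsilon>)"
proof -
 have K: "radL k \<in> three_projs" by (simp add: three_projs_def)
 let ?e = "%w. \<bar>pd 1 0 w (x, y) - PX (radL k) X i (pd 1 0 w) (x, y)\<bar>"
 let ?o = "\<omega> i j (x, y) + \<epsilon>"
 have o: "?o \<ge> \<epsilon>" "?o \<ge> 0" using \<omega>_nonneg[of i j "(x, y)"] \<epsilon>0 by auto
 have r: "CX * (2 * CR) * rate i x <= CX * (2 * CR) * (2 * H)"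
  using rate_le[of x i] X_cell_unit[OF i x] consts_nonneg CR by (intro mult_left_mono) auto
 have 1: "?e u0 <= CX * (2 * CR) * (2 * H)" "?e u2 <= CX * (2 * CR) * (2 * H)"
  by (rule order_trans[OF _ r], use comp_X[OF comps(1) _ _ CR _ K i x y, of 1 0] comp_X[OF comps(3) _ _ CR _ K i x y, of 1 0]
   in \<open>simp add: weight_def\<close>)+
 have 2: "\<epsilon> * ?e u1 <= CX\<omega> * (2 * CR) * H * ?o" "\<epsilon> * ?e u12 <= CX\<omega> * (2 * CR) * H * ?o"
  using comp_X_layer[OF comps(2) _ _ CR _ i x y, of 1 0 j] comp_X_layer[OF comps(4) _ _ CR _ i x y, of 1 0 j]
  by (simp_all add: weight_def mult.commute)
 have 3: "\<epsilon> * ?e w <= CX * (2 * CR) * (2 * H) * ?o" if "?e w <= CX * (2 * CR) * (2 * H)" for w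
 proof -
  have "\<epsilon> * ?e w <= ?o * (CX * (2 * CR) * (2 * H))" using that o \<epsilon>0 by (intro mult_mono) auto
  then show ?thesis by (simp add: mult_ac)
 qed
 have "\<epsilon> * \<bar>tot 1 0 (x, y) - PX (radL k) X i (tot 1 0) (x, y)\<bar> <= \<epsilon> * (?e u0 + ?e u2 + ?e u1 + ?e u12)"
  using tot_PX_error[OF K i y, of 1 0 x] \<epsilon>0 by (intro mult_left_mono) auto
 also have "... <= CX * (2 * CR) * (2 * H) * ?o + CX * (2 * CR) * (2 * H) * ?o + CX\<omega> * (2 * CR) * H * ?o + CX\<omega> * (2 * CR) * H * ?o"
  unfolding distrib_left[of \<epsilon>] by (intro add_mono 2 3 1)
 also have "... = (CX * CR * 16 + CX\<omega> * CR * 8) / 2 * (H * ?o)" by (simp add: algebra_simps)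
 also have "... <= B * (H * ?o)"
 proof (intro mult_right_mono)
  have "CX * CR * 16 <= B" "CX\<omega> * CR * 8 <= B" using e0_pos by (intro B_ge; simp)+
  then have "(CX * CR * 16 + CX\<omega> * CR * 8) / 2 <= (B + B) / 2" by (intro divide_right_mono add_mono) auto
  then show "(CX * CR * 16 + CX\<omega> * CR * 8) / 2 <= B" by simp
  show "0 <= H * ?o" using H_pos o by auto
 qed
 finally show ?thesis by simp
qed

text \<open>The layer factor \<open>EE x\<close> is retained where it is needed later: in the third
  bound, so that the left Radau projection of the flux becomes small, and in the fifth, where the
  energy asks for smallness in the mean.\<close>

lemma error_Y:
 assumes K: "K \<in> three_projs" and j: "j \<in> {1..N}" and x: "x \<in> {0..1}" and y: "y \<in> {Y (j - 1)..Y j}"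
 shows "\<bar>tota 0 0 (x, y) - PY K Y j (tota 0 0) (x, y)\<bar> <= B / 2 * H"
  and "\<bar>tota 1 0 (x, y) - PY K Y j (tota 1 0) (x, y)\<bar> <= B / 2 * H"
  and "\<bar>totb 0 0 (x, y) - PY K Y j (totb 0 0) (x, y)\<bar> <= B / 2 * H * EE x"
  and "\<bar>tot 0 0 (x, y) - PY K Y j (tot 0 0) (x, y)\<bar> <= B * H"
  and "\<epsilon> * \<bar>tot 1 0 (x, y) - PY K Y j (tot 1 0) (x, y)\<bar> <= B * H * (EE x + \<epsilon>)"
  and "sqrt \<epsilon> * \<bar>tot 0 1 (x, y) - PY K Y j (tot 0 1) (x, y)\<bar> <= B * H"
proof -
 let ?e = "%a b w. \<bar>pd a b w (x, y) - PY K Y j (pd a b w) (x, y)\<bar>"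
 have E1: "EE x <= 1" "0 < EE x" using EE_le_1[of x] EE_pos x by auto
 have Bs: "CY * CR * 4 <= B" using e0_pos by (intro B_ge) auto
 have BH: "CY * CR * 2 * r <= B / 2 * r" if "r \<ge> 0" for r using Bs that by (intro mult_right_mono) auto
 have EB: "CY * (CR * EE x) * H <= CY * CR * H"
  using consts_nonneg CR E1 H_pos by (simp add: mult_left_mono mult_right_mono mult_left_le)
 note c = comp_Y[OF comps(1) _ _ CR _ K j x y] comp_Y[OF comps(3) _ _ CR _ K j x y]
  comp_Y[OF comps(2) _ _ CR _ K j x y] comp_Y[OF comps(4) _ _ CR _ K j x y]
 have 1: "\<bar>tota 0 0 (x, y) - PY K Y j (tota 0 0) (x, y)\<bar> <= CY * CR * 2 * H"
  using tota_PY_error[OF K j x, of 0 0 y] c(1)[of 0 0] c(2)[of 0 0] by (simp add: weight_def)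
 then show a: "\<bar>tota 0 0 (x, y) - PY K Y j (tota 0 0) (x, y)\<bar> <= B / 2 * H" by (rule order_trans[OF _ BH]) (use H_pos in simp)
 have 2: "\<bar>tota 1 0 (x, y) - PY K Y j (tota 1 0) (x, y)\<bar> <= CY * CR * 2 * H"
  using tota_PY_error[OF K j x, of 1 0 y] c(1)[of 1 0] c(2)[of 1 0] by (simp add: weight_def)
 then show a': "\<bar>tota 1 0 (x, y) - PY K Y j (tota 1 0) (x, y)\<bar> <= B / 2 * H" by (rule order_trans[OF _ BH]) (use H_pos in simp)
 have "\<bar>totb 0 0 (x, y) - PY K Y j (totb 0 0) (x, y)\<bar> <= CY * CR * 2 * (H * EE x)"
  using totb_PY_error[OF K j x, of 0 0 y] c(3)[of 0 0] c(4)[of 0 0] by (simp add: weight_def mult_ac)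
 then show b: "\<bar>totb 0 0 (x, y) - PY K Y j (totb 0 0) (x, y)\<bar> <= B / 2 * H * EE x"
  unfolding mult.assoc[of "B / 2"] by (rule order_trans[OF _ BH]) (use H_pos E1 in simp)
 have "B / 2 * H * EE x <= B / 2 * H" using E1 consts_nonneg(4) H_pos by (intro mult_left_le) auto
 then show "\<bar>tot 0 0 (x, y) - PY K Y j (tot 0 0) (x, y)\<bar> <= B * H"
  using tot_PY_error[OF K j x, of 0 0 y] a b by simp
 have "\<epsilon> * \<bar>totb 1 0 (x, y) - PY K Y j (totb 1 0) (x, y)\<bar> <= \<epsilon> * (?e 1 0 u1 + ?e 1 0 u12)"
  using totb_PY_error[OF K j x, of 1 0 y] \<epsilon>0 by (intro mult_left_mono) auto
 also have "... <= CY * CR * 2 * (H * EE x)"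
  using c(3)[of 1 0] c(4)[of 1 0] by (simp add: weight_def mult_ac distrib_left)
 also have "... <= B / 2 * (H * EE x)" using BH[of "H * EE x"] H_pos E1 by simp
 finally have b': "\<epsilon> * \<bar>totb 1 0 (x, y) - PY K Y j (totb 1 0) (x, y)\<bar> <= B / 2 * (H * EE x)" .
 have "\<epsilon> * \<bar>tot 1 0 (x, y) - PY K Y j (tot 1 0) (x, y)\<bar>
  <= \<epsilon> * (\<bar>tota 1 0 (x, y) - PY K Y j (tota 1 0) (x, y)\<bar> + \<bar>totb 1 0 (x, y) - PY K Y j (totb 1 0) (x, y)\<bar>)"
  using tot_PY_error[OF K j x, of 1 0 y] \<epsilon>0 by (intro mult_left_mono) auto
 also have "... <= \<epsilon> * (B / 2 * H) + B / 2 * (H * EE x)"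
  unfolding distrib_left using \<epsilon>0 by (intro add_mono b' mult_left_mono a') auto
 also have "... = B / 2 * (H * (EE x + \<epsilon>))" by (simp add: algebra_simps)
 also have "... <= B * (H * (EE x + \<epsilon>))"
  using consts_nonneg(4) H_pos E1 \<epsilon>0 by (intro mult_right_mono) auto
 finally show "\<epsilon> * \<bar>tot 1 0 (x, y) - PY K Y j (tot 1 0) (x, y)\<bar> <= B * H * (EE x + \<epsilon>)" by simp
 have "sqrt \<epsilon> * \<bar>tot 0 1 (x, y) - PY K Y j (tot 0 1) (x, y)\<bar> <= sqrt \<epsilon> * (?e 0 1 u0 + ?e 0 1 u2 + ?e 0 1 u1 + ?e 0 1 u12)"
  using tot_PY_error[OF K j x, of 0 1 y] tota_PY_error[OF K j x, of 0 1 y] totb_PY_error[OF K j x, of 0 1 y] \<epsilon>0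
  by (intro mult_left_mono) auto
 also have "... <= sqrt \<epsilon> * (CY * CR * H) + CY * CR * H + sqrt \<epsilon> * (CY * CR * H) + CY * CR * H"
 proof -
  have "?e 0 1 u0 <= CY * CR * H" "?e 0 1 u1 <= CY * CR * H" "sqrt \<epsilon> * ?e 0 1 u2 <= CY * CR * H" "sqrt \<epsilon> * ?e 0 1 u12 <= CY * CR * H"
   using EB c(1)[of 0 1] c(2)[of 0 1] c(3)[of 0 1] c(4)[of 0 1] by (simp_all add: weight_def mult.commute)
  then show ?thesis unfolding distrib_left[of "sqrt \<epsilon>"] using \<epsilon>0 by (intro add_mono mult_left_mono) auto
 qed
 also have "... = CY * CR * (2 * sqrt \<epsilon> + 2) * H" by (simp add: algebra_simps)
 also have "... <= B * H" using sqrt_\<epsilon>_bound e0_pos \<epsilon>0 H_pos by (intro mult_right_mono B_ge) (auto simp: e0_def)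
 finally show "sqrt \<epsilon> * \<bar>tot 0 1 (x, y) - PY K Y j (tot 0 1) (x, y)\<bar> <= B * H" .
qed

text \<open>One constant for all pointwise bounds of the energy estimate. The product form lets each
  special constant be compared factor by factor: a power of projection constants, then a factor from
  coefficients and layers.\<close>

definition "cc Ma = B * ((1 + CP) * (1 + CP)) * ((1 + Ma) * ((2 + e0) * (2 * exp (2 * \<sigma>) + 2 / \<alpha> + 1)))"

lemma cc_ge:
 assumes "Ma \<ge> 0" "0 <= r" "r <= (1 + CP) * (1 + CP)" "0 <= t" "t <= (1 + Ma) * ((2 + e0) * (2 * exp (2 * \<sigma>) + 2 / \<alpha> + 1))"
 shows "B * r * t <= cc Ma"
 unfolding cc_def using assms consts_nonneg by (intro mult_mono) (auto intro: mult_nonneg_nonneg order_trans)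

lemma cc_special:
 assumes Ma: "Ma \<ge> 0"
 shows "B <= cc Ma" "B * (1 + CP) <= cc Ma" "B * CP * (1 + e0) <= cc Ma"
  "B * (CP * CP) * (Ma * (2 / \<alpha> + 2 * exp (2 * \<sigma>))) <= cc Ma"
  "B * (CP + CP * CP) * (Ma * (2 * exp (2 * \<sigma>) + 1)) <= cc Ma"
proof -
 note e = e0_pos and C = CP(3)
 have x: "exp (2 * \<sigma>) > 0" "2 / \<alpha> > 0" using \<alpha>0 by auto
 have t4: "1 <= 2 * exp (2 * \<sigma>) + 2 / \<alpha> + 1" using x by linarith
 have a1: "1 <= (2 + e0) * (2 * exp (2 * \<sigma>) + 2 / \<alpha> + 1)"
  using mult_mono[of 1 "2 + e0" 1 "2 * exp (2 * \<sigma>) + 2 / \<alpha> + 1"] e t4 by simp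
 have a2: "1 <= (1 + Ma) * ((2 + e0) * (2 * exp (2 * \<sigma>) + 2 / \<alpha> + 1))"
  using mult_mono[of 1 "1 + Ma" 1 "(2 + e0) * (2 * exp (2 * \<sigma>) + 2 / \<alpha> + 1)"] Ma a1 by simp
 have a3: "1 + e0 <= (1 + Ma) * ((2 + e0) * (2 * exp (2 * \<sigma>) + 2 / \<alpha> + 1))"
  using mult_mono[of 1 "1 + Ma" "(1 + e0) * 1" "(2 + e0) * (2 * exp (2 * \<sigma>) + 2 / \<alpha> + 1)"] Ma e t4
   mult_mono[of "1 + e0" "2 + e0" 1 "2 * exp (2 * \<sigma>) + 2 / \<alpha> + 1"] by simp
 have a4: "Ma * s <= (1 + Ma) * ((2 + e0) * (2 * exp (2 * \<sigma>) + 2 / \<alpha> + 1))"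
  if "0 <= s" "s <= 2 * exp (2 * \<sigma>) + 2 / \<alpha> + 1" for s
 proof -
  have "1 * s <= (2 + e0) * (2 * exp (2 * \<sigma>) + 2 / \<alpha> + 1)" using that e by (intro mult_mono) auto
  then show ?thesis using that Ma by (intro mult_mono) auto
 qed
 have r: "1 <= (1 + CP) * (1 + CP)" "1 + CP <= (1 + CP) * (1 + CP)" "CP <= (1 + CP) * (1 + CP)" "CP * CP <= (1 + CP) * (1 + CP)"
  "CP + CP * CP <= (1 + CP) * (1 + CP)" "0 <= CP * CP"
  using C by (auto simp: distrib_left distrib_right intro: add_nonneg_nonneg mult_nonneg_nonneg)
 show "B <= cc Ma" using cc_ge[OF Ma _ r(1) _ a2] by simp
 show "B * (1 + CP) <= cc Ma" using cc_ge[OF Ma _ r(2) _ a2] C by simp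
 show "B * CP * (1 + e0) <= cc Ma" using cc_ge[OF Ma _ r(3) _ a3] C e by simp
 show "B * (CP * CP) * (Ma * (2 / \<alpha> + 2 * exp (2 * \<sigma>))) <= cc Ma"
  using x Ma r C by (intro cc_ge a4 Ma mult_nonneg_nonneg) auto
 show "B * (CP + CP * CP) * (Ma * (2 * exp (2 * \<sigma>) + 1)) <= cc Ma"
  using x Ma r C by (intro cc_ge a4 Ma mult_nonneg_nonneg add_nonneg_nonneg) auto
qed

lemma PX_bound:
 assumes K: "K \<in> three_projs" and i: "i \<in> {1..N}" and x: "x \<in> {X (i - 1)..X i}"
  and g: "continuous_on {X (i - 1)..X i} (%t. g (t, y))" "!!t. t \<in> {X (i - 1)..X i} ==> \<bar>g (t, y)\<bar> <= S"
 shows "\<bar>PX K X i g (x, y)\<bar> <= CP * S"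
 unfolding PX_def split_conv by (rule pj_le_CP[OF K gx.cell[OF i] g(1) x g(2)])

lemma PY_bound:
 assumes K: "K \<in> three_projs" and j: "j \<in> {1..N}" and y: "y \<in> {Y (j - 1)..Y j}"
  and g: "continuous_on {Y (j - 1)..Y j} (%t. g (x, t))" "!!t. t \<in> {Y (j - 1)..Y j} ==> \<bar>g (x, t)\<bar> <= S"
 shows "\<bar>PY K Y j g (x, y)\<bar> <= CP * S"
 unfolding PY_def split_conv by (rule pj_le_CP[OF K gy.cell[OF j] g(1) y g(2)])

lemma PX_diff:
 assumes "K \<in> three_projs" "i \<in> {1..N}" "continuous_on {X (i - 1)..X i} (%x. f (x, y))" "continuous_on {X (i - 1)..X i} (%x. g (x, y))"
 shows "PX K X i (%z. f z - g z) (x, y) = PX K X i f (x, y) - PX K X i g (x, y)"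
 using three_projs[OF assms(1)] interval_proj.pj_diff[OF _ gx.cell[OF assms(2)] assms(3,4)] by (auto simp: PX_def)

lemma PY_diff:
 assumes "K \<in> three_projs" "j \<in> {1..N}" "continuous_on {Y (j - 1)..Y j} (%y. f (x, y))" "continuous_on {Y (j - 1)..Y j} (%y. g (x, y))"
 shows "PY K Y j (%z. f z - g z) (x, y) = PY K Y j f (x, y) - PY K Y j g (x, y)"
 using three_projs[OF assms(1)] interval_proj.pj_diff[OF _ gy.cell[OF assms(2)] assms(3,4)] by (auto simp: PY_def)

lemma cell_lines:
 assumes "continuous_on Q01 f" "i \<in> {1..N}" "j \<in> {1..N}" "K \<in> three_projs" "x \<in> {X (i - 1)..X i}" "y \<in> {Y (j - 1)..Y j}"
 shows "continuous_on {X (i - 1)..X i} (%x. f (x, y))" "continuous_on {Y (j - 1)..Y j} (%y. f (x, y))"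
  "continuous_on {X (i - 1)..X i} (%x. PY K Y j f (x, y))" "continuous_on {Y (j - 1)..Y j} (%y. PX K X i f (x, y))"
proof -
 obtain l where l: "interval_proj k l K" using three_projs[OF assms(4)] by blast
 show "continuous_on {X (i - 1)..X i} (%x. f (x, y))" using X_line[OF assms(1,2)] Y_cell_unit[OF assms(3,6)] by blast
 show "continuous_on {Y (j - 1)..Y j} (%y. f (x, y))" using Y_line[OF assms(1,3)] X_cell_unit[OF assms(2,5)] by blast
 have c: "continuous_on (cl i j) f"
  using X_cell_unit[OF assms(2)] Y_cell_unit[OF assms(3)] by (intro continuous_on_subset[OF assms(1)]) auto
 have "continuous_on (cl i j) (PY K Y j f)"
  using interval_proj.continuous_on_pj_y[OF l gy.cell[OF assms(3)] c] unfolding PY_def by (rule continuous_on_subset) auto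
 then show "continuous_on {X (i - 1)..X i} (%x. PY K Y j f (x, y))" using assms(6) by (rule continuous_on_line_x)
 have "continuous_on (cl i j) (PX K X i f)"
  using interval_proj.continuous_on_pj_x[OF l gx.cell[OF assms(2)] c] unfolding PX_def by (rule continuous_on_subset) auto
 then show "continuous_on {Y (j - 1)..Y j} (%y. PX K X i f (x, y))" using assms(5) by (rule continuous_on_line_y)
qed

text \<open>With the identity $I - \Pi_x\Pi_y = (I - \Pi_x) + \Pi_x(I - \Pi_y)$ errors of tensor products reduce to
  errors in one variable.\<close>

lemma tensor_error:
 assumes K: "K \<in> three_projs" "K' \<in> three_projs" and i: "i \<in> {1..N}" and j: "j \<in> {1..N}"
  and f: "continuous_on Q01 f" and x: "x \<in> {X (i - 1)..X i}" and y: "y \<in> {Y (j - 1)..Y j}"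
 shows "PY K' Y j f (x, y) - PX K X i (PY K' Y j f) (x, y) = PY K' Y j (%z. f z - PX K X i f z) (x, y)"
  and "PX K X i f (x, y) - PX K X i (PY K' Y j f) (x, y) = PX K X i (%z. f z - PY K' Y j f z) (x, y)"
proof -
 obtain l l' where l: "interval_proj k l K" "interval_proj k l' K'" using three_projs K by meson
 have c: "continuous_on (cl i j) f"
  using X_cell_unit[OF i] Y_cell_unit[OF j] by (intro continuous_on_subset[OF f]) auto
 have comm: "PX K X i (PY K' Y j f) = PY K' Y j (PX K X i f)" by (rule tensor_commute[OF l i j c])
 show "PY K' Y j f (x, y) - PX K X i (PY K' Y j f) (x, y) = PY K' Y j (%z. f z - PX K X i f z) (x, y)"
  unfolding comm using cell_lines[OF f i j K(1) x y] by (intro PY_diff[OF K(2) j, symmetric])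
 show "PX K X i f (x, y) - PX K X i (PY K' Y j f) (x, y) = PX K X i (%z. f z - PY K' Y j f z) (x, y)"
  using cell_lines[OF f i j K(2) x y] by (intro PX_diff[OF K(1) i, symmetric])
qed

lemma tensor_error_bounds:
 assumes K: "K \<in> three_projs" "K' \<in> three_projs" and i: "i \<in> {1..N}" and j: "j \<in> {1..N}"
  and f: "continuous_on Q01 f" and x: "x \<in> {X (i - 1)..X i}" and y: "y \<in> {Y (j - 1)..Y j}"
 shows "(!!t. t \<in> {Y (j - 1)..Y j} ==> \<bar>f (x, t) - PX K X i f (x, t)\<bar> <= S) ==>
   \<bar>PY K' Y j f (x, y) - PX K X i (PY K' Y j f) (x, y)\<bar> <= CP * S"
  and "(!!t. t \<in> {X (i - 1)..X i} ==> \<bar>f (t, y) - PY K' Y j f (t, y)\<bar> <= S) ==>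
   \<bar>PX K X i f (x, y) - PX K X i (PY K' Y j f) (x, y)\<bar> <= CP * S"
 unfolding tensor_error[OF assms]
 using cell_lines[OF f i j K(1) x y] cell_lines[OF f i j K(2) x y]
 by (intro PY_bound[OF K(2) j y] PX_bound[OF K(1) i x] continuous_intros; simp)+

lemma in_three: "radR k \<in> three_projs" "radL k \<in> three_projs" "projL2 k \<in> three_projs"
 by (auto simp: three_projs_def)

lemma PX_cmult: "K \<in> three_projs ==> PX K X i (%z. c * f z) z = c * PX K X i f z"
 using three_projs[of K] by (auto simp: PX_def split_beta interval_proj.pj_cmult)

lemma PY_cmult: "K \<in> three_projs ==> PY K Y j (%z. c * f z) z = c * PY K Y j f z"
 using three_projs[of K] by (auto simp: PY_def split_beta interval_proj.pj_cmult)

text \<open>The jump of the error at an interior vertical mesh line is the trace of \<open>\<Pi>_y u - \<Pi>_x \<Pi>_y u\<close>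
 from the right.\<close>

lemma jump_bound:
 assumes y: "y \<in> {Y (j - 1)..Y j}" and j: "j \<in> {1..N}"
 shows "(\<Sum>i=1..N. (PY (radR k) Y j (tot 0 0) (X (i - 1), y) - PX (radR k) X i (PY (radR k) Y j (tot 0 0)) (X (i - 1), y))\<^sup>2)
  <= (CP * B)\<^sup>2 * ((1 + 1 / (4 * \<sigma>)) * h ^ (2 * k + 1))"
proof -
 let ?z = "%i. PY (radR k) Y j (tot 0 0) (X (i - 1), y) - PX (radR k) X i (PY (radR k) Y j (tot 0 0)) (X (i - 1), y)"
 \<comment> \<open>Each of the \<open>N\<close> columns contributes
   \<open>1 / N ^ (2 * k + 2)\<close>; summing them costs one power, which is half an order after
   taking the root.\<close>
 have n2: "1 / real N ^ Suc k * (1 / real N ^ Suc k) * real N <= h ^ (2 * k + 1)"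
 proof -
  have "1 / real N ^ Suc k * (1 / real N ^ Suc k) * real N = (1 / real N) ^ (2 * k + 1)"
   using N0 by (simp add: power_divide power_Suc mult_2 power_add)
  also have "... <= h ^ (2 * k + 1)" using h_pos N0 by (intro power_mono) auto
  finally show ?thesis .
 qed
 have z: "(?z i)\<^sup>2 <= (CP * B)\<^sup>2 * (1 / real N ^ Suc k * (1 / real N ^ Suc k) + (if i <= 2 * m then 0 else H\<^sup>2 * (EE (X (i - 1)))\<^sup>2))"
  if i: "i \<in> {1..N}" for i
 proof -
  let ?x = "X (i - 1)"
  have x: "?x \<in> {X (i - 1)..X i}" using gx.cell[OF i] by simp
  have "\<bar>?z i\<bar> <= CP * (B / 2 * rate i ?x)"
   using tensor_error_bounds(1)[OF in_three(1) in_three(1) i j cont_tot(3) x y, where S = "B / 2 * rate i ?x"]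
    error_u_X[OF in_three(1) i x Y_cell_unit[OF j]] by simp
  then have "(?z i)\<^sup>2 <= (CP * (B / 2 * rate i ?x))\<^sup>2" by (rule abs_le_square_bound)
  also have "... = (CP * B)\<^sup>2 * ((rate i ?x)\<^sup>2 / 4)" by (simp add: power_mult_distrib power_divide)
  also have "... <= (CP * B)\<^sup>2 * (1 / real N ^ Suc k * (1 / real N ^ Suc k) + (if i <= 2 * m then 0 else H\<^sup>2 * (EE ?x)\<^sup>2))"
  proof (intro mult_left_mono zero_le_power2)
   have "(r + s)\<^sup>2 / 4 <= r * r + s\<^sup>2" for r s :: real
   proof -
    have "(r + s)\<^sup>2 = 2 * r\<^sup>2 + 2 * s\<^sup>2 - (r - s)\<^sup>2" by (simp add: power2_sum power2_diff)
    then show ?thesis unfolding power2_eq_square[of r, symmetric]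
     using zero_le_power2[of "r - s"] zero_le_power2[of r] zero_le_power2[of s] by linarith
   qed
   from this[of "1 / real N ^ Suc k" "if i <= 2 * m then 0 else H * EE ?x"]
   show "(rate i ?x)\<^sup>2 / 4 <= 1 / real N ^ Suc k * (1 / real N ^ Suc k) + (if i <= 2 * m then 0 else H\<^sup>2 * (EE ?x)\<^sup>2)"
    unfolding rate_def by (cases "i <= 2 * m") (simp_all only: if_True if_False power_mult_distrib zero_power2 zero_eq_power2 simp_thms)
  qed
  finally show ?thesis .
 qed
 \<comment> \<open>\<open>EE\<close> is increasing, so its square at the left node times the cell
   length is below the integral over the cell. The integral is of order \<open>\<epsilon>\<close>
   and the fine cell length of order \<open>h * \<epsilon>\<close>; the quotient
   \<open>1 / h\<close> is the loss of half an order.\<close>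
 have fine: "(\<Sum>i=1..N. if i <= 2 * m then 0 else (EE (X (i - 1)))\<^sup>2) <= 1 / (4 * \<sigma> * h)"
 proof -
  let ?l = "2 * \<sigma> / \<alpha> * h * \<epsilon>"
  have l: "?l > 0" using \<sigma>0 \<alpha>0 h_pos \<epsilon>0 by simp
  have "?l * (\<Sum>i=1..N. if i <= 2 * m then 0 else (EE (X (i - 1)))\<^sup>2) <= L1 N X (%i x. (EE x)\<^sup>2)"
   unfolding L1_def sum_distrib_left
  proof (rule sum_mono)
   fix i assume i: "i \<in> {1..N}"
   have int: "(%x. (EE x)\<^sup>2) integrable_on {X (i - 1)..X i}"
    by (intro integrable_continuous_real continuous_intros cont_EE)
   show "?l * (if i <= 2 * m then 0 else (EE (X (i - 1)))\<^sup>2) <= integral {X (i - 1)..X i} (%x. (EE x)\<^sup>2)"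
   proof (cases "i <= 2 * m")
    case True then show ?thesis using integral_nonneg[OF int] by simp
   next
    case False
    have "integral {X (i - 1)..X i} (%x. (EE (X (i - 1)))\<^sup>2) <= integral {X (i - 1)..X i} (%x. (EE x)\<^sup>2)"
     using EE_pos by (intro integral_le int) (auto intro!: power_mono EE_mono simp: less_imp_le)
    then show ?thesis using False X_len_fine[OF i False] gx.cell[OF i] by simp
   qed
  qed
  also have "... <= \<epsilon> / (2 * \<alpha>)" by (rule L1_EE_square)
  also have "... = ?l * (1 / (4 * \<sigma> * h))" using \<sigma>0 \<alpha>0 h_pos \<epsilon>0 by (simp add: field_simps)
  finally show ?thesis using l by (simp only: mult_le_cancel_left_pos)
 qed
 have "(\<Sum>i=1..N. (?z i)\<^sup>2) <= (\<Sum>i=1..N. (CP * B)\<^sup>2 * (1 / real N ^ Suc k * (1 / real N ^ Suc k) + (if i <= 2 * m then 0 else H\<^sup>2 * (EE (X (i - 1)))\<^sup>2)))"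
  by (intro sum_mono z)
 also have "... = (CP * B)\<^sup>2 * (1 / real N ^ Suc k * (1 / real N ^ Suc k) * real N + H\<^sup>2 * (\<Sum>i=1..N. if i <= 2 * m then 0 else (EE (X (i - 1)))\<^sup>2))"
 proof -
  have *: "(if i <= 2 * m then 0 else H\<^sup>2 * (EE (X (i - 1)))\<^sup>2) = H\<^sup>2 * (if i <= 2 * m then 0 else (EE (X (i - 1)))\<^sup>2)" for i by simp
  show ?thesis unfolding sum_distrib_left[symmetric] sum.distrib * by simp
 qed
 also have "... <= (CP * B)\<^sup>2 * (h ^ (2 * k + 1) + H\<^sup>2 * (1 / (4 * \<sigma> * h)))"
  by (intro mult_left_mono add_mono n2 fine) auto
 also have "H\<^sup>2 * (1 / (4 * \<sigma> * h)) = 1 / (4 * \<sigma>) * h ^ (2 * k + 1)"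
 proof -
  have "H\<^sup>2 = h ^ (2 * k + 1) * h" by (simp add: H_def power_Suc power_mult_distrib power_add mult_2 power2_eq_square)
  then show ?thesis using h_pos by simp
 qed
 finally show ?thesis by (simp add: distrib_right)
qed

end

section \<open>Bounds on a single cell for all projection errors\<close>

context shishkin_solution
begin

abbreviation "u \<equiv> tot 0 0"
abbreviation "p \<equiv> %z. \<epsilon> * tot 1 0 z"
abbreviation "q \<equiv> %z. \<epsilon> * tot 0 1 z"

lemma cont_upq: "continuous_on Q01 u" "continuous_on Q01 p" "continuous_on Q01 q"
 by (intro continuous_intros cont_tot; simp)+

context
 fixes i j :: nat and x y :: real
 assumes i: "i \<in> {1..N}" and j: "j \<in> {1..N}" and x: "x \<in> {X (i - 1)..X i}" and y: "y \<in> {Y (j - 1)..Y j}"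
begin

lemma \<omega>_indep: "\<omega> i j (x, t) = \<omega> i j (x, y)" by (simp add: \<omega>_def)

lemma p_X: "t \<in> {0..1} ==> \<bar>p (x, t) - PX (radL k) X i p (x, t)\<bar> <= B * H * (\<omega> i j (x, y) + \<epsilon>)"
 using error_ux_X[OF i x, of t j] \<epsilon>0 \<omega>_indep[of t]
 by (simp add: PX_cmult[OF in_three(2)] abs_mult flip: right_diff_distrib)

lemma p_Y: "K \<in> three_projs ==> \<bar>p (x, y) - PY K Y j p (x, y)\<bar> <= B * H * (\<omega> i j (x, y) + \<epsilon>)"
proof -
 assume K: "K \<in> three_projs"
 have "\<bar>p (x, y) - PY K Y j p (x, y)\<bar> <= B * H * (EE x + \<epsilon>)"
  using error_Y(5)[OF K j X_cell_unit[OF i x] y] \<epsilon>0 by (simp add: PY_cmult[OF K] abs_mult flip: right_diff_distrib)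
 also have "... <= B * H * (\<omega> i j (x, y) + \<epsilon>)"
  using EE_le_\<omega>[of "(x, y)" i j] consts_nonneg(4) H_pos by (intro mult_left_mono) auto
 finally show ?thesis .
qed

lemma q_X: "K \<in> three_projs ==> \<bar>q (x, y) - PX K X i q (x, y)\<bar> <= B * H * sqrt \<epsilon>"
proof -
 assume K: "K \<in> three_projs"
 have "\<bar>q (x, y) - PX K X i q (x, y)\<bar> = sqrt \<epsilon> * (sqrt \<epsilon> * \<bar>tot 0 1 (x, y) - PX K X i (tot 0 1) (x, y)\<bar>)"
  using \<epsilon>0 by (simp add: PX_cmult[OF K] abs_mult flip: right_diff_distrib mult.assoc)
 also have "... <= sqrt \<epsilon> * (B * H)" using error_uy_X[OF K i x Y_cell_unit[OF j y]] \<epsilon>0 by (intro mult_left_mono) auto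
 finally show ?thesis by (simp add: mult_ac)
qed

lemma q_Y: "K \<in> three_projs ==> t \<in> {X (i - 1)..X i} ==> \<bar>q (t, y) - PY K Y j q (t, y)\<bar> <= B * H * sqrt \<epsilon>"
proof -
 assume K: "K \<in> three_projs" and t: "t \<in> {X (i - 1)..X i}"
 have "\<bar>q (t, y) - PY K Y j q (t, y)\<bar> = sqrt \<epsilon> * (sqrt \<epsilon> * \<bar>tot 0 1 (t, y) - PY K Y j (tot 0 1) (t, y)\<bar>)"
  using \<epsilon>0 by (simp add: PY_cmult[OF K] abs_mult flip: right_diff_distrib mult.assoc)
 also have "... <= sqrt \<epsilon> * (B * H)" using error_Y(6)[OF K j X_cell_unit[OF i t] y] \<epsilon>0 by (intro mult_left_mono) auto
 finally show ?thesis by (simp add: mult_ac)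
qed

lemma \<zeta>u_bound: "\<bar>PY (radR k) Y j u (x, y) - PX (radR k) X i (PY (radR k) Y j u) (x, y)\<bar> <= CP * (B * H)"
 using error_u_X_sup[OF in_three(1) i x] Y_cell_unit[OF j]
 by (intro tensor_error_bounds(1)[OF in_three(1) in_three(1) i j cont_upq(1) x y]) auto

lemma \<eta>u_bound: "\<bar>u (x, y) - PX (radR k) X i (PY (radR k) Y j u) (x, y)\<bar> <= B * (1 + CP) * H"
 using \<zeta>u_bound error_Y(4)[OF in_three(1) j X_cell_unit[OF i x] y] by (simp add: algebra_simps)

lemma \<zeta>p_bound: "\<bar>PY (projL2 k) Y j p (x, y) - PX (radL k) X i (PY (projL2 k) Y j p) (x, y)\<bar> <= CP * (B * H * (\<omega> i j (x, y) + \<epsilon>))"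
 using p_X Y_cell_unit[OF j]
 by (intro tensor_error_bounds(1)[OF in_three(2) in_three(3) i j cont_upq(2) x y]) auto

lemma \<eta>p_bound: "\<bar>p (x, y) - PX (radL k) X i (PY (projL2 k) Y j p) (x, y)\<bar> <= B * (1 + CP) * H * (\<omega> i j (x, y) + \<epsilon>)"
proof -
 have "\<bar>p (x, y) - PX (radL k) X i (PY (projL2 k) Y j p) (x, y)\<bar> <= B * H * (\<omega> i j (x, y) + \<epsilon>) + CP * (B * H * (\<omega> i j (x, y) + \<epsilon>))"
  using \<zeta>p_bound p_Y[OF in_three(3)] by linarith
 then show ?thesis by (simp add: algebra_simps)
qed

lemma \<zeta>q_bound: "\<bar>PX (projL2 k) X i q (x, y) - PX (projL2 k) X i (PY (radL k) Y j q) (x, y)\<bar> <= CP * (B * H * sqrt \<epsilon>)"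
 using q_Y[OF in_three(2)]
 by (intro tensor_error_bounds(2)[OF in_three(3) in_three(2) i j cont_upq(3) x y]) auto

lemma \<eta>q_bound: "\<bar>q (x, y) - PX (projL2 k) X i (PY (radL k) Y j q) (x, y)\<bar> <= B * (1 + CP) * H * sqrt \<epsilon>"
proof -
 have "\<bar>q (x, y) - PX (projL2 k) X i (PY (radL k) Y j q) (x, y)\<bar> <= B * H * sqrt \<epsilon> + CP * (B * H * sqrt \<epsilon>)"
  using \<zeta>q_bound q_X[OF in_three(3)] by linarith
 then show ?thesis by (simp add: algebra_simps)
qed

context
 fixes a :: fn2 and Ma :: real
 assumes a: "continuous_on Q01 a" and Ma: "!!z. z \<in> Q01 ==> \<bar>a z\<bar> <= Ma"
begin

abbreviation "agb' \<equiv> %z. a z * (totb 0 0 z - PY (radR k) Y j (totb 0 0) z)"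

lemma Ma_nonneg: "Ma \<ge> 0"
 using Ma[of "(0, 0)"] by simp

lemma agb_bound: "t \<in> {0..1} ==> s \<in> {Y (j - 1)..Y j} ==> \<bar>agb' (t, s)\<bar> <= Ma * (B * H * EE t)"
proof -
 assume t: "t \<in> {0..1}" and s: "s \<in> {Y (j - 1)..Y j}"
 have "\<bar>totb 0 0 (t, s) - PY (radR k) Y j (totb 0 0) (t, s)\<bar> <= B / 2 * H * EE t"
  by (rule error_Y(3)[OF in_three(1) j t s])
 also have "... <= B * H * EE t" using consts_nonneg(4) H_pos EE_pos[of t] by (intro mult_right_mono) auto
 finally show ?thesis using Ma[of "(t, s)"] t Y_cell_unit[OF j s] Ma_nonneg
  unfolding abs_mult by (intro mult_mono) auto
qed

lemma agb_cont: "continuous_on ({0..1} \<times> {Y (j - 1)..Y j}) agb'"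
proof -
 have sub: "{0..1} \<times> {Y (j - 1)..Y j} \<subseteq> Q01" using Y_cell_unit[OF j] by auto
 have "continuous_on ({0..1} \<times> {Y (j - 1)..Y j}) (PY (radR k) Y j (totb 0 0))"
  using PY_row[OF proj(1) j, of "totb 0 0"] continuous_on_subset[OF cont_tot(2) sub] RX_RY by simp
 then show ?thesis using continuous_on_subset[OF a sub] continuous_on_subset[OF cont_tot(2) sub, of 0 0]
  by (intro continuous_intros) auto
qed

lemma PY_agb_bound: "t \<in> {0..1} ==> \<bar>PY (projL2 k) Y j agb' (t, y)\<bar> <= CP * (Ma * (B * H)) * EE t"
 using PY_bound[OF in_three(3) j y continuous_on_line_y[OF agb_cont, of t], of "Ma * (B * H * EE t)"] agb_bound[of t]
 by (simp add: mult.assoc)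

text \<open>The inner projection in y keeps the factor \<open>EE\<close>, so the left Radau bound
  for layer functions applies once more.\<close>

lemma \<phi>_raw: "\<bar>PX (radL k) X i (PY (projL2 k) Y j agb') (x, y)\<bar>
 <= CP * (CP * (Ma * (B * H))) * (if i <= 2 * m then 2 / \<alpha> * (H * \<epsilon>) else 2 * exp (2 * \<sigma>) * EE x)"
 unfolding PX_def split_conv
proof (rule radL_layer_bound[OF i x])
 have "continuous_on ({0..1} \<times> {Y (j - 1)..Y j}) (PY (projL2 k) Y j agb')"
  using PY_row[OF proj(3) j, of agb'] agb_cont RX_RY by simp
 from continuous_on_subset[OF continuous_on_line_x[OF this y]]
 show "continuous_on {X (i - 1)..X i} (%t. PY (projL2 k) Y j agb' (t, y))"
  using X_cell_unit[OF i] by blast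
 show "0 <= CP * (Ma * (B * H))" using CP(3) Ma_nonneg consts_nonneg(4) H_pos by (intro mult_nonneg_nonneg) auto
 show "\<bar>PY (projL2 k) Y j agb' (t, y)\<bar> <= CP * (Ma * (B * H)) * EE t" if "t \<in> {X (i - 1)..X i}" for t
  using PY_agb_bound X_cell_unit[OF i that] by blast
qed

text \<open>Both branches are dominated by the common weight, the coarse one through
  \<open>\<epsilon>\<close> and the fine one through \<open>\<omega>\<close>. In the coarse branch
  one factor \<open>H\<close> is given away as at most 1.\<close>

lemma \<phi>_bound: "\<bar>PX (radL k) X i (PY (projL2 k) Y j agb') (x, y)\<bar>
 <= B * (CP * CP) * (Ma * (2 / \<alpha> + 2 * exp (2 * \<sigma>))) * H * (\<omega> i j (x, y) + \<epsilon>)"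
proof -
 have "(if i <= 2 * m then 2 / \<alpha> * (H * \<epsilon>) else 2 * exp (2 * \<sigma>) * EE x) <= (2 / \<alpha> + 2 * exp (2 * \<sigma>)) * (\<omega> i j (x, y) + \<epsilon>)"
 proof (cases "i <= 2 * m")
  case True
  have "2 / \<alpha> * (H * \<epsilon>) <= 2 / \<alpha> * (1 * \<epsilon>)" using H_le_1 \<alpha>0 \<epsilon>0 by (intro mult_left_mono mult_right_mono) auto
  also have "... <= (2 / \<alpha> + 2 * exp (2 * \<sigma>)) * (\<omega> i j (x, y) + \<epsilon>)"
   using \<alpha>0 \<epsilon>0 \<omega>_nonneg[of i j "(x, y)"] by (intro mult_mono) auto
  finally show ?thesis using True by simp
 next
  case False
  have "2 * exp (2 * \<sigma>) * EE x <= (2 / \<alpha> + 2 * exp (2 * \<sigma>)) * (\<omega> i j (x, y) + \<epsilon>)"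
   using \<alpha>0 \<epsilon>0 \<omega>_nonneg[of i j "(x, y)"] EE_le_\<omega>[of "(x, y)" i j] EE_pos[of x] by (intro mult_mono) auto
  then show ?thesis using False by simp
 qed
 then have "CP * (CP * (Ma * (B * H))) * (if i <= 2 * m then 2 / \<alpha> * (H * \<epsilon>) else 2 * exp (2 * \<sigma>) * EE x)
  <= CP * (CP * (Ma * (B * H))) * ((2 / \<alpha> + 2 * exp (2 * \<sigma>)) * (\<omega> i j (x, y) + \<epsilon>))"
  using CP(3) Ma_nonneg consts_nonneg(4) H_pos by (intro mult_left_mono mult_nonneg_nonneg) auto
 also have "... = B * (CP * CP) * (Ma * (2 / \<alpha> + 2 * exp (2 * \<sigma>))) * H * (\<omega> i j (x, y) + \<epsilon>)" by (simp only: mult_ac)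
 finally show ?thesis using \<phi>_raw by linarith
qed

text \<open>At the outflow boundary \<open>EE\<close> is 1 and no power of \<open>\<epsilon>\<close>
  is gained. None is required, because the trace at x = 1 is controlled with a weight free of
  \<open>\<epsilon>\<close>.\<close>

lemma \<theta>_bound: "i = N ==> x = 1 ==> \<bar>PY (projL2 k) Y j agb' (x, y) - PX (radL k) X i (PY (projL2 k) Y j agb') (x, y)\<bar>
 <= B * (CP + CP * CP) * (Ma * (2 * exp (2 * \<sigma>) + 1)) * H"
proof -
 assume iN: "i = N" and x1: "x = 1"
 have fine: "\<not> i <= 2 * m" using iN N4 by linarith
 have E: "EE x = 1" by (simp add: x1 EE_def)
 have 1: "\<bar>PY (projL2 k) Y j agb' (x, y)\<bar> <= CP * (Ma * (B * H))" using PY_agb_bound[of x] x1 E by simp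
 have 2: "\<bar>PX (radL k) X i (PY (projL2 k) Y j agb') (x, y)\<bar> <= CP * (CP * (Ma * (B * H))) * (2 * exp (2 * \<sigma>))"
  using \<phi>_raw fine E by simp
 have "CP * (Ma * (B * H)) \<ge> 0" "CP * (CP * (Ma * (B * H))) \<ge> 0"
  using CP(3) Ma_nonneg consts_nonneg(4) H_pos by (auto intro!: mult_nonneg_nonneg)
 then have 3: "CP * (Ma * (B * H)) * 1 <= CP * (Ma * (B * H)) * (2 * exp (2 * \<sigma>) + 1)"
  "CP * (CP * (Ma * (B * H))) * (2 * exp (2 * \<sigma>)) <= CP * (CP * (Ma * (B * H))) * (2 * exp (2 * \<sigma>) + 1)"
  by (intro mult_left_mono; simp)+
 have "\<bar>PY (projL2 k) Y j agb' (x, y) - PX (radL k) X i (PY (projL2 k) Y j agb') (x, y)\<bar>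
  <= CP * (Ma * (B * H)) * (2 * exp (2 * \<sigma>) + 1) + CP * (CP * (Ma * (B * H))) * (2 * exp (2 * \<sigma>) + 1)"
  using 1 2 3 by linarith
 also have "... = B * (CP + CP * CP) * (Ma * (2 * exp (2 * \<sigma>) + 1)) * H" by (simp add: distrib_left distrib_right mult_ac)
 finally show ?thesis .
qed

end

end

abbreviation "e_u \<equiv> %i j z. u z - PX (radR k) X i (PY (radR k) Y j u) z"
abbreviation "e_p \<equiv> %i j z. p z - PX (radL k) X i (PY (projL2 k) Y j p) z"
abbreviation "e_q \<equiv> %i j z. q z - PY (radL k) Y j (PX (projL2 k) X i q) z"

text \<open>All eleven pointwise bounds are brought to the one constant \<open>cc Ma\<close>. The
  second conclusion measures the projection error in the norm without jumps, where it has the full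
  order.\<close>

theorem family_estimate:
 assumes L: "ldg_problem N X Y k \<epsilon> l1 l2 a ax b f u (tot 1 0) uxx (tot 0 1) uyy (tota 0 0) (tota 1 0) (totb 0 0) U P Q"
  and al: "!!z. z \<in> Q01 ==> \<alpha> <= a z" and \<beta>: "\<beta> > 0" "!!z. z \<in> Q01 ==> \<beta> <= b z - ax z / 2"
  and l1: "l1 \<ge> 0" and l2: "C1 > 0" "C1 * \<epsilon> <= l2"
  and Ma: "!!z. z \<in> Q01 ==> \<bar>a z\<bar> <= Ma" "!!z. z \<in> Q01 ==> \<bar>ax z\<bar> <= Ma" "!!z. z \<in> Q01 ==> \<bar>b z\<bar> <= Ma"
 shows "energy N X Y \<epsilon> a ax b l1 l2
   (%i j z. PX (radR k) X i (PY (radR k) Y j u) z - U i j z)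
   (%i j z. PX (radL k) X i (PY (projL2 k) Y j p) z - P i j z)
   (%i j z. PY (radL k) Y j (PX (projL2 k) X i q) z - Q i j z)
   <= ldg_problem.C\<xi> k \<alpha> \<beta> C1 Ma (1 / \<alpha>) e0 * (cc Ma)\<^sup>2 * H\<^sup>2" (is ?E)
  and "(L2D N X Y (%i j z. (e_p i j z)\<^sup>2) + L2D N X Y (%i j z. (e_q i j z)\<^sup>2)) / \<epsilon>
   + L2D N X Y (%i j z. (b z - ax z / 2) * (e_u i j z)\<^sup>2) <= (cc Ma)\<^sup>2 * H\<^sup>2 * (2 * (1 / \<alpha> + e0) + 1 + 2 * Ma)" (is ?N)
proof -
 interpret L: ldg_problem N X Y k \<epsilon> l1 l2 a ax b f u "tot 1 0" uxx "tot 0 1" uyy "tota 0 0" "tota 1 0" "totb 0 0" U P Q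
  by (rule L)
 note One_nat_def [simp del]
 have Q: "{X 0..X N} \<times> {Y 0..Y N} = Q01" by (simp add: RX_RY)
 have ac: "continuous_on Q01 a" using L.a by (simp add: has_dx_def RX_RY)
 have Ma0: "Ma \<ge> 0" using Ma(1)[of "(0, 0)"] by simp
 define c where "c = cc Ma"
 note cs = cc_special[OF Ma0, folded c_def]
 have c0: "c \<ge> 0" using cs(1) consts_nonneg(4) by linarith
 have H0: "H \<ge> 0" using H_pos by simp
 have o: "0 <= H * (\<omega> i j z + \<epsilon>)" for i j z using \<omega>_nonneg[of i j z] \<epsilon>0 H_pos by auto
 have up: "r <= c * t" if "r <= K * t" "K <= c" "0 <= t" for r K t :: real
  using that by (meson mult_right_mono order_trans)
 have BCP: "B * CP <= c" using cs(2) consts_nonneg(4) by (simp add: distrib_left)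
 let ?cell = "%i j z. i \<in> {1..N} & j \<in> {1..N} & z \<in> cl i j"
 have \<eta>p: "\<bar>L.\<eta>p i j z\<bar> <= c * H * (\<omega> i j z + \<epsilon>)"
  if "i \<in> {1..N}" "j \<in> {1..N}" "z \<in> cl i j" for i j z
  using that \<eta>p_bound[OF that(1,2), of "fst z" "snd z"] up[OF _ cs(2) o, of _ i j z]
  by (auto simp: L.\<eta>p_def L.Pp_def L.p_def mult.assoc)
 have \<eta>q: "\<bar>L.\<eta>q i j z\<bar> <= c * H * sqrt \<epsilon>"
  if "i \<in> {1..N}" "j \<in> {1..N}" "z \<in> cl i j" for i j z
  using that \<eta>q_bound[OF that(1,2), of "fst z" "snd z"] up[OF _ cs(2), of _ "H * sqrt \<epsilon>"] H0 \<epsilon>0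
  by (auto simp: L.\<eta>q_def L.Pq_alt L.q_def mult.assoc)
 have \<eta>u: "\<bar>L.\<eta>u i j z\<bar> <= c * H"
  if "i \<in> {1..N}" "j \<in> {1..N}" "z \<in> cl i j" for i j z
  using that \<eta>u_bound[OF that(1,2), of "fst z" "snd z"] up[OF _ cs(2) H0]
  by (auto simp: L.\<eta>u_def L.Pu_def)
 have gx: "\<epsilon> * \<bar>L.gx i j z\<bar> <= c * H * (\<omega> i j z + \<epsilon>)"
  if "i \<in> {1..N}" "j \<in> {1..N}" "z \<in> cl i j" for i j z
 proof -
  note ij = that(1,2)
  obtain x y where z: "z = (x, y)" "x \<in> {X (i - 1)..X i}" "y \<in> {Y (j - 1)..Y j}" using \<open>z \<in> cl i j\<close> by (rule SigmaE)
  have "\<epsilon> * \<bar>L.gx i j z\<bar> <= B * H * (EE x + \<epsilon>)"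
   using error_Y(5)[OF in_three(1) ij(2) X_cell_unit[OF ij(1) z(2)] z(3)] by (simp add: L.gx_def z)
  also have "... <= B * H * (\<omega> i j z + \<epsilon>)"
   using EE_le_\<omega>[of z i j] consts_nonneg(4) H0 z(1) by (intro mult_left_mono) auto
  finally show ?thesis using up[OF _ cs(1) o, of _ i j z] by (simp add: mult.assoc)
 qed
 have gy: "sqrt \<epsilon> * \<bar>L.gy i j z\<bar> <= c * H"
  if "i \<in> {1..N}" "j \<in> {1..N}" "z \<in> cl i j" for i j z
  using that error_uy_X[OF in_three(1) that(1), of "fst z" "snd z"] Y_cell_unit[OF that(2)] up[OF _ cs(1) H0]
  by (auto simp: L.gy_def)
 have N: "N \<in> {1..N}" "X N \<in> {X (N - 1)..X N}" "Y N \<in> {Y (N - 1)..Y N}"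
  using gx.N1 gx.cell[of N] gy.cell[of N] by auto
 \<comment> \<open>At x = 1 the weight \<open>\<omega>\<close> is 1, so only
   \<open>1 + \<epsilon>\<close> remains, which is at most \<open>1 + e0\<close>. A plain multiple
   of \<open>H\<close> suffices for this trace.\<close>
 have \<zeta>p: "\<bar>L.\<zeta>p N j (X N, y)\<bar> <= c * H" if j: "j \<in> {1..N}" and y: "y \<in> {Y (j - 1)..Y j}" for j y
 proof -
  have "\<not> N <= 2 * m" using N4 by linarith
  then have "\<omega> N j (X N, y) = 1" using X_ends by (simp add: \<omega>_def EE_def)
  then have "\<bar>L.\<zeta>p N j (X N, y)\<bar> <= CP * (B * H * (1 + \<epsilon>))"
   using \<zeta>p_bound[OF N(1) j N(2) y] by (simp add: L.\<zeta>p_def L.Pp_def L.p_def)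
  also have "... <= CP * (B * H * (1 + e0))"
   using \<epsilon>_bound CP(3) consts_nonneg(4) H0 by (intro mult_left_mono) (auto simp: e0_def)
  also have "... = B * CP * (1 + e0) * H" by (simp only: mult_ac)
  finally show ?thesis using up[OF _ cs(3) H0] by blast
 qed
 have \<zeta>q: "\<bar>L.\<zeta>q i N (x, Y N)\<bar> <= c * H * sqrt \<epsilon>" if i: "i \<in> {1..N}" and x: "x \<in> {X (i - 1)..X i}" for i x
 proof -
  have "\<bar>L.\<zeta>q i N (x, Y N)\<bar> <= B * CP * (H * sqrt \<epsilon>)"
   using \<zeta>q_bound[OF i N(1) x N(3)] by (simp add: L.\<zeta>q_def L.Pq_alt[OF i N(1)] L.q_def mult_ac)
  from up[OF this BCP] show ?thesis using H0 \<epsilon>0 by (simp add: mult.assoc)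
 qed
 have \<zeta>u: "\<bar>L.\<zeta>u i j z\<bar> <= c * H"
  if "i \<in> {1..N}" "j \<in> {1..N}" "z \<in> cl i j" for i j z
 proof -
  have "\<bar>L.\<zeta>u i j z\<bar> <= B * CP * H"
   using that \<zeta>u_bound[OF that(1,2), of "fst z" "snd z"] by (auto simp: L.\<zeta>u_def L.Pu_def mult_ac)
  from up[OF this BCP H0] show ?thesis .
 qed
 have ga: "\<bar>L.ga i j z\<bar> <= c * H & \<bar>L.gax i j z\<bar> <= c * H"
  if "i \<in> {1..N}" "j \<in> {1..N}" "z \<in> cl i j" for i j z
 proof -
  note ij = that(1,2)
  obtain x y where z: "z = (x, y)" "x \<in> {X (i - 1)..X i}" "y \<in> {Y (j - 1)..Y j}" using \<open>z \<in> cl i j\<close> by (rule SigmaE)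
  have "B / 2 <= c" using cs(1) consts_nonneg(4) by linarith
  then have up': "r <= c * H" if "r <= B / 2 * H" for r using up[OF that _ H0] by blast
  show ?thesis
   using up'[OF error_Y(1)[OF in_three(1) ij(2) X_cell_unit[OF ij(1) z(2)] z(3)]]
    up'[OF error_Y(2)[OF in_three(1) ij(2) X_cell_unit[OF ij(1) z(2)] z(3)]]
   by (simp add: L.ga_def L.gax_def z)
 qed
 have \<phi>: "\<bar>L.\<phi> i j z\<bar> <= c * H * (\<omega> i j z + \<epsilon>)"
  if "i \<in> {1..N}" "j \<in> {1..N}" "z \<in> cl i j" for i j z
  using that \<phi>_bound[OF that(1,2) _ _ ac Ma(1), of "fst z" "snd z"] up[OF _ cs(4) o, of _ i j z]
  by (auto simp: L.\<phi>_def L.agb_def mult.assoc)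
 have \<theta>: "\<bar>L.\<theta> N j (X N, y)\<bar> <= c * H" if j: "j \<in> {1..N}" and y: "y \<in> {Y (j - 1)..Y j}" for j y
  using \<theta>_bound[OF N(1) j N(2) y ac Ma(1)] up[OF _ cs(5) H0] X_ends by (simp add: L.\<theta>_def L.\<phi>_def L.agb_def)
 note conds = X_ends Y_ends \<alpha>0 al[folded Q] \<beta>(1) \<beta>(2)[folded Q] l1 l2 Ma(1)[folded Q] Ma(2)[folded Q] Ma(3)[folded Q] H0 c0 \<epsilon>_bound[folded e0_def] pc2_\<omega> \<omega>_square
 have "energy N X Y \<epsilon> a ax b l1 l2 L.\<xi>u L.\<xi>p L.\<xi>q <= L.C\<xi> \<alpha> \<beta> C1 Ma (1 / \<alpha>) e0 * c\<^sup>2 * H\<^sup>2"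
  by (rule L.energy_estimate[where \<omega> = \<omega>]) (fact conds \<eta>p \<eta>q \<eta>u gx gy \<zeta>p \<zeta>q \<zeta>u ga \<phi> \<theta>)+
 then show ?E unfolding L.\<xi>u_def L.\<xi>p_def L.\<xi>q_def L.Pu_def L.Pp_def L.Pq_def L.p_def L.q_def c_def .
 have wp: "L2D N X Y (%i j z. (L.\<eta>p i j z)\<^sup>2) <= \<epsilon> * (c\<^sup>2 * H\<^sup>2 * L.K\<omega> (1 / \<alpha>) e0)"
  by (rule L.weight_bound[where \<omega> = \<omega>]) (fact conds L.pc2_errors \<eta>p)+
 have wq: "L2D N X Y (%i j z. (L.\<eta>q i j z)\<^sup>2) <= (c * H * sqrt \<epsilon>)\<^sup>2"
  by (rule L.const_bound[where \<omega> = \<omega>]) (fact conds L.pc2_errors \<eta>q)+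
 have wu: "L2D N X Y (%i j z. (b z - ax z / 2) * (L.\<eta>u i j z)\<^sup>2) <= (2 * Ma) * (c * H)\<^sup>2"
 proof -
  have "L2D N X Y (%i j z. (b z - ax z / 2) * (L.\<eta>u i j z)\<^sup>2) <= L2D N X Y (%i j z. (2 * Ma) * (c * H)\<^sup>2)"
  proof (rule L2D_mono)
   have "continuous_on (RX \<times> RY) ax" using L.a by (simp add: has_dx_def)
   then show "pc2 N X Y (%i j z. (b z - ax z / 2) * (L.\<eta>u i j z)\<^sup>2)"
    by (intro pc2_mult pc2_diff pc2_divide pc2_power pc2_global L.pc2_errors L.b)
   show "pc2 N X Y (%i j z. 2 * Ma * (c * H)\<^sup>2)" by (rule pc2_const)
   fix i j z assume z: "i \<in> {1..N}" "j \<in> {1..N}" "z \<in> cl i j"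
   then have "z \<in> Q01" using X_cell_unit[OF z(1)] Y_cell_unit[OF z(2)] by auto
   then have "b z - ax z / 2 <= 2 * Ma" using Ma(2,3)[of z] Ma0 by (auto simp: abs_le_iff)
   then show "(b z - ax z / 2) * (L.\<eta>u i j z)\<^sup>2 <= 2 * Ma * (c * H)\<^sup>2"
    using Ma0 abs_le_square_bound[OF \<eta>u[OF z]] by (intro mult_mono) auto
  qed
  then show ?thesis by (simp add: L2D_const X_ends Y_ends)
 qed
 have K\<omega>: "L.K\<omega> (1 / \<alpha>) e0 = 2 * (1 / \<alpha> + e0)"
  by (rule L.K\<omega>_def[where \<omega> = \<omega>]) (fact conds)+
 have "(L2D N X Y (%i j z. (L.\<eta>p i j z)\<^sup>2) + L2D N X Y (%i j z. (L.\<eta>q i j z)\<^sup>2)) / \<epsilon>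
  <= (\<epsilon> * (c\<^sup>2 * H\<^sup>2 * L.K\<omega> (1 / \<alpha>) e0) + (c * H * sqrt \<epsilon>)\<^sup>2) / \<epsilon>"
  using wp wq \<epsilon>0 by (intro divide_right_mono add_mono) auto
 also have "... = c\<^sup>2 * H\<^sup>2 * L.K\<omega> (1 / \<alpha>) e0 + c\<^sup>2 * H\<^sup>2" using \<epsilon>0 by (simp add: power_mult_distrib field_simps)
 finally have "(L2D N X Y (%i j z. (L.\<eta>p i j z)\<^sup>2) + L2D N X Y (%i j z. (L.\<eta>q i j z)\<^sup>2)) / \<epsilon>
   + L2D N X Y (%i j z. (b z - ax z / 2) * (L.\<eta>u i j z)\<^sup>2) <= c\<^sup>2 * H\<^sup>2 * L.K\<omega> (1 / \<alpha>) e0 + c\<^sup>2 * H\<^sup>2 + (2 * Ma) * (c * H)\<^sup>2"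
  using wu by linarith
 also have "... = c\<^sup>2 * H\<^sup>2 * (2 * (1 / \<alpha> + e0) + 1 + 2 * Ma)"
  unfolding K\<omega> by (simp add: power_mult_distrib algebra_simps)
 finally show ?N unfolding L.\<eta>u_def L.\<eta>p_def L.\<eta>q_def L.Pu_def L.Pp_def L.Pq_def L.p_def L.q_def c_def .
qed

end

section \<open>Mesh functions as families of functions on the cells\<close>

lemma left_limit:
 fixes \<phi> \<Phi> :: "real => real"
 assumes "c < d" "continuous_on {c..d} \<Phi>" "!!t. t \<in> {c<..<d} ==> \<phi> t = \<Phi> t"
 shows "Lim (at_left d) \<phi> = \<Phi> d"
proof (rule tendsto_Lim)
 have "\<forall>\<^sub>F t in at_left d. \<Phi> t = \<phi> t"
  using eventually_at_left_real[OF assms(1)] by (rule eventually_mono) (simp add: assms(3))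
 then show "(\<phi> \<longlongrightarrow> \<Phi> d) (at_left d)"
  using continuous_on_Icc_at_leftD[OF assms(2,1)] Lim_transform_eventually by blast
qed simp

lemma right_limit:
 fixes \<phi> \<Phi> :: "real => real"
 assumes "c < d" "continuous_on {c..d} \<Phi>" "!!t. t \<in> {c<..<d} ==> \<phi> t = \<Phi> t"
 shows "Lim (at_right c) \<phi> = \<Phi> c"
proof (rule tendsto_Lim)
 have "\<forall>\<^sub>F t in at_right c. \<Phi> t = \<phi> t"
  using eventually_at_right_real[OF assms(1)] by (rule eventually_mono) (simp add: assms(3))
 then show "(\<phi> \<longlongrightarrow> \<Phi> c) (at_right c)"
  using continuous_on_Icc_at_rightD[OF assms(2,1)] Lim_transform_eventually by blast
qed simp

text \<open>Equality is required only in the open interval, so boundary values of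
  \<open>\<phi>\<close> and \<open>\<psi>\<close> are free. The continuous extensions connect the
  Lebesgue integral in \<open>ip\<close> with the gauge integral of the families.\<close>

lemma ip_interval:
 fixes \<phi> \<psi> \<Phi> \<Psi> :: "real => real"
 assumes cont: "continuous_on {c..d} \<Phi>" "continuous_on {c..d} \<Psi>"
  and eq: "!!t. t \<in> {c<..<d} ==> \<phi> t = \<Phi> t & \<psi> t = \<Psi> t"
 shows "ip {c<..<d} \<phi> \<psi> = integral {c..d} (%t. \<Phi> t * \<Psi> t)"
proof -
 have "(%t. \<Phi> t * \<Psi> t) absolutely_integrable_on {c..d}"
  using cont by (intro absolutely_integrable_continuous_real continuous_intros)
 then have "set_integrable lebesgue {c<..<d} (%t. \<Phi> t * \<Psi> t)"
  by (rule set_integrable_subset) auto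
 from set_lebesgue_integral_eq_integral(2)[OF this]
 have "(LINT t:{c<..<d}|lebesgue. \<Phi> t * \<Psi> t) = integral {c..d} (%t. \<Phi> t * \<Psi> t)"
  using integral_open_interval[of c d "%t. \<Phi> t * \<Psi> t"] by (simp add: box_real)
 moreover have "ip {c<..<d} \<phi> \<psi> = (LINT t:{c<..<d}|lebesgue. \<Phi> t * \<Psi> t)"
  unfolding ip_def by (rule set_lebesgue_integral_cong) (auto simp: eq)
 ultimately show ?thesis by simp
qed

lemma cell_integral:
 fixes g G :: fn2
 assumes cont: "continuous_on ({c..d} \<times> {c'..d'}) G"
  and eq: "!!z. z \<in> {c<..<d} \<times> {c'<..<d'} ==> g z = G z"
 shows "g absolutely_integrable_on {c<..<d} \<times> {c'<..<d'}"
  and "integral ({c<..<d} \<times> {c'<..<d'}) g = integral ({c..d} \<times> {c'..d'}) G"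
  and "integral ({c..d} \<times> {c'..d'}) G = integral {c'..d'} (%y. integral {c..d} (%x. G (x, y)))"
  and "integral ({c..d} \<times> {c'..d'}) G = integral {c..d} (%x. integral {c'..d'} (%y. G (x, y)))"
proof -
 have cb: "cbox (c, c') (d, d') = {c..d} \<times> {c'..d'}" by (simp add: cbox_Pair_eq)
 have b: "box (c, c') (d, d') = {c<..<d} \<times> {c'<..<d'}" by (auto simp: box_def Basis_prod_def)
 have "G absolutely_integrable_on {c..d} \<times> {c'..d'}"
  using absolutely_integrable_continuous[of "(c, c')" "(d, d')" G] cont by (simp add: cb)
 then have "G absolutely_integrable_on {c<..<d} \<times> {c'<..<d'}"
 proof (rule set_integrable_subset)
  show "{c<..<d} \<times> {c'<..<d'} \<in> sets lebesgue" unfolding b[symmetric] by simp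
  show "{c<..<d} \<times> {c'<..<d'} \<subseteq> {c..d} \<times> {c'..d'}" by auto
 qed
 moreover have "(g absolutely_integrable_on {c<..<d} \<times> {c'<..<d'}) = (G absolutely_integrable_on {c<..<d} \<times> {c'<..<d'})"
  by (intro set_integrable_cong refl eq)
 ultimately show "g absolutely_integrable_on {c<..<d} \<times> {c'<..<d'}" by (rule iffD2[rotated])
 have "integral ({c<..<d} \<times> {c'<..<d'}) g = integral ({c<..<d} \<times> {c'<..<d'}) G"
  by (rule integral_cong) (rule eq)
 then show "integral ({c<..<d} \<times> {c'<..<d'}) g = integral ({c..d} \<times> {c'..d'}) G"
  using integral_open_interval[of "(c, c')" "(d, d')" G] by (simp add: b cb)
 show x: "integral ({c..d} \<times> {c'..d'}) G = integral {c..d} (%x. integral {c'..d'} (%y. G (x, y)))"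
  using integral_prod_continuous[of c c' d d' G] cont by (simp add: cb)
 show "integral ({c..d} \<times> {c'..d'}) G = integral {c'..d'} (%y. integral {c..d} (%x. G (x, y)))"
  unfolding x using integral_swap_continuous[of c c' d d' "%x y. G (x, y)"] cont by (simp add: cb)
qed

context grid
begin

text \<open>With cells closed on the right, exactly one index belongs to each point beyond the first
  node; \<open>glue\<close> selects the cell in this way.\<close>

lemma LEAST_cell: "i \<in> {1..N} ==> X (i - 1) < t ==> t <= X i ==> (LEAST i. t <= X i) = i"
proof (rule Least_equality)
 fix y assume i: "i \<in> {1..N}" "X (i - 1) < t" "t <= X y"
 show "i <= y"
 proof (rule ccontr)
  assume "\<not> i <= y"
  then have "X y <= X (i - 1)" using i by (intro X_mono) auto
  then show False using i by linarith
 qed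
qed

lemma find_cell:
 assumes "X 0 < t" "t < X N" "!!i. i <= N ==> t \<noteq> X i"
 shows "\<exists>i\<in>{1..N}. t \<in> {X (i - 1)<..<X i}"
proof -
 define i where "i = (LEAST i. t <= X i)"
 have i: "t <= X i" "i <= N" unfolding i_def using assms(2) by (auto intro: LeastI[of _ N] Least_le)
 then have "i \<noteq> 0" using assms(1) by (metis not_le)
 then have "\<not> t <= X (i - 1)" unfolding i_def by (intro not_less_Least) simp
 then show ?thesis using i \<open>i \<noteq> 0\<close> assms(3)[of i] by (intro bexI[of _ i]) auto
qed

lemma ip_cells:
 assumes "pc N X \<Phi>" "pc N X \<Psi>"
  and "!!j t. j \<in> {1..N} ==> t \<in> {X (j - 1)<..<X j} ==> \<phi> t = \<Phi> j t & \<psi> t = \<Psi> j t"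
 shows "(\<Sum>j=1..N. ip {X (j - 1)<..<X j} \<phi> \<psi>) = L1 N X (%j t. \<Phi> j t * \<Psi> j t)"
 unfolding L1_def
proof (rule sum.cong[OF refl])
 fix j assume "j \<in> {1..N}"
 then show "ip {X (j - 1)<..<X j} \<phi> \<psi> = integral {X (j - 1)..X j} (%t. \<Phi> j t * \<Psi> j t)"
  using assms by (intro ip_interval) (auto simp: pc_def)
qed

end

context grid2
begin

lemma sum_ends: "(\<Sum>i=0..N. t i) = t 0 + (\<Sum>i=1..N-1. t i) + (t N :: real)"
 and sum_low: "(\<Sum>i=0..N-1. t i) = t 0 + (\<Sum>i=1..N-1. t i :: real)"
 and sum_high: "(\<Sum>i=1..N. t i) = (\<Sum>i=1..N-1. t i) + (t N :: real)"
proof -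
 obtain n where n: "N = Suc n" using gx.N1 by (cases N) auto
 show "(\<Sum>i=1..N. t i) = (\<Sum>i=1..N-1. t i) + t N" "(\<Sum>i=0..N-1. t i) = t 0 + (\<Sum>i=1..N-1. t i)"
  "(\<Sum>i=0..N. t i) = t 0 + (\<Sum>i=1..N-1. t i) + t N"
  by (simp_all add: n sum.atLeast_Suc_atMost)
qed

lemma pc_step:
 assumes "pc2 N X Y s" "i \<in> {1..N-1}"
 shows "pc N Y (%j y. s i j (X i, y))" "pc N Y (%j y. s (Suc i) j (X i, y))"
 using assms by (auto intro!: trace_pc(1)[OF assms(1)] trace_pc_Suc[OF assms(1)])

text \<open>The sum over the mesh lines is taken out of the integral in y, so that each line gives
  the separate integral by which \<open>T2\<close> is written.\<close>

lemma XD1_expand: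
 assumes U: "pc2 N X Y U" and s: "disc N k s"
 shows "XD1 N X Y U s = L2D N X Y (%i j z. U i j z * dX (s i j) z)
  + (\<Sum>i=1..N-1. L1 N Y (%j y. U i j (X i, y) * (s (Suc i) j (X i, y) - s i j (X i, y))))"
proof -
 note p = disc_pc2(1)[OF s, of X Y] disc_pc2(2)[OF s, of X Y]
 have "XD1 N X Y U s = L1 N Y (%j y. L1 N X (%i x. U i j (x, y) * dX (s i j) (x, y)))
  + L1 N Y (%j y. \<Sum>i=1..N-1. U i j (X i, y) * (s (Suc i) j (X i, y) - s i j (X i, y)))"
  unfolding XD1_def D1_def
  by (intro L1_add pc_sum pc_mult pc_diff pc_step U p pc_L1_y[OF pc2_mult[OF U p(2)]])
 also have "L1 N Y (%j y. \<Sum>i=1..N-1. U i j (X i, y) * (s (Suc i) j (X i, y) - s i j (X i, y)))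
  = (\<Sum>i=1..N-1. L1 N Y (%j y. U i j (X i, y) * (s (Suc i) j (X i, y) - s i j (X i, y))))"
  by (intro L1_sum pc_mult pc_diff pc_step U p) auto
 finally show ?thesis by (simp add: L2D_def)
qed

lemma XD2_expand:
 assumes P: "pc2 N X Y P" and v: "disc N k v"
 shows "XD2 N X Y P v = L2D N X Y (%i j z. P i j z * dX (v i j) z)
  + (\<Sum>i=1..N-1. L1 N Y (%j y. P (Suc i) j (X i, y) * (v (Suc i) j (X i, y) - v i j (X i, y))))
  + L1 N Y (%j y. P 1 j (X 0, y) * v 1 j (X 0, y)) - L1 N Y (%j y. P N j (X N, y) * v N j (X N, y))"
proof -
 note p = disc_pc2(1)[OF v, of X Y] disc_pc2(2)[OF v, of X Y]
 note c = pc_L1_y[OF pc2_mult[OF P p(2)]] trace_pc_1[OF P] trace_pc_1[OF p(1)] trace_pc_N[OF P] trace_pc_N[OF p(1)]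
 have m: "pc N Y (%j y. \<Sum>i=1..N-1. P (Suc i) j (X i, y) * (v (Suc i) j (X i, y) - v i j (X i, y)))"
  by (intro pc_sum pc_mult pc_diff pc_step P p)
 have "XD2 N X Y P v = L1 N Y (%j y. L1 N X (%i x. P i j (x, y) * dX (v i j) (x, y)))
  + L1 N Y (%j y. \<Sum>i=1..N-1. P (Suc i) j (X i, y) * (v (Suc i) j (X i, y) - v i j (X i, y)))
  + L1 N Y (%j y. P 1 j (X 0, y) * v 1 j (X 0, y)) - L1 N Y (%j y. P N j (X N, y) * v N j (X N, y))"
  unfolding XD2_def D2_def
  by (subst L1_diff L1_add; (intro pc_add pc_mult m c)?)+ simp
 also have "L1 N Y (%j y. \<Sum>i=1..N-1. P (Suc i) j (X i, y) * (v (Suc i) j (X i, y) - v i j (X i, y)))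
  = (\<Sum>i=1..N-1. L1 N Y (%j y. P (Suc i) j (X i, y) * (v (Suc i) j (X i, y) - v i j (X i, y))))"
  by (intro L1_sum pc_mult pc_diff pc_step P p) auto
 finally show ?thesis by (simp add: L2D_def)
qed

lemma XL4_expand:
 assumes a: "continuous_on (RX \<times> RY) a" and U: "pc2 N X Y U" and v: "disc N k v"
 shows "XL4 N X Y a U v = - L2D N X Y (%i j z. a z * U i j z * dX (v i j) z)
  - (\<Sum>i=1..N-1. L1 N Y (%j y. a (X i, y) * U i j (X i, y) * (v (Suc i) j (X i, y) - v i j (X i, y))))
  + L1 N Y (%j y. a (X N, y) * U N j (X N, y) * v N j (X N, y))"
proof -
 note p = disc_pc2(1)[OF v, of X Y] disc_pc2(2)[OF v, of X Y]
 have aU: "pc2 N X Y (%i j z. a z * U i j z)" by (intro pc2_mult pc2_global a U)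
 have D: "pc N Y (%j y. D1 N X (%i x. a (x, y) * U i j (x, y)) (%i x. v i j (x, y)) (%i x. dX (v i j) (x, y)))"
  using pc_D1[OF aU p] .
 have T: "pc N Y (%j y. a (X N, y) * U N j (X N, y) * v N j (X N, y))"
  by (intro pc_mult trace_const a trace_pc_N[OF U] trace_pc_N[OF p(1)]) simp
 have "XL4 N X Y a U v = - XD1 N X Y (%i j z. a z * U i j z) v + L1 N Y (%j y. a (X N, y) * U N j (X N, y) * v N j (X N, y))"
  unfolding XL4_def L4_def XD1_def
  by (subst L1_add[OF pc_minus[OF D] T]) (simp add: L1_minus)
 then show ?thesis unfolding XD1_expand[OF aU v] by simp
qed

lemma XJ_expand:
 assumes a: "continuous_on (RX \<times> RY) a" and v: "pc2 N X Y v"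
 shows "XJ N X Y a v = L1 N Y (%j y. a (X 0, y) * (v 1 j (X 0, y))\<^sup>2)
  + (\<Sum>i=1..N-1. L1 N Y (%j y. a (X i, y) * (v (Suc i) j (X i, y) - v i j (X i, y))\<^sup>2))
  + L1 N Y (%j y. a (X N, y) * (v N j (X N, y))\<^sup>2)"
proof -
 have A: "pc N Y (%j y. a (X i, y))" if "i <= N" for i by (rule trace_const[OF a that])
 have m: "pc N Y (%j y. a (X i, y) * (v (Suc i) j (X i, y) - v i j (X i, y))\<^sup>2)" if "i \<in> {1..N-1}" for i
  using that by (intro pc_mult pc_power pc_diff pc_step v A) auto
 have e: "pc N Y (%j y. a (X 0, y) * (v 1 j (X 0, y))\<^sup>2)" "pc N Y (%j y. a (X N, y) * (v N j (X N, y))\<^sup>2)"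
  by (intro pc_mult pc_power A trace_pc_1[OF v] trace_pc_N[OF v]; simp)+
 have "XJ N X Y a v = L1 N Y (%j y. a (X 0, y) * (v 1 j (X 0, y))\<^sup>2)
  + L1 N Y (%j y. \<Sum>i=1..N-1. a (X i, y) * (v (Suc i) j (X i, y) - v i j (X i, y))\<^sup>2)
  + L1 N Y (%j y. a (X N, y) * (v N j (X N, y))\<^sup>2)"
  unfolding XJ_def by (simp only: L1_add[OF pc_add[OF e(1) pc_sum[OF m]] e(2)] L1_add[OF e(1) pc_sum[OF m]])
 then show ?thesis using L1_sum[OF _ m, of "{1..N-1}" "%i. i"] by simp
qed

end

locale mesh_functions = grid2 N X Y k for N :: nat and X Y :: "nat => real" and k :: nat +
 fixes M :: mesh
 assumes M: "cells M = N" "xpt M = X" "ypt M = Y"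
  and ends: "X 0 = 0" "X N = 1" "Y 0 = 0" "Y N = 1"
begin

lemma intervals: "Iint M i = {X (i - 1)<..<X i}" "Jint M j = {Y (j - 1)<..<Y j}"
 by (simp_all add: Iint_def Jint_def M)

lemma Kel: "Kel M i j = {X (i - 1)<..<X i} \<times> {Y (j - 1)<..<Y j}"
 by (simp add: Kel_def intervals)

text \<open>The function is tied to the family only in the open elements, while the family is
  continuous up to the closed cells. One-sided traces of the function are therefore values of the
  family, whatever happens on mesh lines.\<close>

definition rep :: "fn2 => (nat => nat => fn2) => bool"
 where "rep g G \<longleftrightarrow> pc2 N X Y G & (\<forall>i\<in>{1..N}. \<forall>j\<in>{1..N}. \<forall>z\<in>Kel M i j. g z = G i j z)"

lemma rep_pc2: "rep g G ==> pc2 N X Y G" by (simp add: rep_def)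

lemma rep_eq: "rep g G ==> i \<in> {1..N} ==> j \<in> {1..N} ==> z \<in> Kel M i j ==> g z = G i j z"
 by (auto simp: rep_def)

lemma rep_diff: "rep g G ==> rep g' G' ==> rep (%z. g z - g' z) (%i j z. G i j z - G' i j z)"
 and rep_mult: "rep g G ==> rep g' G' ==> rep (%z. g z * g' z) (%i j z. G i j z * G' i j z)"
 by (auto simp: rep_def intro: pc2_diff pc2_mult)

lemma cell_unit:
 assumes "i \<in> {1..N}" "j \<in> {1..N}"
 shows "cl i j \<subseteq> RX \<times> RY"
 by (intro Sigma_mono gx.cell_subset gy.cell_subset assms)

lemma Kel_subset: "Kel M i j \<subseteq> cl i j" by (auto simp: Kel)

lemma rep_global:
 assumes "continuous_on (RX \<times> RY) G" "!!z. z \<in> RX \<times> RY ==> g z = G z"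
 shows "rep g (%i j. G)"
 unfolding rep_def
proof (intro conjI ballI)
 fix i j z assume "i \<in> {1..N}" "j \<in> {1..N}" "z \<in> Kel M i j"
 then have "z \<in> RX \<times> RY" using cell_unit[of i j] Kel_subset[of i j] by blast
 then show "g z = G z" by (rule assms(2))
qed (rule pc2_global[OF assms(1)])

lemma rep_cont: "rep g G ==> i \<in> {1..N} ==> j \<in> {1..N} ==> continuous_on (cl i j) (G i j)"
 by (auto simp: rep_def pc2_def)

lemma Kel_Omega: "i \<in> {1..N} ==> j \<in> {1..N} ==> Kel M i j \<subseteq> Omega"
proof -
 assume ij: "i \<in> {1..N}" "j \<in> {1..N}"
 then have "X 0 <= X (i - 1)" "X i <= X N" "Y 0 <= Y (j - 1)" "Y j <= Y N" by (auto intro!: gx.X_mono gy.X_mono)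
 then show ?thesis by (auto simp: Kel Omega_def ends)
qed

lemma mesh_lines_negligible: "negligible (Omega - (\<Union>(i, j)\<in>{1..N} \<times> {1..N}. Kel M i j))" (is "negligible (_ - ?K)")
proof (rule negligible_subset)
 have "negligible (\<Union>i\<in>{..N}. {z::real\<times>real. z \<bullet> e = t i})" if "e \<in> Basis" for e and t :: "nat => real"
  using that by (intro negligible_Union) auto
 then show "negligible ((\<Union>i\<in>{..N}. {z::real\<times>real. z \<bullet> (1, 0) = X i}) \<union> (\<Union>j\<in>{..N}. {z::real\<times>real. z \<bullet> (0, 1) = Y j}))"
  by (intro negligible_Un) (auto simp: Basis_prod_def)
 show "Omega - ?K \<subseteq> (\<Union>i\<in>{..N}. {z. z \<bullet> (1, 0) = X i}) \<union> (\<Union>j\<in>{..N}. {z. z \<bullet> (0, 1) = Y j})"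
 proof
  fix z assume z: "z \<in> Omega - ?K"
  then obtain x y where xy: "z = (x, y)" "0 < x" "x < 1" "0 < y" "y < 1" by (auto simp: Omega_def)
  show "z \<in> (\<Union>i\<in>{..N}. {z. z \<bullet> (1, 0) = X i}) \<union> (\<Union>j\<in>{..N}. {z. z \<bullet> (0, 1) = Y j})"
  proof (rule ccontr)
   assume "\<not> ?thesis"
   then have "!!i. i <= N ==> x \<noteq> X i" "!!j. j <= N ==> y \<noteq> Y j" by (auto simp: xy)
   then obtain i j where "i \<in> {1..N}" "x \<in> {X (i - 1)<..<X i}" "j \<in> {1..N}" "y \<in> {Y (j - 1)<..<Y j}"
    using gx.find_cell[of x] gy.find_cell[of y] xy by (auto simp: ends)
   then have "z \<in> ?K" unfolding Kel xy by blast
   then show False using z by blast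
  qed
 qed
qed

lemma Kel_disjoint:
 assumes "i \<in> {1..N}" "j \<in> {1..N}" "i' \<in> {1..N}" "j' \<in> {1..N}" "z \<in> Kel M i j" "z \<in> Kel M i' j'"
 shows "i = i' & j = j'"
proof -
 have "X (i - 1) < fst z" "fst z <= X i" "X (i' - 1) < fst z" "fst z <= X i'"
  "Y (j - 1) < snd z" "snd z <= Y j" "Y (j' - 1) < snd z" "snd z <= Y j'" using assms(5,6) by (auto simp: Kel)
 then show ?thesis using gx.LEAST_cell assms(1-4) gy.LEAST_cell by metis
qed

text \<open>The open elements are disjoint and fill the square up to a null set; on each of them the
  continuous extension to the closed cell gives integrability and iterated integrals.\<close>

lemma rep_integral:
 assumes g: "rep g G"
 shows "g absolutely_integrable_on Omega" "integral Omega g = L2D N X Y G"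
proof -
 let ?I = "{1..N} \<times> {1..N}" and ?K = "%(i, j). Kel M i j"
 have c: "g absolutely_integrable_on Kel M i j" 
  "integral (Kel M i j) g = integral {Y (j - 1)..Y j} (%y. integral {X (i - 1)..X i} (%x. G i j (x, y)))"
  if ij: "i \<in> {1..N}" "j \<in> {1..N}" for i j
 proof -
  have eq: "z \<in> {X (i - 1)<..<X i} \<times> {Y (j - 1)<..<Y j} ==> g z = G i j z" for z
   using rep_eq[OF g ij] by (simp add: Kel)
  show "g absolutely_integrable_on Kel M i j"
   unfolding Kel by (rule cell_integral(1)[OF rep_cont[OF g ij] eq])
  have "integral (Kel M i j) g = integral (cl i j) (G i j)"
   unfolding Kel by (rule cell_integral(2)[OF rep_cont[OF g ij] eq])
  also have "... = integral {Y (j - 1)..Y j} (%y. integral {X (i - 1)..X i} (%x. G i j (x, y)))"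
   by (rule cell_integral(3)[OF rep_cont[OF g ij] refl])
  finally show "integral (Kel M i j) g = integral {Y (j - 1)..Y j} (%y. integral {X (i - 1)..X i} (%x. G i j (x, y)))" .
 qed
 have meas: "Kel M i j \<in> sets lebesgue" for i j
  unfolding Kel by (rule sets_completionI_sets) (simp add: borel_open open_Times)
 have 1: "g absolutely_integrable_on (\<Union>p\<in>?I. ?K p)"
  by (rule set_integrable_UN) (use c meas in auto)
 have 2: "(g has_integral (\<Sum>p\<in>?I. integral (?K p) g)) (\<Union>p\<in>?I. ?K p)"
 proof (rule has_integral_UN)
  show "(g has_integral integral (?K p) g) (?K p)" if "p \<in> ?I" for p
   using that set_lebesgue_integral_eq_integral(1)[OF c(1)] by (auto intro!: integrable_integral)
  show "pairwise (%p p'. negligible (?K p \<inter> ?K p')) ?I"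
  proof (intro pairwiseI)
   fix p p' assume "p \<in> ?I" "p' \<in> ?I" "p \<noteq> p'"
   then have "?K p \<inter> ?K p' = {}" using Kel_disjoint by fastforce
   then show "negligible (?K p \<inter> ?K p')" by simp
  qed
 qed simp
 have sub: "(\<Union>p\<in>?I. ?K p) \<subseteq> Omega"
 proof (rule UN_least)
  fix p assume "p \<in> ?I"
  then show "?K p \<subseteq> Omega" using Kel_Omega[of "fst p" "snd p"] by (auto simp: split_beta)
 qed
 then have n1: "negligible {z \<in> (\<Union>p\<in>?I. ?K p) - Omega. g z \<noteq> 0}" by (simp add: Diff_eq_empty_iff[THEN iffD2])
 have n2: "negligible {z \<in> Omega - (\<Union>p\<in>?I. ?K p). g z \<noteq> 0}"
  by (rule negligible_subset[OF mesh_lines_negligible]) auto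
 show "g absolutely_integrable_on Omega" by (rule absolutely_integrable_spike_set[OF 1 n1 n2])
 have "integral Omega g = (\<Sum>p\<in>?I. integral (?K p) g)"
  using integral_spike_set[OF n1 n2] integral_unique[OF 2] by simp
 also have "... = (\<Sum>i=1..N. \<Sum>j=1..N. integral (Kel M i j) g)"
  unfolding sum.cartesian_product by (intro sum.cong) auto
 also have "... = (\<Sum>i=1..N. L1 N Y (%j y. integral {X (i - 1)..X i} (%x. G i j (x, y))))"
  unfolding L1_def by (intro sum.cong refl) (simp add: c(2))
 also have "... = L1 N Y (%j y. \<Sum>i=1..N. integral {X (i - 1)..X i} (%x. G i j (x, y)))"
 proof (intro L1_sum[symmetric])
  fix i assume i: "i \<in> {1..N}"
  show "pc N Y (%j y. integral {X (i - 1)..X i} (%x. G i j (x, y)))"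
   unfolding pc_def
  proof
   fix j assume "j \<in> {1..N}"
   from continuous_on_integral_param[OF continuous_on_swap[OF rep_cont[OF g i this]]]
   show "continuous_on {Y (j - 1)..Y j} (%y. integral {X (i - 1)..X i} (%x. G i j (x, y)))" by simp
  qed
 qed simp
 finally show "integral Omega g = L2D N X Y G" by (simp add: L2D_def L1_def[of N X])
qed

lemma ip_Omega:
 assumes "rep g G" "rep h H"
 shows "ip Omega g h = L2D N X Y (%i j z. G i j z * H i j z)"
proof -
 note gh = rep_integral[OF rep_mult[OF assms]]
 show ?thesis unfolding ip_def set_lebesgue_integral_eq_integral(2)[OF gh(1)] gh(2) ..
qed

lemma
 assumes g: "rep g G" and ij: "i \<in> {1..N}" "j \<in> {1..N}"
 shows tr_x_minus: "y \<in> {Y (j - 1)<..<Y j} ==> tr_x_minus M g i y = G i j (X i, y)"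
  and tr_x_plus: "y \<in> {Y (j - 1)<..<Y j} ==> tr_x_plus M g (i - 1) y = G i j (X (i - 1), y)"
  and tr_y_minus: "x \<in> {X (i - 1)<..<X i} ==> tr_y_minus M g j x = G i j (x, Y j)"
  and tr_y_plus: "x \<in> {X (i - 1)<..<X i} ==> tr_y_plus M g (j - 1) x = G i j (x, Y (j - 1))"
proof -
 have eq: "g (x, y) = G i j (x, y)" if "x \<in> {X (i - 1)<..<X i}" "y \<in> {Y (j - 1)<..<Y j}" for x y
  using rep_eq[OF g ij] that by (simp add: Kel)
 have nz: "i \<noteq> 0" "j \<noteq> 0" "i - 1 \<noteq> N" "j - 1 \<noteq> N" using ij by auto
 {
  assume y: "y \<in> {Y (j - 1)<..<Y j}"
  then have c: "continuous_on {X (i - 1)..X i} (%x. G i j (x, y))" by (intro continuous_on_line_x[OF rep_cont[OF g ij]]) auto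
  show "tr_x_minus M g i y = G i j (X i, y)" "tr_x_plus M g (i - 1) y = G i j (X (i - 1), y)"
   unfolding tr_x_minus_def tr_x_plus_def M
   using left_limit[OF gx.cell[OF ij(1)] c, of "%x. g (x, y)"] right_limit[OF gx.cell[OF ij(1)] c, of "%x. g (x, y)"] eq y nz by auto
 }
 {
  assume x: "x \<in> {X (i - 1)<..<X i}"
  then have c: "continuous_on {Y (j - 1)..Y j} (%y. G i j (x, y))" by (intro continuous_on_line_y[OF rep_cont[OF g ij]]) auto
  show "tr_y_minus M g j x = G i j (x, Y j)" "tr_y_plus M g (j - 1) x = G i j (x, Y (j - 1))"
   unfolding tr_y_minus_def tr_y_plus_def M
   using left_limit[OF gy.cell[OF ij(2)] c, of "%y. g (x, y)"] right_limit[OF gy.cell[OF ij(2)] c, of "%y. g (x, y)"] eq x nz by auto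
 }
qed

lemma tr_x_plus_Suc: "rep g G ==> i < N ==> j \<in> {1..N} ==> y \<in> {Y (j - 1)<..<Y j} ==> tr_x_plus M g i y = G (Suc i) j (X i, y)"
 using tr_x_plus[of g G "Suc i" j y] by simp

lemma jump_x:
 assumes g: "rep g G" and j: "j \<in> {1..N}" and y: "y \<in> {Y (j - 1)<..<Y j}"
 shows "i \<in> {1..N-1} ==> jump_x M g i y = G (Suc i) j (X i, y) - G i j (X i, y)"
  and "jump_x M g 0 y = G 1 j (X 0, y)" and "jump_x M g N y = - G N j (X N, y)"
proof -
 show "jump_x M g i y = G (Suc i) j (X i, y) - G i j (X i, y)" if "i \<in> {1..N-1}"
 proof -
  have "i < N" "i \<in> {1..N}" using that by auto
  then show ?thesis using tr_x_plus_Suc[OF g _ j y, of i] tr_x_minus[OF g _ j y, of i] by (simp add: jump_x_def)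
 qed
 show "jump_x M g 0 y = G 1 j (X 0, y)"
  using tr_x_plus_Suc[OF g _ j y, of 0] gx.N1 by (simp add: jump_x_def tr_x_minus_def)
 show "jump_x M g N y = - G N j (X N, y)"
  using tr_x_minus[OF g _ j y, of N] gx.N1 by (simp add: jump_x_def tr_x_plus_def M)
qed

text \<open>Around an interior point of an element the function coincides with a polynomial in x, so
  the derivative relative to the unit interval is that of the polynomial.\<close>

lemma rep_pdx:
 assumes s: "rep s S" "disc N k S"
 shows "rep (pdx s) (%i j. dX (S i j))"
 unfolding rep_def
proof (intro conjI ballI disc_pc2(2)[OF s(2)])
 fix i j z assume ij: "i \<in> {1..N}" "j \<in> {1..N}" and z: "z \<in> Kel M i j"
 obtain x y where xy: "z = (x, y)" "x \<in> {X (i - 1)<..<X i}" "y \<in> {Y (j - 1)<..<Y j}" using z by (auto simp: Kel)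
 obtain p where p: "(%x. S i j (x, y)) = poly p" "(%x. dX (S i j) (x, y)) = poly (pderiv p)"
  using polyT_dX(1) s(2) ij unfolding disc_def by blast
 have "(poly p has_real_derivative poly (pderiv p) x) (at x)" by (rule poly_DERIV)
 then have "((%t. s (t, y)) has_real_derivative poly (pderiv p) x) (at x)"
 proof (rule has_field_derivative_transform_within_open[where S = "{X (i - 1)<..<X i}"])
  fix t assume t: "t \<in> {X (i - 1)<..<X i}"
  then show "poly p t = s (t, y)" using rep_eq[OF s(1) ij, of "(t, y)"] xy fun_cong[OF p(1), of t] by (simp add: Kel)
 qed (use xy in auto)
 from pdx_eqI[OF has_field_derivative_at_within[OF this]]
 have "pdx s (x, y) = poly (pderiv p) x" using xy subsetD[OF Kel_Omega[OF ij] z] by (simp add: Omega_def)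
 then show "pdx s z = dX (S i j) z" using fun_cong[OF p(2), of x] by (simp add: xy)
qed

end

context mesh_functions
begin

lemma rows:
 assumes "pc N Y \<Phi>" "pc N Y \<Psi>"
  and "!!j t. j \<in> {1..N} ==> t \<in> {Y (j - 1)<..<Y j} ==> \<phi> t = \<Phi> j t & \<psi> t = \<Psi> j t"
 shows "(\<Sum>j=1..N. ip (Jint M j) \<phi> \<psi>) = L1 N Y (%j t. \<Phi> j t * \<Psi> j t)"
 unfolding intervals by (rule gy.ip_cells[OF assms])

lemma T2_x:
 assumes u: "rep u U" and s: "rep s S" "disc N k S"
 shows "ip Omega u (pdx s) + (\<Sum>j=1..N. \<Sum>i=1..N-1. ip (Jint M j) (tr_x_minus M u i) (jump_x M s i)) = XD1 N X Y U S"
proof -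
 have "(\<Sum>j=1..N. ip (Jint M j) (tr_x_minus M u i) (jump_x M s i))
  = L1 N Y (%j y. U i j (X i, y) * (S (Suc i) j (X i, y) - S i j (X i, y)))" if i: "i \<in> {1..N-1}" for i
 proof (rule rows)
  have i': "i \<in> {1..N}" using i by auto
  show "pc N Y (%j y. U i j (X i, y))" by (rule trace_pc(1)[OF rep_pc2[OF u] i'])
  show "pc N Y (%j y. S (Suc i) j (X i, y) - S i j (X i, y))" by (intro pc_diff pc_step rep_pc2[OF s(1)] i)
  show "tr_x_minus M u i y = U i j (X i, y) & jump_x M s i y = S (Suc i) j (X i, y) - S i j (X i, y)"
   if "j \<in> {1..N}" "y \<in> {Y (j - 1)<..<Y j}" for j y
   using tr_x_minus[OF u i' that] jump_x(1)[OF s(1) that i] by blast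
 qed
 then show ?thesis
  unfolding XD1_expand[OF rep_pc2[OF u] s(2)] ip_Omega[OF u rep_pdx[OF s]] by (subst sum.swap) simp
qed

lemma T3_x:
 assumes p: "rep p P" and v: "rep v V" "disc N k V"
 shows "ip Omega p (pdx v) + (\<Sum>j=1..N. (\<Sum>i=0..N-1. ip (Jint M j) (tr_x_plus M p i) (jump_x M v i))
   - ip (Jint M j) (tr_x_minus M p N) (tr_x_minus M v N)) = XD2 N X Y P V"
proof -
 have N: "N \<in> {1..N}" "0 < N" using gx.N1 by auto
 note pv = rep_pc2[OF p] rep_pc2[OF v(1)]
 have 1: "(\<Sum>j=1..N. ip (Jint M j) (tr_x_plus M p i) (jump_x M v i))
  = L1 N Y (%j y. P (Suc i) j (X i, y) * (V (Suc i) j (X i, y) - V i j (X i, y)))" if i: "i \<in> {1..N-1}" for i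
 proof (rule rows)
  have i': "i < N" using i by auto
  show "pc N Y (%j y. P (Suc i) j (X i, y))" by (rule trace_pc_Suc[OF pv(1) i'])
  show "pc N Y (%j y. V (Suc i) j (X i, y) - V i j (X i, y))" by (intro pc_diff pc_step pv i)
  show "tr_x_plus M p i y = P (Suc i) j (X i, y) & jump_x M v i y = V (Suc i) j (X i, y) - V i j (X i, y)"
   if "j \<in> {1..N}" "y \<in> {Y (j - 1)<..<Y j}" for j y
   using tr_x_plus_Suc[OF p i' that] jump_x(1)[OF v(1) that i] by blast
 qed
 have 2: "(\<Sum>j=1..N. ip (Jint M j) (tr_x_plus M p 0) (jump_x M v 0)) = L1 N Y (%j y. P 1 j (X 0, y) * V 1 j (X 0, y))"
  using tr_x_plus_Suc[OF p N(2)] jump_x(2)[OF v(1)] by (intro rows trace_pc_1 pv) auto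
 have 3: "(\<Sum>j=1..N. ip (Jint M j) (tr_x_minus M p N) (tr_x_minus M v N)) = L1 N Y (%j y. P N j (X N, y) * V N j (X N, y))"
  using tr_x_minus[OF p N(1)] tr_x_minus[OF v(1) N(1)] by (intro rows trace_pc_N pv) auto
 have s1: "(\<Sum>i=1..N-1. \<Sum>j=1..N. ip (Jint M j) (tr_x_plus M p i) (jump_x M v i))
  = (\<Sum>i=1..N-1. L1 N Y (%j y. P (Suc i) j (X i, y) * (V (Suc i) j (X i, y) - V i j (X i, y))))"
  by (intro sum.cong refl 1)
 have swp: "(\<Sum>j=1..N. (\<Sum>i=0..N-1. ip (Jint M j) (tr_x_plus M p i) (jump_x M v i))
   - ip (Jint M j) (tr_x_minus M p N) (tr_x_minus M v N))
  = (\<Sum>i=0..N-1. \<Sum>j=1..N. ip (Jint M j) (tr_x_plus M p i) (jump_x M v i)) 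
   - (\<Sum>j=1..N. ip (Jint M j) (tr_x_minus M p N) (tr_x_minus M v N))"
  unfolding sum_subtractf by (subst sum.swap) simp
 show ?thesis
  unfolding XD2_expand[OF pv(1) v(2)] ip_Omega[OF p rep_pdx[OF v]] swp unfolding sum_low 2 3 s1 by simp
qed

lemma T4_x:
 assumes a: "continuous_on (RX \<times> RY) a" and u: "rep u U" and v: "rep v V" "disc N k V"
 shows "- ip Omega (%z. a z * u z) (pdx v)
   - (\<Sum>j=1..N. \<Sum>i=1..N. ip (Jint M j) (%y. a (X i, y) * tr_x_minus M u i y) (jump_x M v i)) = XL4 N X Y a U V"
proof -
 have N: "N \<in> {1..N}" "0 < N" using gx.N1 by auto
 note uv = rep_pc2[OF u] rep_pc2[OF v(1)]
 note au = rep_mult[OF rep_global[OF a refl] u]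
 have 1: "(\<Sum>j=1..N. ip (Jint M j) (%y. a (X i, y) * tr_x_minus M u i y) (jump_x M v i))
  = L1 N Y (%j y. a (X i, y) * U i j (X i, y) * (V (Suc i) j (X i, y) - V i j (X i, y)))" if i: "i \<in> {1..N-1}" for i
 proof (rule rows)
  have i': "i \<in> {1..N}" "i <= N" using i by auto
  show "pc N Y (%j y. a (X i, y) * U i j (X i, y))" by (intro pc_mult trace_const[OF a i'(2)] trace_pc(1)[OF uv(1) i'(1)])
  show "pc N Y (%j y. V (Suc i) j (X i, y) - V i j (X i, y))" by (intro pc_diff pc_step uv i)
  show "a (X i, y) * tr_x_minus M u i y = a (X i, y) * U i j (X i, y) & jump_x M v i y = V (Suc i) j (X i, y) - V i j (X i, y)"
   if "j \<in> {1..N}" "y \<in> {Y (j - 1)<..<Y j}" for j y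
   using tr_x_minus[OF u i'(1) that] jump_x(1)[OF v(1) that i] by simp
 qed
 have 2: "(\<Sum>j=1..N. ip (Jint M j) (%y. a (X N, y) * tr_x_minus M u N y) (jump_x M v N))
  = L1 N Y (%j y. (a (X N, y) * U N j (X N, y)) * - V N j (X N, y))"
  using tr_x_minus[OF u N(1)] jump_x(3)[OF v(1)] by (intro rows trace_pc_N uv pc_mult pc_minus trace_const a) auto
 let ?F = "%i j. ip (Jint M j) (%y. a (X i, y) * tr_x_minus M u i y) (jump_x M v i)"
 have "(\<Sum>j=1..N. \<Sum>i=1..N. ?F i j) = (\<Sum>i=1..N. \<Sum>j=1..N. ?F i j)" by (rule sum.swap)
 also have "... = (\<Sum>i=1..N-1. \<Sum>j=1..N. ?F i j) + (\<Sum>j=1..N. ?F N j)" by (rule sum_high)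
 also have "(\<Sum>i=1..N-1. \<Sum>j=1..N. ?F i j)
  = (\<Sum>i=1..N-1. L1 N Y (%j y. a (X i, y) * U i j (X i, y) * (V (Suc i) j (X i, y) - V i j (X i, y))))"
  by (intro sum.cong refl 1)
 finally show ?thesis
  unfolding XL4_expand[OF a uv(1) v(2)] ip_Omega[OF au rep_pdx[OF v]] 2 by (simp add: L1_minus)
qed

lemma trace_x:
 assumes u: "rep u U" and v: "rep v V"
 shows "(\<Sum>j=1..N. ip (Jint M j) (%y. l * tr_x_minus M u N y) (tr_x_minus M v N)) = l * XT N X Y (%i j z. U i j z * V i j z)"
proof -
 have N: "N \<in> {1..N}" using gx.N1 by auto
 have "(\<Sum>j=1..N. ip (Jint M j) (%y. l * tr_x_minus M u N y) (tr_x_minus M v N))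
  = L1 N Y (%j y. (l * U N j (X N, y)) * V N j (X N, y))"
  using tr_x_minus[OF u N] tr_x_minus[OF v N] by (intro rows trace_pc_N rep_pc2[OF u] rep_pc2[OF v] pc_cmult) auto
 then show ?thesis by (simp add: XT_def mult.assoc L1_cmult)
qed

lemma jumps_x:
 assumes a: "continuous_on (RX \<times> RY) a" and v: "rep v V"
 shows "(\<Sum>j=1..N. \<Sum>i=0..N. 1 / 2 * ip (Jint M j) (%y. a (X i, y)) (%y. (jump_x M v i y)\<^sup>2)) = XJ N X Y a V / 2"
  and "(\<Sum>j=1..N. ip (Jint M j) (%y. l) (%y. (jump_x M v N y)\<^sup>2)) = l * XT N X Y (%i j z. (V i j z)\<^sup>2)"
proof -
 note pv = rep_pc2[OF v]
 have 1: "(\<Sum>j=1..N. ip (Jint M j) (%y. a (X i, y)) (%y. (jump_x M v i y)\<^sup>2))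
  = L1 N Y (%j y. a (X i, y) * (V (Suc i) j (X i, y) - V i j (X i, y))\<^sup>2)" if i: "i \<in> {1..N-1}" for i
  using jump_x(1)[OF v _ _ i] i by (intro rows pc_power pc_diff pc_step pv trace_const a) auto
 have 2: "(\<Sum>j=1..N. ip (Jint M j) (%y. a (X 0, y)) (%y. (jump_x M v 0 y)\<^sup>2)) = L1 N Y (%j y. a (X 0, y) * (V 1 j (X 0, y))\<^sup>2)"
  using jump_x(2)[OF v] by (intro rows pc_power trace_pc_1 pv trace_const a) auto
 have 3: "(\<Sum>j=1..N. ip (Jint M j) (%y. a (X N, y)) (%y. (jump_x M v N y)\<^sup>2)) = L1 N Y (%j y. a (X N, y) * (V N j (X N, y))\<^sup>2)"
  using jump_x(3)[OF v] by (intro rows pc_power trace_pc_N pv trace_const a) auto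
 show "(\<Sum>j=1..N. \<Sum>i=0..N. 1 / 2 * ip (Jint M j) (%y. a (X i, y)) (%y. (jump_x M v i y)\<^sup>2)) = XJ N X Y a V / 2"
 proof -
  let ?F = "%i j. ip (Jint M j) (%y. a (X i, y)) (%y. (jump_x M v i y)\<^sup>2)"
  have "(\<Sum>j=1..N. \<Sum>i=0..N. 1 / 2 * ?F i j) = (\<Sum>i=0..N. \<Sum>j=1..N. ?F i j) / 2"
   by (subst sum.swap) (simp add: sum_divide_distrib)
  also have "(\<Sum>i=0..N. \<Sum>j=1..N. ?F i j) = (\<Sum>j=1..N. ?F 0 j) + (\<Sum>i=1..N-1. \<Sum>j=1..N. ?F i j) + (\<Sum>j=1..N. ?F N j)"
   by (rule sum_ends)
  also have "(\<Sum>i=1..N-1. \<Sum>j=1..N. ?F i j)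
   = (\<Sum>i=1..N-1. L1 N Y (%j y. a (X i, y) * (V (Suc i) j (X i, y) - V i j (X i, y))\<^sup>2))"
   by (intro sum.cong refl 1)
  finally show ?thesis unfolding 2 3 XJ_expand[OF a pv] .
 qed
 have "(\<Sum>j=1..N. ip (Jint M j) (%y. l) (%y. (jump_x M v N y)\<^sup>2)) = L1 N Y (%j y. l * (V N j (X N, y))\<^sup>2)"
  using jump_x(3)[OF v] by (intro rows pc_power trace_pc_N pv pc_const) auto
 then show "(\<Sum>j=1..N. ip (Jint M j) (%y. l) (%y. (jump_x M v N y)\<^sup>2)) = l * XT N X Y (%i j z. (V i j z)\<^sup>2)"
  by (simp add: XT_def L1_cmult)
qed

subsection \<open>Interchanging the variables\<close>

text \<open>The mesh with exchanged axes. Traces, jumps and derivatives in y on \<open>M\<close> are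
  those in x on \<open>Mt\<close>, so the identification of the terms in y follows from the one in
  x.\<close>

definition "Mt = \<lparr>cells = N, xpt = Y, ypt = X\<rparr>"

abbreviation flip :: "fn2 => fn2" where "flip g \<equiv> %z. g (prod.swap z)"

lemma transposed: "mesh_functions N Y X k Mt"
 by (intro mesh_functions.intro mesh_functions_axioms.intro swapped) (auto simp: Mt_def ends)

lemma rep_flip: "rep g G ==> mesh_functions.rep N Y X Mt (flip g) (sw G)"
proof -
 interpret T: mesh_functions N Y X k Mt by (rule transposed)
 assume "rep g G"
 then show ?thesis unfolding rep_def T.rep_def using pc2_sw by (auto simp: Kel T.Kel sw_def)
qed

lemma flip_traces:
 "tr_y_minus M g j = tr_x_minus Mt (flip g) j" "tr_y_plus M g j = tr_x_plus Mt (flip g) j"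
 "jump_y M g j = jump_x Mt (flip g) j" "Iint M i = Jint Mt i"
 by (simp_all add: fun_eq_iff tr_y_minus_def tr_x_minus_def tr_y_plus_def tr_x_plus_def jump_y_def jump_x_def
   Iint_def Jint_def Mt_def M)

lemma pdy_flip: "pdy g z = pdx (flip g) (prod.swap z)"
 by (simp add: pdy_def pdx_def)

lemma rep_unflip:
 assumes "mesh_functions.rep N Y X Mt (flip g) (sw G)"
 shows "rep g G"
proof -
 interpret T: mesh_functions N Y X k Mt by (rule transposed)
 have "rep g G" if "T.rep (flip g) (sw G)"
  unfolding rep_def
 proof (intro conjI ballI)
  show "pc2 N X Y G" using pc2_sw[OF T.rep_pc2[OF that]] by simp
  fix i j z assume "i \<in> {1..N}" "j \<in> {1..N}" "z \<in> Kel M i j"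
  then show "g z = G i j z" using T.rep_eq[OF that, of j i "prod.swap z"] by (auto simp: Kel T.Kel sw_def)
 qed
 then show ?thesis using assms .
qed

lemma ip_flip:
 assumes u: "rep u U" and s: "rep s S" "disc N k S"
 shows "ip Omega u (pdy s) = ip Omega (flip u) (pdx (flip s))"
proof -
 interpret T: mesh_functions N Y X k Mt by (rule transposed)
 have S': "T.rep (flip s) (sw S)" by (rule rep_flip[OF s(1)])
 have dS: "T.rep (pdx (flip s)) (%i j. dX (sw S i j))" by (rule T.rep_pdx[OF S' disc_sw[OF s(2)]])
 have "rep (pdy s) (sw (%i j. dX (sw S i j)))"
  by (rule rep_unflip) (use dS in \<open>simp add: pdy_flip\<close>)
 from ip_Omega[OF u this] have "ip Omega u (pdy s) = L2D N X Y (sw (%j i z. sw U j i z * dX (sw S j i) z))"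
  by (simp add: sw_def)
 also have "... = L2D N Y X (%j i z. sw U j i z * dX (sw S j i) z)"
  by (intro L2D_sw pc2_mult pc2_sw rep_pc2[OF u] T.rep_pc2[OF dS])
 also have "... = ip Omega (flip u) (pdx (flip s))"
  by (rule T.ip_Omega[OF rep_flip[OF u] dS, symmetric])
 finally show ?thesis .
qed

subsection \<open>The bilinear form and the norms\<close>

theorem ldg_form_families:
 assumes a: "continuous_on (RX \<times> RY) a" "continuous_on (RX \<times> RY) (pdx a)" and b: "continuous_on (RX \<times> RY) b"
  and w: "rep u U" "rep p P" "rep q Q" and z: "rep v V" "rep s S" "rep r R" "disc N k V" "disc N k S" "disc N k R"
 shows "ldg_form M \<epsilon> a b l1 l2 (u, p, q) (v, s, r) = bform N X Y \<epsilon> a (pdx a) b l1 l2 U P Q V S R"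
proof -
 interpret T: mesh_functions N Y X k Mt by (rule transposed)
 note T_rep = rep_flip[OF w(1)] rep_flip[OF w(3)] rep_flip[OF z(1)] rep_flip[OF z(3)]
 note T_disc = disc_sw[OF z(4)] disc_sw[OF z(6)]
 have c: "continuous_on (RX \<times> RY) (%z. b z - pdx a z)" by (intro continuous_intros a b)
 have 1: "T1 \<epsilon> a b (u, p, q) (v, s, r) = L2D N X Y (%i j z. P i j z * S i j z + Q i j z * R i j z) / \<epsilon>
  + L2D N X Y (%i j z. (b z - pdx a z) * U i j z * V i j z)"
  unfolding T1_def split_conv ip_Omega[OF w(2) z(2)] ip_Omega[OF w(3) z(3)]
   ip_Omega[OF rep_mult[OF rep_global[OF c refl] w(1)] z(1)]
  by (subst L2D_add) (auto intro!: pc2_mult rep_pc2[OF w(2)] rep_pc2[OF w(3)] rep_pc2[OF z(2)] rep_pc2[OF z(3)]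
    simp: divide_inverse mult.commute)
 have 2: "T2 M (u, p, q) (v, s, r) = XD1 N X Y U S + XD1 N Y X (sw U) (sw R)"
  unfolding T2_def split_conv Let_def M flip_traces ip_flip[OF w(1) z(3,6)] T2_x[OF w(1) z(2,5), symmetric]
   T.T2_x[OF T_rep(1) T_rep(4) T_disc(2), symmetric] by simp
 have 3: "T3 M (u, p, q) (v, s, r) = XD2 N X Y P V + XD2 N Y X (sw Q) (sw V)"
  unfolding T3_def split_conv Let_def M flip_traces ip_flip[OF w(3) z(1,4)] T3_x[OF w(2) z(1,4), symmetric]
   T.T3_x[OF T_rep(2) T_rep(3) T_disc(1), symmetric] by simp
 have "sw (%i j z. U i j z * V i j z) = (%i j z. sw U i j z * sw V i j z)" by (simp add: sw_def)
 then have 4: "T4 M a l1 l2 (u, p, q) (v, s, r) = XL4 N X Y a U V + l1 * XT N X Y (%i j z. U i j z * V i j z)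
  + l2 * XT N Y X (sw (%i j z. U i j z * V i j z))"
  unfolding T4_def split_conv Let_def M flip_traces T4_x[OF a(1) w(1) z(1,4), symmetric]
   trace_x[OF w(1) z(1), symmetric] using T.trace_x[OF T_rep(1) T_rep(3), of l2] by simp
 show ?thesis unfolding ldg_form_def bform_def 1 2 3 4 by simp
qed

lemma norm2_families:
 assumes c: "continuous_on (RX \<times> RY) b" "continuous_on (RX \<times> RY) (pdx a)"
  and pos: "!!z. z \<in> RX \<times> RY ==> 0 <= b z - pdx a z / 2" and \<epsilon>: "\<epsilon> > 0"
  and z: "rep v V" "rep s S" "rep r R"
 shows "(norm2 \<epsilon> a b (v, s, r))\<^sup>2 = (L2D N X Y (%i j z. (S i j z)\<^sup>2) + L2D N X Y (%i j z. (R i j z)\<^sup>2)) / \<epsilon>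
  + L2D N X Y (%i j z. (b z - pdx a z / 2) * (V i j z)\<^sup>2)"
proof -
 have sq: "(L2norm Omega g)\<^sup>2 = L2D N X Y (%i j z. (G i j z)\<^sup>2)" "0 <= L2D N X Y (%i j z. (G i j z)\<^sup>2)" if "rep g G" for g G
 proof -
  show nn: "0 <= L2D N X Y (%i j z. (G i j z)\<^sup>2)" by (intro L2D_nonneg pc2_power rep_pc2[OF that]) auto
  show "(L2norm Omega g)\<^sup>2 = L2D N X Y (%i j z. (G i j z)\<^sup>2)"
   unfolding L2norm_def ip_Omega[OF that that] using nn by (simp add: power2_eq_square)
 qed
 have "continuous_on (RX \<times> RY) (%z. sqrt (b z - pdx a z / 2))" by (intro continuous_intros c) simp
 note w = rep_mult[OF rep_global[OF this refl] z(1)]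
 have e: "L2D N X Y (%i j z. (sqrt (b z - pdx a z / 2) * V i j z)\<^sup>2) = L2D N X Y (%i j z. (b z - pdx a z / 2) * (V i j z)\<^sup>2)"
 proof (intro L2D_cong)
  fix i j z assume "i \<in> {1..N}" "j \<in> {1..N}" "z \<in> cl i j"
  then have "0 <= b z - pdx a z / 2" using cell_unit[of i j] by (intro pos) blast
  then show "(sqrt (b z - pdx a z / 2) * V i j z)\<^sup>2 = (b z - pdx a z / 2) * (V i j z)\<^sup>2"
   by (simp add: power_mult_distrib)
 qed
 have "0 <= inverse \<epsilon> * (L2norm Omega s)\<^sup>2 + inverse \<epsilon> * (L2norm Omega r)\<^sup>2
  + (L2norm Omega (%z. sqrt (b z - pdx a z / 2) * v z))\<^sup>2" using \<epsilon> by simp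
 note root = real_sqrt_pow2[OF this]
 have d: "inverse \<epsilon> * x + inverse \<epsilon> * y = (x + y) / \<epsilon>" for x y :: real
  by (simp add: inverse_eq_divide add_divide_distrib)
 show ?thesis
  unfolding norm2_def split_conv root unfolding sq(1)[OF z(2)] sq(1)[OF z(3)] sq(1)[OF w] e d ..
qed

text \<open>The norm is a root, so its square is the sum of the parts only once this sum is known to
  be nonnegative; the positivity assumptions serve that purpose.\<close>

lemma normE_families:
 assumes c: "continuous_on (RX \<times> RY) b" "continuous_on (RX \<times> RY) (pdx a)" and a: "continuous_on (RX \<times> RY) a"
  and apos: "!!z. z \<in> RX \<times> RY ==> 0 <= a z"
  and pos: "!!z. z \<in> RX \<times> RY ==> 0 <= b z - pdx a z / 2" and \<epsilon>: "\<epsilon> > 0" and l: "0 <= l1" "0 <= l2"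
  and z: "rep v V" "rep s S" "rep r R"
 shows "(normE M \<epsilon> a b l1 l2 (v, s, r))\<^sup>2 = energy N X Y \<epsilon> a (pdx a) b l1 l2 V S R"
proof -
 interpret T: mesh_functions N Y X k Mt by (rule transposed)
 have nn: "0 <= XT N X Y (%i j z. (V i j z)\<^sup>2)"
  unfolding XT_def by (intro L1_nonneg pc_power trace_pc_N rep_pc2[OF z(1)]) auto
 have nnT: "0 <= XT N Y X (sw (%i j z. (V i j z)\<^sup>2))"
  unfolding XT_def sw_def by (intro L1_nonneg pc_power T.trace_pc_N[OF pc2_sw[OF rep_pc2[OF z(1)]], unfolded sw_def]) auto
 have nnJ: "0 <= XJ N X Y a V"
  unfolding XJ_expand[OF a rep_pc2[OF z(1)]]
 proof (intro add_nonneg_nonneg sum_nonneg L1_nonneg)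
  have A: "0 <= a (X i, y)" if "i <= N" "j \<in> {1..N}" "y \<in> {Y (j - 1)..Y j}" for i j y
   using gx.X_mono[of 0 i] gx.X_mono[of i N] gy.cell_subset[OF that(2)] that by (intro apos) auto
  show "0 <= a (X 0, y) * (V 1 j (X 0, y))\<^sup>2" "0 <= a (X N, y) * (V N j (X N, y))\<^sup>2"
   if "j \<in> {1..N}" "y \<in> {Y (j - 1)..Y j}" for j y using A[of _ j y] that by auto
  show "0 <= a (X i, y) * (V (Suc i) j (X i, y) - V i j (X i, y))\<^sup>2"
   if "i \<in> {1..N-1}" "j \<in> {1..N}" "y \<in> {Y (j - 1)..Y j}" for i j y using A[of i j y] that by auto
  have B: "pc N Y (%j y. a (X i, y))" if "i <= N" for i by (rule trace_const[OF a that])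
  show "pc N Y (%j y. a (X 0, y) * (V 1 j (X 0, y))\<^sup>2)" "pc N Y (%j y. a (X N, y) * (V N j (X N, y))\<^sup>2)"
   by (intro pc_mult pc_power B trace_pc_1 trace_pc_N rep_pc2[OF z(1)]; simp)+
  show "pc N Y (%j y. a (X i, y) * (V (Suc i) j (X i, y) - V i j (X i, y))\<^sup>2)" if "i \<in> {1..N-1}" for i
   using that by (intro pc_mult pc_power pc_diff pc_step rep_pc2[OF z(1)] B) auto
 qed
 have T: "(\<Sum>i=1..N. ip (Iint M i) (%x. l2) (%x. (jump_y M v N x)\<^sup>2)) = l2 * XT N Y X (sw (%i j z. (V i j z)\<^sup>2))"
  unfolding flip_traces using T.jumps_x(2)[OF continuous_on_const rep_flip[OF z(1)], of l2] by (simp add: sw_def)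
 have n: "(norm2 \<epsilon> a b (v, s, r))\<^sup>2 = (L2D N X Y (%i j z. (S i j z)\<^sup>2) + L2D N X Y (%i j z. (R i j z)\<^sup>2)) / \<epsilon>
  + L2D N X Y (%i j z. (b z - pdx a z / 2) * (V i j z)\<^sup>2)"
  by (rule norm2_families[OF c _ \<epsilon> z]) (rule pos)
 note eq = n jumps_x[OF a z(1)] T
 have "energy N X Y \<epsilon> a (pdx a) b l1 l2 V S R = (norm2 \<epsilon> a b (v, s, r))\<^sup>2 + XJ N X Y a V / 2
   + l1 * XT N X Y (%i j z. (V i j z)\<^sup>2) + l2 * XT N Y X (sw (%i j z. (V i j z)\<^sup>2))"
  unfolding energy_def eq(1) ..
 moreover have "0 <= ..." using nn nnT nnJ l by (intro add_nonneg_nonneg mult_nonneg_nonneg) auto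
 ultimately show ?thesis
  unfolding normE_def Let_def split_conv M eq(2,3,4) by simp
qed

subsection \<open>The finite element space\<close>

lemma VN_rep:
 assumes "g \<in> VN M k"
 obtains G where "rep g G" "disc N k G"
proof -
 have "\<forall>i\<in>{1..N}. \<forall>j\<in>{1..N}. \<exists>G\<in>polyT k k. \<forall>z\<in>Kel M i j. g z = G z"
  using assms by (simp add: VN_def M)
 then have "\<forall>i. \<forall>j. \<exists>G. i \<in> {1..N} --> j \<in> {1..N} --> G \<in> polyT k k & (\<forall>z\<in>Kel M i j. g z = G z)"
  by blast
 then obtain G where G: "\<forall>i j. i \<in> {1..N} --> j \<in> {1..N} --> G i j \<in> polyT k k & (\<forall>z\<in>Kel M i j. g z = G i j z)" by metis
 then have "disc N k G" by (auto simp: disc_def)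
 moreover from this have "rep g G" using G disc_pc2(1) by (auto simp: rep_def)
 ultimately show ?thesis using that by blast
qed

text \<open>Realises a family by an actual function. On a mesh line inside the square the cell of
  smaller index is taken, a choice that does not affect \<open>rep\<close>.\<close>

definition glue :: "(nat => nat => fn2) => fn2"
 where "glue G z = G (LEAST i. fst z <= X i) (LEAST j. snd z <= Y j) z"

lemma glue:
 assumes "disc N k G"
 shows "rep (glue G) G" "glue G \<in> VN M k"
proof -
 have eq: "glue G z = G i j z" if "i \<in> {1..N}" "j \<in> {1..N}" "z \<in> Kel M i j" for i j z
  using that gx.LEAST_cell[OF that(1), of "fst z"] gy.LEAST_cell[OF that(2), of "snd z"] by (auto simp: glue_def Kel)
 then show "rep (glue G) G" using disc_pc2(1)[OF assms] by (auto simp: rep_def)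
 show "glue G \<in> VN M k" using eq assms by (force simp: VN_def M disc_def)
qed

text \<open>Every element of the space is represented by a family and every family of polynomials is
  realised by \<open>glue\<close>, so the Galerkin equations may be tested with arbitrary
  families.\<close>

theorem method_families:
 assumes a: "continuous_on (RX \<times> RY) a" "continuous_on (RX \<times> RY) (pdx a)" and b: "continuous_on (RX \<times> RY) b"
  and f: "continuous_on (RX \<times> RY) f" and W: "ldg_solution M k \<epsilon> a b f l1 l2 (u, p, q)"
 obtains U P Q where "rep u U" "rep p P" "rep q Q" "disc N k U" "disc N k P" "disc N k Q"
  "!!v s r. disc N k v ==> disc N k s ==> disc N k r ==>
   bform N X Y \<epsilon> a (pdx a) b l1 l2 U P Q v s r = L2D N X Y (%i j z. f z * v i j z)"
proof -
 obtain U P Q where w: "rep u U" "rep p P" "rep q Q" and d: "disc N k U" "disc N k P" "disc N k Q"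
  using W VN_rep unfolding ldg_solution_def mem_Times_iff fst_conv snd_conv by metis
 have "bform N X Y \<epsilon> a (pdx a) b l1 l2 U P Q v s r = L2D N X Y (%i j z. f z * v i j z)"
  if z: "disc N k v" "disc N k s" "disc N k r" for v s r
 proof -
  have "ldg_form M \<epsilon> a b l1 l2 (u, p, q) (glue v, glue s, glue r) = ip Omega f (glue v)"
   using W glue(2) z unfolding ldg_solution_def by blast
  then show ?thesis
   unfolding ldg_form_families[OF a b w glue(1)[OF z(1)] glue(1)[OF z(2)] glue(1)[OF z(3)] z]
    ip_Omega[OF rep_global[OF f refl] glue(1)[OF z(1)]] .
 qed
 with w d that show ?thesis by blast
qed

end

section \<open>Identification of the Gauss--Radau projections\<close>

lemma (in interval_proj) pj_moment:
 assumes "c < d" "continuous_on {c..d} g" "degree q <= l"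
 shows "integral {c..d} (%x. poly q x * pj K c d g x) = integral {c..d} (%x. poly q x * g x)"
proof -
 have "integral {c..d} (%x. poly q x * g x - poly q x * pj K c d g x)
  = integral {c..d} (%x. poly q x * g x) - integral {c..d} (%x. poly q x * pj K c d g x)"
  by (intro integral_diff integrable_continuous_real continuous_intros assms continuous_on_pj)
 moreover have "(%x. poly q x * g x - poly q x * pj K c d g x) = (%x. (g x - pj K c d g x) * poly q x)"
  by (simp add: fun_eq_iff algebra_simps)
 ultimately show ?thesis using pj_orth[OF assms] by simp
qed

lemma polyP_continuous: "v \<in> polyP l ==> continuous_on S v"
 by (auto simp: polyP_def intro!: continuous_intros)

lemma integral_polyT:
 fixes c d c' d' :: real and G :: fn2
 assumes G: "continuous_on ({c..d} \<times> {c'..d'}) G" and v: "v = (%(x, y). \<Sum>m\<le>k. \<Sum>n\<le>l. b m n * x ^ m * y ^ n)"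
 shows "integral ({c..d} \<times> {c'..d'}) (%z. G z * v z)
  = (\<Sum>m\<le>k. \<Sum>n\<le>l. b m n * integral {c..d} (%x. integral {c'..d'} (%y. poly (monom 1 m) x * poly (monom 1 n) y * G (x, y))))"
proof -
 have cb: "cbox (c, c') (d, d') = {c..d} \<times> {c'..d'}" by (simp add: cbox_Pair_eq)
 have int: "g integrable_on ({c..d} \<times> {c'..d'})" if "continuous_on ({c..d} \<times> {c'..d'}) g" for g :: fn2
  using integrable_continuous[of "(c, c')" "(d, d')" g] that by (simp add: cb)
 have t: "continuous_on ({c..d} \<times> {c'..d'}) (%z. fst z ^ m * snd z ^ n * G z)" for m n
  by (intro continuous_intros G)
 have "(%z. G z * v z) = (%z. \<Sum>m\<le>k. \<Sum>n\<le>l. b m n * (fst z ^ m * snd z ^ n * G z))"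
  by (simp add: fun_eq_iff v split_beta sum_distrib_left mult_ac)
 then have "integral ({c..d} \<times> {c'..d'}) (%z. G z * v z)
  = integral ({c..d} \<times> {c'..d'}) (%z. \<Sum>m\<le>k. \<Sum>n\<le>l. b m n * (fst z ^ m * snd z ^ n * G z))" by simp
 also have "... = (\<Sum>m\<le>k. integral ({c..d} \<times> {c'..d'}) (%z. \<Sum>n\<le>l. b m n * (fst z ^ m * snd z ^ n * G z)))"
  by (intro integral_sum int continuous_on_sum continuous_on_mult continuous_on_const t) auto
 also have "... = (\<Sum>m\<le>k. \<Sum>n\<le>l. integral ({c..d} \<times> {c'..d'}) (%z. b m n * (fst z ^ m * snd z ^ n * G z)))"
  by (intro sum.cong refl integral_sum int continuous_on_mult continuous_on_const t) auto
 also have "... = (\<Sum>m\<le>k. \<Sum>n\<le>l. b m n * integral {c..d} (%x. integral {c'..d'} (%y. poly (monom 1 m) x * poly (monom 1 n) y * G (x, y))))"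
  by (intro sum.cong refl) (simp add: cell_integral(4)[OF t refl] poly_monom)
 finally show ?thesis .
qed

context grid2
begin

lemma radau_nodes: "pnode (radR k) = 1" "pnode (radL k) = 0" "pgam (projL2 k) = 0"
 using radR[OF k] radL[OF k] projL2[of k] by auto

context
 fixes i j l l' :: nat and K K' :: proj and u :: fn2
 assumes K: "interval_proj k l K" "interval_proj k l' K'" and ij: "i \<in> {1..N}" "j \<in> {1..N}"
  and u: "continuous_on (cl i j) u"
begin

abbreviation "PP \<equiv> PX K X i (PY K' Y j u)"

lemma PP_commute: "PP = PY K' Y j (PX K X i u)"
 by (rule PX_PY_commute[OF K gx.cell[OF ij(1)] gy.cell[OF ij(2)] u])

lemma PP_poly: "PP \<in> polyT k k"
 by (rule PX_PY_polyT[OF K gx.cell[OF ij(1)] gy.cell[OF ij(2)] u])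

lemma PP_cont: "continuous_on S PP" by (rule polyT_slices(3)[OF PP_poly])

lemma swap_moments:
 fixes G :: fn2
 assumes "continuous_on (cl i j) G"
 shows "integral {X (i - 1)..X i} (%x. integral {Y (j - 1)..Y j} (%y. poly q x * poly q' y * G (x, y)))
  = integral {Y (j - 1)..Y j} (%y. poly q' y * integral {X (i - 1)..X i} (%x. poly q x * G (x, y)))"
proof -
 have c: "continuous_on (cl i j) (%z. poly q (fst z) * poly q' (snd z) * G z)" by (intro continuous_intros assms)
 have "integral {X (i - 1)..X i} (%x. integral {Y (j - 1)..Y j} (%y. poly q x * poly q' y * G (x, y)))
  = integral {Y (j - 1)..Y j} (%y. integral {X (i - 1)..X i} (%x. poly q x * poly q' y * G (x, y)))"
  using cell_integral(3)[OF c refl] cell_integral(4)[OF c refl] by simp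
 also have "... = integral {Y (j - 1)..Y j} (%y. poly q' y * integral {X (i - 1)..X i} (%x. poly q x * G (x, y)))"
 proof (rule integral_cong)
  fix y
  have "(%x. poly q x * poly q' y * G (x, y)) = (%x. poly q' y * (poly q x * G (x, y)))" by (simp add: mult_ac)
  then show "integral {X (i - 1)..X i} (%x. poly q x * poly q' y * G (x, y)) = poly q' y * integral {X (i - 1)..X i} (%x. poly q x * G (x, y))"
   by simp
 qed
 finally show ?thesis .
qed

text \<open>A moment in y removes the projection in y, which may be taken as the outer one; after
  exchanging the integrals, the moment in x removes the other.\<close>

lemma tensor_moments:
 assumes q: "degree q <= l" "degree q' <= l'"
 shows "integral {X (i - 1)..X i} (%x. integral {Y (j - 1)..Y j} (%y. poly q x * poly q' y * PP (x, y)))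
  = integral {X (i - 1)..X i} (%x. integral {Y (j - 1)..Y j} (%y. poly q x * poly q' y * u (x, y)))"
proof -
 have pxu: "continuous_on (cl i j) (PX K X i u)" by (rule PX_cell[OF K(1) ij(1) u])
 have y: "integral {Y (j - 1)..Y j} (%y. poly q x * poly q' y * PP (x, y))
  = integral {Y (j - 1)..Y j} (%y. poly q x * poly q' y * PX K X i u (x, y))" if x: "x \<in> {X (i - 1)..X i}" for x
 proof -
  have "integral {Y (j - 1)..Y j} (%y. poly q' y * pj K' (Y (j - 1)) (Y j) (%t. PX K X i u (x, t)) y)
   = integral {Y (j - 1)..Y j} (%y. poly q' y * PX K X i u (x, y))"
   by (rule interval_proj.pj_moment[OF K(2) gy.cell[OF ij(2)] continuous_on_line_y[OF pxu x] q(2)])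
  then show ?thesis
   unfolding PP_commute by (simp add: PY_def mult.assoc)
 qed
 have x: "integral {X (i - 1)..X i} (%x. poly q x * PX K X i u (x, y)) = integral {X (i - 1)..X i} (%x. poly q x * u (x, y))"
  if "y \<in> {Y (j - 1)..Y j}" for y
  unfolding PX_def split_conv
  by (rule interval_proj.pj_moment[OF K(1) gx.cell[OF ij(1)] continuous_on_line_x[OF u that] q(1)])
 have "integral {X (i - 1)..X i} (%x. integral {Y (j - 1)..Y j} (%y. poly q x * poly q' y * PP (x, y)))
  = integral {X (i - 1)..X i} (%x. integral {Y (j - 1)..Y j} (%y. poly q x * poly q' y * PX K X i u (x, y)))"
  by (rule integral_cong) (rule y)
 also have "... = integral {Y (j - 1)..Y j} (%y. poly q' y * integral {X (i - 1)..X i} (%x. poly q x * PX K X i u (x, y)))"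
  by (rule swap_moments[OF pxu])
 also have "... = integral {Y (j - 1)..Y j} (%y. poly q' y * integral {X (i - 1)..X i} (%x. poly q x * u (x, y)))"
 proof (rule integral_cong)
  fix y assume "y \<in> {Y (j - 1)..Y j}"
  then show "poly q' y * integral {X (i - 1)..X i} (%x. poly q x * PX K X i u (x, y))
   = poly q' y * integral {X (i - 1)..X i} (%x. poly q x * u (x, y))" by (simp only: x)
 qed
 also have "... = integral {X (i - 1)..X i} (%x. integral {Y (j - 1)..Y j} (%y. poly q x * poly q' y * u (x, y)))"
  by (rule swap_moments[OF u, symmetric])
 finally show ?thesis .
qed

lemma PP_moments:
 assumes "v \<in> polyT l l'"
 shows "integral (cl i j) (%z. PP z * v z) = integral (cl i j) (%z. u z * v z)"
proof -
 obtain b where v: "v = (%(x, y). \<Sum>m\<le>l. \<Sum>n\<le>l'. b m n * x ^ m * y ^ n)" using assms by (auto simp: polyT_def)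
 show ?thesis
  unfolding integral_polyT[OF PP_cont v] integral_polyT[OF u v]
 proof (intro sum.cong refl)
  fix m n assume "m \<in> {..l}" "n \<in> {..l'}"
  then have "degree (monom (1::real) m) <= l" "degree (monom (1::real) n) <= l'" by (auto simp: degree_monom_eq)
  from tensor_moments[OF this]
  show "b m n * integral {X (i - 1)..X i} (%x. integral {Y (j - 1)..Y j} (%y. poly (monom 1 m) x * poly (monom 1 n) y * PP (x, y)))
   = b m n * integral {X (i - 1)..X i} (%x. integral {Y (j - 1)..Y j} (%y. poly (monom 1 m) x * poly (monom 1 n) y * u (x, y)))"
   by simp
 qed
qed

lemma PP_trace_x:
 assumes tr: "!!w y. PX K X i w (xe, y) = w (xe, y)" and xe: "xe \<in> {X (i - 1)..X i}" and v: "v \<in> polyP l'"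
 shows "integral {Y (j - 1)..Y j} (%y. PP (xe, y) * v y) = integral {Y (j - 1)..Y j} (%y. u (xe, y) * v y)"
proof -
 obtain q where q: "v = poly q" "degree q <= l'" using v by (auto simp: polyP_def)
 show ?thesis
  unfolding tr q(1) PY_def split_conv mult.commute[of _ "poly q _"]
  by (rule interval_proj.pj_moment[OF K(2) gy.cell[OF ij(2)] continuous_on_line_y[OF u xe] q(2)])
qed

lemma PP_trace_y:
 assumes tr: "!!w x. PY K' Y j w (x, ye) = w (x, ye)" and ye: "ye \<in> {Y (j - 1)..Y j}" and v: "v \<in> polyP l"
 shows "integral {X (i - 1)..X i} (%x. PP (x, ye) * v x) = integral {X (i - 1)..X i} (%x. u (x, ye) * v x)"
proof -
 obtain q where q: "v = poly q" "degree q <= l" using v by (auto simp: polyP_def)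
 show ?thesis
  unfolding PP_commute tr q(1) PX_def split_conv mult.commute[of _ "poly q _"]
  by (rule interval_proj.pj_moment[OF K(1) gx.cell[OF ij(1)] continuous_on_line_x[OF u ye] q(2)])
qed

text \<open>The tensor projection reproduces \<open>Z\<close> and depends only on the listed data,
  on which \<open>Z\<close> and \<open>u\<close> agree. Hence a polynomial satisfying the conditions
  is the projection.\<close>

lemma tensor_characterization:
 assumes Z: "Z \<in> polyT k k"
  and e: "xe = X (i - 1) + (X i - X (i - 1)) * pnode K" "ye = Y (j - 1) + (Y j - Y (j - 1)) * pnode K'"
  and trX: "!!v. pgam K \<noteq> 0 ==> v \<in> polyP l' ==>
   integral {Y (j - 1)..Y j} (%y. Z (xe, y) * v y) = integral {Y (j - 1)..Y j} (%y. u (xe, y) * v y)"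
  and trY: "!!v. pgam K' \<noteq> 0 ==> v \<in> polyP l ==>
   integral {X (i - 1)..X i} (%x. Z (x, ye) * v x) = integral {X (i - 1)..X i} (%x. u (x, ye) * v x)"
  and corner: "pgam K \<noteq> 0 ==> pgam K' \<noteq> 0 ==> Z (xe, ye) = u (xe, ye)"
  and mom: "!!v. v \<in> polyT l l' ==> integral (cl i j) (%z. Z z * v z) = integral (cl i j) (%z. u z * v z)"
 shows "Z z = PP z"
proof -
 note cells = gx.cell[OF ij(1)] gy.cell[OF ij(2)]
 have Zc: "continuous_on (cl i j) Z" by (rule polyT_slices(3)[OF Z])
 have prod: "integral (cl i j) (%z. G z * (case z of (x, y) => poly q x * poly q' y))
  = integral {X (i - 1)..X i} (%x. integral {Y (j - 1)..Y j} (%y. poly q x * poly q' y * G (x, y)))"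
  if "continuous_on (cl i j) G" for G :: fn2 and q q'
 proof -
  have c: "continuous_on (cl i j) (%z. G z * (case z of (x, y) => poly q x * poly q' y))"
   unfolding split_beta by (intro continuous_intros that)
  show ?thesis using cell_integral(4)[OF c refl] by (simp add: mult_ac)
 qed
 have "PP z = PX K X i (PY K' Y j Z) z"
 proof (rule PX_PY_cong[OF K cells u Zc e])
  show "u (xe, ye) = Z (xe, ye)" if "pgam K \<noteq> 0" "pgam K' \<noteq> 0" using corner[OF that] by simp
  show "integral {X (i - 1)..X i} (%t. poly q t * u (t, ye)) = integral {X (i - 1)..X i} (%t. poly q t * Z (t, ye))"
   if "pgam K' \<noteq> 0" "degree q <= l" for q
  proof -
   have "poly q \<in> polyP l" using that(2) by (auto simp: polyP_def)
   from trY[OF that(1) this, symmetric] show ?thesis unfolding mult.commute[of "poly q _"] .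
  qed
  show "integral {Y (j - 1)..Y j} (%t. poly q t * u (xe, t)) = integral {Y (j - 1)..Y j} (%t. poly q t * Z (xe, t))"
   if "pgam K \<noteq> 0" "degree q <= l'" for q
  proof -
   have "poly q \<in> polyP l'" using that(2) by (auto simp: polyP_def)
   from trX[OF that(1) this, symmetric] show ?thesis unfolding mult.commute[of "poly q _"] .
  qed
  show "integral {X (i - 1)..X i} (%t. integral {Y (j - 1)..Y j} (%t'. poly q t * poly q' t' * u (t, t')))
   = integral {X (i - 1)..X i} (%t. integral {Y (j - 1)..Y j} (%t'. poly q t * poly q' t' * Z (t, t')))"
   if "degree q <= l" "degree q' <= l'" for q q'
   using mom[OF polyT_prod[OF that]] unfolding prod[OF u] prod[OF Zc] by simp
 qed
 then show ?thesis using PX_PY_polynomial[OF K cells Z, of z] by simp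
qed

end

lemma radau_traces:
 "i \<in> {1..N} ==> PX (radR k) X i w (X i, y) = w (X i, y)"
 "i \<in> {1..N} ==> PX (radL k) X i w (X (i - 1), y) = w (X (i - 1), y)"
 "j \<in> {1..N} ==> PY (radR k) Y j w (x, Y j) = w (x, Y j)"
 "j \<in> {1..N} ==> PY (radL k) Y j w (x, Y (j - 1)) = w (x, Y (j - 1))"
 unfolding PX_def PY_def split_conv by (rule gx.radR_trace[OF k] gx.radL_trace[OF k] gy.radR_trace[OF k] gy.radL_trace[OF k]; assumption)+

end

context mesh_functions
begin

lemma cell_ends: "i \<in> {1..N} ==> X i \<in> {X (i - 1)..X i}" "i \<in> {1..N} ==> X (i - 1) \<in> {X (i - 1)..X i}"
 "j \<in> {1..N} ==> Y j \<in> {Y (j - 1)..Y j}" "j \<in> {1..N} ==> Y (j - 1) \<in> {Y (j - 1)..Y j}"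
 using gx.cell[of i] gy.cell[of j] by auto

context
 fixes g :: fn2 and G i j
 assumes g: "rep g G" and ij: "i \<in> {1..N}" "j \<in> {1..N}"
begin

lemma ip_Kel:
 assumes "continuous_on (cl i j) v"
 shows "ip (Kel M i j) g v = integral (cl i j) (%z. G i j z * v z)"
proof -
 have c: "continuous_on (cl i j) (%z. G i j z * v z)" by (intro continuous_intros rep_cont[OF g ij] assms)
 have eq: "g z * v z = G i j z * v z" if "z \<in> {X (i - 1)<..<X i} \<times> {Y (j - 1)<..<Y j}" for z
  using rep_eq[OF g ij] that by (simp add: Kel)
 have ai: "(%z. g z * v z) absolutely_integrable_on ({X (i - 1)<..<X i} \<times> {Y (j - 1)<..<Y j})"
  by (rule cell_integral(1)[OF c]) (rule eq)
 have "integral ({X (i - 1)<..<X i} \<times> {Y (j - 1)<..<Y j}) (%z. g z * v z) = integral (cl i j) (%z. G i j z * v z)"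
  by (rule cell_integral(2)[OF c]) (rule eq)
 then show ?thesis
  unfolding ip_def Kel set_lebesgue_integral_eq_integral(2)[OF ai] .
qed

lemma ip_trace_x:
 assumes v: "continuous_on {Y (j - 1)..Y j} v"
 shows "ip (Jint M j) (tr_x_minus M g i) v = integral {Y (j - 1)..Y j} (%y. G i j (X i, y) * v y)"
  "ip (Jint M j) (tr_x_plus M g (i - 1)) v = integral {Y (j - 1)..Y j} (%y. G i j (X (i - 1), y) * v y)"
 unfolding intervals
 using ip_interval[OF continuous_on_line_y[OF rep_cont[OF g ij] cell_ends(1)[OF ij(1)]] v]
  ip_interval[OF continuous_on_line_y[OF rep_cont[OF g ij] cell_ends(2)[OF ij(1)]] v]
  tr_x_minus[OF g ij] tr_x_plus[OF g ij] by blast+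

lemma ip_trace_y:
 assumes v: "continuous_on {X (i - 1)..X i} v"
 shows "ip (Iint M i) (tr_y_minus M g j) v = integral {X (i - 1)..X i} (%x. G i j (x, Y j) * v x)"
  "ip (Iint M i) (tr_y_plus M g (j - 1)) v = integral {X (i - 1)..X i} (%x. G i j (x, Y (j - 1)) * v x)"
 unfolding intervals
 using ip_interval[OF continuous_on_line_x[OF rep_cont[OF g ij] cell_ends(3)[OF ij(2)]] v]
  ip_interval[OF continuous_on_line_x[OF rep_cont[OF g ij] cell_ends(4)[OF ij(2)]] v]
  tr_y_minus[OF g ij] tr_y_plus[OF g ij] by blast+

lemma corner_limit: "Lim (at (X i, Y j) within Kel M i j) g = G i j (X i, Y j)"
proof (rule tendsto_Lim)
 have "(X i, Y j) \<in> closure (Kel M i j)"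
  using gx.cell[OF ij(1)] gy.cell[OF ij(2)] by (simp add: Kel closure_Times)
 moreover have "(X i, Y j) \<notin> Kel M i j" by (simp add: Kel)
 ultimately show "at (X i, Y j) within Kel M i j \<noteq> bot"
  by (auto simp: trivial_limit_within closure_def)
 have "(G i j \<longlongrightarrow> G i j (X i, Y j)) (at (X i, Y j) within cl i j)"
  using rep_cont[OF g ij] cell_ends(1)[OF ij(1)] cell_ends(3)[OF ij(2)] unfolding continuous_on_def by blast
 then have "(G i j \<longlongrightarrow> G i j (X i, Y j)) (at (X i, Y j) within Kel M i j)"
  by (rule tendsto_within_subset[OF _ Kel_subset])
 moreover have "\<forall>\<^sub>F z in at (X i, Y j) within Kel M i j. G i j z = g z"
  unfolding eventually_at_filter using rep_eq[OF g ij] by (intro always_eventually) simp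
 ultimately show "(g \<longlongrightarrow> G i j (X i, Y j)) (at (X i, Y j) within Kel M i j)"
  by (rule Lim_transform_eventually)
qed

end

lemma rep_cong:
 assumes "rep g G" "!!i j z. i \<in> {1..N} ==> j \<in> {1..N} ==> G i j z = F i j z" "disc N k F"
 shows "rep g F"
 using assms(1,2) disc_pc2(1)[OF assms(3)] by (auto simp: rep_def)

lemma polyT_cont: "v \<in> polyT a b ==> continuous_on S v" by (rule polyT_slices(3))

text \<open>The glued tensor projections satisfy the conditions, so the choice operator has a
  witness. Whatever it selects agrees with them inside each element by uniqueness, while its values
  on mesh lines stay undetermined.\<close>

theorem gr_minus_rep:
 assumes g: "rep g G"
 shows "rep (gr_minus M k g) (%i j. PX (radR k) X i (PY (radR k) Y j (G i j)))" (is "rep _ ?F")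
proof -
 note Gc = rep_cont[OF g]
 note R = proj(1) proj(1)
 define P where "P Z \<longleftrightarrow> Z \<in> VN M k & (\<forall>i\<in>{1..cells M}. \<forall>j\<in>{1..cells M}.
   (\<forall>v\<in>polyT (k - 1) (k - 1). ip (Kel M i j) Z v = ip (Kel M i j) g v) \<and>
   (\<forall>v\<in>polyP (k - 1). ip (Jint M j) (tr_x_minus M Z i) v = ip (Jint M j) (tr_x_minus M g i) v) \<and>
   (\<forall>v\<in>polyP (k - 1). ip (Iint M i) (tr_y_minus M Z j) v = ip (Iint M i) (tr_y_minus M g j) v) \<and>
   Lim (at (xpt M i, ypt M j) within Kel M i j) Z = Lim (at (xpt M i, ypt M j) within Kel M i j) g)" for Z
 have gr: "gr_minus M k g = (SOME Z. P Z)" unfolding gr_minus_def P_def ..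
 have dF: "disc N k ?F" unfolding disc_def using PP_poly[OF R _ _ Gc] by blast
 have "P (glue ?F)"
  unfolding P_def M
 proof (intro conjI ballI glue(2)[OF dF])
  note r = glue(1)[OF dF]
  fix i j assume ij: "i \<in> {1..N}" "j \<in> {1..N}"
  show "ip (Kel M i j) (glue ?F) v = ip (Kel M i j) g v" if "v \<in> polyT (k - 1) (k - 1)" for v
   unfolding ip_Kel[OF r ij polyT_cont[OF that]] ip_Kel[OF g ij polyT_cont[OF that]]
   by (rule PP_moments[OF R ij Gc[OF ij] that])
  show "ip (Jint M j) (tr_x_minus M (glue ?F) i) v = ip (Jint M j) (tr_x_minus M g i) v" if "v \<in> polyP (k - 1)" for v
   unfolding ip_trace_x(1)[OF r ij polyP_continuous[OF that]] ip_trace_x(1)[OF g ij polyP_continuous[OF that]]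
   by (rule PP_trace_x[OF R ij Gc[OF ij] radau_traces(1)[OF ij(1)] cell_ends(1)[OF ij(1)] that])
  show "ip (Iint M i) (tr_y_minus M (glue ?F) j) v = ip (Iint M i) (tr_y_minus M g j) v" if "v \<in> polyP (k - 1)" for v
   unfolding ip_trace_y(1)[OF r ij polyP_continuous[OF that]] ip_trace_y(1)[OF g ij polyP_continuous[OF that]]
   by (rule PP_trace_y[OF R ij Gc[OF ij] radau_traces(3)[OF ij(2)] cell_ends(3)[OF ij(2)] that])
  show "Lim (at (X i, Y j) within Kel M i j) (glue ?F) = Lim (at (X i, Y j) within Kel M i j) g"
   unfolding corner_limit[OF r ij] corner_limit[OF g ij] radau_traces(1)[OF ij(1)] radau_traces(3)[OF ij(2)] ..
 qed
 then have Z: "P (gr_minus M k g)" unfolding gr by (rule someI[of P])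
 then obtain ZF where r: "rep (gr_minus M k g) ZF" and d: "disc N k ZF" using VN_rep unfolding P_def by metis
 show ?thesis
 proof (rule rep_cong[OF r _ dF])
  fix i j z assume ij: "i \<in> {1..N}" "j \<in> {1..N}"
  show "ZF i j z = ?F i j z"
  proof (rule tensor_characterization[OF R ij Gc[OF ij], where xe = "X i" and ye = "Y j"])
   show "ZF i j \<in> polyT k k" using d ij by (auto simp: disc_def)
   show "X i = X (i - 1) + (X i - X (i - 1)) * pnode (radR k)" "Y j = Y (j - 1) + (Y j - Y (j - 1)) * pnode (radR k)"
    by (simp_all add: radau_nodes)
   show "integral (cl i j) (%z. ZF i j z * v z) = integral (cl i j) (%z. G i j z * v z)" if "v \<in> polyT (k - 1) (k - 1)" for v
    unfolding ip_Kel[OF r ij polyT_cont[OF that], symmetric] ip_Kel[OF g ij polyT_cont[OF that], symmetric]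
    using Z ij that unfolding P_def M by blast
   show "integral {Y (j - 1)..Y j} (%y. ZF i j (X i, y) * v y) = integral {Y (j - 1)..Y j} (%y. G i j (X i, y) * v y)" if "v \<in> polyP (k - 1)" for v
    unfolding ip_trace_x(1)[OF r ij polyP_continuous[OF that], symmetric] ip_trace_x(1)[OF g ij polyP_continuous[OF that], symmetric]
    using Z ij that unfolding P_def M by blast
   show "integral {X (i - 1)..X i} (%x. ZF i j (x, Y j) * v x) = integral {X (i - 1)..X i} (%x. G i j (x, Y j) * v x)" if "v \<in> polyP (k - 1)" for v
    unfolding ip_trace_y(1)[OF r ij polyP_continuous[OF that], symmetric] ip_trace_y(1)[OF g ij polyP_continuous[OF that], symmetric]
    using Z ij that unfolding P_def M by blast
   show "ZF i j (X i, Y j) = G i j (X i, Y j)"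
    unfolding corner_limit[OF r ij, symmetric] corner_limit[OF g ij, symmetric]
    using Z ij unfolding P_def M by blast
  qed
 qed
qed

text \<open>In y the factor is the $L^2$ projection, whose \<open>pgam\<close> is 0; accordingly
  neither an edge condition in x direction nor a corner condition belongs to the
  characterization.\<close>

theorem gr_x_plus_rep:
 assumes g: "rep g G"
 shows "rep (gr_x_plus M k g) (%i j. PX (radL k) X i (PY (projL2 k) Y j (G i j)))" (is "rep _ ?F")
proof -
 note Gc = rep_cont[OF g]
 note R = proj(2) proj(3)
 define P where "P Z \<longleftrightarrow> Z \<in> VN M k & (\<forall>i\<in>{1..cells M}. \<forall>j\<in>{1..cells M}.
   (\<forall>v\<in>polyT (k - 1) k. ip (Kel M i j) Z v = ip (Kel M i j) g v) \<and>
   (\<forall>v\<in>polyP k. ip (Jint M j) (tr_x_plus M Z (i - 1)) v = ip (Jint M j) (tr_x_plus M g (i - 1)) v))" for Z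
 have gr: "gr_x_plus M k g = (SOME Z. P Z)" unfolding gr_x_plus_def P_def ..
 have dF: "disc N k ?F" unfolding disc_def using PP_poly[OF R _ _ Gc] by blast
 have "P (glue ?F)"
  unfolding P_def M
 proof (intro conjI ballI glue(2)[OF dF])
  note r = glue(1)[OF dF]
  fix i j assume ij: "i \<in> {1..N}" "j \<in> {1..N}"
  show "ip (Kel M i j) (glue ?F) v = ip (Kel M i j) g v" if "v \<in> polyT (k - 1) k" for v
   unfolding ip_Kel[OF r ij polyT_cont[OF that]] ip_Kel[OF g ij polyT_cont[OF that]]
   by (rule PP_moments[OF R ij Gc[OF ij] that])
  show "ip (Jint M j) (tr_x_plus M (glue ?F) (i - 1)) v = ip (Jint M j) (tr_x_plus M g (i - 1)) v" if "v \<in> polyP k" for v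
   unfolding ip_trace_x(2)[OF r ij polyP_continuous[OF that]] ip_trace_x(2)[OF g ij polyP_continuous[OF that]]
   by (rule PP_trace_x[OF R ij Gc[OF ij] radau_traces(2)[OF ij(1)] cell_ends(2)[OF ij(1)] that])
 qed
 then have Z: "P (gr_x_plus M k g)" unfolding gr by (rule someI[of P])
 then obtain ZF where r: "rep (gr_x_plus M k g) ZF" and d: "disc N k ZF" using VN_rep unfolding P_def by metis
 show ?thesis
 proof (rule rep_cong[OF r _ dF])
  fix i j z assume ij: "i \<in> {1..N}" "j \<in> {1..N}"
  show "ZF i j z = ?F i j z"
  proof (rule tensor_characterization[OF R ij Gc[OF ij], where xe = "X (i - 1)"])
   show "ZF i j \<in> polyT k k" using d ij by (auto simp: disc_def)
   show "X (i - 1) = X (i - 1) + (X i - X (i - 1)) * pnode (radL k)" by (simp add: radau_nodes)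
   show "integral (cl i j) (%z. ZF i j z * v z) = integral (cl i j) (%z. G i j z * v z)" if "v \<in> polyT (k - 1) k" for v
    unfolding ip_Kel[OF r ij polyT_cont[OF that], symmetric] ip_Kel[OF g ij polyT_cont[OF that], symmetric]
    using Z ij that unfolding P_def M by blast
   show "integral {Y (j - 1)..Y j} (%y. ZF i j (X (i - 1), y) * v y) = integral {Y (j - 1)..Y j} (%y. G i j (X (i - 1), y) * v y)" if "v \<in> polyP k" for v
    unfolding ip_trace_x(2)[OF r ij polyP_continuous[OF that], symmetric] ip_trace_x(2)[OF g ij polyP_continuous[OF that], symmetric]
    using Z ij that unfolding P_def M by blast
  qed (simp_all add: radau_nodes)
 qed
qed

text \<open>The characterization has the projection in x outermost, whereas the error analysis
  treats \<open>q\<close> as the mirror image of \<open>p\<close>, with y outermost. On each cell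
  the two orders agree.\<close>

theorem gr_y_plus_rep:
 assumes g: "rep g G"
 shows "rep (gr_y_plus M k g) (%i j. PY (radL k) Y j (PX (projL2 k) X i (G i j)))" (is "rep _ ?F'")
proof -
 note Gc = rep_cont[OF g]
 note R = proj(3) proj(2)
 let ?F = "%i j. PX (projL2 k) X i (PY (radL k) Y j (G i j))"
 have comm: "?F i j = ?F' i j" if "i \<in> {1..N}" "j \<in> {1..N}" for i j using PP_commute[OF R that Gc[OF that]] .
 define P where "P Z \<longleftrightarrow> Z \<in> VN M k & (\<forall>i\<in>{1..cells M}. \<forall>j\<in>{1..cells M}.
   (\<forall>v\<in>polyT k (k - 1). ip (Kel M i j) Z v = ip (Kel M i j) g v) \<and>
   (\<forall>v\<in>polyP k. ip (Iint M i) (tr_y_plus M Z (j - 1)) v = ip (Iint M i) (tr_y_plus M g (j - 1)) v))" for Z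
 have gr: "gr_y_plus M k g = (SOME Z. P Z)" unfolding gr_y_plus_def P_def ..
 have dF: "disc N k ?F" unfolding disc_def using PP_poly[OF R _ _ Gc] by blast
 have dF': "disc N k ?F'" using dF comm unfolding disc_def by metis
 have "P (glue ?F)"
  unfolding P_def M
 proof (intro conjI ballI glue(2)[OF dF])
  note r = glue(1)[OF dF]
  fix i j assume ij: "i \<in> {1..N}" "j \<in> {1..N}"
  show "ip (Kel M i j) (glue ?F) v = ip (Kel M i j) g v" if "v \<in> polyT k (k - 1)" for v
   unfolding ip_Kel[OF r ij polyT_cont[OF that]] ip_Kel[OF g ij polyT_cont[OF that]]
   by (rule PP_moments[OF R ij Gc[OF ij] that])
  show "ip (Iint M i) (tr_y_plus M (glue ?F) (j - 1)) v = ip (Iint M i) (tr_y_plus M g (j - 1)) v" if "v \<in> polyP k" for v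
   unfolding ip_trace_y(2)[OF r ij polyP_continuous[OF that]] ip_trace_y(2)[OF g ij polyP_continuous[OF that]]
   by (rule PP_trace_y[OF R ij Gc[OF ij] radau_traces(4)[OF ij(2)] cell_ends(4)[OF ij(2)] that])
 qed
 then have Z: "P (gr_y_plus M k g)" unfolding gr by (rule someI[of P])
 then obtain ZF where r: "rep (gr_y_plus M k g) ZF" and d: "disc N k ZF" using VN_rep unfolding P_def by metis
 show ?thesis
 proof (rule rep_cong[OF r _ dF'])
  fix i j z assume ij: "i \<in> {1..N}" "j \<in> {1..N}"
  have "ZF i j z = ?F i j z"
  proof (rule tensor_characterization[OF R ij Gc[OF ij], where ye = "Y (j - 1)"])
   show "ZF i j \<in> polyT k k" using d ij by (auto simp: disc_def)
   show "Y (j - 1) = Y (j - 1) + (Y j - Y (j - 1)) * pnode (radL k)" by (simp add: radau_nodes)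
   show "integral (cl i j) (%z. ZF i j z * v z) = integral (cl i j) (%z. G i j z * v z)" if "v \<in> polyT k (k - 1)" for v
    unfolding ip_Kel[OF r ij polyT_cont[OF that], symmetric] ip_Kel[OF g ij polyT_cont[OF that], symmetric]
    using Z ij that unfolding P_def M by blast
   show "integral {X (i - 1)..X i} (%x. ZF i j (x, Y (j - 1)) * v x) = integral {X (i - 1)..X i} (%x. G i j (x, Y (j - 1)) * v x)" if "v \<in> polyP k" for v
    unfolding ip_trace_y(2)[OF r ij polyP_continuous[OF that], symmetric] ip_trace_y(2)[OF g ij polyP_continuous[OF that], symmetric]
    using Z ij that unfolding P_def M by blast
  qed (simp_all add: radau_nodes)
  then show "ZF i j z = ?F' i j z" unfolding comm[OF ij] .
 qed
qed

end

section \<open>The energy of a sum\<close>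

lemma square_sum_le: "(x + y)\<^sup>2 <= 2 * x\<^sup>2 + 2 * (y::real)\<^sup>2"
 using zero_le_power2[of "x - y"] by (simp add: power2_eq_square algebra_simps)

lemma L1_square_sum:
 assumes "pc N X A" "pc N X f" "pc N X g" "!!i x. i \<in> {1..N} ==> x \<in> {X (i - 1)..X i} ==> 0 <= A i x"
 shows "L1 N X (%i x. A i x * (f i x + g i x)\<^sup>2) <= 2 * L1 N X (%i x. A i x * (f i x)\<^sup>2) + 2 * L1 N X (%i x. A i x * (g i x)\<^sup>2)"
proof -
 have "L1 N X (%i x. A i x * (f i x + g i x)\<^sup>2) <= L1 N X (%i x. 2 * (A i x * (f i x)\<^sup>2) + 2 * (A i x * (g i x)\<^sup>2))"
 proof (rule L1_mono)
  show "pc N X (%i x. A i x * (f i x + g i x)\<^sup>2)" "pc N X (%i x. 2 * (A i x * (f i x)\<^sup>2) + 2 * (A i x * (g i x)\<^sup>2))"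
   by (intro pc_add pc_cmult pc_mult pc_power assms)+
  show "A i x * (f i x + g i x)\<^sup>2 <= 2 * (A i x * (f i x)\<^sup>2) + 2 * (A i x * (g i x)\<^sup>2)"
   if "i \<in> {1..N}" "x \<in> {X (i - 1)..X i}" for i x
   using mult_left_mono[OF square_sum_le[of "f i x" "g i x"] assms(4)[OF that]] by (simp add: algebra_simps)
 qed
 also have "... = 2 * L1 N X (%i x. A i x * (f i x)\<^sup>2) + 2 * L1 N X (%i x. A i x * (g i x)\<^sup>2)"
  by (subst L1_add) (auto intro!: pc_cmult pc_mult pc_power assms simp: L1_cmult)
 finally show ?thesis .
qed

context grid2
begin

lemma L2D_square_sum:
 assumes "pc2 N X Y (%i j. w)" "pc2 N X Y F" "pc2 N X Y G" "!!z. z \<in> RX \<times> RY ==> 0 <= w z"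
 shows "L2D N X Y (%i j z. w z * (F i j z + G i j z)\<^sup>2)
  <= 2 * L2D N X Y (%i j z. w z * (F i j z)\<^sup>2) + 2 * L2D N X Y (%i j z. w z * (G i j z)\<^sup>2)"
proof -
 have c: "pc2 N X Y (%i j z. 2 * (w z * (F i j z)\<^sup>2))" "pc2 N X Y (%i j z. 2 * (w z * (G i j z)\<^sup>2))"
  by (intro pc2_mult[OF pc2_const] pc2_mult pc2_power assms)+
 have "L2D N X Y (%i j z. w z * (F i j z + G i j z)\<^sup>2) <= L2D N X Y (%i j z. 2 * (w z * (F i j z)\<^sup>2) + 2 * (w z * (G i j z)\<^sup>2))"
 proof (rule L2D_mono)
  show "pc2 N X Y (%i j z. w z * (F i j z + G i j z)\<^sup>2)" by (intro pc2_mult pc2_power pc2_add assms)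
  show "pc2 N X Y (%i j z. 2 * (w z * (F i j z)\<^sup>2) + 2 * (w z * (G i j z)\<^sup>2))" by (intro pc2_add c)
  fix i j z assume "i \<in> {1..N}" "j \<in> {1..N}" "z \<in> cl i j"
  then have "z \<in> RX \<times> RY" using subsetD[OF gx.cell_subset[of i]] subsetD[OF gy.cell_subset[of j]] by (cases z) blast
  from mult_left_mono[OF square_sum_le[of "F i j z" "G i j z"] assms(4)[OF this]]
  show "w z * (F i j z + G i j z)\<^sup>2 <= 2 * (w z * (F i j z)\<^sup>2) + 2 * (w z * (G i j z)\<^sup>2)" by (simp add: algebra_simps)
 qed
 also have "... = 2 * L2D N X Y (%i j z. w z * (F i j z)\<^sup>2) + 2 * L2D N X Y (%i j z. w z * (G i j z)\<^sup>2)"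
  unfolding L2D_add[OF c] L2D_cmult ..
 finally show ?thesis .
qed

lemma norm_part_sum:
 assumes c: "continuous_on (RX \<times> RY) c" "\<forall>z\<in>RX \<times> RY. 0 <= c z" and \<epsilon>: "\<epsilon> > 0"
  and F: "pc2 N X Y V" "pc2 N X Y S" "pc2 N X Y R" and G: "pc2 N X Y V'" "pc2 N X Y S'" "pc2 N X Y R'"
 shows "(L2D N X Y (%i j z. (S i j z + S' i j z)\<^sup>2) + L2D N X Y (%i j z. (R i j z + R' i j z)\<^sup>2)) / \<epsilon>
   + L2D N X Y (%i j z. c z * (V i j z + V' i j z)\<^sup>2)
  <= 2 * ((L2D N X Y (%i j z. (S i j z)\<^sup>2) + L2D N X Y (%i j z. (R i j z)\<^sup>2)) / \<epsilon> + L2D N X Y (%i j z. c z * (V i j z)\<^sup>2))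
   + 2 * ((L2D N X Y (%i j z. (S' i j z)\<^sup>2) + L2D N X Y (%i j z. (R' i j z)\<^sup>2)) / \<epsilon> + L2D N X Y (%i j z. c z * (V' i j z)\<^sup>2))"
proof -
 have one: "L2D N X Y (%i j z. (F i j z + G i j z)\<^sup>2) <= 2 * L2D N X Y (%i j z. (F i j z)\<^sup>2) + 2 * L2D N X Y (%i j z. (G i j z)\<^sup>2)"
  if "pc2 N X Y F" "pc2 N X Y G" for F G
  using L2D_square_sum[OF pc2_const that, of "1"] by simp
 have "(L2D N X Y (%i j z. (S i j z + S' i j z)\<^sup>2) + L2D N X Y (%i j z. (R i j z + R' i j z)\<^sup>2)) / \<epsilon>
  <= (2 * L2D N X Y (%i j z. (S i j z)\<^sup>2) + 2 * L2D N X Y (%i j z. (S' i j z)\<^sup>2)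
    + (2 * L2D N X Y (%i j z. (R i j z)\<^sup>2) + 2 * L2D N X Y (%i j z. (R' i j z)\<^sup>2))) / \<epsilon>"
  using one[OF F(2) G(2)] one[OF F(3) G(3)] \<epsilon> by (intro divide_right_mono add_mono) auto
 moreover have "(2 * s + 2 * s' + (2 * r + 2 * r')) / \<epsilon> = 2 * ((s + r) / \<epsilon>) + 2 * ((s' + r') / \<epsilon>)" for s s' r r'
  by (simp add: add_divide_distrib)
 moreover have "L2D N X Y (%i j z. c z * (V i j z + V' i j z)\<^sup>2)
  <= 2 * L2D N X Y (%i j z. c z * (V i j z)\<^sup>2) + 2 * L2D N X Y (%i j z. c z * (V' i j z)\<^sup>2)"
  by (rule L2D_square_sum[OF pc2_global[OF c(1)] F(1) G(1) bspec[OF c(2)]])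
 ultimately show ?thesis by (simp only: distrib_left)
qed

lemma XJ_sum:
 assumes a: "continuous_on (RX \<times> RY) a" "\<forall>z\<in>RX \<times> RY. 0 <= a z" and V: "pc2 N X Y V" "pc2 N X Y V'"
 shows "XJ N X Y a (%i j z. V i j z + V' i j z) <= 2 * XJ N X Y a V + 2 * XJ N X Y a V'"
proof -
 have A: "pc N Y (%j y. a (X i, y))" if "i <= N" for i by (rule trace_const[OF a(1) that])
 have A0: "0 <= a (X i, y)" if "i <= N" "j \<in> {1..N}" "y \<in> {Y (j - 1)..Y j}" for i j y
  using gx.X_mono[of 0 i] gx.X_mono[of i N] gy.cell_subset[OF that(2)] that by (intro bspec[OF a(2)]) auto
 have 1: "L1 N Y (%j y. a (X 0, y) * (V 1 j (X 0, y) + V' 1 j (X 0, y))\<^sup>2)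
  <= 2 * L1 N Y (%j y. a (X 0, y) * (V 1 j (X 0, y))\<^sup>2) + 2 * L1 N Y (%j y. a (X 0, y) * (V' 1 j (X 0, y))\<^sup>2)"
  by (rule L1_square_sum[OF A trace_pc_1[OF V(1)] trace_pc_1[OF V(2)] A0]) auto
 have 2: "L1 N Y (%j y. a (X N, y) * (V N j (X N, y) + V' N j (X N, y))\<^sup>2)
  <= 2 * L1 N Y (%j y. a (X N, y) * (V N j (X N, y))\<^sup>2) + 2 * L1 N Y (%j y. a (X N, y) * (V' N j (X N, y))\<^sup>2)"
  by (rule L1_square_sum[OF A trace_pc_N[OF V(1)] trace_pc_N[OF V(2)] A0]) auto
 have 3: "L1 N Y (%j y. a (X i, y) * (V (Suc i) j (X i, y) + V' (Suc i) j (X i, y) - (V i j (X i, y) + V' i j (X i, y)))\<^sup>2)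
  <= 2 * L1 N Y (%j y. a (X i, y) * (V (Suc i) j (X i, y) - V i j (X i, y))\<^sup>2)
   + 2 * L1 N Y (%j y. a (X i, y) * (V' (Suc i) j (X i, y) - V' i j (X i, y))\<^sup>2)" if i: "i \<in> {1..N-1}" for i
 proof -
  have i': "i <= N" using i by auto
  have "L1 N Y (%j y. a (X i, y) * ((V (Suc i) j (X i, y) - V i j (X i, y)) + (V' (Suc i) j (X i, y) - V' i j (X i, y)))\<^sup>2)
   <= 2 * L1 N Y (%j y. a (X i, y) * (V (Suc i) j (X i, y) - V i j (X i, y))\<^sup>2)
   + 2 * L1 N Y (%j y. a (X i, y) * (V' (Suc i) j (X i, y) - V' i j (X i, y))\<^sup>2)"
   by (rule L1_square_sum[OF A[OF i'] pc_diff[OF pc_step(2)[OF V(1) i] pc_step(1)[OF V(1) i]]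
      pc_diff[OF pc_step(2)[OF V(2) i] pc_step(1)[OF V(2) i]]]) (rule A0[OF i'])
  moreover have "V (Suc i) j z + V' (Suc i) j z - (V i j z + V' i j z) = (V (Suc i) j z - V i j z) + (V' (Suc i) j z - V' i j z)" for j z
   by simp
  ultimately show ?thesis by (simp only:)
 qed
 have 4: "(\<Sum>i=1..N-1. L1 N Y (%j y. a (X i, y) * (V (Suc i) j (X i, y) + V' (Suc i) j (X i, y) - (V i j (X i, y) + V' i j (X i, y)))\<^sup>2))
  <= 2 * (\<Sum>i=1..N-1. L1 N Y (%j y. a (X i, y) * (V (Suc i) j (X i, y) - V i j (X i, y))\<^sup>2))
   + 2 * (\<Sum>i=1..N-1. L1 N Y (%j y. a (X i, y) * (V' (Suc i) j (X i, y) - V' i j (X i, y))\<^sup>2))"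
  unfolding sum_distrib_left sum.distrib[symmetric] by (rule sum_mono) (rule 3)
 show ?thesis
  unfolding XJ_expand[OF a(1) V(1)] XJ_expand[OF a(1) V(2)] XJ_expand[OF a(1) pc2_add[OF V]] distrib_left
  using 1 2 4 by linarith
qed

text \<open>The estimate for sums, applied to \<open>V\<close> and its negative, bounds 0 by four
  times the jump term.\<close>

lemma XJ_nonneg:
 assumes a: "continuous_on (RX \<times> RY) a" "\<forall>z\<in>RX \<times> RY. 0 <= a z" and V: "pc2 N X Y V"
 shows "0 <= XJ N X Y a V"
proof -
 have "XJ N X Y a (%i j z. V i j z + - V i j z) <= 2 * XJ N X Y a V + 2 * XJ N X Y a (%i j z. - V i j z)"
  by (rule XJ_sum[OF a V pc2_minus[OF V]])
 moreover have "XJ N X Y a (%i j z. V i j z + - V i j z) = 0" by (simp add: XJ_def L1_0)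
 moreover have "(- x - - y)\<^sup>2 = (x - y)\<^sup>2" for x y :: real by (simp add: power2_commute)
 then have "XJ N X Y a (%i j z. - V i j z) = XJ N X Y a V" by (simp add: XJ_def power2_commute)
 ultimately show ?thesis by linarith
qed

lemma XT_nonneg:
 assumes "pc2 N X Y V"
 shows "0 <= XT N X Y (%i j z. (V i j z)\<^sup>2)"
 unfolding XT_def by (intro L1_nonneg pc_power trace_pc_N[OF assms]) auto

lemma XT_square_sum:
 assumes V: "pc2 N X Y V" "pc2 N X Y V'"
 shows "XT N X Y (%i j z. (V i j z + V' i j z)\<^sup>2) <= 2 * XT N X Y (%i j z. (V i j z)\<^sup>2) + 2 * XT N X Y (%i j z. (V' i j z)\<^sup>2)"
 using L1_square_sum[OF pc_const trace_pc_N[OF V(1)] trace_pc_N[OF V(2)], of "%_. 1"] by (simp add: XT_def)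

text \<open>All parts are squares with nonnegative weights, so doubling replaces a triangle
  inequality for the norm.\<close>

theorem energy_sum:
 assumes a: "continuous_on (RX \<times> RY) a" "\<forall>z\<in>RX \<times> RY. 0 <= a z"
  and c: "continuous_on (RX \<times> RY) (%z. b z - ax z / 2)" "\<forall>z\<in>RX \<times> RY. 0 <= b z - ax z / 2"
  and \<epsilon>: "\<epsilon> > 0" and l: "0 <= l1" "0 <= l2"
  and F: "pc2 N X Y V" "pc2 N X Y S" "pc2 N X Y R" and G: "pc2 N X Y V'" "pc2 N X Y S'" "pc2 N X Y R'"
 shows "energy N X Y \<epsilon> a ax b l1 l2 (%i j z. V i j z + V' i j z) (%i j z. S i j z + S' i j z) (%i j z. R i j z + R' i j z)
  <= 2 * energy N X Y \<epsilon> a ax b l1 l2 V S R + 2 * energy N X Y \<epsilon> a ax b l1 l2 V' S' R'"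
proof -
 interpret S: grid2 N Y X k by (rule swapped)
 have 1: "l1 * XT N X Y (%i j z. (V i j z + V' i j z)\<^sup>2) <= 2 * (l1 * XT N X Y (%i j z. (V i j z)\<^sup>2)) + 2 * (l1 * XT N X Y (%i j z. (V' i j z)\<^sup>2))"
  using mult_left_mono[OF XT_square_sum[OF F(1) G(1)] l(1)] by (simp add: algebra_simps)
 have 2: "l2 * XT N Y X (sw (%i j z. (V i j z + V' i j z)\<^sup>2))
  <= 2 * (l2 * XT N Y X (sw (%i j z. (V i j z)\<^sup>2))) + 2 * (l2 * XT N Y X (sw (%i j z. (V' i j z)\<^sup>2)))"
  using mult_left_mono[OF S.XT_square_sum[OF pc2_sw[OF F(1)] pc2_sw[OF G(1)]] l(2)] by (simp add: sw_def algebra_simps)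
 have comb: "n + x / 2 + t + s <= 2 * (n1 + x1 / 2 + t1 + s1) + 2 * (n2 + x2 / 2 + t2 + s2)"
  if "n <= 2 * n1 + 2 * n2" "x <= 2 * x1 + 2 * x2" "t <= 2 * t1 + 2 * t2" "s <= 2 * s1 + 2 * s2"
  for n n1 n2 x x1 x2 t t1 t2 s s1 s2 :: real
  using that by simp
 show ?thesis
  unfolding energy_def by (rule comb[OF norm_part_sum[OF c \<epsilon> F G] XJ_sum[OF a F(1) G(1)] 1 2])
qed

end

section \<open>The error bounds\<close>

lemma (in interval_proj) pj_zero:
 assumes "c < d" "!!t. t \<in> {c..d} ==> g t = 0"
 shows "pj K c d g x = 0"
 using pj_cong[OF assms(1), of g "%t. 0 * g t"] pj_cmult[of c d 0 g x] assms(2) by simp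

lemma sum_from_1: "N \<ge> 1 ==> (\<Sum>i=1..N. d i) = d 1 + (\<Sum>i=1..N-1. d (Suc i) :: real)"
proof -
 assume "N \<ge> 1"
 then obtain n where "N = Suc n" by (cases N) auto
 moreover have "(\<Sum>i=1..Suc n. d i) = d 1 + (\<Sum>i=1..n. d (Suc i))" by (induction n) auto
 ultimately show ?thesis by simp
qed

context shishkin_solution
begin

lemma tot_dx: "a + b < k + 2 ==> x \<in> {0..1} ==> y \<in> {0..1} ==>
  ((%t. tot a b (t, y)) has_real_derivative tot (Suc a) b (x, y)) (at x within {0..1})"
 and tota_dx: "a + b < k + 2 ==> x \<in> {0..1} ==> y \<in> {0..1} ==>
  ((%t. tota a b (t, y)) has_real_derivative tota (Suc a) b (x, y)) (at x within {0..1})"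
 and tot_dy: "a + b < k + 2 ==> x \<in> {0..1} ==> y \<in> {0..1} ==>
  ((%t. tot a b (x, t)) has_real_derivative tot a (Suc b) (x, y)) (at y within {0..1})"
 unfolding tot_def tota_def totb_def
 by (intro DERIV_add comp_dx[OF comps(1)] comp_dx[OF comps(2)] comp_dx[OF comps(3)] comp_dx[OF comps(4)]
   comp_dy[OF comps(1)] comp_dy[OF comps(2)] comp_dy[OF comps(3)] comp_dy[OF comps(4)]; assumption)+

context
 assumes bc: "!!t. t \<in> {0..1} ==> u (0, t) = 0 & u (1, t) = 0 & u (t, 0) = 0 & u (t, 1) = 0"
begin

lemma PYu_zero:
 assumes "j \<in> {1..N}"
 shows "PY (radR k) Y j u (X 0, y) = 0" "PY (radR k) Y j u (X N, y) = 0"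
 unfolding PY_def split_conv X_ends
 by (rule interval_proj.pj_zero[OF proj(1) gy.cell[OF assms]]; use bc Y_cell_unit[OF assms] in blast)+

lemma e_u_right: "j \<in> {1..N} ==> y \<in> {Y (j - 1)..Y j} ==> e_u N j (X N, y) = 0"
 using radau_traces(1)[of N] PYu_zero(2)[of j y] bc[of y] Y_cell_unit[of j y] gx.N1 X_ends by simp

lemma e_u_top: "i \<in> {1..N} ==> x \<in> {X (i - 1)..X i} ==> e_u i N (x, Y N) = 0"
proof -
 assume i: "i \<in> {1..N}" and x: "x \<in> {X (i - 1)..X i}"
 have N: "N \<in> {1..N}" using gx.N1 by simp
 have "continuous_on (cl i N) u"
  by (rule continuous_on_subset[OF cont_upq(1)]) (use X_cell_unit[OF i] Y_cell_unit[OF N] in auto)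
 then have "PX (radR k) X i (PY (radR k) Y N u) (x, Y N) = PX (radR k) X i u (x, Y N)"
  using PP_commute[OF proj(1) proj(1) i N] radau_traces(3)[OF N] by metis
 also have "... = 0"
  unfolding PX_def split_conv Y_ends
  by (rule interval_proj.pj_zero[OF proj(1) gx.cell[OF i]]) (use bc X_cell_unit[OF i] in blast)
 finally show ?thesis using bc[of x] X_cell_unit[OF i x] Y_ends by simp
qed

lemma pc2_e_u: "pc2 N X Y e_u"
 by (intro pc2_diff pc2_PX[OF proj(1)] pc2_PY[OF proj(1)] row_subset pc2_global) (simp_all add: RX_RY cont_upq(1))

lemma XT_e_u: "XT N X Y (%i j z. (e_u i j z)\<^sup>2) = 0" "XT N Y X (sw (%i j z. (e_u i j z)\<^sup>2)) = 0"
proof -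
 have "XT N X Y (%i j z. (e_u i j z)\<^sup>2) = L1 N Y (%_ _. 0)"
  unfolding XT_def by (rule L1_cong) (simp only: e_u_right power_zero_numeral)
 then show "XT N X Y (%i j z. (e_u i j z)\<^sup>2) = 0" by (simp add: L1_0)
 have "XT N Y X (sw (%i j z. (e_u i j z)\<^sup>2)) = L1 N X (%_ _. 0)"
  unfolding XT_def sw_def swap_simp by (rule L1_cong) (simp only: e_u_top power_zero_numeral)
 then show "XT N Y X (sw (%i j z. (e_u i j z)\<^sup>2)) = 0" by (simp add: L1_0)
qed

text \<open>At each node the jump of the projection error reduces to an error in x on the cell to
  the right, and the squares of these were summed in \<open>jump_bound\<close>.\<close>

lemma XJ_e_u:
 assumes a: "continuous_on Q01 a" "!!z. z \<in> Q01 ==> a z <= Ma" and Ma: "0 <= Ma"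
 shows "XJ N X Y a e_u <= Ma * ((CP * B)\<^sup>2 * ((1 + 1 / (4 * \<sigma>)) * h ^ (2 * k + 1)))"
proof -
 let ?K = "(CP * B)\<^sup>2 * ((1 + 1 / (4 * \<sigma>)) * h ^ (2 * k + 1))"
 have ac: "continuous_on (RX \<times> RY) a" using a(1) by (simp add: RX_RY)
 have pcA: "pc N Y (%j y. a (X i, y))" if "i <= N" for i by (rule trace_const[OF ac that])
 have m: "pc N Y (%j y. a (X i, y) * (e_u (Suc i) j (X i, y) - e_u i j (X i, y))\<^sup>2)" if i: "i \<in> {1..N-1}" for i
 proof -
  have "i <= N" using i by auto
  then show ?thesis by (rule pc_mult[OF pcA pc_power[OF pc_diff[OF pc_step(2)[OF pc2_e_u i] pc_step(1)[OF pc2_e_u i]]]])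
 qed
 have pcI: "pc N Y (%j y. a (X 0, y) * (e_u 1 j (X 0, y))\<^sup>2
  + (\<Sum>i=1..N-1. a (X i, y) * (e_u (Suc i) j (X i, y) - e_u i j (X i, y))\<^sup>2) + a (X N, y) * (e_u N j (X N, y))\<^sup>2)"
  by (rule pc_add[OF pc_add[OF pc_mult[OF pcA pc_power[OF trace_pc_1[OF pc2_e_u]]] pc_sum[OF m]]
     pc_mult[OF pcA pc_power[OF trace_pc_N[OF pc2_e_u]]]]) auto
 have "XJ N X Y a e_u <= L1 N Y (%_ _. Ma * ?K)"
  unfolding XJ_def
 proof (rule L1_mono[OF pcI pc_const])
  fix j y assume j: "j \<in> {1..N}" and y: "y \<in> {Y (j - 1)..Y j}"
  define w where "w = PY (radR k) Y j u"
  define d where "d i = w (X (i - 1), y) - PX (radR k) X i w (X (i - 1), y)" for i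
  have yu: "y \<in> {0..1}" by (rule Y_cell_unit[OF j y])
  have aM: "a (X i, y) <= Ma" if "i <= N" for i
  proof -
   have "X i \<in> {X 0..X N}" using gx.X_mono[of 0 i] gx.X_mono[of i N] that by auto
   then show ?thesis using RX_RY yu by (intro a(2)) auto
  qed
  have "w (X 0, y) = 0" unfolding w_def by (rule PYu_zero(1)[OF j])
  moreover have "u (X 0, y) = 0" using bc[OF yu] by (simp only: X_ends)
  ultimately have 1: "e_u 1 j (X 0, y) = d 1" by (simp add: d_def flip: w_def)
  \<comment> \<open>On the left cell the projection in x is exact at the node, so both one-sided
    errors contain the same \<open>u - w\<close>; it cancels in the jump and only the error in x
    from the right is left.\<close>
  have 2: "e_u (Suc i) j (X i, y) - e_u i j (X i, y) = d (Suc i)" if "i \<in> {1..N-1}" for i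
  proof -
   have "i \<in> {1..N}" using that by auto
   then show ?thesis using radau_traces(1)[of i w y] by (simp add: d_def flip: w_def)
  qed
  have "a (X 0, y) * (e_u 1 j (X 0, y))\<^sup>2
   + (\<Sum>i=1..N-1. a (X i, y) * (e_u (Suc i) j (X i, y) - e_u i j (X i, y))\<^sup>2) + a (X N, y) * (e_u N j (X N, y))\<^sup>2
   = a (X 0, y) * (d 1)\<^sup>2 + (\<Sum>i=1..N-1. a (X i, y) * (d (Suc i))\<^sup>2)"
   unfolding 1 e_u_right[OF j y] using sum.cong[OF refl, of "{1..N-1}" "%i. a (X i, y) * (e_u (Suc i) j (X i, y) - e_u i j (X i, y))\<^sup>2" "%i. a (X i, y) * (d (Suc i))\<^sup>2"] 2
   by (simp only: power_zero_numeral mult_zero_right add_0_right)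
  also have "... <= Ma * (d 1)\<^sup>2 + (\<Sum>i=1..N-1. Ma * (d (Suc i))\<^sup>2)"
   using aM by (intro add_mono sum_mono mult_right_mono) auto
  also have "... = Ma * (\<Sum>i=1..N. (d i)\<^sup>2)"
   unfolding sum_from_1[OF gx.N1, of "%i. (d i)\<^sup>2"] by (simp add: distrib_left sum_distrib_left)
  also have "... <= Ma * ?K"
   using jump_bound[OF y j] Ma unfolding d_def w_def by (rule mult_left_mono)
  finally show "a (X 0, y) * (e_u 1 j (X 0, y))\<^sup>2
   + (\<Sum>i=1..N-1. a (X i, y) * (e_u (Suc i) j (X i, y) - e_u i j (X i, y))\<^sup>2) + a (X N, y) * (e_u N j (X N, y))\<^sup>2
   <= Ma * ?K" .
 qed
 then show ?thesis by (simp add: gy.L1_const Y_ends)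
qed

end

lemma pdx_tot:
 assumes "\<forall>z\<in>Q01. g z = tot a b z" "a + b < k + 2" "z \<in> Q01"
 shows "pdx g z = tot (Suc a) b z"
proof -
 obtain x y where z: "z = (x, y)" "x \<in> {0..1}" "y \<in> {0..1}" using assms(3) by (rule SigmaE)
 have "pdx g z = pdx (tot a b) z" by (rule pdx_cong[OF _ assms(3)]) (rule bspec[OF assms(1)])
 then show ?thesis using pdx_eqI[OF tot_dx[OF assms(2) z(2,3)] z(2)] by (simp only: z(1))
qed

lemma pdy_tot:
 assumes "\<forall>z\<in>Q01. g z = tot a b z" "a + b < k + 2" "z \<in> Q01"
 shows "pdy g z = tot a (Suc b) z"
proof -
 obtain x y where z: "z = (x, y)" "x \<in> {0..1}" "y \<in> {0..1}" using assms(3) by (rule SigmaE)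
 have "pdy g z = pdy (tot a b) z" by (rule pdy_cong[OF _ assms(3)]) (rule bspec[OF assms(1)])
 then show ?thesis using pdy_eqI[OF tot_dy[OF assms(2) z(2,3)] z(3)] by (simp only: z(1))
qed

lemma has_dx_tot: "a + b < k + 2 ==> has_dx {0..1} {0..1} (tot a b) (tot (Suc a) b)"
 and has_dx_tota: "a + b < k + 2 ==> has_dx {0..1} {0..1} (tota a b) (tota (Suc a) b)"
 unfolding has_dx_def using cont_tot[of a b] cont_tot[of "Suc a" b] tot_dx tota_dx by simp_all

lemma has_dx_tot_swap:
 assumes "a + b < k + 2"
 shows "has_dx {0..1} {0..1} (%z. tot a b (prod.swap z)) (%z. tot a (Suc b) (prod.swap z))"
proof -
 have "continuous_on Q01 (%z. tot a b' (prod.swap z))" if "b' <= Suc b" for b'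
 proof -
  have "a + b' <= k + 2" using assms that by simp
  moreover have "(%z. tot a b' (prod.swap z)) = (%(y, x). tot a b' (x, y))" by (auto simp: fun_eq_iff)
  ultimately show ?thesis using continuous_on_swap[OF cont_tot(3)[of a b']] by (simp only:)
 qed
 then show ?thesis unfolding has_dx_def using tot_dy[OF assms] by simp
qed

text \<open>Constants for squared errors: \<open>K1\<close> for the projection error without jumps,
  \<open>K2\<close> for the discrete error, \<open>K3\<close> for the jumps of the projection
  error.\<close>

definition "K1 Ma = (cc Ma)\<^sup>2 * (2 * (1 / \<alpha> + e0) + 1 + 2 * Ma)"
definition "K2 \<beta> C1 Ma = ldg_problem.C\<xi> k \<alpha> \<beta> C1 Ma (1 / \<alpha>) e0 * (cc Ma)\<^sup>2"
definition "K3 Ma = Ma * ((CP * B)\<^sup>2 * (1 + 1 / (4 * \<sigma>))) / 2"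

text \<open>The total error is the sum of projection and discrete error. Only the first bound sees
  the jumps of the projection error and hence the lower power of \<open>h\<close>; the third follows
  from the energy of the discrete error by dropping its nonnegative jump and penalty parts.\<close>

theorem error_bounds:
 fixes a b f w :: fn2 and W :: "fn2 \<times> fn2 \<times> fn2"
 defines "MM \<equiv> shishkin_mesh \<tau>x \<tau>y N"
 assumes a: "Ck (Suc 0) Q01 a" and b: "continuous_on Q01 b" and f: "continuous_on Q01 f"
  and al: "\<forall>z\<in>Q01. \<alpha> <= a z" and \<beta>: "\<beta> > 0" "\<forall>z\<in>Q01. \<beta> <= b z - pdx a z / 2"
  and l: "l1 \<ge> 0" "C1 > 0" "C1 * \<epsilon> <= l2"
  and Ma: "\<forall>z\<in>Q01. \<bar>a z\<bar> <= Ma" "\<forall>z\<in>Q01. \<bar>pdx a z\<bar> <= Ma" "\<forall>z\<in>Q01. \<bar>b z\<bar> <= Ma"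
  and w: "\<forall>z\<in>Q01. w z = u z" and bvp: "bvp_solution \<epsilon> a b f w"
  and W: "ldg_solution MM k \<epsilon> a b f l1 l2 W"
 defines "pw \<equiv> %z. \<epsilon> * pdx w z" and "qw \<equiv> %z. \<epsilon> * pdy w z"
 shows "(normE MM \<epsilon> a b l1 l2 (diff3 (w, pw, qw) W))\<^sup>2 <= 2 * (K1 Ma * H\<^sup>2 + K3 Ma * h ^ (2 * k + 1)) + 2 * (K2 \<beta> C1 Ma * H\<^sup>2)"
  and "(normE MM \<epsilon> a b l1 l2 (diff3 (gr_minus MM k w, gr_x_plus MM k pw, gr_y_plus MM k qw) W))\<^sup>2 <= K2 \<beta> C1 Ma * H\<^sup>2"
  and "(norm2 \<epsilon> a b (diff3 (w, pw, qw) W))\<^sup>2 <= 2 * (K1 Ma * H\<^sup>2) + 2 * (K2 \<beta> C1 Ma * H\<^sup>2)"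
proof -
 obtain U' P' Q' where WW: "W = (U', P', Q')" by (cases W) auto
 have M': "cells MM = N" "xpt MM = X" "ypt MM = Y" by (simp_all add: MM_def shishkin_mesh_def X_def Y_def)
 interpret MF: mesh_functions N X Y k MM
  by (intro mesh_functions.intro mesh_functions_axioms.intro grid2_axioms M' X_ends Y_ends)
 have Q: "RX \<times> RY = Q01" by (simp add: RX_RY)
 have ac: "continuous_on Q01 a" "continuous_on Q01 (pdx a)" using Ck_continuous[OF a] Ck_continuous[OF Ck_pdx[OF a]] .
 note conts = ac(1)[folded Q] ac(2)[folded Q] b[folded Q] f[folded Q]
 have cc: "continuous_on (RX \<times> RY) (%z. b z - pdx a z / 2)" by (intro continuous_intros conts) auto
 have "0 < C1 * \<epsilon>" using l(2) \<epsilon>0 by simp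
 then have l2: "l2 \<ge> 0" using l(3) by linarith
 have d1: "\<forall>z\<in>Q01. pdx w z = tot 1 0 z" "\<forall>z\<in>Q01. pdy w z = tot 0 1 z"
  unfolding One_nat_def by (intro ballI pdx_tot[OF w] pdy_tot[OF w]; simp)+
 have d2: "\<forall>z\<in>Q01. pdx (pdx w) z = tot 2 0 z" "\<forall>z\<in>Q01. pdy (pdy w) z = tot 0 2 z"
  unfolding numeral_2_eq_2
  by (intro ballI pdx_tot[OF d1(1)[unfolded One_nat_def]] pdy_tot[OF d1(2)[unfolded One_nat_def]]; use k1 in simp)+
 have sub: "Omega \<subseteq> Q01" using closure_subset[of Omega] by (simp add: closure_Omega)
 \<comment> \<open>The equation is given in the open square only. Through the components its terms
   are continuous on the closed square, so it extends to the boundary.\<close>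
 have pde: "- \<epsilon> * (tot 2 0 z + tot 0 2 z) + a z * tot 1 0 z + b z * u z = f z" if zR: "z \<in> RX \<times> RY" for z
 proof -
  have "(- \<epsilon> * (tot 2 0 z + tot 0 2 z) + a z * tot 1 0 z + b z * u z) - f z = 0"
  proof (rule continuous_constant_on_closure[where S = Omega and f = "%z. (- \<epsilon> * (tot 2 0 z + tot 0 2 z) + a z * tot 1 0 z + b z * u z) - f z"])
   show "continuous_on (closure Omega) (%z. (- \<epsilon> * (tot 2 0 z + tot 0 2 z) + a z * tot 1 0 z + b z * u z) - f z)"
    unfolding closure_Omega by (intro continuous_intros ac b f cont_tot(3)) auto
   fix z assume z: "z \<in> Omega"
   then have "- \<epsilon> * (pdx (pdx w) z + pdy (pdy w) z) + a z * pdx w z + b z * w z = f z"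
    using bvp unfolding bvp_solution_def by blast
   moreover have "z \<in> Q01" using sub z by blast
   ultimately have "- \<epsilon> * (tot 2 0 z + tot 0 2 z) + a z * tot 1 0 z + b z * u z = f z"
    using bspec[OF d1(1)] bspec[OF d2(1)] bspec[OF d2(2)] bspec[OF w] by metis
   then show "(- \<epsilon> * (tot 2 0 z + tot 0 2 z) + a z * tot 1 0 z + b z * u z) - f z = 0"
    by simp
  next
   show "z \<in> closure Omega" using zR unfolding Q closure_Omega .
  qed
  then show ?thesis by simp
 qed
 have fr: "u z = 0" if "z \<in> Q01" "z \<notin> Omega" for z
 proof -
  have "open Omega" by (simp add: Omega_def open_Times)
  then have "z \<in> frontier Omega" using that by (simp add: frontier_def closure_Omega interior_open)
  then have "w z = 0" using bvp unfolding bvp_solution_def by blast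
  then show ?thesis using bspec[OF w that(1)] by simp
 qed
 have bc: "u (0, t) = 0 & u (1, t) = 0 & u (t, 0) = 0 & u (t, 1) = 0" if "t \<in> {0..1}" for t
  using that by (auto intro!: fr simp: Omega_def)
 obtain U P Q where rW: "MF.rep U' U" "MF.rep P' P" "MF.rep Q' Q" and dW: "disc N k U" "disc N k P" "disc N k Q"
  and galerkin: "!!v s r. disc N k v ==> disc N k s ==> disc N k r ==>
   bform N X Y \<epsilon> a (pdx a) b l1 l2 U P Q v s r = L2D N X Y (%i j z. f z * v i j z)"
  using MF.method_families[OF conts W[unfolded WW]] by blast
 have L: "ldg_problem N X Y k \<epsilon> l1 l2 a (pdx a) b f u (tot 1 0) (tot 2 0) (tot 0 1) (tot 0 2) (tota 0 0) (tota 1 0) (totb 0 0) U P Q"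
 proof (intro ldg_problem.intro ldg_problem_axioms.intro grid2_axioms)
  show "has_dx RX RY a (pdx a)"
   unfolding has_dx_def using conts Ck_dx[OF a] by (simp add: RX_RY)
  show "has_dx RX RY u (tot 1 0)" "has_dx RX RY (tot 1 0) (tot 2 0)" "has_dx RX RY (tota 0 0) (tota 1 0)"
   unfolding RX_RY using has_dx_tot[of 0 0] has_dx_tot[of 1 0] has_dx_tota[of 0 0] k1 by (simp_all add: numeral_2_eq_2)
  show "has_dx RY RX (%z. u (prod.swap z)) (%z. tot 0 1 (prod.swap z))"
   "has_dx RY RX (%z. tot 0 1 (prod.swap z)) (%z. tot 0 2 (prod.swap z))"
   unfolding RX_RY using has_dx_tot_swap[of 0 0] has_dx_tot_swap[of 0 1] k1 by (simp_all add: numeral_2_eq_2)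
  show "u = (%z. tota 0 0 z + totb 0 0 z)" by (rule tot_def)
  show "continuous_on (RX \<times> RY) (totb 0 0)" unfolding Q by (rule cont_tot) simp
  show "u (X 0, y) = 0 & u (X N, y) = 0" if "y \<in> RY" for y using bc[of y] that by (simp add: X_ends Y_ends)
  show "u (x, Y 0) = 0 & u (x, Y N) = 0" if "x \<in> RX" for x using bc[of x] that by (simp add: X_ends Y_ends)
 qed (fact \<epsilon>0 conts pde dW galerkin)+
 note est = family_estimate[OF L bspec[OF al] \<beta>(1) bspec[OF \<beta>(2)] l bspec[OF Ma(1)] bspec[OF Ma(2)] bspec[OF Ma(3)]]
 let ?V = "%i j z. PX (radR k) X i (PY (radR k) Y j u) z - U i j z"
 let ?S = "%i j z. PX (radL k) X i (PY (projL2 k) Y j p) z - P i j z"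
 let ?R = "%i j z. PY (radL k) Y j (PX (projL2 k) X i q) z - Q i j z"
 have EN: "energy N X Y \<epsilon> a (pdx a) b l1 l2 ?V ?S ?R <= K2 \<beta> C1 Ma * H\<^sup>2"
  unfolding K2_def by (rule est(1)) assumption+
 have NN: "(L2D N X Y (%i j z. (e_p i j z)\<^sup>2) + L2D N X Y (%i j z. (e_q i j z)\<^sup>2)) / \<epsilon>
   + L2D N X Y (%i j z. (b z - pdx a z / 2) * (e_u i j z)\<^sup>2) <= K1 Ma * H\<^sup>2"
 proof -
  have K1: "K1 Ma * H\<^sup>2 = (cc Ma)\<^sup>2 * H\<^sup>2 * (2 * (1 / \<alpha> + e0) + 1 + 2 * Ma)" unfolding K1_def by (simp only: mult_ac)
  show ?thesis unfolding K1 by (rule est(2)) assumption+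
 qed
 have pqw: "pw z = p z" "qw z = q z" if "z \<in> Q01" for z
  unfolding pw_def qw_def bspec[OF d1(1) that] bspec[OF d1(2) that] by (rule refl)+
 have rw: "MF.rep w (%i j. u)" by (rule MF.rep_global; unfold Q; rule cont_upq(1) bspec[OF w]; assumption?)
 have rp: "MF.rep pw (%i j. p)" by (rule MF.rep_global; unfold Q; rule cont_upq(2) pqw(1); assumption?)
 have rq: "MF.rep qw (%i j. q)" by (rule MF.rep_global; unfold Q; rule cont_upq(3) pqw(2); assumption?)
 note rg = MF.gr_minus_rep[OF rw] MF.gr_x_plus_rep[OF rp] MF.gr_y_plus_rep[OF rq]
 note r\<xi> = MF.rep_diff[OF rg(1) rW(1)] MF.rep_diff[OF rg(2) rW(2)] MF.rep_diff[OF rg(3) rW(3)]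
 note re = MF.rep_diff[OF rw rW(1)] MF.rep_diff[OF rp rW(2)] MF.rep_diff[OF rq rW(3)]
 have apos: "0 <= a z" if "z \<in> RX \<times> RY" for z using bspec[OF al, of z] that Q \<alpha>0 by simp
 have cpos: "0 <= b z - pdx a z / 2" if "z \<in> RX \<times> RY" for z using bspec[OF \<beta>(2), of z] that Q \<beta>(1) by simp
 note pos = conts(3) conts(2) conts(1) apos cpos \<epsilon>0 l(1) l2
 have E2: "(normE MM \<epsilon> a b l1 l2 (diff3 (gr_minus MM k w, gr_x_plus MM k pw, gr_y_plus MM k qw) W))\<^sup>2
  = energy N X Y \<epsilon> a (pdx a) b l1 l2 ?V ?S ?R"
  unfolding diff3_def WW split_conv by (rule MF.normE_families) (fact pos r\<xi>)+
 have E1: "(normE MM \<epsilon> a b l1 l2 (diff3 (w, pw, qw) W))\<^sup>2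
  = energy N X Y \<epsilon> a (pdx a) b l1 l2 (%i j z. u z - U i j z) (%i j z. p z - P i j z) (%i j z. q z - Q i j z)"
  unfolding diff3_def WW split_conv by (rule MF.normE_families) (fact pos re)+
 have E3: "(norm2 \<epsilon> a b (diff3 (w, pw, qw) W))\<^sup>2
  = (L2D N X Y (%i j z. (p z - P i j z)\<^sup>2) + L2D N X Y (%i j z. (q z - Q i j z)\<^sup>2)) / \<epsilon>
  + L2D N X Y (%i j z. (b z - pdx a z / 2) * (u z - U i j z)\<^sup>2)"
  unfolding diff3_def WW split_conv by (rule MF.norm2_families) (fact pos re)+
 have split: "(%i j z. u z - U i j z) = (%i j z. e_u i j z + ?V i j z)" "(%i j z. p z - P i j z) = (%i j z. e_p i j z + ?S i j z)"
  "(%i j z. q z - Q i j z) = (%i j z. e_q i j z + ?R i j z)" by simp_all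
 have spl: "u z - U i j z = e_u i j z + ?V i j z" "p z - P i j z = e_p i j z + ?S i j z" "q z - Q i j z = e_q i j z + ?R i j z" for i j z
  by simp_all
 note pc\<xi> = r\<xi>[THEN MF.rep_pc2]
 have pce: "pc2 N X Y e_u" "pc2 N X Y e_p" "pc2 N X Y e_q"
  using MF.rep_pc2[OF MF.rep_diff[OF rw rg(1)]] MF.rep_pc2[OF MF.rep_diff[OF rp rg(2)]] MF.rep_pc2[OF MF.rep_diff[OF rq rg(3)]] .
 have apos': "\<forall>z\<in>RX \<times> RY. 0 <= a z" and cpos': "\<forall>z\<in>RX \<times> RY. 0 <= b z - pdx a z / 2" using apos cpos by blast+
 have Ma0: "0 <= Ma" using bspec[OF Ma(1), of "(0, 0)"] by simp
 have aM: "a z <= Ma" if "z \<in> Q01" for z using bspec[OF Ma(1) that] by (simp add: abs_le_iff)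
 have XJ: "XJ N X Y a e_u <= Ma * ((CP * B)\<^sup>2 * ((1 + 1 / (4 * \<sigma>)) * h ^ (2 * k + 1)))"
  by (rule XJ_e_u) (fact bc ac aM Ma0)+
 have XT: "XT N X Y (%i j z. (e_u i j z)\<^sup>2) = 0" "XT N Y X (sw (%i j z. (e_u i j z)\<^sup>2)) = 0"
  by (rule XT_e_u, fact bc)+
 have K3: "Ma * ((CP * B)\<^sup>2 * ((1 + 1 / (4 * \<sigma>)) * h ^ (2 * k + 1))) / 2 = K3 Ma * h ^ (2 * k + 1)"
  by (simp add: K3_def mult.assoc)
 have comb: "n + x / 2 + l1 * 0 + l2 * 0 <= n' + x' / 2" if "n <= n'" "x <= x'" for n n' x x' :: real
  using that by simp
 have EE: "energy N X Y \<epsilon> a (pdx a) b l1 l2 e_u e_p e_q <= K1 Ma * H\<^sup>2 + K3 Ma * h ^ (2 * k + 1)"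
  unfolding energy_def XT K3[symmetric] by (rule comb[OF NN XJ])
 show "(normE MM \<epsilon> a b l1 l2 (diff3 (w, pw, qw) W))\<^sup>2 <= 2 * (K1 Ma * H\<^sup>2 + K3 Ma * h ^ (2 * k + 1)) + 2 * (K2 \<beta> C1 Ma * H\<^sup>2)"
  unfolding E1 split
  by (rule order_trans[OF energy_sum[OF conts(1) apos' cc cpos' \<epsilon>0 l(1) l2 pce pc\<xi>] add_mono[OF mult_left_mono[OF EE] mult_left_mono[OF EN]]])
   simp_all
 show "(normE MM \<epsilon> a b l1 l2 (diff3 (gr_minus MM k w, gr_x_plus MM k pw, gr_y_plus MM k qw) W))\<^sup>2 <= K2 \<beta> C1 Ma * H\<^sup>2"
  unfolding E2 by (rule EN)
 have grow: "n <= n + x / 2 + t + s" if "0 <= x" "0 <= t" "0 <= s" for n x t s :: real using that by simp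
 interpret S: grid2 N Y X k by (rule swapped)
 have "0 <= XJ N X Y a ?V" by (rule XJ_nonneg[OF conts(1) apos' pc\<xi>(1)])
 moreover have "0 <= l1 * XT N X Y (%i j z. (?V i j z)\<^sup>2)" by (intro mult_nonneg_nonneg l(1) XT_nonneg pc\<xi>(1))
 moreover have "0 <= l2 * XT N Y X (sw (%i j z. (?V i j z)\<^sup>2))"
  using mult_nonneg_nonneg[OF l2 S.XT_nonneg[OF pc2_sw[OF pc\<xi>(1)]]] by (simp add: sw_def)
 ultimately have XX: "(L2D N X Y (%i j z. (?S i j z)\<^sup>2) + L2D N X Y (%i j z. (?R i j z)\<^sup>2)) / \<epsilon>
  + L2D N X Y (%i j z. (b z - pdx a z / 2) * (?V i j z)\<^sup>2) <= K2 \<beta> C1 Ma * H\<^sup>2"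
  by (rule order_trans[OF grow EN[unfolded energy_def]])
 show "(norm2 \<epsilon> a b (diff3 (w, pw, qw) W))\<^sup>2 <= 2 * (K1 Ma * H\<^sup>2) + 2 * (K2 \<beta> C1 Ma * H\<^sup>2)"
  unfolding E3 spl
  by (rule order_trans[OF norm_part_sum[OF cc cpos' \<epsilon>0 pce pc\<xi>] add_mono[OF mult_left_mono[OF NN] mult_left_mono[OF XX]]])
   simp_all
qed

end

text \<open>Adding 1 to the root makes the resulting constant positive even when \<open>L\<close> is
  0.\<close>

lemma root_bound:
 assumes "x\<^sup>2 <= L * t\<^sup>2" "0 <= L" "0 <= (t::real)"
 shows "x <= (1 + sqrt L) * t"
proof -
 have "x\<^sup>2 <= (sqrt L * t)\<^sup>2" using assms by (simp add: power_mult_distrib)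
 then have "x <= sqrt L * t" by (rule power2_le_imp_le) (use assms in simp)
 also have "... <= (1 + sqrt L) * t" using assms(3) by (simp add: distrib_right)
 finally show ?thesis .
qed

lemma rescale_bound: "r <= C * s * E ==> s * t = 1 ==> 0 <= t ==> r * t <= C * (E::real)"
proof -
 assume "r <= C * s * E" "s * t = 1" "0 <= t"
 then have "r * t <= (C * s * E) * t" by (intro mult_right_mono)
 also have "... = C * E * (s * t)" by (simp only: mult_ac)
 finally show ?thesis using \<open>s * t = 1\<close> by simp
qed

text \<open>The real powers of \<open>\<epsilon>\<close> in the assumption are cleared by
  multiplying with natural powers of \<open>\<epsilon>\<close> and \<open>sqrt \<epsilon>\<close>,
  which puts all four components into the common form.\<close>

lemma (in shishkin) regularity_components:
 assumes "regularity k \<alpha> \<delta> CR \<epsilon> w"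
 obtains u0 u1 u2 u12 where "comp 0 0 CR u0" "comp 1 0 CR u1" "comp 0 1 CR u2" "comp 1 1 CR u12"
  "\<forall>z\<in>Q01. w z = u0 z + u1 z + u2 z + u12 z"
proof -
 obtain u0 u1 u2 u12 where C: "\<forall>v\<in>{u0, u1, u2, u12}. Ck (k + 2) Q01 v"
  and w: "\<forall>z\<in>Q01. w z = u0 z + u1 z + u2 z + u12 z"
  and bd: "\<forall>(x, y)\<in>Q01. \<forall>i j. i + j <= k + 2 \<longrightarrow>
    \<bar>pd i j u0 (x, y)\<bar> <= CR \<and>
    \<bar>pd i j u1 (x, y)\<bar> <= CR * \<epsilon> powr (- real i) * exp (- \<alpha> * (1 - x) / \<epsilon>) \<and>
    \<bar>pd i j u2 (x, y)\<bar> <= CR * \<epsilon> powr (- real j / 2) * (exp (- \<delta> * y / sqrt \<epsilon>) + exp (- \<delta> * (1 - y) / sqrt \<epsilon>)) \<and>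
    \<bar>pd i j u12 (x, y)\<bar> <= CR * \<epsilon> powr (- (real i + real j / 2)) * exp (- \<alpha> * (1 - x) / \<epsilon>)
      * (exp (- \<delta> * y / sqrt \<epsilon>) + exp (- \<delta> * (1 - y) / sqrt \<epsilon>))"
  using assms unfolding regularity_def closure_Omega by blast
 have bds: "\<bar>pd i j u0 (x, y)\<bar> <= CR" "\<bar>pd i j u1 (x, y)\<bar> <= CR * \<epsilon> powr (- real i) * EE x"
  "\<bar>pd i j u2 (x, y)\<bar> <= CR * \<epsilon> powr (- real j / 2) * FF y"
  "\<bar>pd i j u12 (x, y)\<bar> <= CR * \<epsilon> powr (- (real i + real j / 2)) * EE x * FF y"
  if "x \<in> {0..1}" "y \<in> {0..1}" "i + j <= k + 2" for x y i j
 proof -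
  have "(x, y) \<in> Q01" using that by blast
  from bspec[OF bd this] that(3)
  show "\<bar>pd i j u0 (x, y)\<bar> <= CR" "\<bar>pd i j u1 (x, y)\<bar> <= CR * \<epsilon> powr (- real i) * EE x"
   "\<bar>pd i j u2 (x, y)\<bar> <= CR * \<epsilon> powr (- real j / 2) * FF y"
   "\<bar>pd i j u12 (x, y)\<bar> <= CR * \<epsilon> powr (- (real i + real j / 2)) * EE x * FF y"
   unfolding EE_def FF_def split_conv by blast+
 qed
 have i1: "\<epsilon> powr (- real i) * \<epsilon> ^ i = 1" for i
  using \<epsilon>0 by (simp add: powr_minus powr_realpow)
 have sq: "sqrt \<epsilon> ^ j = \<epsilon> powr (real j / 2)" for j
  using \<epsilon>0 by (simp add: powr_half_sqrt[symmetric] powr_powr flip: powr_realpow)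
 have j1: "\<epsilon> powr (- real j / 2) * sqrt \<epsilon> ^ j = 1" for j
  unfolding sq using \<epsilon>0 by (simp flip: powr_add)
 have ij1: "\<epsilon> powr (- (real i + real j / 2)) * (\<epsilon> ^ i * sqrt \<epsilon> ^ j) = 1" for i j
 proof -
  have "\<epsilon> powr (- (real i + real j / 2)) = \<epsilon> powr (- real i) * \<epsilon> powr (- real j / 2)"
   by (simp flip: powr_add)
  then have "\<epsilon> powr (- (real i + real j / 2)) * (\<epsilon> ^ i * sqrt \<epsilon> ^ j)
   = (\<epsilon> powr (- real i) * \<epsilon> ^ i) * (\<epsilon> powr (- real j / 2) * sqrt \<epsilon> ^ j)" by (simp only: mult_ac)
  then show ?thesis unfolding i1 j1 by simp
 qed
 have nn: "0 <= \<epsilon> ^ i" "0 <= sqrt \<epsilon> ^ j" "0 <= \<epsilon> ^ i * sqrt \<epsilon> ^ j" for i j using \<epsilon>0 by auto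
 show ?thesis
 proof (rule that)
  show "comp 0 0 CR u0" unfolding comp_def using C bds(1) by simp
  show "comp 1 0 CR u1" unfolding comp_def using C rescale_bound[OF bds(2) i1 nn(1)] by simp
  show "comp 0 1 CR u2" unfolding comp_def using C rescale_bound[OF bds(3) j1 nn(2)] by simp
  have "\<bar>pd i j u12 (x, y)\<bar> * (\<epsilon> ^ i * sqrt \<epsilon> ^ j) <= CR * (EE x * FF y)" if "x \<in> {0..1}" "y \<in> {0..1}" "i + j <= k + 2" for x y i j
   using rescale_bound[OF _ ij1 nn(3), of _ CR i j "EE x * FF y"] bds(4)[OF that] by (simp add: mult.assoc)
  then show "comp 1 1 CR u12" unfolding comp_def using C by (simp add: mult.assoc)
 qed (rule w)
qed

text \<open>The constant must be fixed before \<open>\<epsilon>\<close> and \<open>N\<close>. Its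
  parts were built inside locales that fix both, but outside they take only the parameters they
  really involve, so the argument list itself witnesses the independence. Moduli ensure that it is
  nonnegative.\<close>

definition error_const :: "nat => real => real => real => real => real => real => real => real"
 where "error_const k \<alpha> \<beta> \<delta> \<sigma> C1 CR Ma = 2 * \<bar>shishkin_solution.K1 k \<alpha> \<delta> \<sigma> CR Ma\<bar> + 2 * \<bar>shishkin_solution.K2 k \<alpha> \<delta> \<sigma> CR \<beta> C1 Ma\<bar>
  + 2 * \<bar>shishkin_solution.K3 k \<alpha> \<delta> \<sigma> CR Ma\<bar>"

lemma continuous_bound_Q01: "continuous_on Q01 g ==> \<exists>K. \<forall>z\<in>Q01. \<bar>g z :: real\<bar> <= K"
 using compact_imp_bounded[OF compact_continuous_image[of Q01 g]] compact_Times[OF compact_Icc compact_Icc]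
 by (auto simp: bounded_iff)

theorem theorem4p1:
  fixes k :: nat
  assumes "k \<ge> 1"
  shows "\<exists>n::nat. \<forall>(a::fn2) (b::fn2) (f::fn2) (\<alpha>::real) (\<beta>::real) (\<sigma>::real) (\<delta>::real)
      (C0::real) (C1::real) (C2::real) (CR::real).
    Ck n (closure Omega) a \<and> Ck n (closure Omega) b \<and> Ck n (closure Omega) f \<and>
    \<alpha> > 0 \<and> (\<forall>z\<in>closure Omega. a z \<ge> \<alpha>) \<and> (\<forall>z\<in>closure Omega. b z \<ge> 0) \<and>
    \<beta> > 0 \<and> (\<forall>z\<in>closure Omega. b z - 1 / 2 * pdx a z \<ge> \<beta>) \<and>
    \<sigma> \<ge> real k + 2 \<and> \<delta> > 0 \<and> C0 > 0 \<and> C1 > 0 \<and> CR > 0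
    \<longrightarrow>
    (\<exists>C>0. \<forall>(\<epsilon>::real) (N::nat) (lam1::real) (lam2::real) (u::fn2) (W::fn2 \<times> fn2 \<times> fn2).
      \<epsilon> > 0 \<and> N \<ge> 4 \<and> 4 dvd N \<and>
      tau1 \<sigma> \<alpha> \<epsilon> N \<le> 1 / 2 \<and> tau2 \<sigma> \<delta> \<epsilon> N \<le> 1 / 4 \<and>
      \<epsilon> powr (1 / 4) * ln (real N) \<le> C2 \<and>
      0 \<le> lam1 \<and> lam1 \<le> C0 \<and> C1 * \<epsilon> \<le> lam2 \<and> lam2 \<le> C0 \<and>
      bvp_solution \<epsilon> a b f u \<and> regularity k \<alpha> \<delta> CR \<epsilon> u \<and>
      ldg_solution (shishkin_mesh (tau1 \<sigma> \<alpha> \<epsilon> N) (tau2 \<sigma> \<delta> \<epsilon> N) N) k \<epsilon> a b f lam1 lam2 W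
      \<longrightarrow>
      (let M = shishkin_mesh (tau1 \<sigma> \<alpha> \<epsilon> N) (tau2 \<sigma> \<delta> \<epsilon> N) N;
           p = (\<lambda>z. \<epsilon> * pdx u z);
           q = (\<lambda>z. \<epsilon> * pdy u z);
           w = (u, p, q);
           projw = (gr_minus M k u, gr_x_plus M k p, gr_y_plus M k q);
           h = ln (real N) / real N
       in normE M \<epsilon> a b lam1 lam2 (diff3 w W) \<le> C * h powr (real k + 1 / 2)
        \<and> normE M \<epsilon> a b lam1 lam2 (diff3 projw W) \<le> C * h ^ (k + 1)
        \<and> norm2 \<epsilon> a b (diff3 w W) \<le> C * h ^ (k + 1)))"
proof (rule exI[of _ "Suc 0"], intro allI impI)
 fix a b f :: fn2 and \<alpha> \<beta> \<sigma> \<delta> C0 C1 C2 CR :: real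
 assume A: "Ck (Suc 0) (closure Omega) a & Ck (Suc 0) (closure Omega) b & Ck (Suc 0) (closure Omega) f \<and>
  \<alpha> > 0 & (\<forall>z\<in>closure Omega. a z \<ge> \<alpha>) & (\<forall>z\<in>closure Omega. b z \<ge> 0) \<and>
  \<beta> > 0 & (\<forall>z\<in>closure Omega. b z - 1 / 2 * pdx a z \<ge> \<beta>) \<and>
  \<sigma> \<ge> real k + 2 & \<delta> > 0 & C0 > 0 & C1 > 0 & CR > 0"
 \<comment> \<open>The smoothness order 1 makes \<open>pdx a\<close> continuous; together with
   \<open>a\<close> and \<open>b\<close> it is then bounded on the compact square, which yields
   \<open>Ma\<close>.\<close>
 have a: "Ck (Suc 0) Q01 a" and bc: "continuous_on Q01 b" and fc: "continuous_on Q01 f"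
  and al: "\<forall>z\<in>Q01. \<alpha> <= a z" and be: "\<forall>z\<in>Q01. \<beta> <= b z - pdx a z / 2"
  using A Ck_continuous unfolding closure_Omega by auto
 have pos: "\<alpha> > 0" "\<beta> > 0" "\<sigma> \<ge> real k + 2" "\<delta> > 0" "C1 > 0" "CR > 0" using A by auto
 obtain A1 A2 A3 where A123: "\<forall>z\<in>Q01. \<bar>a z\<bar> <= A1" "\<forall>z\<in>Q01. \<bar>pdx a z\<bar> <= A2" "\<forall>z\<in>Q01. \<bar>b z\<bar> <= A3"
  using continuous_bound_Q01[OF Ck_continuous[OF a]] continuous_bound_Q01[OF Ck_continuous[OF Ck_pdx[OF a]]] continuous_bound_Q01[OF bc]
  by blast
 define Ma where "Ma = max A1 (max A2 A3)"
 have Ma: "\<forall>z\<in>Q01. \<bar>a z\<bar> <= Ma" "\<forall>z\<in>Q01. \<bar>pdx a z\<bar> <= Ma" "\<forall>z\<in>Q01. \<bar>b z\<bar> <= Ma"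
  using A123 unfolding Ma_def by (auto simp: le_max_iff_disj)
 define L where "L = error_const k \<alpha> \<beta> \<delta> \<sigma> C1 CR Ma"
 have L0: "0 <= L" by (simp add: L_def error_const_def)
 show "\<exists>C>0. \<forall>(\<epsilon>::real) (N::nat) (lam1::real) (lam2::real) (u::fn2) (W::fn2 \<times> fn2 \<times> fn2).
   \<epsilon> > 0 & N \<ge> 4 & 4 dvd N \<and>
   tau1 \<sigma> \<alpha> \<epsilon> N <= 1 / 2 & tau2 \<sigma> \<delta> \<epsilon> N <= 1 / 4 \<and>
   \<epsilon> powr (1 / 4) * ln (real N) <= C2 \<and>
   0 <= lam1 & lam1 <= C0 & C1 * \<epsilon> <= lam2 & lam2 <= C0 \<and>
   bvp_solution \<epsilon> a b f u & regularity k \<alpha> \<delta> CR \<epsilon> u \<and>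
   ldg_solution (shishkin_mesh (tau1 \<sigma> \<alpha> \<epsilon> N) (tau2 \<sigma> \<delta> \<epsilon> N) N) k \<epsilon> a b f lam1 lam2 W
   \<longrightarrow>
   (let M = shishkin_mesh (tau1 \<sigma> \<alpha> \<epsilon> N) (tau2 \<sigma> \<delta> \<epsilon> N) N;
      p = (%z. \<epsilon> * pdx u z);
      q = (%z. \<epsilon> * pdy u z);
      w = (u, p, q);
      projw = (gr_minus M k u, gr_x_plus M k p, gr_y_plus M k q);
      h = ln (real N) / real N
    in normE M \<epsilon> a b lam1 lam2 (diff3 w W) <= C * h powr (real k + 1 / 2)
    & normE M \<epsilon> a b lam1 lam2 (diff3 projw W) <= C * h ^ (k + 1)
    & norm2 \<epsilon> a b (diff3 w W) <= C * h ^ (k + 1))"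
 proof (rule exI[of _ "1 + sqrt L"], intro conjI allI impI)
  show "1 + sqrt L > 0" using real_sqrt_ge_zero[OF L0] by linarith
  fix \<epsilon> :: real and N :: nat and lam1 lam2 :: real and u :: fn2 and W :: "fn2 \<times> fn2 \<times> fn2"
  assume H: "\<epsilon> > 0 & N \<ge> 4 & 4 dvd N \<and>
   tau1 \<sigma> \<alpha> \<epsilon> N <= 1 / 2 & tau2 \<sigma> \<delta> \<epsilon> N <= 1 / 4 \<and>
   \<epsilon> powr (1 / 4) * ln (real N) <= C2 \<and>
   0 <= lam1 & lam1 <= C0 & C1 * \<epsilon> <= lam2 & lam2 <= C0 \<and>
   bvp_solution \<epsilon> a b f u & regularity k \<alpha> \<delta> CR \<epsilon> u \<and>
   ldg_solution (shishkin_mesh (tau1 \<sigma> \<alpha> \<epsilon> N) (tau2 \<sigma> \<delta> \<epsilon> N) N) k \<epsilon> a b f lam1 lam2 W"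
  obtain m where m: "N = 4 * m" "m \<ge> 1" using H by (auto elim!: dvdE)
  interpret S: shishkin k N m \<alpha> \<delta> \<sigma> \<epsilon>
   using H m pos assms by unfold_locales auto
  obtain u0 u1 u2 u12 where comps: "S.comp 0 0 CR u0" "S.comp 1 0 CR u1" "S.comp 0 1 CR u2" "S.comp 1 1 CR u12"
   and u: "\<forall>z\<in>Q01. u z = u0 z + u1 z + u2 z + u12 z"
   using S.regularity_components[of CR u] H by blast
  interpret R: shishkin_solution k N m \<alpha> \<delta> \<sigma> \<epsilon> u0 u1 u2 u12 CR
   by (intro shishkin_solution.intro shishkin_solution_axioms.intro S.shishkin_axioms comps less_imp_le pos)
  have u': "\<forall>z\<in>Q01. u z = R.tot 0 0 z"
   using u by (simp add: R.tot_def R.tota_def R.totb_def pd_0_0)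
  define K1 K2 K3 where "K1 = R.K1 Ma" and "K2 = R.K2 \<beta> C1 Ma" and "K3 = R.K3 Ma"
  have Leq: "L = 2 * \<bar>K1\<bar> + 2 * \<bar>K2\<bar> + 2 * \<bar>K3\<bar>" by (simp add: L_def error_const_def K1_def K2_def K3_def)
  have lam: "0 <= lam1" "C1 * \<epsilon> <= lam2" and bvp: "bvp_solution \<epsilon> a b f u"
   and W: "ldg_solution (shishkin_mesh S.\<tau>x S.\<tau>y N) k \<epsilon> a b f lam1 lam2 W" using H by (simp_all add: S.\<tau>x_def S.\<tau>y_def)
  note eb = R.error_bounds[OF a bc fc al pos(2) be lam(1) pos(5) lam(2) Ma u' bvp W, folded K1_def K2_def K3_def]
  have h: "S.h = ln (real N) / real N" by (rule S.h_def)
  \<comment> \<open>\<open>T\<close> is the square of the energy rate h^(k + 1/2). Since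
    \<open>h\<close> is below 1, it dominates the square of \<open>H\<close>, and a single constant
    covers all three bounds.\<close>
  define T where "T = S.h ^ (2 * k + 1)"
  have H2: "S.H\<^sup>2 = (S.h ^ (k + 1))\<^sup>2" by (simp add: S.H_def)
  have HT: "S.H\<^sup>2 <= T"
  proof -
   have "S.H\<^sup>2 = S.h ^ (2 * k + 2)" unfolding H2 power_mult[symmetric] by (simp add: mult.commute)
   then show ?thesis unfolding T_def using S.h_pos S.h_less_1 by (simp add: power_decreasing)
  qed
  have T: "T = (S.h powr (real k + 1 / 2))\<^sup>2"
  proof -
   have "(S.h powr (real k + 1 / 2))\<^sup>2 = S.h powr (real (2 * k + 1))"
    unfolding power2_eq_square powr_add[symmetric] by (simp add: algebra_simps)
   then show ?thesis unfolding T_def using powr_realpow[OF S.h_pos(1), of "2 * k + 1"] by simp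
  qed
  have c: "K * S.H\<^sup>2 <= \<bar>K\<bar> * S.H\<^sup>2" "\<bar>K\<bar> * S.H\<^sup>2 <= \<bar>K\<bar> * T" "K * T <= \<bar>K\<bar> * T" "0 <= \<bar>K\<bar> * S.H\<^sup>2" for K
  proof -
   have nn: "0 <= T" "0 <= S.H\<^sup>2" using S.h_pos by (auto simp: T_def)
   show "K * S.H\<^sup>2 <= \<bar>K\<bar> * S.H\<^sup>2" "K * T <= \<bar>K\<bar> * T" by (intro mult_right_mono abs_ge_self nn)+
   show "\<bar>K\<bar> * S.H\<^sup>2 <= \<bar>K\<bar> * T" by (intro mult_left_mono HT abs_ge_zero)
   show "0 <= \<bar>K\<bar> * S.H\<^sup>2" using nn by simp
  qed
  have LT: "L * t = 2 * (\<bar>K1\<bar> * t) + 2 * (\<bar>K2\<bar> * t) + 2 * (\<bar>K3\<bar> * t)" for t by (simp add: Leq algebra_simps)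
  have hn: "0 <= S.h powr (real k + 1 / 2)" "0 <= S.h ^ (k + 1)" using S.h_pos by auto
  have 1: "2 * (K1 * S.H\<^sup>2 + K3 * T) + 2 * (K2 * S.H\<^sup>2) <= L * (S.h powr (real k + 1 / 2))\<^sup>2"
  proof -
   have "2 * (x1 + x3) + 2 * x2 <= 2 * y1 + 2 * y2 + 2 * y3" if "x1 <= y1" "x2 <= y2" "x3 <= y3" for x1 x2 x3 y1 y2 y3 :: real
    using that by simp
   from this[OF order_trans[OF c(1,2)] order_trans[OF c(1,2)] c(3)] show ?thesis
    unfolding T[symmetric] LT .
  qed
  have 2: "K2 * S.H\<^sup>2 <= L * (S.h ^ (k + 1))\<^sup>2" "2 * (K1 * S.H\<^sup>2) + 2 * (K2 * S.H\<^sup>2) <= L * (S.h ^ (k + 1))\<^sup>2"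
  proof -
   have "x2 <= 2 * y1 + 2 * y2 + 2 * y3" "2 * x1 + 2 * x2 <= 2 * y1 + 2 * y2 + 2 * y3"
    if "x1 <= y1" "x2 <= y2" "0 <= y1" "0 <= y2" "0 <= y3" for x1 x2 y1 y2 y3 :: real
    using that by simp_all
   from this[OF c(1) c(1) c(4) c(4) c(4)] show "K2 * S.H\<^sup>2 <= L * (S.h ^ (k + 1))\<^sup>2"
    "2 * (K1 * S.H\<^sup>2) + 2 * (K2 * S.H\<^sup>2) <= L * (S.h ^ (k + 1))\<^sup>2"
    unfolding H2[symmetric] LT by this+
  qed
  show "let M = shishkin_mesh (tau1 \<sigma> \<alpha> \<epsilon> N) (tau2 \<sigma> \<delta> \<epsilon> N) N;
      p = (%z. \<epsilon> * pdx u z);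
      q = (%z. \<epsilon> * pdy u z);
      w = (u, p, q);
      projw = (gr_minus M k u, gr_x_plus M k p, gr_y_plus M k q);
      h = ln (real N) / real N
    in normE M \<epsilon> a b lam1 lam2 (diff3 w W) <= (1 + sqrt L) * h powr (real k + 1 / 2)
    & normE M \<epsilon> a b lam1 lam2 (diff3 projw W) <= (1 + sqrt L) * h ^ (k + 1)
    & norm2 \<epsilon> a b (diff3 w W) <= (1 + sqrt L) * h ^ (k + 1)"
   unfolding Let_def h[symmetric] S.\<tau>x_def[symmetric] S.\<tau>y_def[symmetric]
   using root_bound[OF order_trans[OF eb(1)[folded T_def] 1] L0 hn(1)]
    root_bound[OF order_trans[OF eb(2) 2(1)] L0 hn(2)] root_bound[OF order_trans[OF eb(3) 2(2)] L0 hn(2)] by blast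
 qed
qed

end
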